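(* Let $T>0$, let $(V,d,\pi,\kappa)$ and $(\phi,\psi^*,\alpha)$ satisfy the standing assumptions listed in the context, and assume that $D_\phi:[0,\infty)^2\to[0,\infty]$ is convex. Let $a_n:E\to[0,\infty)$ be symmetric bounded Borel functions with $\sup_n\|a_n\|_{L^\infty(\vartheta_\kappa)}<\infty$ and $a_n(x,y)\to1$ for $\vartheta_\kappa$-a.e. $(x,y)\in E$, and set $\kappa_n(x,\mathrm dy):=a_n(x,y)\,\kappa(x,\mathrm dy)$. Suppose that $\sup_{x\in V}\kappa_n(x,V)<\infty$ for every $n$. Let $\rho_0^n,\rho_0\in\mathcal M^+(V)$ have finite entropy, with $\rho_0^n\to\rho_0$ setwise and $\mathscr E(\rho_0^n)\to\mathscr E(\rho_0)$ as $n\to\infty$. Let $(\rho^n,j^n)$ be Balanced solutions on $[0,T]$ of the evolution systems associated with $\kappa_n$, with initial data $\rho^n_0$. Then there exist $(\rho,j)\in\mathcal{CE}([0,T])$ and a (not relabeled) subsequence such that, as $n\to\infty$, $\rho^n_t\to\rho_t$ setwise for all $t\in[0,T]$, and $j^n_\lambda\to j_\lambda$ $\sigma$-setwise in $\mathcal M_\sigma([0,T]\times E)$, where $j_\lambda(\mathrm dt\,\mathrm dx\,\mathrm dy):=j_t(\mathrm dx\,\mathrm dy)\,\mathrm dt$ and $j^n_\lambda(\mathrm dt\,\mathrm dx\,\mathrm dy):=j^n_t(\mathrm dx\,\mathrm dy)\,\mathrm dt$; moreover $\rho_t=u_t\pi$ for all $t\in[0,T]$ for some $u\in L^1(0,T;L^1(V;\pi))$,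 and $(\rho,j)$ is a Dissipative solution of the evolution system associated with $\kappa$.
   Context: **Setting.** $(V,d)$ is a separable metric space, $\pi$ a finite positive Borel measure on $V$, $E:=V\times V$, $E':=E\setminus\{(x,x):x\in V\}$, $\mathcal M^+(V)$ is the set of finite positive Borel measures on $V$. The jump kernel $\kappa=(\kappa(x,\cdot))_{x\in V}$ is a family of positive $\sigma$-finite Borel measures on $V$ with $\kappa(x,\{x\})=0$, such that $x\mapsto\int_V f(y)(1\wedge d^2(x,y))\,\kappa(x,\mathrm dy)$ is Borel for every bounded Borel $f:V\to\mathbb R$, and $\sup_{x\in V}\int_V(1\wedge d^2(x,y))\,\kappa(x,\mathrm dy)<\infty$. The $\sigma$-finite measure $\vartheta_\kappa(\mathrm dx\,\mathrm dy):=\pi(\mathrm dx)\,\kappa(x,\mathrm dy)$ on $E$ is invariant under $(x,y)\mapsto(y,x)$ (detailed balance). Write $\overline\nabla\varphi(x,y):=\varphi(y)-\varphi(x)$. **Fluxes and convergence.** For a separable metric space $Y$, $\mathcal M_\sigma(Y)$ is the set of pairs $\mu=(\mu^+,\mu^-)$ of mutually singular $\sigma$-finite positive Borel measures on $Y$; $|\mu|:=\mu^++\mu^-$ and $\int f\,\mathrm d\mu:=\int f\,\mathrm d\mu^+-\int f\,\mathrm d\mu^-$ for $f\in L^1(|\mu|)$. A family $(j_t)_{t\in[0,T]}\subset\mathcal M_\sigma(E)$ is measurable if $t\mapsto j_t^\pm(B)$ is Borel for every Borel $B$. If $|\mu|\ll\gamma$ with $\gamma$ positive $\sigma$-finite,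 $\frac{\mathrm d\mu}{\mathrm d\gamma}:=\frac{\mathrm d\mu^+}{\mathrm d\gamma}-\frac{\mathrm d\mu^-}{\mathrm d\gamma}$. Finite signed measures $\mu_n\to\mu$ setwise if $\mu_n(B)\to\mu(B)$ for all Borel $B$. $\mu_n\in\mathcal M_\sigma(Y)$ converges $\sigma$-setwise to $\mu\in\mathcal M_\sigma(Y)$ if for some increasing sequence of Borel sets $A_k$ with $\bigcup_kA_k=Y$ and $|\mu|(A_k)<\infty$, all restrictions of $\mu_n$ to $A_k$ are finite signed measures converging setwise to the restriction of $\mu$ to $A_k$, for every $k$. **Densities.** $\phi\in C([0,\infty))\cap C^1((0,\infty))$ is convex, $\min\phi=0$, $\lim_{r\to\infty}\phi(r)/r=\infty$. $\psi^*:\mathbb R\to[0,\infty)$ is convex, differentiable, even, $\psi^*(0)=0$, $\lim_{|\xi|\to\infty}\psi^*(\xi)/|\xi|=\infty$, $\lim_{\xi\to0}\psi^*(\xi)/|\xi|^2\in(0,\infty)$; $\psi$ is its convex conjugate. $\alpha:[0,\infty)^2\to[0,\infty)$ is not identically zero, continuous, concave, symmetric. **Functionals.** $\mathscr E(\rho):=\int_V\phi(\frac{\mathrm d\rho}{\mathrm d\pi})\,\mathrm d\pi$ if $\rho\ll\pi$, $+\infty$ otherwise. For $\rho=u\pi$ and $j\in\mathcal M_\sigma(E)$ let $\nu_\rho(\mathrm dx\,\mathrm dy):=\alpha(u(x),u(y))\,\vartheta_\kappa(\mathrm dx\,\mathrm dy)$ and $\mathscr R(\rho,j):=\frac12\iint\psi\big(\frac{\mathrm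 d(2j)}{\mathrm d\nu_\rho}\big)\,\mathrm d\nu_\rho$ if $|j|\ll\nu_\rho$, $+\infty$ otherwise (only $\rho\ll\pi$ is relevant, since the curves considered have finite entropy). Set $\phi'(0):=\lim_{r\downarrow0}\phi'(r)\in[-\infty,\infty)$, $\Lambda_\phi(u,v):=\phi'(v)-\phi'(u)$ for $(u,v)\ne(0,0)$, $\Lambda_\phi(0,0):=0$. $D_\phi^+(u,v):=\psi^*(\Lambda_\phi(u,v))\alpha(u,v)$ if $\alpha(u,v)>0$ (with $\psi^*(\pm\infty)=+\infty$), $:=0$ if $u=v=0$, $:=+\infty$ if $\alpha(u,v)=0$ and $u\neq v$; $D_\phi:[0,\infty)^2\to[0,\infty]$ is the lower semicontinuous envelope of $D_\phi^+$. The Fisher information is $\mathscr D(\rho):=\frac12\iint_E D_\phi(u(x),u(y))\,\vartheta_\kappa(\mathrm dx\,\mathrm dy)$ for $\rho=u\pi$. **Continuity equation.** $\mathrm{Lip}_b(V)$ is the space of bounded $d$-Lipschitz functions. $(\rho,j)\in\mathcal{CE}([0,T])$ means: $\rho=(\rho_t)_{t\in[0,T]}\subset\mathcal M^+(V)$; $j=(j_t)_{t\in[0,T]}\subset\mathcal M_\sigma(E)$ is a measurable family with $|j_t|(E\setminus E')=0$ and $\int_0^T\iint_E(1\wedge d(x,y))\,|j_t|(\mathrm dx\,\mathrm dy)\,\mathrm dt<\infty$; and for all $\varphi\in\mathrm{Lip}_b(V)$ and $[s,t]\subset[0,T]$: $\int_V\varphi\,\mathrm d\rho_t-\int_V\varphi\,\mathrm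 d\rho_s=\int_s^t\iint_{E'}\overline\nabla\varphi(x,y)\,j_r(\mathrm dx\,\mathrm dy)\,\mathrm dr$. **Solutions.** $(\rho,j)\in\mathcal{CE}([0,T])$ with $\mathscr E(\rho_0)<\infty$ is a Dissipative solution if $\int_0^t(\mathscr R(\rho_r,j_r)+\mathscr D(\rho_r))\,\mathrm dr+\mathscr E(\rho_t)\le\mathscr E(\rho_0)$ for all $t\in[0,T]$, and a Balanced solution if $\int_s^t(\mathscr R(\rho_r,j_r)+\mathscr D(\rho_r))\,\mathrm dr+\mathscr E(\rho_t)=\mathscr E(\rho_s)$ for all $[s,t]\subset[0,T]$. For the evolution system associated with $\kappa_n$, the objects $\vartheta_{\kappa_n},\mathscr R^n,\mathscr D^n$ and solutions are defined in the same way with $\kappa_n$ in place of $\kappa$. *)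

theory Defs
  imports "HOL-Probability.Essential_Supremum"
begin

text \<open>
  The separable metric space \<open>V\<close> is a type of class
  \<open>{metric_space, second_countable_topology}\<close> (for metric spaces, second countable means
  separable). Borel measures are measures \<open>\<mu>\<close> with \<open>sets \<mu> = sets borel\<close>. The edge space \<open>E\<close> is the
  product type; by second countability its Borel sets are the product sigma-algebra.
\<close>

section \<open>Signed sigma-finite measures and setwise convergence\<close>

definition finite_borel_measures :: "'a::topological_space measure set" where
  "finite_borel_measures = {\<mu>. sets \<mu> = sets borel \<and> finite_measure \<mu>}"

definition mutually_singular :: "'a measure \<Rightarrow> 'a measure \<Rightarrow> bool" where
  "mutually_singular M N \<longleftrightarrow>
     (\<exists>A\<in>sets M. emeasure M (space M - A) = 0 \<and> emeasure N A = 0)"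

text \<open>A pair \<open>(\<mu>\<^sup>+, \<mu>\<^sup>-)\<close> of positive measures.\<close>
type_synonym 'a flux = "'a measure \<times> 'a measure"

text \<open>\<open>\<M>\<^sub>\<sigma>(Y)\<close>. The measurable space \<open>Y\<close> is passed as a measure \<open>N\<close>, of which only \<open>space\<close> and
  \<open>sets\<close> matter.\<close>
definition sigma_fluxes :: "'a measure \<Rightarrow> 'a flux set" where
  "sigma_fluxes N = {\<mu>. sets (fst \<mu>) = sets N \<and> sets (snd \<mu>) = sets N \<and>
     sigma_finite_measure (fst \<mu>) \<and> sigma_finite_measure (snd \<mu>) \<and>
     mutually_singular (fst \<mu>) (snd \<mu>)}"

definition total_variation :: "'a flux \<Rightarrow> 'a measure" where
  "total_variation \<mu> = measure_of (space (fst \<mu>)) (sets (fst \<mu>))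
     (\<lambda>B. emeasure (fst \<mu>) B + emeasure (snd \<mu>) B)"

text \<open>Only meaningful on sets of finite total variation.\<close>
definition signed_value :: "'a flux \<Rightarrow> 'a set \<Rightarrow> real" where
  "signed_value \<mu> B = measure (fst \<mu>) B - measure (snd \<mu>) B"

definition flux_integral :: "'a flux \<Rightarrow> 'a set \<Rightarrow> ('a \<Rightarrow> real) \<Rightarrow> real" where
  "flux_integral \<mu> A f = (LINT z:A|fst \<mu>. f z) - (LINT z:A|snd \<mu>. f z)"

definition double_flux :: "'a flux \<Rightarrow> 'a flux" where
  "double_flux \<mu> = (scale_measure 2 (fst \<mu>), scale_measure 2 (snd \<mu>))"

definition flux_RN_deriv :: "'a measure \<Rightarrow> 'a flux \<Rightarrow> 'a \<Rightarrow> real" where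
  "flux_RN_deriv \<gamma> \<mu> z =
     enn2real (RN_deriv \<gamma> (fst \<mu>) z) - enn2real (RN_deriv \<gamma> (snd \<mu>) z)"

text \<open>Finite signed measures enter as real-valued set functions.\<close>
definition setwise_conv :: "'a measure \<Rightarrow> (nat \<Rightarrow> 'a set \<Rightarrow> real) \<Rightarrow> ('a set \<Rightarrow> real) \<Rightarrow> bool" where
  "setwise_conv N ms m \<longleftrightarrow> (\<forall>B\<in>sets N. (\<lambda>n. ms n B) \<longlonglongrightarrow> m B)"

definition sigma_setwise_conv :: "'a measure \<Rightarrow> (nat \<Rightarrow> 'a flux) \<Rightarrow> 'a flux \<Rightarrow> bool" where
  "sigma_setwise_conv N \<mu>s \<mu> \<longleftrightarrow>
     (\<forall>n. \<mu>s n \<in> sigma_fluxes N) \<and> \<mu> \<in> sigma_fluxes N \<and>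
     (\<exists>A. incseq A \<and> range A \<subseteq> sets N \<and> (\<Union>k. A k) = space N \<and>
        (\<forall>k. emeasure (total_variation \<mu>) (A k) < \<infinity> \<and>
             (\<forall>n. emeasure (total_variation (\<mu>s n)) (A k) < \<infinity>) \<and>
             setwise_conv N (\<lambda>n B. signed_value (\<mu>s n) (B \<inter> A k))
                            (\<lambda>B. signed_value \<mu> (B \<inter> A k))))"

section \<open>The jump kernel\<close>

definition edge_measure :: "'v::{metric_space, second_countable_topology} measure \<Rightarrow>
    ('v \<Rightarrow> 'v measure) \<Rightarrow> ('v \<times> 'v) measure" where
  "edge_measure \<pi> \<kappa> = measure_of UNIV (sets borel)
     (\<lambda>B. \<integral>\<^sup>+ x. (\<integral>\<^sup>+ y. indicator B (x, y) \<partial>\<kappa> x) \<partial>\<pi>)"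

definition jump_setting :: "'v::{metric_space, second_countable_topology} measure \<Rightarrow>
    ('v \<Rightarrow> 'v measure) \<Rightarrow> bool" where
  "jump_setting \<pi> \<kappa> \<longleftrightarrow>
     \<pi> \<in> finite_borel_measures \<and>
     (\<forall>x. sets (\<kappa> x) = sets borel \<and> sigma_finite_measure (\<kappa> x) \<and> emeasure (\<kappa> x) {x} = 0) \<and>
     (\<forall>f::'v \<Rightarrow> real. f \<in> borel_measurable borel \<and> bounded (range f) \<longrightarrow>
        (\<lambda>x. \<integral>y. f y * min 1 ((dist x y)\<^sup>2) \<partial>\<kappa> x) \<in> borel_measurable borel) \<and>
     (SUP x. \<integral>\<^sup>+ y. ennreal (min 1 ((dist x y)\<^sup>2)) \<partial>\<kappa> x) < \<infinity> \<and>
     distr (edge_measure \<pi> \<kappa>) borel prod.swap = edge_measure \<pi> \<kappa>"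

section \<open>The densities\<close>

abbreviation quadrant :: "(real \<times> real) set" where
  "quadrant \<equiv> {0..} \<times> {0..}"

definition entropy_density :: "(real \<Rightarrow> real) \<Rightarrow> bool" where
  "entropy_density \<phi> \<longleftrightarrow>
     continuous_on {0..} \<phi> \<and> \<phi> C1_differentiable_on {0<..} \<and> convex_on {0..} \<phi> \<and>
     (\<forall>r\<ge>0. 0 \<le> \<phi> r) \<and> (\<exists>r\<ge>0. \<phi> r = 0) \<and>
     filterlim (\<lambda>r. \<phi> r / r) at_top at_top"

definition dual_dissipation_density :: "(real \<Rightarrow> real) \<Rightarrow> bool" where
  "dual_dissipation_density \<psi>s \<longleftrightarrow>
     (\<forall>\<xi>. 0 \<le> \<psi>s \<xi>) \<and> convex_on UNIV \<psi>s \<and> (\<forall>\<xi>. \<psi>s differentiable (at \<xi>)) \<and>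
     (\<forall>\<xi>. \<psi>s (- \<xi>) = \<psi>s \<xi>) \<and> \<psi>s 0 = 0 \<and>
     filterlim (\<lambda>\<xi>. \<psi>s \<xi> / \<bar>\<xi>\<bar>) at_top at_infinity \<and>
     (\<exists>c>0. ((\<lambda>\<xi>. \<psi>s \<xi> / \<bar>\<xi>\<bar>\<^sup>2) \<longlongrightarrow> c) (at 0))"

definition flux_density :: "(real \<times> real \<Rightarrow> real) \<Rightarrow> bool" where
  "flux_density \<alpha> \<longleftrightarrow>
     (\<forall>z\<in>quadrant. 0 \<le> \<alpha> z) \<and> (\<exists>z\<in>quadrant. \<alpha> z \<noteq> 0) \<and>
     continuous_on quadrant \<alpha> \<and> concave_on quadrant \<alpha> \<and>
     (\<forall>u\<ge>0. \<forall>v\<ge>0. \<alpha> (u, v) = \<alpha> (v, u))"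

text \<open>The supremum is finite when \<open>f\<close> is bounded below and grows superlinearly.\<close>
definition convex_conjugate :: "(real \<Rightarrow> real) \<Rightarrow> real \<Rightarrow> real" where
  "convex_conjugate f s = (SUP \<xi>. s * \<xi> - f \<xi>)"

section \<open>Entropy, dissipation potential and Fisher information\<close>

definition dens :: "'v measure \<Rightarrow> 'v measure \<Rightarrow> 'v \<Rightarrow> real" where
  "dens \<pi> \<rho> x = enn2real (RN_deriv \<pi> \<rho> x)"

definition entropy_functional :: "'v measure \<Rightarrow> (real \<Rightarrow> real) \<Rightarrow> 'v measure \<Rightarrow> ennreal" where
  "entropy_functional \<pi> \<phi> \<rho> =
     (if absolutely_continuous \<pi> \<rho> then \<integral>\<^sup>+ x. ennreal (\<phi> (dens \<pi> \<rho> x)) \<partial>\<pi> else \<infinity>)"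

definition edge_activity :: "'v::{metric_space, second_countable_topology} measure \<Rightarrow>
    ('v \<Rightarrow> 'v measure) \<Rightarrow> (real \<times> real \<Rightarrow> real) \<Rightarrow> 'v measure \<Rightarrow> ('v \<times> 'v) measure" where
  "edge_activity \<pi> \<kappa> \<alpha> \<rho> =
     density (edge_measure \<pi> \<kappa>) (\<lambda>(x, y). ennreal (\<alpha> (dens \<pi> \<rho> x, dens \<pi> \<rho> y)))"

text \<open>Along curves of finite entropy \<open>\<rho> \<lless> \<pi>\<close> always holds; for other \<open>\<rho>\<close> the functionals
  \<open>\<R>\<close> and \<open>\<D>\<close> are given the value \<open>\<infinity>\<close> by convention.\<close>
definition dissipation_potential :: "'v::{metric_space, second_countable_topology} measure \<Rightarrow>
    ('v \<Rightarrow> 'v measure) \<Rightarrow> (real \<Rightarrow> real) \<Rightarrow> (real \<times> real \<Rightarrow> real) \<Rightarrow>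
    'v measure \<Rightarrow> ('v \<times> 'v) flux \<Rightarrow> ennreal" where
  "dissipation_potential \<pi> \<kappa> \<psi>s \<alpha> \<rho> j =
     (let \<nu> = edge_activity \<pi> \<kappa> \<alpha> \<rho> in
      if absolutely_continuous \<pi> \<rho> \<and> absolutely_continuous \<nu> (total_variation j)
      then (\<integral>\<^sup>+ z. ennreal (convex_conjugate \<psi>s (flux_RN_deriv \<nu> (double_flux j) z)) \<partial>\<nu>) / 2
      else \<infinity>)"

definition ext_deriv :: "(real \<Rightarrow> real) \<Rightarrow> real \<Rightarrow> ereal" where
  "ext_deriv \<phi> r = (if 0 < r then ereal (deriv \<phi> r) else Lim (at_right 0) (\<lambda>s. ereal (deriv \<phi> s)))"

text \<open>The difference is never of the form \<open>\<infinity> - \<infinity>\<close>: \<open>ext_deriv \<phi> r\<close> can only be infinite at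
  \<open>r = 0\<close>.\<close>
definition Lambda :: "(real \<Rightarrow> real) \<Rightarrow> real \<Rightarrow> real \<Rightarrow> ereal" where
  "Lambda \<phi> u v = (if u = 0 \<and> v = 0 then 0 else ext_deriv \<phi> v - ext_deriv \<phi> u)"

definition ext_density :: "(real \<Rightarrow> real) \<Rightarrow> ereal \<Rightarrow> ennreal" where
  "ext_density \<psi>s \<xi> = (if \<bar>\<xi>\<bar> = \<infinity> then \<infinity> else ennreal (\<psi>s (real_of_ereal \<xi>)))"

text \<open>The diagonal case \<open>\<alpha> (u, u) = 0\<close> with \<open>u > 0\<close> cannot occur: a concave nonnegative function
  vanishing at an interior point of the quadrant vanishes identically.\<close>
definition Fisher_density_plus ::
    "(real \<Rightarrow> real) \<Rightarrow> (real \<Rightarrow> real) \<Rightarrow> (real \<times> real \<Rightarrow> real) \<Rightarrow> real \<times> real \<Rightarrow> ennreal" where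
  "Fisher_density_plus \<phi> \<psi>s \<alpha> = (\<lambda>(u, v).
     if \<alpha> (u, v) > 0 then ext_density \<psi>s (Lambda \<phi> u v) * ennreal (\<alpha> (u, v))
     else if u = 0 \<and> v = 0 then 0
     else \<infinity>)"

definition lsc_on :: "'a::topological_space set \<Rightarrow> ('a \<Rightarrow> ennreal) \<Rightarrow> bool" where
  "lsc_on S g \<longleftrightarrow> (\<forall>z\<in>S. g z \<le> Liminf (at z within S) g)"

definition lsc_envelope ::
    "'a::topological_space set \<Rightarrow> ('a \<Rightarrow> ennreal) \<Rightarrow> 'a \<Rightarrow> ennreal" where
  "lsc_envelope S f z = (SUP g\<in>{g. lsc_on S g \<and> (\<forall>w\<in>S. g w \<le> f w)}. g z)"

definition Fisher_density ::
    "(real \<Rightarrow> real) \<Rightarrow> (real \<Rightarrow> real) \<Rightarrow> (real \<times> real \<Rightarrow> real) \<Rightarrow> real \<times> real \<Rightarrow> ennreal" where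
  "Fisher_density \<phi> \<psi>s \<alpha> = lsc_envelope quadrant (Fisher_density_plus \<phi> \<psi>s \<alpha>)"

text \<open>The library's \<open>convex_on\<close> only covers real-valued functions.\<close>
definition ext_convex_on :: "'a::real_vector set \<Rightarrow> ('a \<Rightarrow> ennreal) \<Rightarrow> bool" where
  "ext_convex_on S f \<longleftrightarrow> convex S \<and>
     (\<forall>x\<in>S. \<forall>y\<in>S. \<forall>t::real. 0 < t \<and> t < 1 \<longrightarrow>
        f ((1 - t) *\<^sub>R x + t *\<^sub>R y) \<le> ennreal (1 - t) * f x + ennreal t * f y)"

definition Fisher_information :: "'v::{metric_space, second_countable_topology} measure \<Rightarrow>
    ('v \<Rightarrow> 'v measure) \<Rightarrow> (real \<Rightarrow> real) \<Rightarrow> (real \<Rightarrow> real) \<Rightarrow> (real \<times> real \<Rightarrow> real) \<Rightarrow>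
    'v measure \<Rightarrow> ennreal" where
  "Fisher_information \<pi> \<kappa> \<phi> \<psi>s \<alpha> \<rho> =
     (if absolutely_continuous \<pi> \<rho>
      then (\<integral>\<^sup>+ (x, y). Fisher_density \<phi> \<psi>s \<alpha> (dens \<pi> \<rho> x, dens \<pi> \<rho> y) \<partial>edge_measure \<pi> \<kappa>) / 2
      else \<infinity>)"

section \<open>Continuity equation and solutions\<close>

text \<open>Curves on \<open>[0,T]\<close> are functions of a real variable whose values outside \<open>[0,T]\<close> are
  irrelevant.\<close>

definition off_diagonal :: "('v \<times> 'v) set" where
  "off_diagonal = {(x, y). x \<noteq> y}"

definition measurable_flux_family ::
    "real \<Rightarrow> (real \<Rightarrow> ('v::{metric_space, second_countable_topology} \<times> 'v) flux) \<Rightarrow> bool" where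
  "measurable_flux_family T j \<longleftrightarrow>
     (\<forall>t\<in>{0..T}. j t \<in> sigma_fluxes borel) \<and>
     (\<forall>B\<in>sets borel.
        (\<lambda>t. emeasure (fst (j t)) B) \<in> borel_measurable (restrict_space borel {0..T}) \<and>
        (\<lambda>t. emeasure (snd (j t)) B) \<in> borel_measurable (restrict_space borel {0..T}))"

definition Lip_b :: "('v::metric_space \<Rightarrow> real) set" where
  "Lip_b = {f. bounded (range f) \<and> (\<exists>L. L-lipschitz_on UNIV f)}"

definition CE :: "real \<Rightarrow> ((real \<Rightarrow> 'v::{metric_space, second_countable_topology} measure) \<times>
    (real \<Rightarrow> ('v \<times> 'v) flux)) set" where
  "CE T = {(\<rho>, j).
     (\<forall>t\<in>{0..T}. \<rho> t \<in> finite_borel_measures) \<and>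
     measurable_flux_family T j \<and>
     (\<forall>t\<in>{0..T}. emeasure (total_variation (j t)) (- off_diagonal) = 0) \<and>
     (\<integral>\<^sup>+ t\<in>{0..T}. (\<integral>\<^sup>+ z. ennreal (min 1 (dist (fst z) (snd z))) \<partial>total_variation (j t))
        \<partial>lborel) < \<infinity> \<and>
     (\<forall>f\<in>Lip_b. \<forall>s t. 0 \<le> s \<and> s \<le> t \<and> t \<le> T \<longrightarrow>
        (\<integral>x. f x \<partial>\<rho> t) - (\<integral>x. f x \<partial>\<rho> s) =
        (LINT r:{s..t}|lborel. flux_integral (j r) off_diagonal (\<lambda>(x, y). f y - f x)))}"

definition dissipative_solution :: "real \<Rightarrow> 'v::{metric_space, second_countable_topology} measure \<Rightarrow>
    ('v \<Rightarrow> 'v measure) \<Rightarrow> (real \<Rightarrow> real) \<Rightarrow> (real \<Rightarrow> real) \<Rightarrow> (real \<times> real \<Rightarrow> real) \<Rightarrow>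
    (real \<Rightarrow> 'v measure) \<Rightarrow> (real \<Rightarrow> ('v \<times> 'v) flux) \<Rightarrow> bool" where
  "dissipative_solution T \<pi> \<kappa> \<phi> \<psi>s \<alpha> \<rho> j \<longleftrightarrow>
     (\<rho>, j) \<in> CE T \<and> entropy_functional \<pi> \<phi> (\<rho> 0) < \<infinity> \<and>
     (\<forall>t\<in>{0..T}.
        (\<integral>\<^sup>+ r\<in>{0..t}. (dissipation_potential \<pi> \<kappa> \<psi>s \<alpha> (\<rho> r) (j r) +
            Fisher_information \<pi> \<kappa> \<phi> \<psi>s \<alpha> (\<rho> r)) \<partial>lborel)
          + entropy_functional \<pi> \<phi> (\<rho> t) \<le> entropy_functional \<pi> \<phi> (\<rho> 0))"

definition balanced_solution :: "real \<Rightarrow> 'v::{metric_space, second_countable_topology} measure \<Rightarrow>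
    ('v \<Rightarrow> 'v measure) \<Rightarrow> (real \<Rightarrow> real) \<Rightarrow> (real \<Rightarrow> real) \<Rightarrow> (real \<times> real \<Rightarrow> real) \<Rightarrow>
    (real \<Rightarrow> 'v measure) \<Rightarrow> (real \<Rightarrow> ('v \<times> 'v) flux) \<Rightarrow> bool" where
  "balanced_solution T \<pi> \<kappa> \<phi> \<psi>s \<alpha> \<rho> j \<longleftrightarrow>
     (\<rho>, j) \<in> CE T \<and> entropy_functional \<pi> \<phi> (\<rho> 0) < \<infinity> \<and>
     (\<forall>s t. 0 \<le> s \<and> s \<le> t \<and> t \<le> T \<longrightarrow>
        (\<integral>\<^sup>+ r\<in>{s..t}. (dissipation_potential \<pi> \<kappa> \<psi>s \<alpha> (\<rho> r) (j r) +
            Fisher_information \<pi> \<kappa> \<phi> \<psi>s \<alpha> (\<rho> r)) \<partial>lborel)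
          + entropy_functional \<pi> \<phi> (\<rho> t) = entropy_functional \<pi> \<phi> (\<rho> s))"

section \<open>Space-time objects\<close>

definition time_space :: "real \<Rightarrow> (real \<times> 'a::topological_space) measure" where
  "time_space T = restrict_space borel ({0..T} \<times> UNIV)"

definition time_measure :: "real \<Rightarrow> (real \<Rightarrow> 'a::topological_space measure) \<Rightarrow> (real \<times> 'a) measure" where
  "time_measure T \<mu> = measure_of ({0..T} \<times> UNIV) (sets (time_space T))
     (\<lambda>B. \<integral>\<^sup>+ t\<in>{0..T}. emeasure (\<mu> t) (Pair t -` B) \<partial>lborel)"

definition time_flux :: "real \<Rightarrow> (real \<Rightarrow> 'a::topological_space flux) \<Rightarrow> (real \<times> 'a) flux" where
  "time_flux T j = (time_measure T (\<lambda>t. fst (j t)), time_measure T (\<lambda>t. snd (j t)))"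

text \<open>Since \<open>L\<^sup>1(V;\<pi>)\<close> depends on the term \<open>\<pi>\<close>, it is not a type, and the Bochner space
  \<open>L\<^sup>1(0,T;L\<^sup>1(V;\<pi>))\<close> is defined through representatives: \<open>u\<close> is strongly measurable, that is, almost
  everywhere on \<open>(0,T)\<close> the limit in \<open>L\<^sup>1(V;\<pi>)\<close> of simple functions, and its norm is integrable.\<close>

definition simple_L1_curve :: "real \<Rightarrow> 'v measure \<Rightarrow> (real \<Rightarrow> 'v \<Rightarrow> real) \<Rightarrow> bool" where
  "simple_L1_curve T \<pi> s \<longleftrightarrow>
     (\<exists>(m::nat) A g. (\<forall>i<m. A i \<in> sets borel \<and> integrable \<pi> (g i)) \<and>
        (\<forall>t\<in>{0..T}. \<forall>x. s t x = (\<Sum>i<m. indicator (A i) t * g i x)))"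

definition Bochner_L1 :: "real \<Rightarrow> 'v measure \<Rightarrow> (real \<Rightarrow> 'v \<Rightarrow> real) \<Rightarrow> bool" where
  "Bochner_L1 T \<pi> u \<longleftrightarrow>
     (\<forall>t\<in>{0..T}. integrable \<pi> (u t)) \<and>
     (\<exists>s. (\<forall>k. simple_L1_curve T \<pi> (s k)) \<and>
        (AE t in lborel. t \<in> {0..T} \<longrightarrow>
           (\<lambda>k. \<integral>x. \<bar>s k t x - u t x\<bar> \<partial>\<pi>) \<longlonglongrightarrow> 0)) \<and>
     (\<integral>\<^sup>+ t\<in>{0..T}. ennreal (\<integral>x. \<bar>u t x\<bar> \<partial>\<pi>) \<partial>lborel) < \<infinity>"

end

theory Submission
  imports Defs "HOL-Library.Diagonal_Subsequence"
begin

text \<open>With \<open>\<omega> = min 1 d\<close> and the edge measure \<open>\<theta>\<close>, the measure \<open>\<omega>\<^sup>2 \<theta>\<close> is finite and symmetric. The superlinear growth of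
  \<open>\<phi>\<close> makes the densities of \<open>\<rho>\<^sup>n\<^sub>t\<close> uniformly integrable, and Young's inequality for \<open>\<psi>\<close> together with
  \<open>\<psi>\<^sup>*(s) \<lesssim> s\<^sup>2\<close> near \<open>0\<close> turns the bounded dissipation into uniform absolute continuity of the finite
  measures \<open>\<omega> j\<^sup>n\<close> with respect to \<open>dt \<omega>\<^sup>2 \<theta>\<close>. Hence a subsequence of \<open>\<omega> j\<^sup>n\<close> converges setwise; the
  continuity equation makes \<open>t \<mapsto> \<rho>\<^sup>n\<^sub>t(B)\<close> equicontinuous for closed \<open>B\<close>, which gives setwise convergence for all \<open>t\<close>.

  For the energy inequality, twice the total dissipation has the convex lower semicontinuous integrand
  \<open>\<psi>(2w/\<alpha>(u,v)) \<alpha>(u,v) + D(u,v)\<close>, the supremum of countably many affine functions of \<open>(w,u,v)\<close>. Testing the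
  approximating solutions with bounded measurable selections of these affine functions only involves
  setwise convergence and \<open>a\<^sub>n \<rightarrow> 1\<close>, so that the lower bounds pass to the limit; the supremum over
  the selections is taken afterwards. The entropy is treated in the same way.\<close>

section \<open>Affine minorants of the densities\<close>

text \<open>Three obstacles give the proof its form. The jump measures may be infinite near the
  diagonal, so fluxes are compared only after multiplication by \<omega>, and the division by
  \<omega> is undone only where 1/\<omega> is bounded; the sets where it is bounded are also the
  exhaustion in the \<sigma>-setwise convergence. The positive and negative parts of the fluxes have
  separate limits that need not be mutually singular, so the limit flux is rebuilt from the
  difference of the two limit densities, and its tests are signed and do not see their common part.
  Finally, the definition of a solution says nothing about measurability in time of the dissipation
  rates, and \<open>nn_integral\<close> of a nonmeasurable function is only a lower integral. Along
  the sequence the rates are therefore bounded from below by measurable functions, which Young's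
  inequality supplies for compactness and duality for the limit. The densities of
  \<open>\<rho>n n t\<close> are likewise chosen for each time separately; measurability in time is
  recovered from the measures that they define.\<close>

lemma separation_affine_minorant:
  fixes f :: "real \<times> real \<Rightarrow> ennreal"
  assumes conv: "ext_convex_on quadrant f" and lsc: "lsc_on quadrant f"
    and z0: "z0 \<in> quadrant" and y: "0 \<le> y" "ennreal y < f z0"
  shows "\<exists>b c d::real. (\<forall>u\<ge>0. \<forall>v\<ge>0. ennreal (b + c * u + d * v) \<le> f (u, v)) \<and>
           y < b + c * fst z0 + d * snd z0"
proof -
  \<comment> \<open>The part of the epigraph with finite height: convexity of \<open>f\<close> makes
    it convex, lower semicontinuity makes it closed, and \<open>(z0, y)\<close> lies outside, so a
    hyperplane separates strictly.\<close>
  define S where "S = {(z, r::real). z \<in> quadrant \<and> 0 \<le> r \<and> f z \<le> ennreal r}"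
  have cS: "convex S"
    unfolding convex_alt
  proof (intro ballI allI impI)
    fix x x' t assume x: "x \<in> S" "x' \<in> S" and t: "0 \<le> (t::real) \<and> t \<le> 1"
    obtain z r z' r' where e: "x = (z, r)" "x' = (z', r')" by (cases x, cases x')
    have q: "z \<in> quadrant" "z' \<in> quadrant" "0 \<le> r" "0 \<le> r'" "f z \<le> ennreal r" "f z' \<le> ennreal r'"
      using x by (auto simp: S_def e)
    show "(1 - t) *\<^sub>R x + t *\<^sub>R x' \<in> S"
    proof (cases "t = 0 \<or> t = 1")
      case True then show ?thesis using x by auto
    next
      case False
      then have t: "0 < t" "t < 1" using t by auto
      have "f ((1 - t) *\<^sub>R z + t *\<^sub>R z') \<le> ennreal (1 - t) * f z + ennreal t * f z'"
        using conv q t by (auto simp: ext_convex_on_def)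
      also have "\<dots> \<le> ennreal (1 - t) * ennreal r + ennreal t * ennreal r'"
        using q by (intro add_mono mult_left_mono) auto
      also have "\<dots> = ennreal ((1 - t) * r + t * r')"
        using t q by (simp add: ennreal_mult' [symmetric] ennreal_plus[symmetric] del: ennreal_plus)
      finally have 1: "f ((1 - t) *\<^sub>R z + t *\<^sub>R z') \<le> ennreal ((1 - t) * r + t * r')" .
      have 2: "(1 - t) *\<^sub>R z + t *\<^sub>R z' \<in> quadrant"
        using q t by (auto simp: mem_Times_iff)
      have 3: "0 \<le> (1 - t) * r + t * r'" using t q by simp
      show ?thesis unfolding S_def using 1 2 3 by (simp add: e)
    qed
  qed
  have clS: "closed S"
    unfolding closed_sequential_limits
  proof (intro allI impI, elim conjE)
    fix x l assume x: "\<forall>n::nat. x n \<in> S" and l: "x \<longlonglongrightarrow> l"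
    obtain z r where e: "l = (z, r)" by (cases l)
    have lz: "(\<lambda>n. fst (x n)) \<longlonglongrightarrow> z" and lr: "(\<lambda>n. snd (x n)) \<longlonglongrightarrow> r"
      using tendsto_fst[OF l] tendsto_snd[OF l] by (auto simp: e)
    have q: "fst (x n) \<in> quadrant" "0 \<le> snd (x n)" "f (fst (x n)) \<le> ennreal (snd (x n))" for n
      using x[rule_format, of n] by (auto simp: S_def)
    have "closed quadrant" by (intro closed_Times closed_atLeast)
    then have zq: "z \<in> quadrant" using q(1) lz by (rule closed_sequentially)
    have r0: "0 \<le> r" using lr q(2) by (intro LIMSEQ_le_const) auto
    have "f z \<le> ennreal r"
    proof (rule ccontr)
      assume "\<not> f z \<le> ennreal r"
      then obtain y where y: "ennreal r < y" "y < f z" by (metis dense not_le)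
      have "f z \<le> Liminf (at z within quadrant) f" using lsc zq by (auto simp: lsc_on_def)
      then have "eventually (\<lambda>w. y < f w) (at z within quadrant)"
        by (intro less_LiminfD order_less_le_trans[OF y(2)])
      then obtain U where U: "open U" "z \<in> U" "\<And>w. w \<in> U \<Longrightarrow> w \<noteq> z \<Longrightarrow> w \<in> quadrant \<Longrightarrow> y < f w"
        unfolding eventually_at_topological by blast
      have "eventually (\<lambda>n. fst (x n) \<in> U) sequentially" using lz U(1,2) by (rule topological_tendstoD)
      then have "eventually (\<lambda>n. y \<le> ennreal (snd (x n))) sequentially"
      proof eventually_elim
        case (elim n)
        \<comment> \<open>The limit inferior at \<open>z\<close> ignores the point \<open>z\<close>
          itself; there \<open>y < f z\<close> holds by the choice of \<open>y\<close>.\<close>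
        then have "y < f (fst (x n))" using U(3)[of "fst (x n)"] q(1)[of n] y(2) by (cases "fst (x n) = z") auto
        then show ?case using q(3)[of n] by auto
      qed
      moreover have "(\<lambda>n. ennreal (snd (x n))) \<longlonglongrightarrow> ennreal r" using lr by (rule tendsto_ennrealI)
      ultimately have "y \<le> ennreal r" by (intro tendsto_lowerbound) auto
      then show False using y by auto
    qed
    then show "l \<in> S" using zq r0 by (simp add: S_def e)
  qed
  show ?thesis
  proof (cases "S = {}")
    case True
    have inf: "f z = \<infinity>" if "z \<in> quadrant" for z
    proof (rule ccontr)
      assume a: "f z \<noteq> \<infinity>"
      then have "(z, enn2real (f z)) \<in> S" using that by (auto simp: S_def top.not_eq_extremum)
      with True show False by auto
    qed
    show ?thesis
      by (rule exI[of _ "y + 1"], rule exI[of _ 0], rule exI[of _ 0]) (auto simp: inf)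
  next
    case False
    have "(z0, y) \<notin> S" using y by (auto simp: S_def)
    from separating_hyperplane_closed_point[OF cS clS this]
    obtain a \<beta> where a: "inner a (z0, y) < \<beta>" "\<And>x. x \<in> S \<Longrightarrow> inner a x > \<beta>" by blast
    obtain p1 p2 s where e: "a = ((p1, p2), s)" by (metis prod.exhaust)
    have a0: "p1 * fst z0 + p2 * snd z0 + s * y < \<beta>"
      using a(1) by (cases z0) (simp add: e inner_prod_def)
    have a1: "p1 * u + p2 * v + s * r > \<beta>" if "u \<ge> 0" "v \<ge> 0" "0 \<le> r" "f (u, v) \<le> ennreal r" for u v r
      using a(2)[of "((u, v), r)"] that by (simp add: S_def e inner_prod_def)
    obtain u1 v1 r1 where S1: "u1 \<ge> 0" "v1 \<ge> 0" "0 \<le> r1" "f (u1, v1) \<le> ennreal r1"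
      using False by (auto simp: S_def)
    \<comment> \<open>The epigraph is closed upwards: raising \<open>r\<close> above one of its
      points would violate the separation if \<open>s\<close> were negative.\<close>
    have s: "s \<ge> 0"
    proof (rule ccontr)
      assume s: "\<not> s \<ge> 0"
      define r where "r = max r1 ((p1 * u1 + p2 * v1 - \<beta>) / (- s))"
      have "f (u1, v1) \<le> ennreal r" using S1(4) by (rule order_trans) (simp add: r_def ennreal_leI)
      then have "p1 * u1 + p2 * v1 + s * r > \<beta>" using S1 by (intro a1) (auto simp: r_def)
      moreover have "r \<ge> (p1 * u1 + p2 * v1 - \<beta>) / (- s)" by (simp add: r_def)
      then have "p1 * u1 + p2 * v1 - \<beta> \<le> r * (- s)" using s by (subst (asm) pos_divide_le_eq) auto
      ultimately show False by (simp add: algebra_simps)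
    qed
    show ?thesis
    \<comment> \<open>A vertical hyperplane carries no information on heights; it only says that
      \<open>p1 u + p2 v > \<beta>\<close> wherever \<open>f\<close> is finite. There
      \<open>k (\<beta> - p1 u - p2 v)\<close> is negative and truncated to 0 by
      \<open>ennreal\<close>, while \<open>k\<close> scales its positive value at \<open>z0\<close>
      to \<open>y + 1\<close>. If \<open>s > 0\<close>, division by \<open>s\<close> gives the
      minorant.\<close>
    proof (cases "s = 0")
      case True
      define k where "k = (y + 1) / (\<beta> - p1 * fst z0 - p2 * snd z0)"
      have pos: "\<beta> - p1 * fst z0 - p2 * snd z0 > 0" using a0 True by simp
      then have k: "k > 0" using y by (simp add: k_def)
      have eq: "k * (\<beta> - p1 * fst z0 - p2 * snd z0) = y + 1" using pos by (simp add: k_def)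
      have "ennreal (k * \<beta> + (- k * p1) * u + (- k * p2) * v) \<le> f (u, v)" if "u \<ge> 0" "v \<ge> 0" for u v
      proof (cases "f (u, v) = \<infinity>")
        case False
        then have "p1 * u + p2 * v > \<beta>"
          using a1[of u v "enn2real (f (u, v))"] that True by (auto simp: top.not_eq_extremum)
        then have "k * (\<beta> - p1 * u - p2 * v) \<le> 0" using k by (intro mult_nonneg_nonpos) auto
        then show ?thesis by (simp add: algebra_simps ennreal_neg)
      qed simp
      then show ?thesis
        using eq by (intro exI[of _ "k * \<beta>"] exI[of _ "- k * p1"] exI[of _ "- k * p2"])
          (auto simp: algebra_simps)
    next
      case False
      then have s: "s > 0" using s by simp
      have "ennreal (\<beta> / s + (- p1 / s) * u + (- p2 / s) * v) \<le> f (u, v)" if "u \<ge> 0" "v \<ge> 0" for u v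
      proof (cases "f (u, v) = \<infinity>")
        case False
        then have "p1 * u + p2 * v + s * enn2real (f (u, v)) > \<beta>"
          using a1[of u v "enn2real (f (u, v))"] that by (auto simp: top.not_eq_extremum)
        then have "\<beta> / s + (- p1 / s) * u + (- p2 / s) * v \<le> enn2real (f (u, v))"
          using s by (simp add: pos_divide_le_eq flip: add_divide_distrib diff_divide_distrib) (simp add: algebra_simps)
        then have "ennreal (\<beta> / s + (- p1 / s) * u + (- p2 / s) * v) \<le> ennreal (enn2real (f (u, v)))"
          by (rule ennreal_leI)
        also have "\<dots> = f (u, v)" using False by (simp add: top.not_eq_extremum)
        finally show ?thesis .
      qed simp
      moreover have "y < \<beta> / s + (- p1 / s) * fst z0 + (- p2 / s) * snd z0"
        using a0 s by (simp add: pos_less_divide_eq flip: add_divide_distrib diff_divide_distrib) (simp add: algebra_simps)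
      ultimately show ?thesis by blast
    qed
  qed
qed

text \<open>On the quadrant the coefficients of an affine minorant may be lowered, hence taken rational.\<close>
lemma rational_affine_minorant:
  fixes f :: "real \<times> real \<Rightarrow> ennreal"
  assumes conv: "ext_convex_on quadrant f" and lsc: "lsc_on quadrant f"
    and z0: "z0 \<in> quadrant" and y: "0 \<le> y" "ennreal y < f z0"
  shows "\<exists>b c d::rat. (\<forall>u\<ge>0. \<forall>v\<ge>0. ennreal (of_rat b + of_rat c * u + of_rat d * v) \<le> f (u, v)) \<and>
           y < of_rat b + of_rat c * fst z0 + of_rat d * snd z0"
proof -
  obtain b c d :: real where m: "\<And>u v. u \<ge> 0 \<Longrightarrow> v \<ge> 0 \<Longrightarrow> ennreal (b + c * u + d * v) \<le> f (u, v)"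
    and g: "y < b + c * fst z0 + d * snd z0"
    using separation_affine_minorant[OF assms] by blast
  \<comment> \<open>The excess over \<open>y\<close> at \<open>z0\<close>, divided by the total
    weight of the three coefficients: lowering each of them by less than \<open>e\<close> loses less
    than this excess.\<close>
  define e where "e = (b + c * fst z0 + d * snd z0 - y) / (1 + fst z0 + snd z0)"
  have n: "fst z0 \<ge> 0" "snd z0 \<ge> 0" using z0 by auto
  then have e: "e > 0" using g by (simp add: e_def)
  have low: "\<exists>q::rat. x - e < of_rat q \<and> of_rat q < x" for x
    using of_rat_dense[of "x - e" x] e by auto
  obtain b' c' d' :: rat where
    r: "b - e < of_rat b'" "of_rat b' < b" "c - e < of_rat c'" "of_rat c' < c"
       "d - e < of_rat d'" "of_rat d' < d"
    using low[of b] low[of c] low[of d] by blast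
  have "ennreal (of_rat b' + of_rat c' * u + of_rat d' * v) \<le> f (u, v)" if "u \<ge> 0" "v \<ge> 0" for u v
  proof -
    have "of_rat b' + of_rat c' * u + of_rat d' * v \<le> b + c * u + d * v"
      using r that by (intro add_mono mult_right_mono) auto
    then show ?thesis using m[OF that] by (meson ennreal_leI order_trans)
  qed
  moreover have "y < of_rat b' + of_rat c' * fst z0 + of_rat d' * snd z0"
  proof -
    have "e * (1 + fst z0 + snd z0) = b + c * fst z0 + d * snd z0 - y"
      using n by (simp add: e_def)
    then have "y = (b - e) + (c - e) * fst z0 + (d - e) * snd z0" by (simp add: algebra_simps)
    also have "\<dots> < of_rat b' + of_rat c' * fst z0 + of_rat d' * snd z0"
      using r n by (intro add_less_le_mono mult_right_mono) auto
    finally show ?thesis .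
  qed
  ultimately show ?thesis by blast
qed

lemma lsc_on_lsc_envelope: "lsc_on S (lsc_envelope S f)"
  unfolding lsc_on_def
proof
  fix z assume z: "z \<in> S"
  show "lsc_envelope S f z \<le> Liminf (at z within S) (lsc_envelope S f)"
    unfolding lsc_envelope_def[of S f z]
  proof (rule SUP_least)
    fix g assume g: "g \<in> {g. lsc_on S g \<and> (\<forall>w\<in>S. g w \<le> f w)}"
    then have "g z \<le> Liminf (at z within S) g" using z by (auto simp: lsc_on_def)
    also have "\<dots> \<le> Liminf (at z within S) (lsc_envelope S f)"
      using g by (intro Liminf_mono always_eventually) (auto simp: lsc_envelope_def intro: SUP_upper)
    finally show "g z \<le> Liminf (at z within S) (lsc_envelope S f)" .
  qed
qed

lemma lsc_on_continuous:
  fixes g :: "'a::topological_space \<Rightarrow> real"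
  assumes "continuous_on S g"
  shows "lsc_on S (\<lambda>z. ennreal (g z))"
  unfolding lsc_on_def
proof
  fix z assume "z \<in> S"
  show "ennreal (g z) \<le> Liminf (at z within S) (\<lambda>z. ennreal (g z))"
  proof (cases "at z within S = bot")
    case False
    have "((\<lambda>z. ennreal (g z)) \<longlongrightarrow> ennreal (g z)) (at z within S)"
      using assms \<open>z \<in> S\<close> by (auto simp: continuous_on_def)
    then show ?thesis using lim_imp_Liminf[OF False, of "\<lambda>z. ennreal (g z)" "ennreal (g z)"] by simp
  qed (simp add: Liminf_bot)
qed

text \<open>Levels below \<open>c\<close> are handled by the convergence of \<open>g\<close> alone,
  as \<open>f\<close> is nonnegative; higher levels can be lowered by the finite number
  \<open>c\<close>. The lemma keeps \<open>D\<close> lower semicontinuous when the continuous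
  penalty built from \<open>gap\<close> is added.\<close>

lemma Liminf_add_tendsto_ennreal:
  fixes f :: "'a \<Rightarrow> ennreal"
  assumes F: "F \<noteq> bot" and g: "(g \<longlongrightarrow> ennreal c) F"
  shows "Liminf F f + ennreal c \<le> Liminf F (\<lambda>x. f x + g x)"
proof (rule le_Liminf_iff[THEN iffD2], intro allI impI)
  fix y assume y: "y < Liminf F f + ennreal c"
  show "eventually (\<lambda>x. y < f x + g x) F"
  proof (cases "ennreal c \<le> y")
    case False
    then have "eventually (\<lambda>x. y < g x) F" using order_tendstoD(1)[OF g] by auto
    then show ?thesis by eventually_elim (metis add_increasing zero_le order_refl order_less_le_trans)
  next
    case True
    define l where "l = y - ennreal c"
    have fin: "y < top" using y by (meson le_less_trans less_le_trans not_le top.not_eq_extremum top_greatest)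
    have yl: "y = l + ennreal c" using True by (simp add: l_def diff_add_cancel_ennreal)
    have lL: "l < Liminf F f" using y unfolding yl by (simp add: ennreal_add_left_cancel_less add.commute)
    obtain l' where l': "l < l'" "l' < Liminf F f" using dense[OF lL] by blast
    have l'fin: "l' < top" using l'(2) by (meson less_le_trans top_greatest)
    have e1: "eventually (\<lambda>x. l' < f x) F" using l'(2) by (rule less_LiminfD)
    have e2: "eventually (\<lambda>x. y < l' + g x) F"
    proof -
      have "((\<lambda>x. l' + g x) \<longlongrightarrow> l' + ennreal c) F" by (intro tendsto_intros g)
      moreover have "y < l' + ennreal c" unfolding yl using l'(1) by (simp add: ennreal_add_left_cancel_less add.commute)
      ultimately show ?thesis by (rule order_tendstoD(1))
    qed
    from e1 e2 show ?thesis
      by eventually_elim (meson add_right_mono less_imp_le less_le_trans)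
  qed
qed

text \<open>Concavity on the segment from the origin to \<open>(u, v)\<close> bounds
  \<open>\<alpha> (u, v)\<close> by \<open>u + v\<close> times the value at the rescaled point
  \<open>(u, v) / (u + v)\<close>, which lies in the unit square, where \<open>\<alpha>\<close> is
  bounded by compactness.\<close>

lemma flux_density_growth:
  assumes "flux_density \<alpha>"
  shows "\<exists>C>0. \<forall>u\<ge>0. \<forall>v\<ge>0. \<alpha> (u, v) \<le> C * (1 + u + v)"
proof -
  have a: "\<And>z. z \<in> quadrant \<Longrightarrow> 0 \<le> \<alpha> z" "continuous_on quadrant \<alpha>" "concave_on quadrant \<alpha>"
    using assms by (auto simp: flux_density_def)
  let ?Q = "{0..1::real} \<times> {0..1::real}"
  have "compact (\<alpha> ` ?Q)"
    by (intro compact_continuous_image compact_Times compact_Icc continuous_on_subset[OF a(2)]) auto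
  then have "bounded (\<alpha> ` ?Q)" by (rule compact_imp_bounded)
  then obtain C where C: "C > 0" "\<And>z. z \<in> ?Q \<Longrightarrow> \<bar>\<alpha> z\<bar> \<le> C"
    unfolding bounded_pos by auto
  have "\<alpha> (u, v) \<le> C * (1 + u + v)" if uv: "u \<ge> 0" "v \<ge> 0" for u v
  proof (cases "u + v \<le> 1")
    case True
    then have "\<alpha> (u, v) \<le> C" using C(2)[of "(u, v)"] uv by auto
    also have "\<dots> \<le> C * (1 + u + v)" using C(1) uv by (simp add: algebra_simps)
    finally show ?thesis .
  next
    case False
    define s where "s = u + v"
    have s: "s > 1" using False by (simp add: s_def)
    have "(1 - 1 / s) * \<alpha> (0, 0) + (1 / s) * \<alpha> (u, v) \<le> \<alpha> ((1 - 1 / s) *\<^sub>R (0, 0) + (1 / s) *\<^sub>R (u, v))"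
      by (rule concave_onD[OF a(3)]) (use s uv in auto)
    also have "\<dots> = \<alpha> (u / s, v / s)" by simp
    also have "\<dots> \<le> C" using C(2)[of "(u / s, v / s)"] uv s by (auto simp: s_def)
    finally have "(1 - 1 / s) * \<alpha> (0, 0) + (1 / s) * \<alpha> (u, v) \<le> C" .
    moreover have "(1 - 1 / s) * \<alpha> (0, 0) \<ge> 0" using a(1)[of "(0,0)"] s by simp
    ultimately have "\<alpha> (u, v) \<le> C * s" using s by (simp add: field_simps)
    also have "\<dots> \<le> C * (1 + u + v)" using C(1) by (simp add: s_def)
    finally show ?thesis .
  qed
  then show ?thesis using C(1) by blast
qed

text \<open>The de la Vallee Poussin form of superlinear growth: the factor in front of
  \<open>\<phi>\<close> can be as small as desired at the price of a constant.\<close>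

lemma entropy_density_superlinear:
  assumes "entropy_density \<phi>" "\<epsilon> > 0"
  shows "\<exists>M\<ge>0. \<forall>r\<ge>0. r \<le> M + \<epsilon> * \<phi> r"
proof -
  have "filterlim (\<lambda>r. \<phi> r / r) at_top at_top" and nn: "\<And>r. r \<ge> 0 \<Longrightarrow> 0 \<le> \<phi> r"
    using assms by (auto simp: entropy_density_def)
  then have "eventually (\<lambda>r. 1 / \<epsilon> \<le> \<phi> r / r) at_top" by (auto simp: filterlim_at_top)
  then obtain R where R: "\<And>r. r \<ge> R \<Longrightarrow> 1 / \<epsilon> \<le> \<phi> r / r" by (auto simp: eventually_at_top_linorder)
  have "r \<le> max R 1 + \<epsilon> * \<phi> r" if r: "r \<ge> 0" for r
  proof (cases "r \<ge> max R 1")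
    case True
    then have "1 / \<epsilon> \<le> \<phi> r / r" "r > 0" using R by auto
    then have "r \<le> \<epsilon> * \<phi> r" using assms(2) by (simp add: field_simps)
    then show ?thesis by simp
  next
    case False
    moreover have "0 \<le> \<epsilon> * \<phi> r" using nn[OF r] assms(2) by simp
    ultimately show ?thesis by linarith
  qed
  then show ?thesis by (intro exI[of _ "max R 1"]) auto
qed

section \<open>The dissipation density and its conjugate\<close>

locale dual_dissipation =
  fixes \<psi>s :: "real \<Rightarrow> real"
  assumes psi: "dual_dissipation_density \<psi>s"
begin

abbreviation "\<psi> \<equiv> convex_conjugate \<psi>s"

lemma psis_nonneg: "0 \<le> \<psi>s x" and psis_0: "\<psi>s 0 = 0" and psis_minus: "\<psi>s (- x) = \<psi>s x"
  using psi by (auto simp: dual_dissipation_density_def)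

lemma continuous_psis: "continuous_on UNIV \<psi>s"
  using psi by (auto simp: dual_dissipation_density_def intro!: continuous_at_imp_continuous_on
      differentiable_imp_continuous_within)

text \<open>The conjugate is a \<open>SUP\<close> of reals, which is meaningful only for sets
  bounded above; superlinear growth of \<open>\<psi>s\<close> provides the bound.\<close>

lemma conjugate_bdd_above: "bdd_above (range (\<lambda>\<xi>. s * \<xi> - \<psi>s \<xi>))"
proof -
  have "filterlim (\<lambda>\<xi>. \<psi>s \<xi> / \<bar>\<xi>\<bar>) at_top at_infinity" using psi by (auto simp: dual_dissipation_density_def)
  then have "eventually (\<lambda>\<xi>. \<bar>s\<bar> \<le> \<psi>s \<xi> / \<bar>\<xi>\<bar>) at_infinity" by (auto simp: filterlim_at_top)
  then obtain R where R: "\<And>\<xi>. norm \<xi> \<ge> R \<Longrightarrow> \<bar>s\<bar> \<le> \<psi>s \<xi> / \<bar>\<xi>\<bar>" by (auto simp: eventually_at_infinity)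
  have "s * \<xi> - \<psi>s \<xi> \<le> \<bar>s\<bar> * \<bar>R\<bar>" for \<xi>
  proof (cases "\<bar>\<xi>\<bar> \<ge> R \<and> \<xi> \<noteq> 0")
    case True
    then have "\<bar>s\<bar> * \<bar>\<xi>\<bar> \<le> \<psi>s \<xi>" using R[of \<xi>] by (simp add: field_simps)
    moreover have "s * \<xi> \<le> \<bar>s\<bar> * \<bar>\<xi>\<bar>" by (metis abs_ge_self abs_mult)
    ultimately show ?thesis by (smt (verit) mult_nonneg_nonneg abs_ge_zero)
  next
    case False
    then have "\<bar>\<xi>\<bar> \<le> \<bar>R\<bar>" by auto
    then have "\<bar>s\<bar> * \<bar>\<xi>\<bar> \<le> \<bar>s\<bar> * \<bar>R\<bar>" by (intro mult_left_mono) auto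
    moreover have "s * \<xi> \<le> \<bar>s\<bar> * \<bar>\<xi>\<bar>" by (metis abs_ge_self abs_mult)
    ultimately show ?thesis using psis_nonneg[of \<xi>] by linarith
  qed
  then show ?thesis by (auto intro!: bdd_aboveI)
qed

lemma Young: "s * \<xi> \<le> \<psi> s + \<psi>s \<xi>"
  using cSUP_upper[OF UNIV_I conjugate_bdd_above, of s \<xi>] by (simp add: convex_conjugate_def)

lemma psi_nonneg: "0 \<le> \<psi> s"
  using Young[of s 0] by (simp add: psis_0)

text \<open>Continuity of \<open>\<psi>s\<close> allows the supremum in the conjugate to run over
  the rationals. This makes \<open>\<psi>\<close> Borel measurable and later keeps the dual family
  countable.\<close>

lemma less_psi_rational:
  assumes "y < \<psi> s"
  shows "\<exists>q::rat. y < s * of_rat q - \<psi>s (of_rat q)"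
proof -
  obtain \<xi> where \<xi>: "y < s * \<xi> - \<psi>s \<xi>"
    using assms unfolding convex_conjugate_def by (subst (asm) less_cSUP_iff[OF _ conjugate_bdd_above]) auto
  have "isCont (\<lambda>\<xi>. s * \<xi> - \<psi>s \<xi>) \<xi>"
    using continuous_psis by (intro continuous_intros) (simp add: continuous_on_eq_continuous_at)
  then have "eventually (\<lambda>x. y < s * x - \<psi>s x) (nhds \<xi>)"
    using tendsto_at_iff_tendsto_nhds[of "\<lambda>\<xi>. s * \<xi> - \<psi>s \<xi>" \<xi>]
    by (intro order_tendstoD(1)[OF _ \<xi>]) (simp add: isCont_def)
  then obtain d where d: "d > 0" "\<And>x. dist x \<xi> < d \<Longrightarrow> y < s * x - \<psi>s x"
    unfolding eventually_nhds_metric by blast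
  obtain q :: rat where "\<xi> < of_rat q" "of_rat q < \<xi> + d" using of_rat_dense[of \<xi> "\<xi> + d"] d(1) by auto
  then show ?thesis using d(2)[of "of_rat q"] by (auto simp: dist_real_def)
qed

lemma borel_measurable_psi [measurable]: "\<psi> \<in> borel_measurable borel"
proof (rule borel_measurableI_greater)
  fix y
  have "{s. y < \<psi> s} = (\<Union>q::rat. {s. y < s * of_rat q - \<psi>s (of_rat q)})"
  proof (intro equalityI subsetI)
    fix s assume "s \<in> (\<Union>q::rat. {s. y < s * of_rat q - \<psi>s (of_rat q)})"
    then obtain q :: rat where "y < s * of_rat q - \<psi>s (of_rat q)" by blast
    then show "s \<in> {s. y < \<psi> s}" using Young[of s "of_rat q"] by simp
  qed (use less_psi_rational in blast)
  also have "\<dots> \<in> sets borel" by (intro sets.countable_UN'') auto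
  finally show "{s \<in> space borel. y < \<psi> s} \<in> sets borel" by simp
qed

lemma borel_measurable_psis [measurable]: "\<psi>s \<in> borel_measurable borel"
  using continuous_psis by (rule borel_measurable_continuous_onI)

text \<open>Meant for \<open>s\<close> the truncated distance: the cost of the slope
  \<open>L s\<close> is then integrable against the possibly infinite jump measure. Near 0 the bound
  comes from the finite limit of \<open>\<psi>s \<xi> / \<xi>\<^sup>2\<close>; for
  \<open>\<xi> \<ge> d\<close> any bound \<open>B\<close> is at most
  \<open>B / d\<^sup>2 * \<xi>\<^sup>2\<close>.\<close>

lemma psis_quadratic_bound:
  assumes L: "L \<ge> 0"
  shows "\<exists>C\<ge>0. \<forall>s\<in>{0..1}. \<psi>s (L * s) \<le> C * s\<^sup>2"
proof -
  obtain c where c: "c > 0" "((\<lambda>\<xi>. \<psi>s \<xi> / \<bar>\<xi>\<bar>\<^sup>2) \<longlongrightarrow> c) (at 0)"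
    using psi by (auto simp: dual_dissipation_density_def)
  have "eventually (\<lambda>\<xi>. \<psi>s \<xi> / \<bar>\<xi>\<bar>\<^sup>2 < c + 1) (at 0)"
    using c(2) by (rule order_tendstoD) simp
  then obtain d where d: "d > 0" "\<And>\<xi>. \<xi> \<noteq> 0 \<Longrightarrow> dist \<xi> 0 < d \<Longrightarrow> \<psi>s \<xi> / \<bar>\<xi>\<bar>\<^sup>2 < c + 1"
    unfolding eventually_at by blast
  have "compact (\<psi>s ` {0..L})"
    by (intro compact_continuous_image compact_Icc continuous_on_subset[OF continuous_psis]) auto
  then obtain B where B: "B > 0" "\<And>z. z \<in> {0..L} \<Longrightarrow> \<bar>\<psi>s z\<bar> \<le> B"
    using compact_imp_bounded[of "\<psi>s ` {0..L}"] unfolding bounded_pos by auto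
  define K where "K = max (c + 1) (B / d\<^sup>2)"
  have K0: "K \<ge> 0" using c(1) by (simp add: K_def)
  have K: "\<psi>s \<xi> \<le> K * \<xi>\<^sup>2" if \<xi>: "0 \<le> \<xi>" "\<xi> \<le> L" for \<xi>
  proof (cases "\<xi> < d")
    case True
    show ?thesis
    proof (cases "\<xi> = 0")
      case False
      then have "\<psi>s \<xi> / \<xi>\<^sup>2 < c + 1" using d(2)[of \<xi>] True \<xi> by (auto simp: dist_real_def)
      then have "\<psi>s \<xi> \<le> (c + 1) * \<xi>\<^sup>2" using False by (simp add: field_simps)
      also have "\<dots> \<le> K * \<xi>\<^sup>2" by (intro mult_right_mono) (auto simp: K_def)
      finally show ?thesis .
    qed (simp add: psis_0)
  next
    case False
    have "\<psi>s \<xi> \<le> B" using B(2)[of \<xi>] \<xi> by auto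
    also have "B = B / d\<^sup>2 * d\<^sup>2" using d(1) by simp
    also have "\<dots> \<le> K * \<xi>\<^sup>2"
      using False d(1) B(1) K0 by (intro mult_mono power_mono) (auto simp: K_def)
    finally show ?thesis .
  qed
  show ?thesis
  proof (intro exI[of _ "K * L\<^sup>2"] conjI ballI)
    fix s :: real assume s: "s \<in> {0..1}"
    then have "\<psi>s (L * s) \<le> K * (L * s)\<^sup>2" using L by (intro K) (auto simp: mult_left_le)
    then show "\<psi>s (L * s) \<le> K * L\<^sup>2 * s\<^sup>2" by (simp add: power_mult_distrib)
  qed (use K0 in simp)
qed

end

text \<open>\<open>\<phi>\<close> is read as a function on the quadrant that depends on the first
  variable only, so that the rational minorants found above apply; setting the second variable to 0
  then removes their third coefficient.\<close>

lemma entropy_density_affine: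
  assumes "entropy_density \<phi>"
  shows "\<exists>b c :: nat \<Rightarrow> real. b 0 = 0 \<and> c 0 = 0 \<and> (\<forall>i. \<forall>r\<ge>0. b i + c i * r \<le> \<phi> r) \<and>
           (\<forall>r\<ge>0. ennreal (\<phi> r) = (SUP i. ennreal (b i + c i * r)))"
proof -
  let ?f = "\<lambda>z::real \<times> real. ennreal (\<phi> (fst z))"
  have nn: "\<And>r. r \<ge> 0 \<Longrightarrow> 0 \<le> \<phi> r" and cont: "continuous_on {0..} \<phi>" and conv: "convex_on {0..} \<phi>"
    using assms by (auto simp: entropy_density_def)
  have "continuous_on quadrant (\<lambda>z. \<phi> (fst z))"
    by (rule continuous_on_compose2[OF cont]) (auto intro!: continuous_intros)
  then have lsc: "lsc_on quadrant ?f" by (rule lsc_on_continuous)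
  have conv': "ext_convex_on quadrant ?f"
    unfolding ext_convex_on_def
  proof (intro conjI ballI allI impI)
    show "convex quadrant" by (intro convex_Times) auto
    fix x y :: "real \<times> real" and t :: real assume xy: "x \<in> quadrant" "y \<in> quadrant" and t: "0 < t \<and> t < 1"
    have "\<phi> ((1 - t) *\<^sub>R fst x + t *\<^sub>R fst y) \<le> (1 - t) * \<phi> (fst x) + t * \<phi> (fst y)"
      using xy t by (intro convex_onD[OF conv]) auto
    then have "?f ((1 - t) *\<^sub>R x + t *\<^sub>R y) \<le> ennreal ((1 - t) * \<phi> (fst x) + t * \<phi> (fst y))"
      by (intro ennreal_leI) simp
    also have "\<dots> = ennreal (1 - t) * ?f x + ennreal t * ?f y"
      using t xy nn[of "fst x"] nn[of "fst y"] by (auto simp: ennreal_mult)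
    finally show "?f ((1 - t) *\<^sub>R x + t *\<^sub>R y) \<le> ennreal (1 - t) * ?f x + ennreal t * ?f y" .
  qed
  define A where "A = {(b::rat, c::rat). \<forall>r\<ge>0. ennreal (of_rat b + of_rat c * r) \<le> ennreal (\<phi> r)}"
  have A0: "(0, 0) \<in> A" by (auto simp: A_def)
  \<comment> \<open>The zero minorant sits at index 0, so that a maximum over the first indices is
    never negative.\<close>
  define e where "e n = (if n = 0 then (0, 0) else from_nat_into A (n - 1))" for n
  have eA: "e n \<in> A" for n using A0 from_nat_into[of A] by (auto simp: e_def)
  have eA': "\<exists>n. e n = a" if a: "a \<in> A" for a
  proof -
    obtain k where "from_nat_into A k = a" using from_nat_into_surj[of A a] a countableI_type[of A] by blast
    then have "e (Suc k) = a" by (simp add: e_def)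
    then show ?thesis by blast
  qed
  let ?b = "\<lambda>n. real_of_rat (fst (e n))" and ?c = "\<lambda>n. real_of_rat (snd (e n))"
  have le: "ennreal (?b i + ?c i * r) \<le> ennreal (\<phi> r)" if "r \<ge> 0" for i r
    using eA[of i] that by (auto simp: A_def split: prod.splits)
  have "ennreal (\<phi> r) = (SUP i. ennreal (?b i + ?c i * r))" if r: "r \<ge> 0" for r
  proof (rule antisym)
    show "(SUP i. ennreal (?b i + ?c i * r)) \<le> ennreal (\<phi> r)" using le[OF r] by (auto intro: SUP_least)
    show "ennreal (\<phi> r) \<le> (SUP i. ennreal (?b i + ?c i * r))"
    proof (rule dense_le)
      fix y assume y: "y < ennreal (\<phi> r)"
      then have "y < top" by (rule less_trans) simp
      then obtain y' where y': "y = ennreal y'" "0 \<le> y'" by (cases y) auto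
      have "\<exists>b c d::rat. (\<forall>u\<ge>0. \<forall>v\<ge>0. ennreal (of_rat b + of_rat c * u + of_rat d * v) \<le> ?f (u, v)) \<and>
          y' < of_rat b + of_rat c * fst (r, 0::real) + of_rat d * snd (r, 0::real)"
        by (rule rational_affine_minorant[OF conv' lsc]) (use y y' r in auto)
      then obtain b c d :: rat where
        m: "\<forall>u\<ge>0. \<forall>v\<ge>0. ennreal (of_rat b + of_rat c * u + of_rat d * v) \<le> ?f (u, v)" and
        "y' < of_rat b + of_rat c * fst (r, 0::real) + of_rat d * snd (r, 0::real)" by blast
      then have g: "y' < of_rat b + of_rat c * r" by simp
      have "(b, c) \<in> A" using m[rule_format, of _ 0] by (auto simp: A_def)
      then obtain n where "e n = (b, c)" using eA' by blast
      then have "y \<le> ennreal (?b n + ?c n * r)" using g by (simp add: y'(1) ennreal_leI)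
      also have "\<dots> \<le> (SUP i. ennreal (?b i + ?c i * r))" by (rule SUP_upper) simp
      finally show "y \<le> (SUP i. ennreal (?b i + ?c i * r))" .
    qed
  qed
  moreover have "?b i + ?c i * r \<le> \<phi> r" if "r \<ge> 0" for i r
    using le[OF that] nn[OF that] by (simp add: ennreal_le_iff)
  ultimately show ?thesis by (intro exI[of _ ?b] exI[of _ ?c]) (auto simp: e_def)
qed

section \<open>A countable dual family for the total dissipation density\<close>

locale flow_densities = dual_dissipation \<psi>s for \<psi>s +
  fixes \<phi> :: "real \<Rightarrow> real" and \<alpha> :: "real \<times> real \<Rightarrow> real"
  assumes alpha: "flux_density \<alpha>"
    and D_convex: "ext_convex_on quadrant (Fisher_density \<phi> \<psi>s \<alpha>)"
begin

abbreviation "D \<equiv> Fisher_density \<phi> \<psi>s \<alpha>"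

lemma alpha_nonneg: "u \<ge> 0 \<Longrightarrow> v \<ge> 0 \<Longrightarrow> 0 \<le> \<alpha> (u, v)"
  using alpha by (auto simp: flux_density_def)

definition "\<alpha>bound = (SOME C. C > 0 \<and> (\<forall>u\<ge>0. \<forall>v\<ge>0. \<alpha> (u, v) \<le> C * (1 + u + v)))"

lemma alpha_bound_pos: "\<alpha>bound > 0"
  and alpha_bound: "u \<ge> 0 \<Longrightarrow> v \<ge> 0 \<Longrightarrow> \<alpha> (u, v) \<le> \<alpha>bound * (1 + u + v)"
  using someI_ex[OF flux_density_growth[OF alpha]] unfolding \<alpha>bound_def by auto

text \<open>A convex nonnegative function that differs from \<open>- \<alpha>\<close> by an affine
  one. With \<open>p = \<psi>s \<xi>\<close>, the condition that
  \<open>b + c u + d v + p \<alpha> (u, v)\<close> lies below \<open>D\<close> is not affine in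
  \<open>(u, v)\<close>; replacing \<open>\<alpha>\<close> by an affine function minus
  \<open>gap\<close> turns it into the condition that an affine function lies below the convex
  function \<open>D + p gap\<close>.\<close>

definition "gap = (\<lambda>z. \<alpha>bound * (1 + fst z + snd z) - \<alpha> z)"

lemma gap_nonneg: "z \<in> quadrant \<Longrightarrow> 0 \<le> gap z"
  using alpha_bound[of "fst z" "snd z"] by (auto simp: gap_def)

lemma gap_convex:
  assumes "x \<in> quadrant" "y \<in> quadrant" "0 < t" "t < 1"
  shows "gap ((1 - t) *\<^sub>R x + t *\<^sub>R y) \<le> (1 - t) * gap x + t * gap y"
proof -
  have "(1 - t) * \<alpha> x + t * \<alpha> y \<le> \<alpha> ((1 - t) *\<^sub>R x + t *\<^sub>R y)"
    by (rule concave_onD) (use alpha assms in \<open>auto simp: flux_density_def\<close>)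
  then show ?thesis by (simp add: gap_def algebra_simps)
qed

lemma ext_convex_on_penalised:
  assumes p: "p \<ge> 0"
  shows "ext_convex_on quadrant (\<lambda>z. D z + ennreal (p * gap z))"
  unfolding ext_convex_on_def
proof (intro conjI ballI allI impI)
  show "convex quadrant" by (intro convex_Times) auto
  fix x y :: "real \<times> real" and t :: real assume xy: "x \<in> quadrant" "y \<in> quadrant" and t: "0 < t \<and> t < 1"
  have 1: "D ((1 - t) *\<^sub>R x + t *\<^sub>R y) \<le> ennreal (1 - t) * D x + ennreal t * D y"
    using D_convex xy t unfolding ext_convex_on_def by blast
  have "p * gap ((1 - t) *\<^sub>R x + t *\<^sub>R y) \<le> p * ((1 - t) * gap x + t * gap y)"
    using gap_convex[OF xy] t p by (intro mult_left_mono) auto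
  also have "\<dots> = (1 - t) * (p * gap x) + t * (p * gap y)" by (simp add: algebra_simps)
  finally have "ennreal (p * gap ((1 - t) *\<^sub>R x + t *\<^sub>R y)) \<le> ennreal ((1 - t) * (p * gap x) + t * (p * gap y))"
    by (rule ennreal_leI)
  also have "\<dots> = ennreal (1 - t) * ennreal (p * gap x) + ennreal t * ennreal (p * gap y)"
    using t p gap_nonneg[OF xy(1)] gap_nonneg[OF xy(2)] by (auto simp: ennreal_mult)
  finally have 2: "ennreal (p * gap ((1 - t) *\<^sub>R x + t *\<^sub>R y))
      \<le> ennreal (1 - t) * ennreal (p * gap x) + ennreal t * ennreal (p * gap y)" .
  show "D ((1 - t) *\<^sub>R x + t *\<^sub>R y) + ennreal (p * gap ((1 - t) *\<^sub>R x + t *\<^sub>R y))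
      \<le> ennreal (1 - t) * (D x + ennreal (p * gap x)) + ennreal t * (D y + ennreal (p * gap y))"
    using add_mono[OF 1 2] by (simp add: distrib_left algebra_simps)
qed

lemma lsc_on_penalised:
  assumes p: "p \<ge> 0"
  shows "lsc_on quadrant (\<lambda>z. D z + ennreal (p * gap z))"
  unfolding lsc_on_def
proof
  fix z assume z: "z \<in> quadrant"
  show "D z + ennreal (p * gap z) \<le> Liminf (at z within quadrant) (\<lambda>z. D z + ennreal (p * gap z))"
  proof (cases "at z within quadrant = bot")
    case False
    have "continuous_on quadrant (\<lambda>z. p * gap z)"
      using alpha unfolding gap_def flux_density_def by (intro continuous_intros) auto
    then have "((\<lambda>z. ennreal (p * gap z)) \<longlongrightarrow> ennreal (p * gap z)) (at z within quadrant)"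
      using z by (auto simp: continuous_on_def)
    then have "Liminf (at z within quadrant) D + ennreal (p * gap z)
        \<le> Liminf (at z within quadrant) (\<lambda>z. D z + ennreal (p * gap z))"
      by (rule Liminf_add_tendsto_ennreal[OF False])
    moreover have "D z \<le> Liminf (at z within quadrant) D"
      using lsc_on_lsc_envelope[of quadrant "Fisher_density_plus \<phi> \<psi>s \<alpha>"] z
      unfolding lsc_on_def Fisher_density_def by blast
    ultimately show ?thesis by (meson add_right_mono order_trans)
  qed (simp add: Liminf_bot)
qed

text \<open>The affine functions \<open>(w, u, v) \<mapsto> 2\<xi>w + b + cu + dv\<close> with \<open>(\<xi>, b, c, d)\<close> in this set lie below the
  integrand \<open>\<psi>(2w/\<alpha>)\<alpha> + D\<close> of twice the total dissipation; a countable subfamily recovers it.\<close>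
definition dual_family :: "(real \<times> real \<times> real \<times> real) set" where
  "dual_family = {(\<xi>, b, c, d). \<forall>u\<ge>0. \<forall>v\<ge>0. ennreal (b + c * u + d * v + \<psi>s \<xi> * \<alpha> (u, v)) \<le> D (u, v)}"

lemma zero_in_dual_family: "(0, 0, 0, 0) \<in> dual_family"
  by (auto simp: dual_family_def psis_0)

text \<open>An affine minorant of \<open>D + p gap\<close> with rational coefficients becomes an
  element of the dual family after subtracting \<open>p * \<alpha>bound * (1 + u + v)\<close>. The
  shifted coefficients may be irrational; countability comes from the parameters.\<close>

definition of_rationals :: "rat \<times> rat \<times> rat \<times> rat \<Rightarrow> real \<times> real \<times> real \<times> real" where
  "of_rationals = (\<lambda>(q, b, c, d). let p = \<psi>s (of_rat q) * \<alpha>bound in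
     (of_rat q, of_rat b - p, of_rat c - p, of_rat d - p))"

text \<open>Zero comes first, for the same reason as for the minorants of \<open>\<phi>\<close>; the
  shift of the enumeration by one makes room for it.\<close>

definition "dual_seq = (\<lambda>n. if n = 0 then (0, 0, 0, 0) else
   from_nat_into (insert (0, 0, 0, 0) (dual_family \<inter> range of_rationals)) (n - 1))"

lemma dual_seq_in: "dual_seq n \<in> dual_family"
proof (cases "n = 0")
  case False
  then have "dual_seq n \<in> insert (0, 0, 0, 0) (dual_family \<inter> range of_rationals)"
    unfolding dual_seq_def by (simp add: from_nat_into del: insert_iff)
  then show ?thesis using zero_in_dual_family by (elim insertE) auto
qed (simp add: dual_seq_def zero_in_dual_family)

lemma dual_seq_surj:
  assumes "of_rationals x \<in> dual_family"
  shows "\<exists>n. dual_seq n = of_rationals x"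
proof -
  have "countable (insert (0, 0, 0, 0) (dual_family \<inter> range of_rationals))"
    by (intro countable_insert countable_subset[OF Int_lower2] countable_image countableI_type)
  then obtain k where "from_nat_into (insert (0, 0, 0, 0) (dual_family \<inter> range of_rationals)) k = of_rationals x"
    using from_nat_into_surj[of _ "of_rationals x"] assms by (metis Int_iff insertI2 rangeI)
  then have "dual_seq (Suc k) = of_rationals x" by (simp add: dual_seq_def)
  then show ?thesis by blast
qed

definition "dual_val = (\<lambda>(\<xi>, b, c, d) (w, u, v). 2 * \<xi> * w + b + c * u + d * (v::real) :: real)"

text \<open>As a countable supremum this is measurable without further work, and it takes the value
  \<infinity> by itself where \<open>\<alpha>\<close> vanishes and \<open>w\<close> does not, so the
  quotient \<open>2 w / \<alpha>\<close> is avoided there.\<close>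

definition "integrand wuv = (SUP n. ennreal (dual_val (dual_seq n) wuv))"

text \<open>For a fixed rational slope \<open>q\<close> the coefficients \<open>b\<close>,
  \<open>c\<close>, \<open>d\<close> range over the minorants of \<open>D + p gap\<close>, whose
  supremum is that function. Taking \<open>p gap\<close> away again leaves \<open>D\<close> plus the
  part linear in \<open>w\<close>.\<close>

lemma integrand_ge:
  assumes uv: "u \<ge> 0" "v \<ge> 0" and t: "2 * of_rat q * w - \<psi>s (of_rat q) * \<alpha> (u, v) \<ge> 0"
  shows "D (u, v) + ennreal (2 * of_rat q * w - \<psi>s (of_rat q) * \<alpha> (u, v)) \<le> integrand (w, u, v)"
proof (rule dense_le)
  define t where "t = 2 * of_rat q * w - \<psi>s (of_rat q) * \<alpha> (u, v)"
  let ?p = "\<psi>s (of_rat q)"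
  let ?G = "\<lambda>z. D z + ennreal (?p * gap z)"
  fix y assume y: "y < D (u, v) + ennreal (2 * of_rat q * w - ?p * \<alpha> (u, v))"
  then have "y < top" by (meson less_le_trans top_greatest)
  then obtain y' where y': "y = ennreal y'" "0 \<le> y'" by (cases y) auto
  have g: "?p * gap (u, v) \<ge> 0" using gap_nonneg[of "(u, v)"] uv psis_nonneg by simp
  \<comment> \<open>The level to beat is \<open>y'\<close> after \<open>t\<close> is removed and the
    penalty added. If it is negative, the zero minorant suffices. Otherwise it has to be compared
    with \<open>D + p gap\<close>, and the sign of \<open>y' - t\<close> is distinguished because
    \<open>ennreal\<close> has no negative values to carry the difference.\<close>
  have "\<exists>b c d::rat. (\<forall>u\<ge>0. \<forall>v\<ge>0. ennreal (of_rat b + of_rat c * u + of_rat d * v) \<le> ?G (u, v)) \<and>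
           y' - t + ?p * gap (u, v) < of_rat b + of_rat c * u + of_rat d * v"
  proof (cases "y' - t + ?p * gap (u, v) < 0")
    case True then show ?thesis by (intro exI[of _ 0]) auto
  next
    case False
    have "ennreal (y' - t + ?p * gap (u, v)) < ?G (u, v)"
    proof (cases "y' \<le> t")
      case True
      have "ennreal y' < D (u, v) + ennreal t" using y by (simp add: y' t_def)
      show ?thesis
      proof (cases "y' = t")
        case True
        with \<open>ennreal y' < _\<close> have "0 < D (u, v)" by (metis add.commute add.right_neutral gr_zeroI less_irrefl)
        then show ?thesis using True g by (simp add: ennreal_add_left_cancel_less add.commute[of "D (u, v)"])
      next
        case False
        then have "y' - t + ?p * gap (u, v) < ?p * gap (u, v)" using \<open>y' \<le> t\<close> by simp
        then have "ennreal (y' - t + ?p * gap (u, v)) < ennreal (?p * gap (u, v))"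
          using \<open>\<not> y' - t + ?p * gap (u, v) < 0\<close> by (intro ennreal_lessI) auto
        also have "\<dots> \<le> ?G (u, v)" by simp
        finally show ?thesis .
      qed
    next
      case F: False
      have "ennreal t + ennreal (y' - t) < ennreal t + D (u, v)"
        using y F t by (simp add: y' t_def add.commute flip: ennreal_plus)
      then have "ennreal (y' - t) < D (u, v)" by (simp add: ennreal_add_left_cancel_less)
      then have "ennreal (?p * gap (u, v)) + ennreal (y' - t) < ennreal (?p * gap (u, v)) + D (u, v)"
        by (simp add: ennreal_add_left_cancel_less)
      then show ?thesis using F g by (simp add: add.commute flip: ennreal_plus)
    qed
    then show ?thesis
      using rational_affine_minorant[OF ext_convex_on_penalised[OF psis_nonneg] lsc_on_penalised[OF psis_nonneg],
          of "(u, v)" "y' - t + ?p * gap (u, v)" "of_rat q"] False uv by auto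
  qed
  then obtain b c d :: rat where
    m: "\<And>u v. u \<ge> 0 \<Longrightarrow> v \<ge> 0 \<Longrightarrow> ennreal (of_rat b + of_rat c * u + of_rat d * v) \<le> ?G (u, v)" and
    gt: "y' - t + ?p * gap (u, v) < of_rat b + of_rat c * u + of_rat d * v" by blast
  have "of_rationals (q, b, c, d) \<in> dual_family"
    unfolding dual_family_def of_rationals_def
  proof (clarsimp simp: Let_def)
    fix u v :: real assume uv: "0 \<le> u" "0 \<le> v"
    have "ennreal (of_rat b + of_rat c * u + of_rat d * v - ?p * gap (u, v)) \<le> D (u, v)"
      using m[OF uv] gap_nonneg[of "(u, v)"] uv psis_nonneg
      by (simp add: ennreal_minus[symmetric] ennreal_minus_le_iff add.commute)
    then show "ennreal (of_rat b - ?p * \<alpha>bound + (of_rat c - ?p * \<alpha>bound) * u + (of_rat d - ?p * \<alpha>bound) * v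
        + ?p * \<alpha> (u, v)) \<le> D (u, v)"
      by (simp add: gap_def algebra_simps)
  qed
  then obtain n where n: "dual_seq n = of_rationals (q, b, c, d)" using dual_seq_surj by blast
  have "y' \<le> dual_val (dual_seq n) (w, u, v)"
    using gt by (simp add: n dual_val_def of_rationals_def Let_def gap_def t_def algebra_simps)
  then have "y \<le> ennreal (dual_val (dual_seq n) (w, u, v))" by (simp add: y' ennreal_leI)
  also have "\<dots> \<le> integrand (w, u, v)" unfolding integrand_def by (rule SUP_upper) simp
  finally show "y \<le> integrand (w, u, v)" .
qed

lemma integrand_ge_D: "u \<ge> 0 \<Longrightarrow> v \<ge> 0 \<Longrightarrow> D (u, v) \<le> integrand (w, u, v)"
  using integrand_ge[of u v 0 w] by (simp add: psis_0)

text \<open>With \<open>\<alpha> (u, v) = 0\<close> the penalty \<open>\<psi>s q * \<alpha>\<close>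
  disappears, so the slopes \<open>n\<close> and \<open>- n\<close>, chosen according to the sign of
  \<open>w\<close>, contribute \<open>2 n \<bar>w\<bar>\<close> at no cost.\<close>

lemma integrand_degenerate:
  assumes uv: "u \<ge> 0" "v \<ge> 0" and "\<alpha> (u, v) = 0" "w \<noteq> 0"
  shows "integrand (w, u, v) = \<infinity>"
proof (rule ccontr)
  assume "integrand (w, u, v) \<noteq> \<infinity>"
  then obtain h where h: "integrand (w, u, v) = ennreal h" "h \<ge> 0" by (cases "integrand (w, u, v)") auto
  obtain n :: nat where n: "of_nat n * \<bar>w\<bar> > h" using assms by (meson ex_less_of_nat_mult zero_less_abs_iff)
  have "ennreal (2 * of_nat n * \<bar>w\<bar>) \<le> integrand (w, u, v)"
  proof (cases "w \<ge> 0")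
    case True
    then have "D (u, v) + ennreal (2 * of_nat n * \<bar>w\<bar>) \<le> integrand (w, u, v)"
      using integrand_ge[OF uv, of "of_nat n" w] assms by simp
    then show ?thesis by (rule order_trans[rotated]) simp
  next
    case False
    then have "D (u, v) + ennreal (2 * of_nat n * \<bar>w\<bar>) \<le> integrand (w, u, v)"
      using integrand_ge[OF uv, of "- of_nat n" w] assms by (simp add: of_rat_minus mult_nonneg_nonpos2 mult_nonneg_nonpos)
    then show ?thesis by (rule order_trans[rotated]) simp
  qed
  then have "2 * of_nat n * \<bar>w\<bar> \<le> h" using h by simp
  moreover have "0 \<le> of_nat n * \<bar>w\<bar>" by simp
  ultimately show False using n by linarith
qed

text \<open>If the claim fails, all quantities are finite and the comparison is one of reals. For
  \<open>s = 2 w / \<alpha>\<close>, multiplying \<open>s \<xi> - \<psi>s \<xi>\<close> by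
  \<open>\<alpha>\<close> gives \<open>2 \<xi> w - \<psi>s \<xi> \<alpha>\<close>, the value of a
  slope in \<open>integrand_ge\<close>; a rational slope already exceeds the assumed gap.\<close>

lemma integrand_ge_total:
  assumes uv: "u \<ge> 0" "v \<ge> 0" and a: "\<alpha> (u, v) > 0"
  shows "ennreal (\<psi> (2 * w / \<alpha> (u, v)) * \<alpha> (u, v)) + D (u, v) \<le> integrand (w, u, v)"
proof (rule ccontr)
  assume c: "\<not> ?thesis"
  define s where "s = 2 * w / \<alpha> (u, v)"
  have D: "D (u, v) \<le> integrand (w, u, v)" by (rule integrand_ge_D[OF uv])
  have "integrand (w, u, v) < top" using c by (auto simp: not_le intro: less_le_trans)
  then obtain h where h: "integrand (w, u, v) = ennreal h" "h \<ge> 0" by (cases "integrand (w, u, v)") auto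
  have "D (u, v) < top" using D h by (auto simp: le_less_trans)
  then obtain e where e: "D (u, v) = ennreal e" "e \<ge> 0" by (cases "D (u, v)") auto
  have "h < \<psi> s * \<alpha> (u, v) + e"
    using c psi_nonneg[of s] a by (simp add: h e s_def flip: ennreal_plus)
  then have "(h - e) / \<alpha> (u, v) < \<psi> s" using a by (simp add: field_simps)
  then obtain q where q: "(h - e) / \<alpha> (u, v) < s * of_rat q - \<psi>s (of_rat q)" using less_psi_rational by blast
  have eq: "(s * of_rat q - \<psi>s (of_rat q)) * \<alpha> (u, v) = 2 * of_rat q * w - \<psi>s (of_rat q) * \<alpha> (u, v)"
    using a by (simp add: s_def field_simps)
  have lt: "h - e < 2 * of_rat q * w - \<psi>s (of_rat q) * \<alpha> (u, v)"
    using q a unfolding eq[symmetric] by (simp add: pos_divide_less_eq)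
  \<comment> \<open>Together with \<open>lt\<close> this makes the value of the slope positive, as
    \<open>integrand_ge\<close> requires.\<close>
  have "h \<ge> e" using D by (simp add: h e)
  then have "ennreal e + ennreal (2 * of_rat q * w - \<psi>s (of_rat q) * \<alpha> (u, v)) \<le> ennreal h"
    using integrand_ge[OF uv, of q w] lt by (simp add: h e)
  then show False using lt \<open>h \<ge> e\<close> e h by (simp flip: ennreal_plus)
qed

lemma integrand_ge_all:
  assumes "u \<ge> 0" "v \<ge> 0" "integrand (w, u, v) < \<infinity>"
  shows "\<alpha> (u, v) = 0 \<Longrightarrow> w = 0"
    and "ennreal (\<psi> (2 * w / \<alpha> (u, v))) * ennreal (\<alpha> (u, v)) + D (u, v) \<le> integrand (w, u, v)"
proof -
  show "\<alpha> (u, v) = 0 \<Longrightarrow> w = 0" using integrand_degenerate[OF assms(1,2), of w] assms(3) by (cases "w = 0") auto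
  show "ennreal (\<psi> (2 * w / \<alpha> (u, v))) * ennreal (\<alpha> (u, v)) + D (u, v) \<le> integrand (w, u, v)"
    using integrand_ge_total[OF assms(1,2)] integrand_ge_D[OF assms(1,2)] alpha_nonneg[OF assms(1,2)] psi_nonneg
    by (cases "\<alpha> (u, v) = 0") (auto simp: ennreal_mult)
qed

end

section \<open>Semidirect products of measures\<close>

definition finite_kernel :: "('a::topological_space \<Rightarrow> 'b::topological_space measure) \<Rightarrow> bool" where
  "finite_kernel K \<longleftrightarrow> (\<forall>x. sets (K x) = sets borel \<and> emeasure (K x) UNIV < \<infinity>) \<and>
     (\<forall>B\<in>sets borel. (\<lambda>x. emeasure (K x) B) \<in> borel_measurable borel)"

text \<open>The formula of \<open>edge_measure\<close> over an arbitrary base. It serves three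
  purposes: the jump measure over \<open>\<pi>\<close>, the weighted fluxes over time, and, with
  constant kernels, product measures.\<close>

definition semidirect :: "'a::topological_space measure \<Rightarrow> ('a \<Rightarrow> 'b::topological_space measure) \<Rightarrow> ('a \<times> 'b) measure" where
  "semidirect M K = measure_of UNIV (sets borel) (\<lambda>B. \<integral>\<^sup>+ x. (\<integral>\<^sup>+ y. indicator B (x, y) \<partial>K x) \<partial>M)"

lemma edge_measure_eq_semidirect: "edge_measure \<pi> \<kappa> = semidirect \<pi> \<kappa>"
  by (simp add: edge_measure_def semidirect_def)

lemma sets_semidirect [simp]: "sets (semidirect M K) = sets borel"
  unfolding semidirect_def by (subst sets_measure_of) (auto simp: sets.sigma_sets_eq[of borel, simplified])

lemma space_semidirect [simp]: "space (semidirect M K) = UNIV"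
  unfolding semidirect_def by (rule space_measure_of) auto

lemma measurable_semidirect1 [simp]: "measurable (semidirect M K) N = measurable borel N"
  by (rule measurable_cong_sets) auto

lemma space_eq_UNIV: "sets M = sets (borel :: 'a::topological_space measure) \<Longrightarrow> space M = UNIV"
  using sets_eq_imp_space_eq[of M borel] by simp

lemma finite_kernelD:
  assumes "finite_kernel K"
  shows "sets (K x) = sets borel" "emeasure (K x) UNIV < \<infinity>" "space (K x) = UNIV" "finite_measure (K x)"
    "B \<in> sets borel \<Longrightarrow> (\<lambda>x. emeasure (K x) B) \<in> borel_measurable borel"
proof -
  show 1: "sets (K x) = sets borel" "emeasure (K x) UNIV < \<infinity>"
    "B \<in> sets borel \<Longrightarrow> (\<lambda>x. emeasure (K x) B) \<in> borel_measurable borel"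
    using assms by (auto simp: finite_kernel_def)
  show 2: "space (K x) = UNIV" by (rule space_eq_UNIV[OF 1(1)])
  show "finite_measure (K x)" by (rule finite_measureI) (use 1(2) 2 in auto)
qed

lemma measurable_Pair_section:
  fixes f :: "'a::second_countable_topology \<times> 'b::second_countable_topology \<Rightarrow> 'c"
  assumes "f \<in> measurable borel N"
  shows "(\<lambda>y. f (x, y)) \<in> measurable borel N"
  using assms unfolding borel_prod[symmetric] by measurable

lemma sets_Pair_section:
  fixes B :: "('a::second_countable_topology \<times> 'b::second_countable_topology) set"
  assumes "B \<in> sets borel"
  shows "Pair x -` B \<in> sets borel"
  using measurable_sets[OF measurable_Pair_section[OF measurable_ident, of x] assms] by (simp add: vimage_def)

lemma nn_integral_indicator_section:
  fixes A :: "('a::second_countable_topology \<times> 'b::second_countable_topology) set"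
  assumes "sets N = sets borel" "A \<in> sets borel"
  shows "(\<integral>\<^sup>+ y. indicator A (x, y) \<partial>N) = emeasure N (Pair x -` A)"
proof -
  have "(\<lambda>y. indicator A (x, y)) = (indicator (Pair x -` A) :: 'b \<Rightarrow> ennreal)"
    by (auto simp: fun_eq_iff split: split_indicator)
  then show ?thesis using sets_Pair_section[OF assms(2), of x] assms(1) by simp
qed

lemma rectangles_generate:
  "sets (borel :: ('a::second_countable_topology \<times> 'b::second_countable_topology) measure)
     = sigma_sets UNIV {A \<times> B | A B. A \<in> sets borel \<and> B \<in> sets borel}"
  unfolding borel_prod[symmetric] sets_pair_measure by simp

text \<open>A Dynkin argument from rectangles; finiteness of the slices is what turns complements
  into differences.\<close>

lemma kernel_emeasure_measurable:
  fixes K :: "'a::second_countable_topology \<Rightarrow> 'b::second_countable_topology measure"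
  assumes K: "finite_kernel K" and B: "B \<in> sets borel"
  shows "(\<lambda>x. emeasure (K x) (Pair x -` B)) \<in> borel_measurable borel"
proof -
  let ?G = "{A \<times> B | A B. A \<in> sets (borel::'a measure) \<and> B \<in> sets (borel::'b measure)}"
  have "Int_stable ?G" by (rule Int_stable_pair_measure_generator)
  moreover have "?G \<subseteq> Pow UNIV" by auto
  moreover have "B \<in> sigma_sets UNIV ?G" using B by (simp add: rectangles_generate)
  ultimately show ?thesis
  proof (induction rule: sigma_sets_induct_disjoint)
    case (basic C)
    then obtain A B where C: "C = A \<times> B" "A \<in> sets borel" "B \<in> sets borel" by auto
    have "emeasure (K x) (Pair x -` C) = indicator A x * emeasure (K x) B" for x
      by (auto simp: C(1) indicator_def vimage_def)
    then show ?case using finite_kernelD(5)[OF K C(3)] C(2) by simp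
  next
    case empty then show ?case by simp
  next
    case (compl C)
    have "emeasure (K x) (Pair x -` (UNIV - C)) = emeasure (K x) UNIV - emeasure (K x) (Pair x -` C)" for x
    proof -
      have "Pair x -` (UNIV - C) = UNIV - Pair x -` C" by auto
      moreover have "Pair x -` C \<in> sets (K x)"
        using compl(1) sets_Pair_section[of C x] finite_kernelD(1)[OF K] by (simp add: rectangles_generate)
      ultimately show ?thesis
        using emeasure_compl[of "Pair x -` C" "K x"] finite_kernelD(3)[OF K, of x]
          finite_measure.emeasure_finite[OF finite_kernelD(4)[OF K]] by simp
    qed
    then show ?case using compl(2) finite_kernelD(5)[OF K, of UNIV] by simp
  next
    case (union C)
    have "emeasure (K x) (Pair x -` (\<Union>i. C i)) = (\<Sum>i. emeasure (K x) (Pair x -` C i))" for x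
    proof -
      have "range (\<lambda>i. Pair x -` C i) \<subseteq> sets (K x)"
        using union(2) sets_Pair_section[of "C _" x] finite_kernelD(1)[OF K] by (auto simp: rectangles_generate)
      moreover have "disjoint_family (\<lambda>i. Pair x -` C i)"
        using union(1) by (auto simp: disjoint_family_on_def)
      ultimately show ?thesis by (simp add: suminf_emeasure vimage_UN)
    qed
    then show ?case using union(3) by simp
  qed
qed

lemma kernel_nn_integral_measurable:
  fixes K :: "'a::second_countable_topology \<Rightarrow> 'b::second_countable_topology measure"
  assumes K: "finite_kernel K" and f: "f \<in> borel_measurable borel"
  shows "(\<lambda>x. \<integral>\<^sup>+ y. f (x, y) \<partial>K x) \<in> borel_measurable borel"
  using f
proof (induction rule: borel_measurable_induct)
  case (cong f g) then show ?case by simp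
next
  case (set A)
  have "(\<integral>\<^sup>+ y. indicator A (x, y) \<partial>K x) = emeasure (K x) (Pair x -` A)" for x
    by (rule nn_integral_indicator_section[OF finite_kernelD(1)[OF K] set])
  then show ?case using kernel_emeasure_measurable[OF K set] by simp
next
  case (mult f c)
  then have "(\<integral>\<^sup>+ y. c * f (x, y) \<partial>K x) = c * (\<integral>\<^sup>+ y. f (x, y) \<partial>K x)" for x
    by (intro nn_integral_cmult) (simp add: measurable_Pair_section measurable_cong_sets[OF finite_kernelD(1)[OF K] refl])
  then show ?case using mult by simp
next
  case (add f g)
  then have "(\<integral>\<^sup>+ y. f (x, y) + g (x, y) \<partial>K x) = (\<integral>\<^sup>+ y. f (x, y) \<partial>K x) + (\<integral>\<^sup>+ y. g (x, y) \<partial>K x)" for x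
    by (intro nn_integral_add) (simp_all add: measurable_Pair_section measurable_cong_sets[OF finite_kernelD(1)[OF K] refl])
  then show ?case using add by (simp add: add.commute)
next
  case (seq U)
  have "(\<integral>\<^sup>+ y. (SUP i. U i) (x, y) \<partial>K x) = (SUP i. \<integral>\<^sup>+ y. U i (x, y) \<partial>K x)" for x
    unfolding SUP_apply
    by (intro nn_integral_monotone_convergence_SUP)
       (use seq in \<open>auto simp: measurable_Pair_section measurable_cong_sets[OF finite_kernelD(1)[OF K] refl] incseq_def le_fun_def\<close>)
  then show ?case using seq by simp
qed

text \<open>\<open>measure_of\<close> returns the given set function only if it is a measure.
  Countable additivity exchanges a sum with the outer integral, which is possible because the slices
  of a finite kernel are measurable.\<close>

lemma emeasure_semidirect:
  fixes K :: "'a::second_countable_topology \<Rightarrow> 'b::second_countable_topology measure"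
  assumes K: "finite_kernel K" and M: "sets M = sets borel" and B: "B \<in> sets borel"
  shows "emeasure (semidirect M K) B = (\<integral>\<^sup>+ x. emeasure (K x) (Pair x -` B) \<partial>M)"
proof -
  have eq: "(\<integral>\<^sup>+ y. indicator B (x, y) \<partial>K x) = emeasure (K x) (Pair x -` B)" if "B \<in> sets borel" for B x
    by (rule nn_integral_indicator_section[OF finite_kernelD(1)[OF K] that])
  have "emeasure (semidirect M K) B = (\<integral>\<^sup>+ x. (\<integral>\<^sup>+ y. indicator B (x, y) \<partial>K x) \<partial>M)"
  proof (rule emeasure_measure_of[OF semidirect_def])
    show "sets borel \<subseteq> Pow UNIV" by auto
    show "B \<in> sets (semidirect M K)" using B by simp
    show "positive (sets (semidirect M K)) (\<lambda>B. \<integral>\<^sup>+ x. (\<integral>\<^sup>+ y. indicator B (x, y) \<partial>K x) \<partial>M)"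
      by (simp add: positive_def)
    show "countably_additive (sets (semidirect M K)) (\<lambda>B. \<integral>\<^sup>+ x. (\<integral>\<^sup>+ y. indicator B (x, y) \<partial>K x) \<partial>M)"
    proof (rule countably_additiveI)
      fix A :: "nat \<Rightarrow> _" assume A: "range A \<subseteq> sets (semidirect M K)" "disjoint_family A"
      then have Ab: "\<And>i. A i \<in> sets borel" by auto
      have "(\<Sum>i. \<integral>\<^sup>+ x. (\<integral>\<^sup>+ y. indicator (A i) (x, y) \<partial>K x) \<partial>M) = (\<integral>\<^sup>+ x. (\<Sum>i. emeasure (K x) (Pair x -` A i)) \<partial>M)"
        using kernel_emeasure_measurable[OF K Ab]
        by (subst nn_integral_suminf) (simp_all add: eq[OF Ab] measurable_cong_sets[OF M refl])
      also have "\<dots> = (\<integral>\<^sup>+ x. emeasure (K x) (Pair x -` (\<Union>i. A i)) \<partial>M)"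
      proof (intro nn_integral_cong)
        fix x
        have "range (\<lambda>i. Pair x -` A i) \<subseteq> sets (K x)"
          using Ab sets_Pair_section finite_kernelD(1)[OF K] by auto
        moreover have "disjoint_family (\<lambda>i. Pair x -` A i)"
          using A(2) by (auto simp: disjoint_family_on_def)
        ultimately show "(\<Sum>i. emeasure (K x) (Pair x -` A i)) = emeasure (K x) (Pair x -` (\<Union>i. A i))"
          by (simp add: suminf_emeasure vimage_UN)
      qed
      also have "\<dots> = (\<integral>\<^sup>+ x. (\<integral>\<^sup>+ y. indicator (\<Union>i. A i) (x, y) \<partial>K x) \<partial>M)"
        using Ab by (subst eq) auto
      finally show "(\<Sum>i. \<integral>\<^sup>+ x. (\<integral>\<^sup>+ y. indicator (A i) (x, y) \<partial>K x) \<partial>M)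
        = (\<integral>\<^sup>+ x. (\<integral>\<^sup>+ y. indicator (\<Union>i. A i) (x, y) \<partial>K x) \<partial>M)" .
    qed
  qed
  then show ?thesis by (simp add: eq[OF B])
qed

lemma nn_integral_semidirect:
  fixes K :: "'a::second_countable_topology \<Rightarrow> 'b::second_countable_topology measure"
  assumes K: "finite_kernel K" and M: "sets M = sets borel" and f: "f \<in> borel_measurable borel"
  shows "(\<integral>\<^sup>+ z. f z \<partial>semidirect M K) = (\<integral>\<^sup>+ x. (\<integral>\<^sup>+ y. f (x, y) \<partial>K x) \<partial>M)"
  using f
proof (induction rule: borel_measurable_induct)
  case (cong f g) then show ?case by (simp cong: nn_integral_cong)
next
  case (set A)
  have "(\<integral>\<^sup>+ y. indicator A (x, y) \<partial>K x) = emeasure (K x) (Pair x -` A)" for x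
    by (rule nn_integral_indicator_section[OF finite_kernelD(1)[OF K] set])
  then show ?case using emeasure_semidirect[OF K M set] set by simp
next
  case (mult f c)
  then have "(\<integral>\<^sup>+ y. c * f (x, y) \<partial>K x) = c * (\<integral>\<^sup>+ y. f (x, y) \<partial>K x)" for x
    by (intro nn_integral_cmult) (simp add: measurable_Pair_section measurable_cong_sets[OF finite_kernelD(1)[OF K] refl])
  then show ?case using mult kernel_nn_integral_measurable[OF K mult(2)]
    by (simp add: nn_integral_cmult measurable_cong_sets[OF M refl])
next
  case (add f g)
  then have "(\<integral>\<^sup>+ y. g (x, y) + f (x, y) \<partial>K x) = (\<integral>\<^sup>+ y. g (x, y) \<partial>K x) + (\<integral>\<^sup>+ y. f (x, y) \<partial>K x)" for x
    by (intro nn_integral_add) (simp_all add: measurable_Pair_section measurable_cong_sets[OF finite_kernelD(1)[OF K] refl])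
  then show ?case using add kernel_nn_integral_measurable[OF K add(1)] kernel_nn_integral_measurable[OF K add(3)]
    by (simp add: nn_integral_add measurable_cong_sets[OF M refl])
next
  case (seq U)
  have "(\<integral>\<^sup>+ y. (SUP i. U i) (x, y) \<partial>K x) = (SUP i. \<integral>\<^sup>+ y. U i (x, y) \<partial>K x)" for x
    unfolding SUP_apply
    by (intro nn_integral_monotone_convergence_SUP)
       (use seq in \<open>auto simp: measurable_Pair_section measurable_cong_sets[OF finite_kernelD(1)[OF K] refl] incseq_def le_fun_def\<close>)
  moreover have "(\<integral>\<^sup>+ x. (SUP i. \<integral>\<^sup>+ y. U i (x, y) \<partial>K x) \<partial>M) = (SUP i. \<integral>\<^sup>+ x. \<integral>\<^sup>+ y. U i (x, y) \<partial>K x \<partial>M)"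
    using kernel_nn_integral_measurable[OF K seq(1)] seq(3)
    by (intro nn_integral_monotone_convergence_SUP)
       (auto simp: measurable_cong_sets[OF M refl] incseq_def le_fun_def intro!: nn_integral_mono)
  moreover have "(\<integral>\<^sup>+ z. (SUP i. U i) z \<partial>semidirect M K) = (SUP i. \<integral>\<^sup>+ z. U i z \<partial>semidirect M K)"
    unfolding SUP_apply using seq by (intro nn_integral_monotone_convergence_SUP) auto
  ultimately show ?case using seq by simp
qed

lemma semidirect_density:
  fixes K :: "'a::second_countable_topology \<Rightarrow> 'b::second_countable_topology measure"
  assumes K: "finite_kernel K" and M: "sets M = sets borel" and f: "f \<in> borel_measurable borel"
  shows "semidirect M (\<lambda>x. density (K x) (\<lambda>y. f (x, y))) = density (semidirect M K) f" (is "?L = ?R")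
proof -
  have "?L = measure_of UNIV (sets borel) (emeasure ?R)"
    unfolding semidirect_def[of M "\<lambda>x. density (K x) (\<lambda>y. f (x, y))"]
  proof (rule measure_of_eq)
    fix B :: "('a \<times> 'b) set" assume "B \<in> sigma_sets UNIV (sets borel)"
    then have B: "B \<in> sets borel" by (simp add: sets.sigma_sets_eq[of borel, simplified])
    have m: "(\<lambda>y. f (x, y)) \<in> borel_measurable (K x)" "(\<lambda>y. indicator B (x, y)) \<in> borel_measurable (K x)" for x
      using f B by (simp_all add: measurable_Pair_section measurable_cong_sets[OF finite_kernelD(1)[OF K] refl])
    have "emeasure ?R B = (\<integral>\<^sup>+ x. \<integral>\<^sup>+ y. f (x, y) * indicator B (x, y) \<partial>K x \<partial>M)"
      using f B nn_integral_semidirect[OF K M, of "\<lambda>z. f z * indicator B z"] by (simp add: emeasure_density)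
    also have "\<dots> = (\<integral>\<^sup>+ x. (\<integral>\<^sup>+ y. indicator B (x, y) \<partial>density (K x) (\<lambda>y. f (x, y))) \<partial>M)"
      by (intro nn_integral_cong) (simp add: nn_integral_density[OF m])
    finally show "(\<integral>\<^sup>+ x. (\<integral>\<^sup>+ y. indicator B (x, y) \<partial>density (K x) (\<lambda>y. f (x, y))) \<partial>M) = emeasure ?R B" by simp
  qed auto
  also have "\<dots> = ?R"
    using measure_of_of_measure[of ?R] by simp
  finally show ?thesis .
qed

lemma AE_semidirect:
  fixes K :: "'a::second_countable_topology \<Rightarrow> 'b::second_countable_topology measure"
  assumes K: "finite_kernel K" and M: "sets M = sets borel" and P: "{z. P z} \<in> sets borel"
  shows "(AE z in semidirect M K. P z) \<longleftrightarrow> (AE x in M. AE y in K x. P (x, y))"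
proof -
  let ?N = "{z. \<not> P z}"
  have N: "?N \<in> sets borel" using P by (simp add: Compl_eq[symmetric] Collect_neg_eq)
  have sec: "{y. \<not> P (x, y)} \<in> sets (K x)" for x
    using sets_Pair_section[OF N, of x] finite_kernelD(1)[OF K] by (simp add: vimage_def)
  have "(AE z in semidirect M K. P z) \<longleftrightarrow> emeasure (semidirect M K) ?N = 0"
    using N by (subst AE_iff_measurable[OF _ refl]) auto
  also have "\<dots> \<longleftrightarrow> (AE x in M. emeasure (K x) (Pair x -` ?N) = 0)"
    using kernel_emeasure_measurable[OF K N]
    by (subst emeasure_semidirect[OF K M N], subst nn_integral_0_iff_AE) (auto simp: measurable_cong_sets[OF M refl])
  also have "\<dots> \<longleftrightarrow> (AE x in M. AE y in K x. P (x, y))"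
    using AE_iff_measurable[OF sec, of _ "\<lambda>y. P (_, y)"] finite_kernelD(3)[OF K]
    by (intro AE_cong) (auto simp: vimage_def)
  finally show ?thesis .
qed

lemma integral_semidirect:
  fixes K :: "'a::second_countable_topology \<Rightarrow> 'b::second_countable_topology measure" and f :: "'a \<times> 'b \<Rightarrow> real"
  assumes K: "finite_kernel K" and M: "sets M = sets borel" and f: "integrable (semidirect M K) f"
  shows "(\<integral>z. f z \<partial>semidirect M K) = (\<integral>x. (\<integral>y. f (x, y) \<partial>K x) \<partial>M)"
    and "integrable M (\<lambda>x. \<integral>y. f (x, y) \<partial>K x)"
proof -
  have fm: "f \<in> borel_measurable borel" using f by (auto dest: borel_measurable_integrable)
  note Kb = measurable_cong_sets[OF finite_kernelD(1)[OF K] refl] and Mb = measurable_cong_sets[OF M refl]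
  have fx: "(\<lambda>y. f (x, y)) \<in> borel_measurable (K x)" for x
    using fm by (simp add: measurable_Pair_section Kb)
  define p where "p x = (\<integral>\<^sup>+ y. ennreal (f (x, y)) \<partial>K x)" for x
  define n where "n x = (\<integral>\<^sup>+ y. ennreal (- f (x, y)) \<partial>K x)" for x
  have pm: "p \<in> borel_measurable M" "n \<in> borel_measurable M"
    unfolding p_def n_def Mb using fm
    by (auto intro!: kernel_nn_integral_measurable[OF K, of "\<lambda>z. ennreal (f z)"] kernel_nn_integral_measurable[OF K, of "\<lambda>z. ennreal (- f z)"])
  have P: "(\<integral>\<^sup>+ z. ennreal (f z) \<partial>semidirect M K) = (\<integral>\<^sup>+ x. p x \<partial>M)"
    and N: "(\<integral>\<^sup>+ z. ennreal (- f z) \<partial>semidirect M K) = (\<integral>\<^sup>+ x. n x \<partial>M)"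
    unfolding p_def n_def using fm
    by (auto intro!: nn_integral_semidirect[OF K M, of "\<lambda>z. ennreal (f z)"] nn_integral_semidirect[OF K M, of "\<lambda>z. ennreal (- f z)"])
  have fin: "(\<integral>\<^sup>+ x. p x \<partial>M) < \<infinity>" "(\<integral>\<^sup>+ x. n x \<partial>M) < \<infinity>"
    using f unfolding P[symmetric] N[symmetric] real_integrable_def by (auto simp: top.not_eq_extremum)
  then have "AE x in M. p x < \<infinity>" "AE x in M. n x < \<infinity>"
    using nn_integral_noteq_infinite[OF pm(1)] nn_integral_noteq_infinite[OF pm(2)] by (auto simp: top.not_eq_extremum)
  then have ae: "AE x in M. (\<integral>y. f (x, y) \<partial>K x) = enn2real (p x) - enn2real (n x)"
  proof eventually_elim
    case (elim x)
    then have "integrable (K x) (\<lambda>y. f (x, y))"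
      using fx by (auto simp: real_integrable_def p_def n_def)
    then show ?case unfolding p_def n_def by (rule real_lebesgue_integral_def)
  qed
  have ip: "integrable M (\<lambda>x. enn2real (p x))" and ep: "(\<integral>x. enn2real (p x) \<partial>M) = enn2real (\<integral>\<^sup>+ x. p x \<partial>M)"
    if "p \<in> borel_measurable M" "(\<integral>\<^sup>+ x. p x \<partial>M) < \<infinity>" for p :: "'a \<Rightarrow> ennreal"
  proof -
    have "AE x in M. p x < \<infinity>" using nn_integral_noteq_infinite[OF that(1)] that(2) by (auto simp: top.not_eq_extremum)
    then have e: "(\<integral>\<^sup>+ x. ennreal (enn2real (p x)) \<partial>M) = (\<integral>\<^sup>+ x. p x \<partial>M)"
      by (intro nn_integral_cong_AE) (auto simp: top.not_eq_extremum)
    show "integrable M (\<lambda>x. enn2real (p x))" using that e by (intro integrableI_nonneg) auto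
    show "(\<integral>x. enn2real (p x) \<partial>M) = enn2real (\<integral>\<^sup>+ x. p x \<partial>M)"
      using that(1) e by (subst integral_eq_nn_integral) auto
  qed
  \<comment> \<open>The slice integral is 0 wherever the slice is not integrable. This is written as
    an explicit case distinction on \<open>p\<close> and \<open>n\<close>, since almost everywhere
    equality alone does not give measurability for a base that may be incomplete.\<close>
  have meas: "(\<lambda>x. \<integral>y. f (x, y) \<partial>K x) \<in> borel_measurable M"
  proof -
    have "(\<lambda>x. \<integral>y. f (x, y) \<partial>K x) = (\<lambda>x. if p x < \<infinity> \<and> n x < \<infinity> then enn2real (p x) - enn2real (n x) else 0)"
    proof
      fix x
      show "(\<integral>y. f (x, y) \<partial>K x) = (if p x < \<infinity> \<and> n x < \<infinity> then enn2real (p x) - enn2real (n x) else 0)"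
      proof (cases "p x < \<infinity> \<and> n x < \<infinity>")
        case True
        then have "integrable (K x) (\<lambda>y. f (x, y))" using fx by (auto simp: real_integrable_def p_def n_def)
        then show ?thesis using True unfolding p_def n_def by (simp add: real_lebesgue_integral_def)
      next
        case False
        then have "\<not> integrable (K x) (\<lambda>y. f (x, y))" by (auto simp: real_integrable_def p_def n_def top.not_eq_extremum)
        then show ?thesis unfolding if_not_P[OF False] by (rule not_integrable_integral_eq)
      qed
    qed
    then show ?thesis using pm by simp
  qed
  show "(\<integral>z. f z \<partial>semidirect M K) = (\<integral>x. (\<integral>y. f (x, y) \<partial>K x) \<partial>M)"
  proof -
    have "(\<integral>z. f z \<partial>semidirect M K) = enn2real (\<integral>\<^sup>+ x. p x \<partial>M) - enn2real (\<integral>\<^sup>+ x. n x \<partial>M)"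
      using real_lebesgue_integral_def[OF f] by (simp add: P N)
    also have "\<dots> = (\<integral>x. enn2real (p x) - enn2real (n x) \<partial>M)"
      using ip[OF pm(1) fin(1)] ip[OF pm(2) fin(2)] by (simp add: ep[OF pm(1) fin(1)] ep[OF pm(2) fin(2)])
    also have "\<dots> = (\<integral>x. (\<integral>y. f (x, y) \<partial>K x) \<partial>M)"
      using ae pm meas by (intro integral_cong_AE) auto
    finally show ?thesis .
  qed
  have "integrable M (\<lambda>x. enn2real (p x) - enn2real (n x))"
    by (intro Bochner_Integration.integrable_diff ip[OF pm(1) fin(1)] ip[OF pm(2) fin(2)])
  then show "integrable M (\<lambda>x. \<integral>y. f (x, y) \<partial>K x)"
    using ae meas by (subst integrable_cong_AE) (use pm in auto)
qed

section \<open>Setwise convergence\<close>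

text \<open>Finite intersections of a countable basis. Countability is needed twice: for the
  diagonal extraction of subsequences and for choosing one null set of times when slices of measures
  are identified.\<close>

lemma ex_countable_Int_stable_generator:
  "\<exists>G :: 'a::second_countable_topology set set. countable G \<and> Int_stable G \<and> UNIV \<in> G \<and>
     sets borel = sigma_sets UNIV G"
proof -
  obtain B :: "'a set set" where B: "countable B" "topological_basis B" using ex_countable_basis by blast
  define G where "G = {\<Inter>F | F. finite F \<and> F \<subseteq> B}"
  have "G = \<Inter> ` {F. finite F \<and> F \<subseteq> B}" by (auto simp: G_def)
  then have cG: "countable G" using countable_Collect_finite_subset[OF B(1)] by simp
  have oB: "open b" if "b \<in> B" for b using B(2) that by (rule topological_basis_open)
  have oG: "open g" if "g \<in> G" for g
    using that oB by (auto simp: G_def intro!: open_Inter)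
  have "Int_stable G"
    unfolding Int_stable_def
  proof (intro ballI)
    fix a b assume "a \<in> G" "b \<in> G"
    then obtain F F' where "a = \<Inter>F" "b = \<Inter>F'" "finite F" "finite F'" "F \<subseteq> B" "F' \<subseteq> B"
      by (auto simp: G_def)
    then have "a \<inter> b = \<Inter>(F \<union> F') \<and> finite (F \<union> F') \<and> F \<union> F' \<subseteq> B" by auto
    then show "a \<inter> b \<in> G" unfolding G_def by blast
  qed
  moreover have "UNIV \<in> G" unfolding G_def by (auto intro!: exI[of _ "{}"])
  moreover have "B \<subseteq> G" unfolding G_def
  proof
    fix b assume "b \<in> B"
    then show "b \<in> {\<Inter>F | F. finite F \<and> F \<subseteq> B}" by (auto intro!: exI[of _ "{b}"])
  qed
  have "sets (borel :: 'a measure) = sigma_sets UNIV B"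
    unfolding borel_eq_countable_basis[OF B] by (rule sets_measure_of) auto
  then have "sets (borel :: 'a measure) = sigma_sets UNIV G"
  proof (intro antisym)
    show "sets borel \<subseteq> sigma_sets UNIV G" if "sets (borel :: 'a measure) = sigma_sets UNIV B"
      unfolding that by (rule sigma_sets_mono'[OF \<open>B \<subseteq> G\<close>])
    have "G \<subseteq> sets borel" using oG by auto
    then show "sigma_sets UNIV G \<subseteq> sets borel" using sets.sigma_sets_subset[of G borel] by simp
  qed
  ultimately show ?thesis using cG by blast
qed

section \<open>Setwise limits under uniform absolute continuity\<close>

definition uniformly_ac :: "'a measure \<Rightarrow> (nat \<Rightarrow> 'a measure) \<Rightarrow> bool" where
  "uniformly_ac M \<mu> \<longleftrightarrow> (\<forall>\<epsilon>>0. \<exists>\<delta>>0. \<forall>n. \<forall>B\<in>sets M. measure M B < \<delta> \<longrightarrow> measure (\<mu> n) B < \<epsilon>)"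

lemma uniformly_acE:
  assumes "uniformly_ac M \<mu>" "\<epsilon> > 0"
  obtains \<delta> where "\<delta> > 0" "\<And>n B. B \<in> sets M \<Longrightarrow> measure M B < \<delta> \<Longrightarrow> measure (\<mu> n) B < \<epsilon>"
  using assms unfolding uniformly_ac_def by blast

lemma uniformly_ac_subseq: "uniformly_ac M \<mu> \<Longrightarrow> uniformly_ac M (\<lambda>n. \<mu> (r n))"
  unfolding uniformly_ac_def by meson

lemma measure_remainder_small:
  assumes M: "finite_measure M" and A: "range A \<subseteq> sets M" and d: "\<delta> > (0::real)"
  shows "\<exists>k::nat. measure M ((\<Union>i. A i) - (\<Union>i<k. A i)) < \<delta>"
proof -
  interpret finite_measure M by fact
  let ?D = "\<lambda>k. (\<Union>i. A i) - (\<Union>i<k. A i)"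
  have "(\<lambda>k. measure M (?D k)) \<longlonglongrightarrow> measure M (\<Inter>k. ?D k)"
    using A by (intro finite_Lim_measure_decseq) (auto simp: decseq_def less_le_trans)
  moreover have "(\<Inter>k. ?D k) = {}" by auto
  ultimately have "(\<lambda>k. measure M (?D k)) \<longlonglongrightarrow> 0" by (metis measure_empty)
  from order_tendstoD(2)[OF this d] show ?thesis by (auto dest: eventually_happens)
qed

text \<open>The convergence part of the Dunford--Pettis theorem: uniform absolute continuity lets the sets on
  which the measures converge form a Dynkin system.\<close>
lemma convergent_on_generator:
  fixes M :: "'a::second_countable_topology measure"
  assumes M: "finite_measure M" "sets M = sets borel"
    and \<mu>: "\<And>n. finite_measure (\<mu> n)" "\<And>n. sets (\<mu> n) = sets borel"
    and ac: "uniformly_ac M \<mu>"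
    and G: "Int_stable G" "UNIV \<in> G" "sets borel = sigma_sets UNIV G"
    and conv: "\<And>C. C \<in> G \<Longrightarrow> convergent (\<lambda>n. measure (\<mu> n) C)"
    and B: "B \<in> sets borel"
  shows "convergent (\<lambda>n. measure (\<mu> n) B)"
proof -
  have sp: "space (\<mu> n) = UNIV" for n using sets_eq_imp_space_eq[OF \<mu>(2)[of n]] by simp
  have "B \<in> sigma_sets UNIV G" using B G(3) by simp
  with G(1) subset_UNIV[of G, folded Pow_UNIV] show ?thesis
  proof (induction rule: sigma_sets_induct_disjoint)
    case (basic A) then show ?case by (rule conv)
  next
    case empty then show ?case by (simp add: convergent_const)
  next
    case (compl A)
    have "measure (\<mu> n) (UNIV - A) = measure (\<mu> n) UNIV - measure (\<mu> n) A" for n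
      using finite_measure.finite_measure_compl[OF \<mu>(1), of A n] compl(1) \<mu>(2) G(3) sp by simp
    then show ?case using convergent_diff[OF conv[OF G(2)] compl(2)] by simp
  next
    case (union A)
    have Ab: "A i \<in> sets borel" for i using union(2) G(3) by auto
    show ?case
    proof (rule Cauchy_convergent, rule metric_CauchyI)
      fix \<epsilon> :: real assume "\<epsilon> > 0"
      then obtain \<delta> where \<delta>: "\<delta> > 0" "\<And>n B. B \<in> sets M \<Longrightarrow> measure M B < \<delta> \<Longrightarrow> measure (\<mu> n) B < \<epsilon> / 3"
        using \<open>\<epsilon> > 0\<close> by (auto intro: uniformly_acE[OF ac, of "\<epsilon> / 3"])
      \<comment> \<open>The tail of the disjoint union is small for \<open>M\<close>, hence small
        for all \<open>\<mu> n\<close> at once, and the finitely many other sets converge by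
        induction. The finite sum and the two tails each receive
        \<open>\<epsilon> / 3\<close>.\<close>
      obtain k where k: "measure M ((\<Union>i. A i) - (\<Union>i<k. A i)) < \<delta>"
        using measure_remainder_small[OF M(1) _ \<delta>(1), of A] Ab M(2) by auto
      have "convergent (\<lambda>n. \<Sum>i<k. measure (\<mu> n) (A i))" using union(3) by (intro convergent_sum) auto
      then have "Cauchy (\<lambda>n. \<Sum>i<k. measure (\<mu> n) (A i))" by (rule convergent_Cauchy)
      then obtain N where N: "\<And>m n. m \<ge> N \<Longrightarrow> n \<ge> N \<Longrightarrow> dist (\<Sum>i<k. measure (\<mu> m) (A i)) (\<Sum>i<k. measure (\<mu> n) (A i)) < \<epsilon> / 3"
        using \<open>\<epsilon> > 0\<close> metric_CauchyD[of "\<lambda>n. \<Sum>i<k. measure (\<mu> n) (A i)" "\<epsilon> / 3"]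
        by (meson divide_pos_pos zero_less_numeral)
      have split: "measure (\<mu> n) (\<Union>i. A i) = (\<Sum>i<k. measure (\<mu> n) (A i)) + measure (\<mu> n) ((\<Union>i. A i) - (\<Union>i<k. A i))" for n
      proof -
        interpret finite_measure "\<mu> n" by (rule \<mu>(1))
        have "measure (\<mu> n) (\<Union>i<k. A i) = (\<Sum>i<k. measure (\<mu> n) (A i))"
          using Ab \<mu>(2) union(1) by (intro finite_measure_finite_Union) (auto simp: disjoint_family_on_def)
        moreover have "measure (\<mu> n) ((\<Union>i. A i) - (\<Union>i<k. A i)) = measure (\<mu> n) (\<Union>i. A i) - measure (\<mu> n) (\<Union>i<k. A i)"
          using Ab \<mu>(2) by (intro finite_measure_Diff) auto
        ultimately show ?thesis by simp
      qed
      have "dist (measure (\<mu> m) (\<Union>i. A i)) (measure (\<mu> n) (\<Union>i. A i)) < \<epsilon>" if "m \<ge> N" "n \<ge> N" for m n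
      proof -
        have "measure (\<mu> l) ((\<Union>i. A i) - (\<Union>i<k. A i)) < \<epsilon> / 3" for l
          using \<delta>(2)[OF _ k] Ab M(2) by auto
        from this[of m] this[of n] N[OF that] show ?thesis
          unfolding split[of m] split[of n] dist_real_def
          using measure_nonneg[of "\<mu> m" "(\<Union>i. A i) - (\<Union>i<k. A i)"] measure_nonneg[of "\<mu> n" "(\<Union>i. A i) - (\<Union>i<k. A i)"]
          unfolding abs_less_iff by linarith
      qed
      then show "\<exists>N. \<forall>m\<ge>N. \<forall>n\<ge>N. dist (measure (\<mu> m) (\<Union>i. A i)) (measure (\<mu> n) (\<Union>i. A i)) < \<epsilon>" by blast
    qed
  qed
qed

text \<open>Uniform absolute continuity takes the place of the Vitali-Hahn-Saks theorem. It is
  inherited by the finitely additive limit, where it yields continuity at the empty set, hence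
  countable additivity, and also absolute continuity with respect to \<open>M\<close>.\<close>

lemma setwise_limit_density:
  fixes M :: "'a::second_countable_topology measure"
  assumes M: "finite_measure M" "sets M = sets borel"
    and \<mu>: "\<And>n. finite_measure (\<mu> n)" "\<And>n. sets (\<mu> n) = sets borel"
    and ac: "uniformly_ac M \<mu>"
    and conv: "\<And>B. B \<in> sets borel \<Longrightarrow> convergent (\<lambda>n. measure (\<mu> n) B)"
  shows "\<exists>g::'a \<Rightarrow> real. g \<in> borel_measurable borel \<and> (\<forall>x. 0 \<le> g x) \<and> finite_measure (density M (\<lambda>x. ennreal (g x))) \<and>
     (\<forall>B\<in>sets borel. (\<lambda>n. measure (\<mu> n) B) \<longlonglongrightarrow> measure (density M (\<lambda>x. ennreal (g x))) B)"
proof -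
  have spM: "space M = UNIV" and sp: "space (\<mu> n) = UNIV" for n
    using sets_eq_imp_space_eq[OF M(2)] sets_eq_imp_space_eq[OF \<mu>(2)[of n]] by auto
  interpret M: finite_measure M by fact
  define m where "m B = lim (\<lambda>n. measure (\<mu> n) B)" for B
  have lim: "(\<lambda>n. measure (\<mu> n) B) \<longlonglongrightarrow> m B" if "B \<in> sets borel" for B
    using conv[OF that] by (simp add: m_def convergent_LIMSEQ_iff)
  have m0: "0 \<le> m B" if "B \<in> sets borel" for B
    using lim[OF that] by (rule LIMSEQ_le_const) auto
  have madd: "m (A \<union> B) = m A + m B" if "A \<in> sets borel" "B \<in> sets borel" "A \<inter> B = {}" for A B
  proof (rule LIMSEQ_unique[OF lim])
    have "measure (\<mu> n) (A \<union> B) = measure (\<mu> n) A + measure (\<mu> n) B" for n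
      using that \<mu> by (intro finite_measure.finite_measure_Union) auto
    then show "(\<lambda>n. measure (\<mu> n) (A \<union> B)) \<longlonglongrightarrow> m A + m B"
      using tendsto_add[OF lim[OF that(1)] lim[OF that(2)]] by simp
  qed (use that in auto)
  have mac: "\<exists>\<delta>>0. \<forall>B\<in>sets borel. measure M B < \<delta> \<longrightarrow> m B \<le> \<epsilon>" if e: "\<epsilon> > 0" for \<epsilon>
  proof -
    obtain \<delta> where \<delta>: "\<delta> > 0" "\<And>n B. B \<in> sets M \<Longrightarrow> measure M B < \<delta> \<Longrightarrow> measure (\<mu> n) B < \<epsilon>"
      using uniformly_acE[OF ac e] by blast
    have "m B \<le> \<epsilon>" if "B \<in> sets borel" "measure M B < \<delta>" for B
      using lim[OF that(1)] by (rule LIMSEQ_le_const2) (use \<delta>(2) that M(2) in \<open>auto intro: less_imp_le\<close>)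
    then show ?thesis using \<delta>(1) by blast
  qed
  define N where "N = measure_of UNIV (sets borel) (\<lambda>B. ennreal (m B))"
  have setsN: "sets N = sets borel"
    unfolding N_def by (subst sets_measure_of) (auto simp: sets.sigma_sets_eq[of borel, simplified])
  interpret borel: sigma_algebra UNIV "sets (borel :: 'a measure)" using sets.sigma_algebra_axioms[of borel] by simp
  have emN: "emeasure N B = ennreal (m B)" if B: "B \<in> sets borel" for B
  proof (rule emeasure_measure_of[OF N_def])
    show "B \<in> sets N" using B setsN by simp
    show "positive (sets N) (\<lambda>B. ennreal (m B))"
      unfolding positive_def using lim[of "{}"] by (simp add: LIMSEQ_const_iff)
    have pos: "positive (sets borel) (\<lambda>B. ennreal (m B))"
      unfolding positive_def using lim[of "{}"] by (simp add: LIMSEQ_const_iff)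
    show "countably_additive (sets N) (\<lambda>B. ennreal (m B))"
      unfolding setsN
    proof (rule borel.empty_continuous_imp_countably_additive[OF pos])
      show "Measure_Space.additive (sets borel) (\<lambda>B. ennreal (m B))"
        unfolding additive_def using madd m0 by (auto simp: ennreal_plus)
      show "\<forall>A\<in>sets borel. ennreal (m A) \<noteq> \<infinity>" by simp
      fix A :: "nat \<Rightarrow> 'a set" assume A: "range A \<subseteq> sets borel" "decseq A" "(\<Inter>i. A i) = {}"
      have "(\<lambda>i. measure M (A i)) \<longlonglongrightarrow> 0"
        using M.finite_Lim_measure_decseq[of A] A M(2) by simp
      have "(\<lambda>i. m (A i)) \<longlonglongrightarrow> 0"
      proof (rule LIMSEQ_I)
        fix \<epsilon> :: real assume "\<epsilon> > 0"
        then obtain \<delta> where \<delta>: "\<delta> > 0" "\<And>B. B \<in> sets borel \<Longrightarrow> measure M B < \<delta> \<Longrightarrow> m B \<le> \<epsilon> / 2"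
          using mac[of "\<epsilon> / 2"] by auto
        have "eventually (\<lambda>i. measure M (A i) < \<delta>) sequentially"
          using \<open>(\<lambda>i. measure M (A i)) \<longlonglongrightarrow> 0\<close> \<delta>(1) by (rule order_tendstoD)
        then obtain i0 where "\<And>i. i \<ge> i0 \<Longrightarrow> measure M (A i) < \<delta>" by (auto simp: eventually_sequentially)
        then have "norm (m (A i) - 0) < \<epsilon>" if "i \<ge> i0" for i
        proof -
          have "A i \<in> sets borel" using A(1) by auto
          then have "m (A i) \<le> \<epsilon> / 2" "0 \<le> m (A i)"
            using \<delta>(2)[of "A i"] m0[of "A i"] \<open>\<And>i. i \<ge> i0 \<Longrightarrow> measure M (A i) < \<delta>\<close>[OF that] by auto
          then show ?thesis using \<open>\<epsilon> > 0\<close> by simp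
        qed
        then show "\<exists>i0. \<forall>i\<ge>i0. norm (m (A i) - 0) < \<epsilon>" by blast
      qed
      then show "(\<lambda>i. ennreal (m (A i))) \<longlonglongrightarrow> 0" using tendsto_ennrealI by fastforce
    qed
  qed auto
  have spN: "space N = UNIV" using sets_eq_imp_space_eq[OF setsN] by simp
  interpret N: finite_measure N by (rule finite_measureI) (simp add: spN emN)
  have "absolutely_continuous M N"
    unfolding absolutely_continuous_def
  proof
    fix B assume B: "B \<in> null_sets M"
    then have Bb: "B \<in> sets borel" and "measure M B = 0" using M(2) by (auto simp: measure_def null_sets_def)
    then have "m B \<le> \<epsilon>" if "\<epsilon> > 0" for \<epsilon> using mac[OF that] by auto
    then have "m B \<le> 0" by (metis dense not_le)
    then show "B \<in> null_sets N" using Bb emN[OF Bb] setsN by (auto simp: null_sets_def ennreal_neg)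
  qed
  then have RN: "density M (RN_deriv M N) = N" by (rule M.density_RN_deriv) (simp add: setsN M(2))
  define g where "g x = enn2real (RN_deriv M N x)" for x
  have RNb: "RN_deriv M N \<in> borel_measurable borel"
    using borel_measurable_RN_deriv[of M N] by (simp add: measurable_cong_sets[OF M(2) refl])
  have "AE x in M. RN_deriv M N x \<noteq> \<infinity>"
    by (rule M.RN_deriv_finite[OF N.sigma_finite_measure_axioms \<open>absolutely_continuous M N\<close>]) (simp add: setsN M(2))
  then have "density M (\<lambda>x. ennreal (g x)) = density M (RN_deriv M N)"
    unfolding g_def using RNb
    by (intro density_cong) (auto simp: measurable_cong_sets[OF M(2) refl] top.not_eq_extremum)
  then have gN: "density M (\<lambda>x. ennreal (g x)) = N" using RN by simp
  show ?thesis
  proof (intro exI[of _ g] conjI ballI)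
    show "g \<in> borel_measurable borel" unfolding g_def using RNb by simp
    show "finite_measure (density M (\<lambda>x. ennreal (g x)))" unfolding gN by (rule N.finite_measure_axioms)
    fix B :: "'a set" assume B: "B \<in> sets borel"
    have "measure N B = m B" using emN[OF B] m0[OF B] by (simp add: measure_def)
    then show "(\<lambda>n. measure (\<mu> n) B) \<longlonglongrightarrow> measure (density M (\<lambda>x. ennreal (g x))) B" unfolding gN using lim[OF B] by simp
  qed (simp add: g_def)
qed

text \<open>\<open>h\<close> is uniformly within \<open>1 / k\<close> of a step function whose
  integral is a finite sum of measures of level sets. The total masses are bounded because they
  converge, so the approximation error is uniform in \<open>n\<close>.\<close>

lemma setwise_conv_integral_unit:
  fixes h :: "'a \<Rightarrow> real"
  assumes \<mu>: "\<And>n. finite_measure (\<mu> n)" "\<And>n. sets (\<mu> n) = sets M" "finite_measure M"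
    and conv: "\<And>B. B \<in> sets M \<Longrightarrow> (\<lambda>n. measure (\<mu> n) B) \<longlonglongrightarrow> measure M B"
    and h: "h \<in> borel_measurable M" "\<And>x. 0 \<le> h x" "\<And>x. h x \<le> 1"
  shows "(\<lambda>n. \<integral>x. h x \<partial>\<mu> n) \<longlonglongrightarrow> (\<integral>x. h x \<partial>M)"
proof (rule LIMSEQ_I)
  fix \<epsilon> :: real assume \<epsilon>: "\<epsilon> > 0"
  have sp: "space (\<mu> n) = space M" for n by (rule sets_eq_imp_space_eq[OF \<mu>(2)])
  obtain C where C: "C > 0" "\<And>n. measure (\<mu> n) (space M) \<le> C" "measure M (space M) \<le> C"
  proof -
    have "Bseq (\<lambda>n. measure (\<mu> n) (space M))" using conv[OF sets.top] by (auto intro: convergent_imp_Bseq convergentI)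
    then obtain K where "K > 0" "\<And>n. norm (measure (\<mu> n) (space M)) \<le> K" by (auto elim: BseqE)
    then show ?thesis by (intro that[of "max K (measure M (space M))"]) (auto intro: le_max_iff_disj[THEN iffD2])
  qed
  obtain k :: nat where k: "k > 0" "C / real k < \<epsilon> / 3"
  proof -
    obtain k :: nat where "real k > C / (\<epsilon> / 3)" using reals_Archimedean2 by blast
    moreover from this have "k > 0" using C(1) \<epsilon> by (intro gr0I) (auto simp: field_simps)
    ultimately show ?thesis using \<epsilon> by (intro that[of k]) (auto simp: field_simps)
  qed
  \<comment> \<open>Each level \<open>i / k\<close> below \<open>h x\<close> contributes
    \<open>1 / k\<close>, so \<open>g\<close> is \<open>h\<close> rounded down to multiples of
    \<open>1 / k\<close>.\<close>
  define g where "g x = (\<Sum>i\<in>{1..k}. indicator {x. real i \<le> real k * h x} x / real k)" for x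
  have geq: "g x = real_of_int \<lfloor>real k * h x\<rfloor> / real k" for x
  proof -
    have "0 \<le> \<lfloor>real k * h x\<rfloor>" using h(2)[of x] by simp
    moreover have kh: "real k * h x \<le> real k * 1" using h(3) by (intro mult_left_mono) auto
    have "\<lfloor>real k * h x\<rfloor> \<le> int k" using kh by linarith
    have iff: "i \<le> nat \<lfloor>real k * h x\<rfloor> \<longleftrightarrow> real i \<le> real k * h x" for i
      using \<open>0 \<le> \<lfloor>real k * h x\<rfloor>\<close> by (simp add: le_nat_iff le_floor_iff)
    have "g x = (\<Sum>i\<in>{1..nat \<lfloor>real k * h x\<rfloor>}. 1 / real k)"
      unfolding g_def using \<open>\<lfloor>real k * h x\<rfloor> \<le> int k\<close>
      by (intro sum.mono_neutral_cong_right) (auto simp: indicator_def iff)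
    then show ?thesis using \<open>0 \<le> \<lfloor>real k * h x\<rfloor>\<close> by simp
  qed
  have gh: "\<bar>h x - g x\<bar> \<le> 1 / real k" for x
  proof -
    have "\<bar>real k * h x - real_of_int \<lfloor>real k * h x\<rfloor>\<bar> \<le> 1" by linarith
    then have "\<bar>real k * h x - real_of_int \<lfloor>real k * h x\<rfloor>\<bar> / real k \<le> 1 / real k" by (intro divide_right_mono) auto
    moreover have "h x - g x = (real k * h x - real_of_int \<lfloor>real k * h x\<rfloor>) / real k"
      using k(1) by (simp add: geq field_simps)
    ultimately show ?thesis by (simp add: abs_divide)
  qed
  let ?A = "\<lambda>i. {x \<in> space M. real i \<le> real k * h x}"
  have A: "?A i \<in> sets M" for i using h(1) by measurable
  have close: "\<bar>(\<integral>x. h x \<partial>N) - (\<Sum>i\<in>{1..k}. measure N (?A i) / real k)\<bar> \<le> C / real k"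
    if N: "finite_measure N" "sets N = sets M" "measure N (space M) \<le> C" for N
  proof -
    interpret finite_measure N by fact
    have spN: "space N = space M" by (rule sets_eq_imp_space_eq[OF N(2)])
    have hN: "h \<in> borel_measurable N" using h(1) by (simp add: measurable_cong_sets[OF N(2) refl])
    have ih: "integrable N h" by (rule integrable_const_bound[of _ 1]) (use h hN in auto)
    have ii: "integrable N (\<lambda>x. indicator (?A i) x / real k)" for i
      using A[of i] by (intro integrable_divide integrable_real_indicator) (auto simp: N(2) emeasure_eq_measure)
    have "?A i \<inter> space N = ?A i" for i using spN by auto
    then have e: "(\<integral>x. (\<Sum>i\<in>{1..k}. indicator (?A i) x / real k) \<partial>N) = (\<Sum>i\<in>{1..k}. measure N (?A i) / real k)"
      using A ii by (subst Bochner_Integration.integral_sum) (auto simp: N(2))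
    have "\<bar>(\<integral>x. h x \<partial>N) - (\<Sum>i\<in>{1..k}. measure N (?A i) / real k)\<bar>
        = \<bar>\<integral>x. h x - (\<Sum>i\<in>{1..k}. indicator (?A i) x / real k) \<partial>N\<bar>"
      unfolding Bochner_Integration.integral_diff[OF ih Bochner_Integration.integrable_sum[OF ii]] e ..
    also have "\<dots> \<le> (\<integral>x. \<bar>h x - (\<Sum>i\<in>{1..k}. indicator (?A i) x / real k)\<bar> \<partial>N)" by (rule integral_abs_bound)
    also have "\<dots> \<le> (\<integral>x. 1 / real k \<partial>N)"
    proof (rule integral_mono)
      show "integrable N (\<lambda>x. \<bar>h x - (\<Sum>i\<in>{1..k}. indicator (?A i) x / real k)\<bar>)"
        using ih ii by (intro integrable_abs Bochner_Integration.integrable_diff Bochner_Integration.integrable_sum) auto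
      fix x assume "x \<in> space N"
      then have "(\<Sum>i\<in>{1..k}. indicator (?A i) x / real k) = g x"
        unfolding g_def by (intro sum.cong) (auto simp: spN indicator_def)
      then show "\<bar>h x - (\<Sum>i\<in>{1..k}. indicator (?A i) x / real k)\<bar> \<le> 1 / real k" using gh[of x] by simp
    qed simp
    also have "\<dots> \<le> C / real k" using N(3) k(1) by (simp add: spN divide_right_mono)
    finally show ?thesis .
  qed
  have "(\<lambda>n. \<Sum>i\<in>{1..k}. measure (\<mu> n) (?A i) / real k) \<longlonglongrightarrow> (\<Sum>i\<in>{1..k}. measure M (?A i) / real k)"
    using k(1) by (intro tendsto_sum tendsto_divide conv A tendsto_const) auto
  from LIMSEQ_D[OF this, of "\<epsilon> / 3"] \<epsilon> obtain n0 where n0: "\<And>n. n \<ge> n0 \<Longrightarrow>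
    norm ((\<Sum>i\<in>{1..k}. measure (\<mu> n) (?A i) / real k) - (\<Sum>i\<in>{1..k}. measure M (?A i) / real k)) < \<epsilon> / 3" by auto
  have "norm ((\<integral>x. h x \<partial>\<mu> n) - (\<integral>x. h x \<partial>M)) < \<epsilon>" if "n \<ge> n0" for n
    using n0[OF that] close[OF \<mu>(1)[of n] \<mu>(2) C(2)] close[OF \<mu>(3) refl C(3)] k(2) unfolding real_norm_def by argo
  then show "\<exists>n0. \<forall>n\<ge>n0. norm ((\<integral>x. h x \<partial>\<mu> n) - (\<integral>x. h x \<partial>M)) < \<epsilon>" by blast
qed

lemma setwise_conv_integral:
  fixes h :: "'a \<Rightarrow> real"
  assumes \<mu>: "\<And>n. finite_measure (\<mu> n)" "\<And>n. sets (\<mu> n) = sets M" "finite_measure M"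
    and conv: "\<And>B. B \<in> sets M \<Longrightarrow> (\<lambda>n. measure (\<mu> n) B) \<longlonglongrightarrow> measure M B"
    and h: "h \<in> borel_measurable M" "\<And>x. \<bar>h x\<bar> \<le> C"
  shows "(\<lambda>n. \<integral>x. h x \<partial>\<mu> n) \<longlonglongrightarrow> (\<integral>x. h x \<partial>M)"
proof -
  \<comment> \<open>The added 1 keeps \<open>D\<close> positive even for \<open>C = 0\<close>, so
    that the rescaling of \<open>h\<close> to the unit interval is possible.\<close>
  define D where "D = C + 1"
  have "\<bar>h x\<bar> < D" for x using h(2)[of x] by (simp add: D_def)
  then have hD: "- D < h x" "h x < D" for x by (metis abs_less_iff minus_less_iff)+
  then have D: "D > 0" using order.strict_trans[OF hD] by (metis neg_less_pos)
  define g where "g x = (h x + D) / (2 * D)" for x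
  have hg: "h x = 2 * D * g x - D" for x using D by (simp add: g_def)
  have gm: "g \<in> borel_measurable M" unfolding g_def using h(1) by measurable
  have g01: "0 \<le> g x" "g x \<le> 1" for x using hD[of x] D by (auto simp: g_def divide_simps)
  have e: "(\<integral>x. h x \<partial>N) = 2 * D * (\<integral>x. g x \<partial>N) - D * measure N (space M)"
    if N: "finite_measure N" "sets N = sets M" for N
  proof -
    interpret finite_measure N by fact
    have "integrable N g"
      by (rule integrable_const_bound[of _ 1]) (use g01 gm in \<open>auto simp: measurable_cong_sets[OF N(2) refl]\<close>)
    then show ?thesis unfolding hg using sets_eq_imp_space_eq[OF N(2)] by simp
  qed
  have "(\<lambda>n. 2 * D * (\<integral>x. g x \<partial>\<mu> n) - D * measure (\<mu> n) (space M)) \<longlonglongrightarrow> 2 * D * (\<integral>x. g x \<partial>M) - D * measure M (space M)"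
    by (intro tendsto_intros setwise_conv_integral_unit[OF \<mu>] conv gm g01 sets.top)
  then show ?thesis by (simp add: e[OF \<mu>(1,2)] e[OF \<mu>(3) refl])
qed

lemma ex_convergent_diagonal:
  fixes x :: "'i \<Rightarrow> nat \<Rightarrow> real"
  assumes I: "countable I" and bnd: "\<And>i. i \<in> I \<Longrightarrow> Bseq (x i)"
  shows "\<exists>r::nat \<Rightarrow> nat. strict_mono r \<and> (\<forall>i\<in>I. convergent (\<lambda>n. x i (r n)))"
proof (cases "I = {}")
  case True then show ?thesis by (intro exI[of _ id]) (simp add: strict_mono_def)
next
  case False
  define y where "y k = x (from_nat_into I k)" for k
  have yb: "Bseq (y k)" for k using bnd from_nat_into[OF False] by (simp add: y_def)
  interpret subseqs "\<lambda>k s. convergent (\<lambda>n. y k (s n))"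
  proof
    fix k and s :: "nat \<Rightarrow> nat" assume s: "strict_mono s"
    have "bounded (range (\<lambda>n. y k (s n)))" using yb[of k] unfolding Bseq_eq_bounded
      by (rule bounded_subset) auto
    then obtain l r where "strict_mono r" "((\<lambda>n. y k (s n)) \<circ> r) \<longlonglongrightarrow> l"
      using bounded_imp_convergent_subsequence by blast
    then show "\<exists>r'. strict_mono r' \<and> convergent (\<lambda>n. y k ((s \<circ> r') n))"
      by (intro exI[of _ r]) (auto simp: convergent_def o_def)
  qed
  have "convergent (\<lambda>n. y k (diagseq n))" for k
  proof -
    \<comment> \<open>Only from index \<open>k + 1\<close> on is the diagonal sequence a subsequence
      of one along which \<open>y k\<close> converges.\<close>
    have "convergent (\<lambda>n. y k ((diagseq \<circ> ((+) (Suc k))) n))"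
    proof (rule diagseq_holds)
      fix r s :: "nat \<Rightarrow> nat" and n assume "strict_mono r" "convergent (\<lambda>m. y n (s m))"
      then show "convergent (\<lambda>m. y n ((s \<circ> r) m))" using convergent_subseq_convergent[of "\<lambda>m. y n (s m)" r] by (simp add: o_def)
    qed
    then have "convergent (\<lambda>n. y k (diagseq (n + Suc k)))" by (simp add: add.commute)
    then show ?thesis by (subst (asm) convergent_ignore_initial_segment[of "\<lambda>n. y k (diagseq n)" "Suc k"])
  qed
  then have "\<forall>i\<in>I. convergent (\<lambda>n. x i (diagseq n))"
    unfolding y_def by (metis I from_nat_into_surj)
  then show ?thesis using subseq_diagseq by blast
qed

text \<open>The function \<open>Y\<close> need not be measurable, so that additivity of the integral is not available.\<close>
lemma nn_integral_le_add_nonmeasurable: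
  assumes X: "X \<in> borel_measurable M" and Z: "Z \<in> borel_measurable M" "AE x in M. Z x < \<infinity>"
    and le: "AE x in M. X x \<le> Y x + Z x"
  shows "(\<integral>\<^sup>+ x. X x \<partial>M) \<le> (\<integral>\<^sup>+ x. Y x \<partial>M) + (\<integral>\<^sup>+ x. Z x \<partial>M)"
proof -
  \<comment> \<open>Both \<open>X - Z\<close> and \<open>Z\<close> are measurable, so additivity is
    applied to them; \<open>Y\<close> enters only through monotonicity.\<close>
  have "(\<integral>\<^sup>+ x. X x \<partial>M) \<le> (\<integral>\<^sup>+ x. (X x - Z x) + Z x \<partial>M)"
    by (intro nn_integral_mono) (metis diff_add_cancel_ennreal add.commute le_add1 add_increasing linear ennreal_minus_eq_0 order_refl zero_le add_0)
  also have "\<dots> = (\<integral>\<^sup>+ x. X x - Z x \<partial>M) + (\<integral>\<^sup>+ x. Z x \<partial>M)"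
    using X Z by (intro nn_integral_add) auto
  also have "(\<integral>\<^sup>+ x. X x - Z x \<partial>M) \<le> (\<integral>\<^sup>+ x. Y x \<partial>M)"
  proof (rule nn_integral_mono_AE)
    from le Z(2) show "AE x in M. X x - Z x \<le> Y x"
      by eventually_elim (metis add.commute ennreal_minus_le_iff infinity_ennreal_def less_irrefl)
  qed
  finally show ?thesis by (simp add: add_right_mono)
qed

section \<open>Closed sets seen through Lipschitz functions\<close>

lemma Lip_b_measurable: "f \<in> Lip_b \<Longrightarrow> f \<in> borel_measurable borel"
  unfolding Lip_b_def using borel_measurable_continuous_onI lipschitz_on_continuous_on by blast

lemma Lip_b_closed_indicator_approx:
  fixes C :: "'v::metric_space set"
  assumes C: "closed C"
  shows "\<exists>f::nat \<Rightarrow> 'v \<Rightarrow> real. (\<forall>k. f k \<in> Lip_b) \<and> (\<forall>k x. 0 \<le> f k x \<and> f k x \<le> 1) \<and>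
           (\<forall>x. (\<lambda>k. f k x) \<longlonglongrightarrow> indicator C x)"
\<comment> \<open>The distance to the empty set is 0 by convention, so the general formula would
  give the constant 1 here.\<close>
proof (cases "C = {}")
  case True
  then show ?thesis by (intro exI[of _ "\<lambda>_ _. 0"]) (auto simp: Lip_b_def lipschitz_on_def intro!: exI[of _ 0])
next
  case False
  define f where "f k x = max 0 (1 - real k * infdist x C)" for k x
  have "f k \<in> Lip_b" for k
    unfolding Lip_b_def
  proof (intro CollectI conjI exI)
    show "bounded (range (f k))" unfolding bounded_iff
      by (intro exI[of _ 1]) (auto simp: f_def infdist_nonneg)
    show "(real k)-lipschitz_on UNIV (f k)"
    proof (rule lipschitz_onI)
      fix x y
      have "\<bar>infdist x C - infdist y C\<bar> \<le> dist x y"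
        by (rule infdist_triangle_abs)
      then have "real k * \<bar>infdist x C - infdist y C\<bar> \<le> real k * dist x y" by (intro mult_left_mono) auto
      moreover have "real k * \<bar>infdist x C - infdist y C\<bar> = \<bar>real k * infdist x C - real k * infdist y C\<bar>"
        by (simp add: abs_mult flip: right_diff_distrib)
      ultimately show "dist (f k x) (f k y) \<le> real k * dist x y"
        unfolding dist_real_def f_def by linarith
    qed simp
  qed
  moreover have "0 \<le> f k x \<and> f k x \<le> 1" for k x by (auto simp: f_def infdist_nonneg)
  moreover have "(\<lambda>k. f k x) \<longlonglongrightarrow> indicator C x" for x
  proof (cases "x \<in> C")
    case True then show ?thesis by (simp add: f_def)
  next
    case False
    then have "infdist x C > 0"
      using C \<open>C \<noteq> {}\<close> by (metis in_closed_iff_infdist_zero infdist_nonneg order_le_less)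
    then obtain k0 :: nat where k0: "real k0 * infdist x C > 1" using ex_less_of_nat_mult by blast
    have "f k x = 0" if "k \<ge> k0" for k
    proof -
      have "real k0 * infdist x C \<le> real k * infdist x C" using that by (intro mult_right_mono) (auto simp: infdist_nonneg)
      then show ?thesis using k0 by (simp add: f_def)
    qed
    then have "eventually (\<lambda>k. f k x = 0) sequentially" by (auto simp: eventually_sequentially)
    then show ?thesis using False by (simp add: tendsto_eventually)
  qed
  ultimately show ?thesis by blast
qed

lemma closed_sets_generate:
  "Int_stable {C :: 'a::topological_space set. closed C}"
  "sets (borel :: 'a measure) = sigma_sets UNIV {C. closed C}"
proof -
  show "Int_stable {C :: 'a set. closed C}" by (auto simp: Int_stable_def)
  show "sets (borel :: 'a measure) = sigma_sets UNIV {C. closed C}"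
    by (subst borel_eq_closed) (simp add: sets_measure_of)
qed

lemma abs_indicator_diff_le_1: "0 \<le> y \<and> y \<le> 1 \<Longrightarrow> \<bar>indicator C x - (y::real)\<bar> \<le> 1"
  by (auto simp: indicator_def)

text \<open>The continuity equation admits Lipschitz tests only. The error is measured with a single
  finite measure; uniform integrability later transfers it from \<open>\<pi>\<close> to all
  \<open>\<rho>n n t\<close>.\<close>

lemma Lip_b_L1_approx:
  fixes M :: "'v::metric_space measure"
  assumes M: "finite_measure M" "sets M = sets borel" and C: "closed C" and \<epsilon>: "\<epsilon> > 0"
  shows "\<exists>f\<in>Lip_b. (\<forall>x. 0 \<le> f x \<and> f x \<le> 1) \<and> (\<integral>x. \<bar>indicator C x - f x\<bar> \<partial>M) < \<epsilon>"
proof -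
  interpret finite_measure M by fact
  have Mb: "borel_measurable M = borel_measurable (borel::'v measure)" by (rule measurable_cong_sets[OF M(2) refl])
  obtain f :: "nat \<Rightarrow> 'v \<Rightarrow> real" where f: "\<And>k. f k \<in> Lip_b" "\<And>k x. 0 \<le> f k x \<and> f k x \<le> 1"
    "\<And>x. (\<lambda>k. f k x) \<longlonglongrightarrow> indicator C x" using Lip_b_closed_indicator_approx[OF C] by auto
  have Cb: "C \<in> sets borel" using C by simp
  have "(\<lambda>k. \<integral>x. \<bar>indicator C x - f k x\<bar> \<partial>M) \<longlonglongrightarrow> (\<integral>x. 0 \<partial>M)"
  proof (rule integral_dominated_convergence[where w = "\<lambda>_. 1"])
    show "AE x in M. (\<lambda>k. \<bar>indicator C x - f k x\<bar>) \<longlonglongrightarrow> 0"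
    proof (rule AE_I2)
      fix x
      have "(\<lambda>k. indicator C x - f k x) \<longlonglongrightarrow> indicator C x - indicator C x" by (intro tendsto_intros f)
      then show "(\<lambda>k. \<bar>indicator C x - f k x\<bar>) \<longlonglongrightarrow> 0" using tendsto_rabs_zero by fastforce
    qed
    show "AE x in M. norm \<bar>indicator C x - f k x\<bar> \<le> 1" for k
      using abs_indicator_diff_le_1[OF f(2)] by (intro AE_I2) auto
    show "(\<lambda>x. \<bar>indicator C x - f k x\<bar>) \<in> borel_measurable M" for k
      using Lip_b_measurable[OF f(1)[of k]] Cb by (simp add: Mb)
  qed auto
  then have "eventually (\<lambda>k. (\<integral>x. \<bar>indicator C x - f k x\<bar> \<partial>M) < \<epsilon>) sequentially"
    using \<epsilon> by (intro order_tendstoD) auto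
  then obtain k where "(\<integral>x. \<bar>indicator C x - f k x\<bar> \<partial>M) < \<epsilon>" by (auto dest: eventually_happens)
  then show ?thesis using f by blast
qed

section \<open>Disintegration of densities\<close>

lemma finite_kernel_const:
  "sets M = sets borel \<Longrightarrow> finite_measure M \<Longrightarrow> finite_kernel (\<lambda>_. M)"
  using finite_measure.emeasure_finite[of M UNIV] by (simp add: finite_kernel_def top.not_eq_extremum)

lemma finite_measure_semidirect:
  fixes K :: "'a::second_countable_topology \<Rightarrow> 'b::second_countable_topology measure"
  assumes K: "finite_kernel K" and M: "sets M = sets borel" and fin: "(\<integral>\<^sup>+ x. emeasure (K x) UNIV \<partial>M) < \<infinity>"
  shows "finite_measure (semidirect M K)"
  using emeasure_semidirect[OF K M, of UNIV] fin by (intro finite_measureI) auto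

text \<open>Since the Borel sets are countably generated, a density of the space-time measures is, for almost
  every \<open>x\<close>, a density of the slices.\<close>
lemma kernel_Radon_Nikodym:
  fixes K L :: "'a::second_countable_topology \<Rightarrow> 'b::second_countable_topology measure"
  assumes K: "finite_kernel K" and L: "finite_kernel L"
    and M: "sets M = sets borel" "sigma_finite_measure M"
    and fin: "(\<integral>\<^sup>+ x. emeasure (K x) UNIV \<partial>M) < \<infinity>" "(\<integral>\<^sup>+ x. emeasure (L x) UNIV \<partial>M) < \<infinity>"
    and ac: "absolutely_continuous (semidirect M L) (semidirect M K)"
  shows "\<exists>f::'a \<times> 'b \<Rightarrow> real. f \<in> borel_measurable borel \<and> (\<forall>z. 0 \<le> f z) \<and>
     semidirect M K = density (semidirect M L) (\<lambda>z. ennreal (f z)) \<and>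
     (AE x in M. K x = density (L x) (\<lambda>y. ennreal (f (x, y))))"
proof -
  interpret M: sigma_finite_measure M by fact
  interpret SL: finite_measure "semidirect M L" by (rule finite_measure_semidirect[OF L M(1) fin(2)])
  interpret SK: finite_measure "semidirect M K" by (rule finite_measure_semidirect[OF K M(1) fin(1)])
  define r where "r = RN_deriv (semidirect M L) (semidirect M K)"
  have rm: "r \<in> borel_measurable borel" unfolding r_def using borel_measurable_RN_deriv[of "semidirect M L"] by simp
  have r: "density (semidirect M L) r = semidirect M K"
    unfolding r_def by (rule SL.density_RN_deriv[OF ac]) simp
  have rf: "AE z in semidirect M L. r z \<noteq> \<infinity>"
    unfolding r_def by (rule SL.RN_deriv_finite[OF SK.sigma_finite_measure_axioms ac]) simp
  define f where "f z = enn2real (r z)" for z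
  have fm [measurable]: "f \<in> borel_measurable borel" unfolding f_def using rm by simp
  have f: "density (semidirect M L) (\<lambda>z. ennreal (f z)) = semidirect M K"
    unfolding r[symmetric] using rf rm by (intro density_cong) (auto simp: f_def top.not_eq_extremum)
  obtain G :: "'b set set" where G: "countable G" "Int_stable G" "UNIV \<in> G" "sets borel = sigma_sets UNIV G"
    using ex_countable_Int_stable_generator by blast
  have Lm: "(\<lambda>y. ennreal (f (x, y))) \<in> borel_measurable (L x)" for x
    using measurable_Pair_section[of "\<lambda>z. ennreal (f z)" borel x] by (simp add: measurable_cong_sets[OF finite_kernelD(1)[OF L] refl])
  \<comment> \<open>For a fixed \<open>C\<close>, testing on rectangles \<open>A \<times> C\<close>
    shows that both sides are densities of one measure on the base, and uniqueness of densities over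
    a \<sigma>-finite \<open>M\<close> makes them equal almost everywhere. The null set depends on
    \<open>C\<close>; since \<open>G\<close> is countable and determines measures, one null set
    serves for all Borel sets.\<close>
  have "AE x in M. emeasure (K x) C = emeasure (density (L x) (\<lambda>y. ennreal (f (x, y)))) C" if "C \<in> G" for C
  proof -
    have C: "C \<in> sets borel" using that G(4) by auto
    let ?k = "\<lambda>x. emeasure (K x) C" and ?l = "\<lambda>x. \<integral>\<^sup>+ y. ennreal (f (x, y)) * indicator C y \<partial>L x"
    have km: "?k \<in> borel_measurable M" using finite_kernelD(5)[OF K C] by (simp add: measurable_cong_sets[OF M(1) refl])
    have sC: "UNIV \<times> C \<in> sets (borel :: ('a \<times> 'b) measure)" using C by (intro borel_Times) auto
    have lm: "?l \<in> borel_measurable M"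
    proof -
      have "(\<lambda>z. ennreal (f z) * indicator (UNIV \<times> C) z) \<in> borel_measurable borel" using sC by auto
      from kernel_nn_integral_measurable[OF L this] show ?thesis
        by (simp add: measurable_cong_sets[OF M(1) refl] indicator_def mem_Times_iff)
    qed
    have "density M ?k = density M ?l"
    proof (rule measure_eqI)
      fix A assume "A \<in> sets (density M ?k)"
      then have A: "A \<in> sets borel" using M(1) by simp
      have AC: "A \<times> C \<in> sets (borel :: ('a \<times> 'b) measure)" using A C by (rule borel_Times)
      have "emeasure (density M ?k) A = (\<integral>\<^sup>+ x. emeasure (K x) (Pair x -` (A \<times> C)) \<partial>M)"
        using A km M(1) by (subst emeasure_density) (auto intro!: nn_integral_cong simp: indicator_def vimage_def)
      also have "\<dots> = emeasure (density (semidirect M L) (\<lambda>z. ennreal (f z))) (A \<times> C)"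
        unfolding f by (rule emeasure_semidirect[OF K M(1) AC, symmetric])
      also have "\<dots> = (\<integral>\<^sup>+ z. ennreal (f z) * indicator (A \<times> C) z \<partial>semidirect M L)"
        using AC by (subst emeasure_density) auto
      also have "\<dots> = (\<integral>\<^sup>+ x. \<integral>\<^sup>+ y. ennreal (f (x, y)) * indicator (A \<times> C) (x, y) \<partial>L x \<partial>M)"
        using AC by (intro nn_integral_semidirect[OF L M(1)]) auto
      also have "\<dots> = (\<integral>\<^sup>+ x. ?l x * indicator A x \<partial>M)"
        by (intro nn_integral_cong) (auto simp: indicator_def)
      also have "\<dots> = emeasure (density M ?l) A" using A lm M(1) by (subst emeasure_density) auto
      finally show "emeasure (density M ?k) A = emeasure (density M ?l) A" .
    qed simp
    then have "AE x in M. ?k x = ?l x" using M.density_unique_iff[OF km lm] by simp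
    moreover have "emeasure (density (L x) (\<lambda>y. ennreal (f (x, y)))) C = ?l x" for x
      using C finite_kernelD(1)[OF L] by (intro emeasure_density Lm) auto
    ultimately show ?thesis by simp
  qed
  then have "AE x in M. \<forall>C\<in>G. emeasure (K x) C = emeasure (density (L x) (\<lambda>y. ennreal (f (x, y)))) C"
    using G(1) by (simp add: AE_ball_countable)
  then have "AE x in M. K x = density (L x) (\<lambda>y. ennreal (f (x, y)))"
  proof eventually_elim
    case (elim x)
    show ?case
    proof (rule measure_eqI_generator_eq[OF G(2), of UNIV _ _ "\<lambda>_. UNIV"])
      show "emeasure (K x) UNIV \<noteq> \<infinity>" using finite_kernelD(2)[OF K, of x] by simp
      show "emeasure (K x) C = emeasure (density (L x) (\<lambda>y. ennreal (f (x, y)))) C" if "C \<in> G" for C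
        using elim that by blast
    qed (use G finite_kernelD(1)[OF K] finite_kernelD(1)[OF L] in auto)
  qed
  then show ?thesis using fm f by (intro exI[of _ f]) (auto simp: f_def)
qed

text \<open>The jointly measurable counterpart of \<open>simple_L1_curve\<close>: a sum over
  disjoint or overlapping time sets, each carrying a fixed spatial function. Density of these
  functions in the product space gives strong measurability of a curve.\<close>

definition rectangle_simple :: "'v::topological_space measure \<Rightarrow> (real \<times> 'v \<Rightarrow> real) \<Rightarrow> bool" where
  "rectangle_simple M s \<longleftrightarrow> (\<exists>(m::nat) A g. (\<forall>i<m. A i \<in> sets borel \<and> g i \<in> borel_measurable borel \<and> integrable M (g i)) \<and>
     (\<forall>t x. s (t, x) = (\<Sum>i<m. indicator (A i) t * g i x)))"

lemma rectangle_simpleI: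
  fixes m :: nat
  assumes "\<And>i. i < m \<Longrightarrow> A i \<in> sets borel" "\<And>i. i < m \<Longrightarrow> g i \<in> borel_measurable borel" "\<And>i. i < m \<Longrightarrow> integrable M (g i)"
    "\<And>t x. s (t, x) = (\<Sum>i<m. indicator (A i) t * g i x)"
  shows "rectangle_simple M s"
  unfolding rectangle_simple_def using assms by (intro exI[of _ m] exI[of _ A] exI[of _ g]) auto

lemma rectangle_simple_add:
  assumes "rectangle_simple M s" "rectangle_simple M s'"
  shows "rectangle_simple M (\<lambda>z. s z + s' z)"
proof -
  obtain m A g where s: "\<And>i. i < m \<Longrightarrow> A i \<in> sets borel \<and> g i \<in> borel_measurable borel \<and> integrable M (g i)"
    "\<And>t x. s (t, x) = (\<Sum>i<(m::nat). indicator (A i) t * g i x)" using assms(1) unfolding rectangle_simple_def by blast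
  obtain m' A' g' where s': "\<And>i. i < m' \<Longrightarrow> A' i \<in> sets borel \<and> g' i \<in> borel_measurable borel \<and> integrable M (g' i)"
    "\<And>t x. s' (t, x) = (\<Sum>i<(m'::nat). indicator (A' i) t * g' i x)" using assms(2) unfolding rectangle_simple_def by blast
  show ?thesis
  proof (rule rectangle_simpleI[where m = "m + m'" and A = "\<lambda>i. if i < m then A i else A' (i - m)"
        and g = "\<lambda>i. if i < m then g i else g' (i - m)"])
    fix t x
    have "(\<Sum>i<m + m'. indicator (if i < m then A i else A' (i - m)) t * (if i < m then g i else g' (i - m)) x)
        = (\<Sum>i<m. indicator (A i) t * g i x) + (\<Sum>i<m'. indicator (A' i) t * g' i x)"
      by (induction m') auto
    then show "s (t, x) + s' (t, x) = (\<Sum>i<m + m'. indicator (if i < m then A i else A' (i - m)) t * (if i < m then g i else g' (i - m)) x)"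
      by (simp add: s(2) s'(2))
  qed (use s(1) s'(1) in auto)
qed

lemma rectangle_simple_cmult:
  assumes "rectangle_simple M s"
  shows "rectangle_simple M (\<lambda>z. c * s z)"
proof -
  obtain m A g where s: "\<And>i. i < m \<Longrightarrow> A i \<in> sets borel \<and> g i \<in> borel_measurable borel \<and> integrable M (g i)"
    "\<And>t x. s (t, x) = (\<Sum>i<(m::nat). indicator (A i) t * g i x)" using assms(1) unfolding rectangle_simple_def by blast
  show ?thesis
  proof (rule rectangle_simpleI[where m = m and A = A and g = "\<lambda>i x. c * g i x"])
    show "c * s (t, x) = (\<Sum>i<m. indicator (A i) t * (c * g i x))" for t x
      unfolding s(2) sum_distrib_left by (simp add: mult.left_commute)
  qed (auto simp: s(1) intro!: borel_measurable_times)
qed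

lemma rectangle_simple_rectangle:
  assumes "finite_measure M" "sets M = sets borel" "A \<in> sets borel" "B \<in> sets borel"
  shows "rectangle_simple M (indicator (A \<times> B))"
proof -
  interpret finite_measure M by fact
  show ?thesis
    by (rule rectangle_simpleI[where m = 1 and A = "\<lambda>_. A" and g = "\<lambda>_. indicator B"])
      (use assms in \<open>auto simp: indicator_def intro!: integrable_const_bound[of _ 1]\<close>)
qed

lemma rectangle_simple_0: "finite_measure M \<Longrightarrow> sets M = sets borel \<Longrightarrow> rectangle_simple M (\<lambda>_. 0)"
  using rectangle_simple_cmult[OF rectangle_simple_rectangle[of M "{}" "{}"], of 0] by simp

lemma rectangle_simple_measurable:
  fixes M :: "'v::second_countable_topology measure"
  assumes "rectangle_simple M s"
  shows "s \<in> borel_measurable borel"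
proof -
  obtain m A g where s: "\<And>i. i < m \<Longrightarrow> A i \<in> sets borel \<and> g i \<in> borel_measurable borel \<and> integrable M (g i)"
    "\<And>t x. s (t, x) = (\<Sum>i<(m::nat). indicator (A i) t * g i x)" using assms(1) unfolding rectangle_simple_def by blast
  have "s = (\<lambda>z. \<Sum>i<m. indicator (A i) (fst z) * g i (snd z))" using s(2) by (auto simp: fun_eq_iff)
  moreover have "(\<lambda>z. \<Sum>i<m. indicator (A i) (fst z) * g i (snd z)) \<in> borel_measurable (borel \<Otimes>\<^sub>M borel)"
    by (intro borel_measurable_sum borel_measurable_times measurable_compose[OF measurable_fst]
        measurable_compose[OF measurable_snd]) (auto simp: s(1) intro!: borel_measurable_indicator)
  ultimately show ?thesis by (simp add: borel_prod)
qed

lemma rectangle_simple_integrable: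
  fixes M :: "'v::second_countable_topology measure"
  assumes N: "finite_measure N" "sets N = sets (borel :: real measure)" and M: "finite_measure M" "sets M = sets borel"
    and s: "rectangle_simple M s"
  shows "integrable (semidirect N (\<lambda>_. M)) s"
proof -
  have K: "finite_kernel (\<lambda>_::real. M)" using M by (intro finite_kernel_const)
  obtain m A g where s: "\<And>i. i < m \<Longrightarrow> A i \<in> sets borel \<and> g i \<in> borel_measurable borel \<and> integrable M (g i)"
    "\<And>t x. s (t, x) = (\<Sum>i<(m::nat). indicator (A i) t * g i x)" using s unfolding rectangle_simple_def by blast
  have "integrable (semidirect N (\<lambda>_. M)) (\<lambda>z. indicator (A i) (fst z) * g i (snd z))" if "i < m" for i
  proof (rule integrableI_bounded)
    show m: "(\<lambda>z. indicator (A i) (fst z) * g i (snd z)) \<in> borel_measurable (semidirect N (\<lambda>_. M))"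
      using s(1)[OF that] unfolding measurable_semidirect1 borel_prod[symmetric]
      by (intro borel_measurable_times measurable_compose[OF measurable_fst] measurable_compose[OF measurable_snd]) auto
    have "(\<integral>\<^sup>+ z. ennreal (norm (indicator (A i) (fst z) * g i (snd z))) \<partial>semidirect N (\<lambda>_. M))
        = (\<integral>\<^sup>+ t. \<integral>\<^sup>+ x. ennreal (norm (indicator (A i) t * g i x)) \<partial>M \<partial>N)"
      using nn_integral_semidirect[OF K N(2), of "\<lambda>z. ennreal (norm (indicator (A i) (fst z) * g i (snd z)))"] m by simp
    also have "\<dots> \<le> (\<integral>\<^sup>+ t. \<integral>\<^sup>+ x. ennreal (norm (g i x)) \<partial>M \<partial>N)"
      by (intro nn_integral_mono ennreal_leI) (auto simp: indicator_def)
    also have "\<dots> < \<infinity>"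
      using s(1)[OF that] finite_measure.emeasure_finite[OF N(1)]
      by (auto simp: integrable_iff_bounded ennreal_mult_less_top top.not_eq_extremum)
    finally show "(\<integral>\<^sup>+ z. ennreal (norm (indicator (A i) (fst z) * g i (snd z))) \<partial>semidirect N (\<lambda>_. M)) < \<infinity>" .
  qed
  then have "integrable (semidirect N (\<lambda>_. M)) (\<lambda>z. \<Sum>i<m. indicator (A i) (fst z) * g i (snd z))"
    by (intro Bochner_Integration.integrable_sum) auto
  moreover have "s = (\<lambda>z. \<Sum>i<m. indicator (A i) (fst z) * g i (snd z))" using s(2) by (auto simp: fun_eq_iff)
  ultimately show ?thesis by simp
qed

text \<open>The approximable sets contain the rectangles and form a Dynkin system: complements are
  handled by subtracting from the constant 1, and a disjoint union is cut off after finitely many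
  sets.\<close>

lemma rectangle_simple_set_approx:
  fixes M :: "'v::second_countable_topology measure"
  assumes N: "finite_measure N" "sets N = sets (borel :: real measure)" and M: "finite_measure M" "sets M = sets borel"
    and B: "B \<in> sets borel" and e: "\<epsilon> > 0"
  shows "\<exists>s. rectangle_simple M s \<and> (\<integral>z. \<bar>indicator B z - s z\<bar> \<partial>semidirect N (\<lambda>_. M)) < \<epsilon>"
proof -
  let ?S = "semidirect N (\<lambda>_. M)"
  let ?G = "{A \<times> B | A B. A \<in> sets (borel::real measure) \<and> B \<in> sets (borel::'v measure)}"
  have K: "finite_kernel (\<lambda>_::real. M)" using M by (intro finite_kernel_const)
  have "(\<integral>\<^sup>+ x. emeasure M UNIV \<partial>N) < \<infinity>"
    using finite_measure.emeasure_finite[OF N(1)] finite_measure.emeasure_finite[OF M(1)]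
    by (simp add: ennreal_mult_less_top top.not_eq_extremum)
  then interpret S: finite_measure ?S by (rule finite_measure_semidirect[OF K N(2)])
  have int1: "integrable ?S (indicator C :: _ \<Rightarrow> real)" if "C \<in> sets borel" for C
    using that by (intro S.integrable_const_bound[of _ 1]) auto
  have ints: "integrable ?S (\<lambda>z. \<bar>indicator C z - s z\<bar>)" if "C \<in> sets borel" "rectangle_simple M s" for C s
    using int1[OF that(1)] rectangle_simple_integrable[OF N M that(2)] by auto
  have "Int_stable ?G" by (rule Int_stable_pair_measure_generator)
  moreover have "?G \<subseteq> Pow UNIV" by auto
  moreover have "B \<in> sigma_sets UNIV ?G" using B by (simp add: rectangles_generate)
  ultimately show ?thesis using e
  proof (induction arbitrary: \<epsilon> rule: sigma_sets_induct_disjoint)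
    case (basic C)
    then obtain A B where "C = A \<times> B" "A \<in> sets borel" "B \<in> sets borel" by auto
    then show ?case using rectangle_simple_rectangle[OF M, of A B] basic(2) by (intro exI[of _ "indicator C"]) auto
  next
    case empty
    then show ?case using rectangle_simple_0[OF M] by (intro exI[of _ "\<lambda>_. 0"]) simp
  next
    case (compl C)
    then obtain s where s: "rectangle_simple M s" "(\<integral>z. \<bar>indicator C z - s z\<bar> \<partial>?S) < \<epsilon>" by blast
    have "rectangle_simple M (\<lambda>z. indicator (UNIV \<times> UNIV) z + (-1) * s z)"
      by (intro rectangle_simple_add rectangle_simple_cmult s rectangle_simple_rectangle[OF M]) auto
    moreover have "(\<lambda>z. \<bar>indicator (UNIV - C) z - (indicator (UNIV \<times> UNIV) z + (-1) * s z)\<bar>) = (\<lambda>z. \<bar>indicator C z - s z\<bar>)"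
      by (auto simp: fun_eq_iff indicator_def)
    ultimately show ?case using s(2) by (intro exI[of _ "\<lambda>z. indicator (UNIV \<times> UNIV) z + (-1) * s z"]) simp
  next
    case (union C)
    have Cb: "C i \<in> sets borel" for i using union(2) rectangles_generate[where 'a=real and 'b='v] by auto
    obtain k where k: "measure ?S ((\<Union>i. C i) - (\<Union>i<k. C i)) < \<epsilon> / 2"
      using measure_remainder_small[OF S.finite_measure_axioms, of C "\<epsilon> / 2"] Cb union(4) by auto
    \<comment> \<open>Half of the error went to the discarded tail; the \<open>k\<close> retained
      sets share the other half. \<open>Suc k\<close> avoids a division by zero when no set is
      retained.\<close>
    have "\<exists>s. rectangle_simple M s \<and> (\<integral>z. \<bar>indicator (C i) z - s z\<bar> \<partial>?S) < \<epsilon> / (2 * real (Suc k))" for i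
      using union(4) by (intro union(3)) auto
    then obtain s where s: "\<And>i. rectangle_simple M (s i)"
      "\<And>i. (\<integral>z. \<bar>indicator (C i) z - s i z\<bar> \<partial>?S) < \<epsilon> / (2 * real (Suc k))" by metis
    have "rectangle_simple M (\<lambda>z. \<Sum>i<k. s i z)" for k
    proof (induction k)
      case 0 show ?case using rectangle_simple_0[OF M] by simp
    next
      case (Suc k) then show ?case using rectangle_simple_add[OF Suc s(1)[of k]] by simp
    qed
    then have ss: "rectangle_simple M (\<lambda>z. \<Sum>i<k. s i z)" .
    let ?R = "(\<Union>i. C i) - (\<Union>i<k. C i)"
    have Rb: "?R \<in> sets borel" using Cb by auto
    have "\<bar>indicator (\<Union>i. C i) z - (\<Sum>i<k. s i z)\<bar> \<le> indicator ?R z + (\<Sum>i<k. \<bar>indicator (C i) z - s i z\<bar>)" for z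
    proof -
      have "disjoint_family_on C {..<k}" using union(1) by (rule disjoint_family_on_mono[rotated]) auto
      then have "(\<Sum>i<k. indicator (C i) z) = (indicator (\<Union>i<k. C i) z :: real)"
        by (simp add: indicator_UN_disjoint)
      then have "indicator (\<Union>i. C i) z = indicator ?R z + (\<Sum>i<k. indicator (C i) z :: real)"
        by (auto simp: indicator_def)
      then have "\<bar>indicator (\<Union>i. C i) z - (\<Sum>i<k. s i z)\<bar> = \<bar>indicator ?R z + (\<Sum>i<k. indicator (C i) z - s i z)\<bar>"
        by (simp add: sum_subtractf)
      also have "\<dots> \<le> \<bar>indicator ?R z\<bar> + \<bar>\<Sum>i<k. indicator (C i) z - s i z\<bar>" by (rule abs_triangle_ineq)
      also have "\<dots> \<le> indicator ?R z + (\<Sum>i<k. \<bar>indicator (C i) z - s i z\<bar>)"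
        by (intro add_mono sum_abs) (simp add: abs_of_nonneg)
      finally show ?thesis .
    qed
    then have "(\<integral>z. \<bar>indicator (\<Union>i. C i) z - (\<Sum>i<k. s i z)\<bar> \<partial>?S)
        \<le> (\<integral>z. indicator ?R z + (\<Sum>i<k. \<bar>indicator (C i) z - s i z\<bar>) \<partial>?S)"
      using Cb ss s(1) by (intro integral_mono Bochner_Integration.integrable_add Bochner_Integration.integrable_sum ints int1) auto
    also have "\<dots> = measure ?S ?R + (\<Sum>i<k. (\<integral>z. \<bar>indicator (C i) z - s i z\<bar> \<partial>?S))"
      using Rb ints[OF Cb s(1)] int1[OF Rb] by (subst Bochner_Integration.integral_add) (auto simp: Bochner_Integration.integral_sum)
    also have "\<dots> < \<epsilon>"
    proof -
      have "(\<Sum>i<k. (\<integral>z. \<bar>indicator (C i) z - s i z\<bar> \<partial>?S)) \<le> (\<Sum>i<k. \<epsilon> / (2 * real (Suc k)))"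
        using s(2) by (intro sum_mono less_imp_le)
      also have "\<dots> \<le> \<epsilon> / 2" using union(4) by (simp add: field_simps)
      finally show ?thesis using k by simp
    qed
    finally show ?case using ss by blast
  qed
qed

lemma rectangle_simple_approx:
  fixes M :: "'v::second_countable_topology measure"
  assumes N: "finite_measure N" "sets N = sets (borel :: real measure)" and M: "finite_measure M" "sets M = sets borel"
    and f: "integrable (semidirect N (\<lambda>_. M)) f" and e: "\<epsilon> > 0"
  shows "\<exists>s. rectangle_simple M s \<and> (\<integral>z. \<bar>f z - s z\<bar> \<partial>semidirect N (\<lambda>_. M)) < \<epsilon>"
  using f e
proof (induction arbitrary: \<epsilon> rule: integrable_induct)
  let ?S = "semidirect N (\<lambda>_. M)"
  note ri = rectangle_simple_integrable[OF N M]
  case (base A c)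
  obtain s where s: "rectangle_simple M s" "(\<integral>z. \<bar>indicator A z - s z\<bar> \<partial>?S) < \<epsilon> / (\<bar>c\<bar> + 1)"
    using rectangle_simple_set_approx[OF N M, of A "\<epsilon> / (\<bar>c\<bar> + 1)"] base by auto
  have "(\<integral>z. \<bar>indicator A z *\<^sub>R c - c * s z\<bar> \<partial>?S) = \<bar>c\<bar> * (\<integral>z. \<bar>indicator A z - s z\<bar> \<partial>?S)"
  proof -
    have "(\<lambda>z. \<bar>indicator A z *\<^sub>R c - c * s z\<bar>) = (\<lambda>z. \<bar>c\<bar> * \<bar>indicator A z - s z\<bar>)"
      by (simp add: fun_eq_iff mult.commute right_diff_distrib flip: abs_mult)
    then show ?thesis by simp
  qed
  also have "\<dots> \<le> \<bar>c\<bar> * (\<epsilon> / (\<bar>c\<bar> + 1))" using s(2) by (intro mult_left_mono) auto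
  also have "\<dots> < \<epsilon>" using base(3) by (simp add: field_simps)
  finally show ?case using rectangle_simple_cmult[OF s(1), of c] by blast
next
  let ?S = "semidirect N (\<lambda>_. M)"
  note ri = rectangle_simple_integrable[OF N M]
  case (add f g)
  obtain s s' where s: "rectangle_simple M s" "(\<integral>z. \<bar>f z - s z\<bar> \<partial>?S) < \<epsilon> / 2"
    "rectangle_simple M s'" "(\<integral>z. \<bar>g z - s' z\<bar> \<partial>?S) < \<epsilon> / 2"
    using add(3)[of "\<epsilon> / 2"] add(4)[of "\<epsilon> / 2"] add(5) by auto
  have i: "integrable ?S (\<lambda>z. \<bar>f z - s z\<bar>)" "integrable ?S (\<lambda>z. \<bar>g z - s' z\<bar>)"
    using add(1,2) ri[OF s(1)] ri[OF s(3)] by auto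
  have "(\<integral>z. \<bar>f z + g z - (s z + s' z)\<bar> \<partial>?S) \<le> (\<integral>z. \<bar>f z - s z\<bar> + \<bar>g z - s' z\<bar> \<partial>?S)"
    using add(1,2) ri[OF s(1)] ri[OF s(3)] i by (intro integral_mono) auto
  also have "\<dots> < \<epsilon>" using s i by simp
  finally show ?case using rectangle_simple_add[OF s(1,3)] by (intro exI[of _ "\<lambda>z. s z + s' z"]) auto
next
  let ?S = "semidirect N (\<lambda>_. M)"
  note ri = rectangle_simple_integrable[OF N M]
  case (lim f u)
  have "(\<lambda>i. \<integral>z. \<bar>f z - u i z\<bar> \<partial>?S) \<longlonglongrightarrow> (\<integral>z. 0 \<partial>?S)"
  \<comment> \<open>The approximating functions are bounded by twice \<open>\<bar>f\<bar>\<close>,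
    hence the factor 3 for the difference.\<close>
  proof (rule integral_dominated_convergence[where w = "\<lambda>z. 3 * norm (f z)"])
    show "AE z in ?S. (\<lambda>i. \<bar>f z - u i z\<bar>) \<longlonglongrightarrow> 0"
    proof (rule AE_I2)
      fix z
      have "(\<lambda>i. f z - u i z) \<longlonglongrightarrow> f z - f z" by (intro tendsto_intros lim(2)) simp
      then show "(\<lambda>i. \<bar>f z - u i z\<bar>) \<longlonglongrightarrow> 0" using tendsto_rabs_zero by fastforce
    qed
    show "AE z in ?S. norm \<bar>f z - u i z\<bar> \<le> 3 * norm (f z)" for i
      using lim(3)[of _ i] by (intro AE_I2) (smt (verit) real_norm_def)
    show "(\<lambda>z. \<bar>f z - u i z\<bar>) \<in> borel_measurable ?S" for i
      by (intro borel_measurable_abs borel_measurable_diff borel_measurable_integrable lim)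
  qed (use lim(1,4) in auto)
  then have "eventually (\<lambda>i. (\<integral>z. \<bar>f z - u i z\<bar> \<partial>?S) < \<epsilon> / 2) sequentially"
    using lim(6) by (intro order_tendstoD) auto
  then obtain i where i: "(\<integral>z. \<bar>f z - u i z\<bar> \<partial>?S) < \<epsilon> / 2" by (auto dest: eventually_happens)
  obtain s where s: "rectangle_simple M s" "(\<integral>z. \<bar>u i z - s z\<bar> \<partial>?S) < \<epsilon> / 2" using lim(5)[of "\<epsilon> / 2" i] lim(6) by auto
  have ii: "integrable ?S (\<lambda>z. \<bar>f z - u i z\<bar>)" "integrable ?S (\<lambda>z. \<bar>u i z - s z\<bar>)"
    using lim(1,4) ri[OF s(1)] by auto
  have "(\<integral>z. \<bar>f z - s z\<bar> \<partial>?S) \<le> (\<integral>z. \<bar>f z - u i z\<bar> + \<bar>u i z - s z\<bar> \<partial>?S)"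
    using lim(4) ri[OF s(1)] ii by (intro integral_mono) auto
  also have "\<dots> < \<epsilon>" using s i ii by simp
  finally show ?case using s(1) by blast
qed

section \<open>Fluxes\<close>

lemma
  assumes "sets (snd \<mu>) = sets (fst \<mu>)"
  shows sets_total_variation: "sets (total_variation \<mu>) = sets (fst \<mu>)"
    and emeasure_total_variation:
      "B \<in> sets (fst \<mu>) \<Longrightarrow> emeasure (total_variation \<mu>) B = emeasure (fst \<mu>) B + emeasure (snd \<mu>) B"
proof -
  show s: "sets (total_variation \<mu>) = sets (fst \<mu>)"
    unfolding total_variation_def by (subst sets_measure_of) (auto simp: sets.space_closed sets.sigma_sets_eq)
  assume B: "B \<in> sets (fst \<mu>)"
  show "emeasure (total_variation \<mu>) B = emeasure (fst \<mu>) B + emeasure (snd \<mu>) B"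
  proof (rule emeasure_measure_of[OF total_variation_def])
    show "countably_additive (sets (total_variation \<mu>)) (\<lambda>B. emeasure (fst \<mu>) B + emeasure (snd \<mu>) B)"
      unfolding s
    proof (rule countably_additiveI)
      fix A :: "nat \<Rightarrow> _" assume A: "range A \<subseteq> sets (fst \<mu>)" "disjoint_family A"
      then have "(\<Sum>i. emeasure (fst \<mu>) (A i)) = emeasure (fst \<mu>) (\<Union>i. A i)"
        "(\<Sum>i. emeasure (snd \<mu>) (A i)) = emeasure (snd \<mu>) (\<Union>i. A i)"
        using assms by (auto intro!: suminf_emeasure)
      then show "(\<Sum>i. emeasure (fst \<mu>) (A i) + emeasure (snd \<mu>) (A i))
          = emeasure (fst \<mu>) (\<Union>i. A i) + emeasure (snd \<mu>) (\<Union>i. A i)"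
        by (simp add: suminf_add[symmetric])
    qed
  qed (use B s in \<open>auto simp: positive_def sets.space_closed\<close>)
qed

lemma nn_integral_total_variation:
  assumes s: "sets (snd \<mu>) = sets (fst \<mu>)" and f: "f \<in> borel_measurable (fst \<mu>)"
  shows "(\<integral>\<^sup>+ z. f z \<partial>total_variation \<mu>) = (\<integral>\<^sup>+ z. f z \<partial>fst \<mu>) + (\<integral>\<^sup>+ z. f z \<partial>snd \<mu>)"
  using f
proof (induction rule: borel_measurable_induct)
  note sp = sets_eq_imp_space_eq[OF s] sets_eq_imp_space_eq[OF sets_total_variation[OF s]]
  note m = measurable_cong_sets[OF s refl] measurable_cong_sets[OF sets_total_variation[OF s] refl]
  case (cong f g)
  have "(\<integral>\<^sup>+ z. f z \<partial>M) = (\<integral>\<^sup>+ z. g z \<partial>M)" if "space M = space (fst \<mu>)" for M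
    using cong(3) that by (intro nn_integral_cong) auto
  then show ?case using cong(4) sp by simp
next
  case (set A) then show ?case
    using s sets_total_variation[OF s] by (simp add: emeasure_total_variation[OF s])
next
  case (mult f c)
  then show ?case
    by (simp add: nn_integral_cmult measurable_cong_sets[OF s refl] measurable_cong_sets[OF sets_total_variation[OF s] refl] distrib_left)
next
  case (add f g)
  then show ?case
    by (simp add: nn_integral_add measurable_cong_sets[OF s refl] measurable_cong_sets[OF sets_total_variation[OF s] refl] ac_simps)
next
  case (seq U)
  note m = measurable_cong_sets[OF s refl] measurable_cong_sets[OF sets_total_variation[OF s] refl]
  have e: "(\<integral>\<^sup>+ z. (SUP i. U i) z \<partial>M) = (SUP i. \<integral>\<^sup>+ z. U i z \<partial>M)" if "sets M = sets (fst \<mu>)" for M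
    unfolding SUP_apply using seq by (intro nn_integral_monotone_convergence_SUP) (auto simp: measurable_cong_sets[OF that refl])
  have "(SUP i. (\<integral>\<^sup>+ z. U i z \<partial>fst \<mu>) + (\<integral>\<^sup>+ z. U i z \<partial>snd \<mu>))
      = (SUP i. \<integral>\<^sup>+ z. U i z \<partial>fst \<mu>) + (SUP i. \<integral>\<^sup>+ z. U i z \<partial>snd \<mu>)"
    using seq by (intro ennreal_SUP_add) (auto simp: incseq_def le_fun_def intro!: nn_integral_mono)
  then show ?case using seq e[OF refl] e[OF s] e[OF sets_total_variation[OF s]] by simp
qed

lemma absolutely_continuous_total_variation:
  assumes s: "sets (fst \<mu>) = sets N" "sets (snd \<mu>) = sets N"
  shows "absolutely_continuous N (total_variation \<mu>) \<longleftrightarrow>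
    absolutely_continuous N (fst \<mu>) \<and> absolutely_continuous N (snd \<mu>)"
  using s sets_total_variation[of \<mu>] emeasure_total_variation[of \<mu>]
  unfolding absolutely_continuous_def null_sets_def by auto

lemma density_enn2real_RN_deriv:
  assumes \<nu>: "sigma_finite_measure \<nu>" and \<mu>: "sigma_finite_measure \<mu>" "sets \<mu> = sets \<nu>" "absolutely_continuous \<nu> \<mu>"
  shows "density \<nu> (\<lambda>z. ennreal (enn2real (RN_deriv \<nu> \<mu> z))) = \<mu>"
proof -
  interpret sigma_finite_measure \<nu> by fact
  have "AE z in \<nu>. RN_deriv \<nu> \<mu> z \<noteq> \<infinity>" by (rule RN_deriv_finite[OF \<mu>(1,3,2)])
  then have "density \<nu> (\<lambda>z. ennreal (enn2real (RN_deriv \<nu> \<mu> z))) = density \<nu> (RN_deriv \<nu> \<mu>)"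
    by (intro density_cong) (auto simp: top.not_eq_extremum)
  then show ?thesis using density_RN_deriv[OF \<mu>(3,2)] by simp
qed

text \<open>\<open>RN_deriv\<close> is a choice that is unique only almost everywhere. This
  identifies the choice made in the dissipation potential with given densities, so that the
  potential can be computed in both directions.\<close>

lemma flux_RN_deriv_density:
  assumes \<nu>: "sigma_finite_measure \<nu>" and p: "p \<in> borel_measurable \<nu>" "\<And>z. 0 \<le> p z"
    and q: "q \<in> borel_measurable \<nu>" "\<And>z. 0 \<le> q z"
    and j: "fst j = density \<nu> (\<lambda>z. ennreal (p z))" "snd j = density \<nu> (\<lambda>z. ennreal (q z))"
  shows "AE z in \<nu>. flux_RN_deriv \<nu> (double_flux j) z = 2 * (p z - q z)"
proof -
  interpret sigma_finite_measure \<nu> by fact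
  have *: "AE z in \<nu>. enn2real (RN_deriv \<nu> (scale_measure 2 (density \<nu> (\<lambda>z. ennreal (p z)))) z) = 2 * p z"
    if p: "p \<in> borel_measurable \<nu>" "\<And>z. 0 \<le> p z" for p :: "'a \<Rightarrow> real"
  proof -
    have "density \<nu> (\<lambda>z. ennreal (2 * p z)) = scale_measure 2 (density \<nu> (\<lambda>z. ennreal (p z)))"
      using p by (intro measure_eqI) (auto simp: emeasure_density ennreal_mult mult.assoc nn_integral_cmult)
    then have "AE z in \<nu>. ennreal (2 * p z) = RN_deriv \<nu> (scale_measure 2 (density \<nu> (\<lambda>z. ennreal (p z)))) z"
      using p by (intro RN_deriv_unique) auto
    then show ?thesis by eventually_elim (metis enn2real_ennreal mult_nonneg_nonneg that(2) zero_le_numeral)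
  qed
  from *[OF p] *[OF q] show ?thesis
    unfolding flux_RN_deriv_def double_flux_def by eventually_elim (simp add: j)
qed

section \<open>The jump kernel\<close>

text \<open>The weight \<omega> of the overview. It is the weight in the integrability condition of
  \<open>CE\<close>, and its square is the weight in the condition on the jump kernel.\<close>

definition cutdist :: "'v::metric_space \<times> 'v \<Rightarrow> real" where
  "cutdist z = min 1 (dist (fst z) (snd z))"

lemma cutdist_bounds: "0 \<le> cutdist z" "cutdist z \<le> 1" "\<bar>cutdist z\<bar> \<le> 1"
  by (auto simp: cutdist_def)

lemma cutdist_eq_0: "cutdist z = 0 \<longleftrightarrow> fst z = snd z" "cutdist (x, y) = 0 \<longleftrightarrow> x = y"
  by (auto simp: cutdist_def min_def)

lemma cutdist_sq: "(cutdist (x, y))\<^sup>2 = min 1 ((dist x y)\<^sup>2)"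
  using one_le_power[of "dist x y" 2] power_le_one[of "dist x y" 2]
  by (cases "dist x y \<le> 1") (auto simp: cutdist_def min_def)

lemma cutdist_measurable [measurable]: "cutdist \<in> borel_measurable borel"
  unfolding cutdist_def by (intro borel_measurable_continuous_onI continuous_intros)

lemma cutdist_swap: "cutdist (prod.swap z) = cutdist z"
  by (simp add: cutdist_def dist_commute)

lemma swap_measurable [measurable]:
  "prod.swap \<in> measurable borel (borel :: ('v::second_countable_topology \<times> 'v) measure)"
  by (intro borel_measurable_continuous_onI continuous_on_swap)

lemma fst_snd_borel [measurable]:
  "fst \<in> measurable borel (borel :: 'a::topological_space measure)"
  "snd \<in> measurable borel (borel :: 'b::topological_space measure)"
  by (auto intro!: borel_measurable_continuous_onI continuous_intros)

locale jump =
  fixes \<pi> :: "'v::{metric_space, second_countable_topology} measure" and \<kappa> :: "'v \<Rightarrow> 'v measure"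
  assumes setting: "jump_setting \<pi> \<kappa>"
begin

lemma pi: "sets \<pi> = sets borel" "finite_measure \<pi>" "space \<pi> = UNIV"
  using setting space_eq_UNIV[of \<pi>] by (auto simp: jump_setting_def finite_borel_measures_def)

lemma kappa: "sets (\<kappa> x) = sets borel" "space (\<kappa> x) = UNIV" "emeasure (\<kappa> x) {x} = 0"
  using setting space_eq_UNIV[of "\<kappa> x"] by (auto simp: jump_setting_def)

lemma kappa_measurable: "measurable (\<kappa> x) N = measurable borel N"
  by (rule measurable_cong_sets[OF kappa(1) refl])

lemma pi_measurable: "measurable \<pi> N = measurable borel N"
  by (rule measurable_cong_sets[OF pi(1) refl])

text \<open>The tempered jump kernel. Its total masses are uniformly bounded, whereas those of
  \<open>\<kappa>\<close> may be infinite, and the measurability assumption of the setting is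
  exactly one about integrals against it.\<close>

definition "K x = density (\<kappa> x) (\<lambda>y. ennreal ((cutdist (x, y))\<^sup>2))"

lemma cutdist_section:
  fixes x :: 'v
  shows "(\<lambda>y. (cutdist (x, y))\<^sup>2) \<in> borel_measurable borel"
  using measurable_Pair_section[of "\<lambda>z. (cutdist z)\<^sup>2" borel x] by simp

text \<open>The maximum with 1 makes the bound on the masses positive, so that functions can be
  divided by it.\<close>

definition "K0 = max 1 (enn2real (SUP x. \<integral>\<^sup>+ y. ennreal (min 1 ((dist x y)\<^sup>2)) \<partial>\<kappa> x))"

lemma K0_ge_1: "1 \<le> K0" by (simp add: K0_def)

lemma emeasure_K: "B \<in> sets borel \<Longrightarrow> emeasure (K x) B = (\<integral>\<^sup>+ y. ennreal ((cutdist (x, y))\<^sup>2) * indicator B y \<partial>\<kappa> x)"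
  unfolding K_def using cutdist_section[of x] by (intro emeasure_density) (auto simp: kappa kappa_measurable)

lemma K_bounded: "emeasure (K x) UNIV \<le> ennreal K0"
proof -
  have fin: "(SUP x. \<integral>\<^sup>+ y. ennreal (min 1 ((dist x y)\<^sup>2)) \<partial>\<kappa> x) < \<infinity>" using setting by (simp add: jump_setting_def)
  have "emeasure (K x) UNIV = (\<integral>\<^sup>+ y. ennreal (min 1 ((dist x y)\<^sup>2)) \<partial>\<kappa> x)" by (simp add: emeasure_K cutdist_sq)
  also have "\<dots> \<le> (SUP x. \<integral>\<^sup>+ y. ennreal (min 1 ((dist x y)\<^sup>2)) \<partial>\<kappa> x)" by (rule SUP_upper) simp
  also have "\<dots> = ennreal (enn2real (SUP x. \<integral>\<^sup>+ y. ennreal (min 1 ((dist x y)\<^sup>2)) \<partial>\<kappa> x))" using fin by simp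
  also have "\<dots> \<le> ennreal K0" by (intro ennreal_leI) (simp add: K0_def)
  finally show ?thesis .
qed

lemma K_kernel: "finite_kernel K"
  unfolding finite_kernel_def
proof (intro conjI allI ballI)
  show "sets (K x) = sets borel" for x by (simp add: K_def kappa)
  show "emeasure (K x) UNIV < \<infinity>" for x using K_bounded[of x] by (simp add: le_less_trans)
  fix B :: "'v set" assume B: "B \<in> sets borel"
  have "(\<lambda>x. \<integral>y. indicator B y * min 1 ((dist x y)\<^sup>2) \<partial>\<kappa> x) \<in> borel_measurable borel"
  proof -
    have "bounded (range (indicator B :: 'v \<Rightarrow> real))" unfolding bounded_iff by (intro exI[of _ 1]) (auto simp: indicator_def)
    moreover have "(indicator B :: 'v \<Rightarrow> real) \<in> borel_measurable borel" using B by simp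
    ultimately show ?thesis using setting unfolding jump_setting_def by blast
  qed
  \<comment> \<open>The setting states measurability for Bochner integrals, so the finite
    nonnegative integral is rewritten as one.\<close>
  moreover have "emeasure (K x) B = ennreal (\<integral>y. indicator B y * min 1 ((dist x y)\<^sup>2) \<partial>\<kappa> x)" for x
  proof -
    have m: "(\<lambda>y. indicator B y * min 1 ((dist x y)\<^sup>2)) \<in> borel_measurable (\<kappa> x)"
      using B cutdist_section[of x] by (simp add: kappa_measurable cutdist_sq)
    have e: "emeasure (K x) B = (\<integral>\<^sup>+ y. ennreal (indicator B y * min 1 ((dist x y)\<^sup>2)) \<partial>\<kappa> x)"
      unfolding emeasure_K[OF B] by (intro nn_integral_cong) (auto simp: cutdist_sq indicator_def)
    have "emeasure (K x) B \<le> emeasure (K x) UNIV" by (rule emeasure_mono) (auto simp: K_def kappa)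
    then have "emeasure (K x) B < \<infinity>" using K_bounded[of x] by (simp add: le_less_trans)
    then have "integrable (\<kappa> x) (\<lambda>y. indicator B y * min 1 ((dist x y)\<^sup>2))"
      using e m by (intro integrableI_nonneg) auto
    then show ?thesis unfolding e by (intro nn_integral_eq_integral) auto
  qed
  ultimately show "(\<lambda>x. emeasure (K x) B) \<in> borel_measurable borel" by simp
qed

text \<open>Defined through \<open>K\<close> because finite kernels have a well-behaved semidirect
  product; the edge measure, which may be infinite, is recovered from \<open>lam\<close> as a
  density.\<close>

definition "lam = semidirect \<pi> K"

lemma sets_lam [simp]: "sets lam = sets borel" and space_lam [simp]: "space lam = UNIV"
  and measurable_lam [simp]: "measurable lam N = measurable borel N"
  by (simp_all add: lam_def)

lemma finite_lam: "finite_measure lam"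
  unfolding lam_def
proof (rule finite_measure_semidirect[OF K_kernel pi(1)])
  have "(\<integral>\<^sup>+ x. emeasure (K x) UNIV \<partial>\<pi>) \<le> (\<integral>\<^sup>+ x. ennreal K0 \<partial>\<pi>)" by (intro nn_integral_mono K_bounded)
  also have "\<dots> < \<infinity>" using finite_measure.emeasure_finite[OF pi(2)] by (simp add: ennreal_mult_less_top top.not_eq_extremum)
  finally show "(\<integral>\<^sup>+ x. emeasure (K x) UNIV \<partial>\<pi>) < \<infinity>" .
qed

text \<open>The weight vanishes only at \<open>y = x\<close>, a point that \<open>\<kappa> x\<close>
  does not charge, so the tempering can be inverted.\<close>

lemma kappa_eq: "\<kappa> x = density (K x) (\<lambda>y. ennreal (1 / (cutdist (x, y))\<^sup>2))"
proof -
  have "density (K x) (\<lambda>y. ennreal (1 / (cutdist (x, y))\<^sup>2))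
      = density (\<kappa> x) (\<lambda>y. ennreal ((cutdist (x, y))\<^sup>2) * ennreal (1 / (cutdist (x, y))\<^sup>2))"
    unfolding K_def using cutdist_section[of x] by (intro density_density_eq) (auto simp: kappa_measurable)
  also have "\<dots> = density (\<kappa> x) (\<lambda>_. 1)"
  proof (rule density_cong)
    have "AE y in \<kappa> x. y \<notin> {x}" using kappa(3)[of x] by (intro AE_not_in) (auto simp: null_sets_def kappa)
    then show "AE y in \<kappa> x. ennreal ((cutdist (x, y))\<^sup>2) * ennreal (1 / (cutdist (x, y))\<^sup>2) = 1"
      by eventually_elim (auto simp: ennreal_mult[symmetric] cutdist_eq_0)
  qed (use cutdist_section[of x] in \<open>auto simp: kappa_measurable\<close>)
  finally show ?thesis by (simp add: density_1)
qed

abbreviation "\<theta> \<equiv> edge_measure \<pi> \<kappa>"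

lemma theta_eq: "\<theta> = density lam (\<lambda>z. ennreal (1 / (cutdist z)\<^sup>2))"
proof -
  have "\<theta> = semidirect \<pi> (\<lambda>x. density (K x) (\<lambda>y. ennreal (1 / (cutdist (x, y))\<^sup>2)))"
    unfolding edge_measure_eq_semidirect by (rule arg_cong[of _ _ "semidirect \<pi>"]) (rule ext, rule kappa_eq)
  also have "\<dots> = density lam (\<lambda>z. ennreal (1 / (cutdist z)\<^sup>2))"
    unfolding lam_def by (rule semidirect_density[OF K_kernel pi(1)]) simp
  finally show ?thesis .
qed

lemma sets_theta [simp]: "sets \<theta> = sets borel" and space_theta [simp]: "space \<theta> = UNIV"
  and measurable_theta [simp]: "measurable \<theta> N = measurable borel N"
  by (simp_all add: edge_measure_eq_semidirect)

lemma lam_off_diagonal: "AE z in lam. cutdist z \<noteq> 0"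
proof -
  have "AE y in K x. cutdist (x, y) \<noteq> 0" for x
    unfolding K_def using cutdist_section[of x]
    by (subst AE_density) (auto simp: kappa_measurable)
  then show ?thesis unfolding lam_def by (subst AE_semidirect[OF K_kernel pi(1)]) auto
qed

lemma lam_eq: "lam = density \<theta> (\<lambda>z. ennreal ((cutdist z)\<^sup>2))"
proof -
  have "density \<theta> (\<lambda>z. ennreal ((cutdist z)\<^sup>2)) = density lam (\<lambda>z. ennreal (1 / (cutdist z)\<^sup>2) * ennreal ((cutdist z)\<^sup>2))"
    unfolding theta_eq by (rule density_density_eq) auto
  also have "\<dots> = density lam (\<lambda>_. 1)"
    using lam_off_diagonal by (intro density_cong) (auto simp: ennreal_mult[symmetric] elim: eventually_mono)
  finally show ?thesis by (simp add: density_1)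
qed

lemma sigma_finite_theta: "sigma_finite_measure \<theta>"
proof -
  interpret finite_measure lam by (rule finite_lam)
  show ?thesis unfolding theta_eq by (subst sigma_finite_iff_density_finite) auto
qed

text \<open>The two measures are densities of each other with weights that vanish at most on the
  diagonal, and \<open>lam\<close> does not charge the diagonal.\<close>

lemma AE_lam_iff_theta: "(AE z in lam. P z) \<longleftrightarrow> (AE z in \<theta>. P z)"
proof
  assume "AE z in lam. P z" then show "AE z in \<theta>. P z"
    unfolding theta_eq by (subst AE_density) auto
next
  assume "AE z in \<theta>. P z"
  then have "AE z in lam. 0 < ennreal (1 / (cutdist z)\<^sup>2) \<longrightarrow> P z"
    unfolding theta_eq by (subst (asm) AE_density) auto
  with lam_off_diagonal show "AE z in lam. P z" by eventually_elim (auto simp: ennreal_less_zero_iff)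
qed

lemma nn_integral_theta_swap:
  assumes "f \<in> borel_measurable borel"
  shows "(\<integral>\<^sup>+ z. f (prod.swap z) \<partial>\<theta>) = (\<integral>\<^sup>+ z. f z \<partial>\<theta>)"
proof -
  have "distr \<theta> borel prod.swap = \<theta>" using setting by (simp add: jump_setting_def)
  then have "(\<integral>\<^sup>+ z. f z \<partial>\<theta>) = (\<integral>\<^sup>+ z. f z \<partial>distr \<theta> borel prod.swap)" by simp
  also have "\<dots> = (\<integral>\<^sup>+ z. f (prod.swap z) \<partial>\<theta>)" using assms by (intro nn_integral_distr) auto
  finally show ?thesis by simp
qed

lemma nn_integral_theta: "f \<in> borel_measurable borel \<Longrightarrow>
    (\<integral>\<^sup>+ z. f z \<partial>\<theta>) = (\<integral>\<^sup>+ z. ennreal (1 / (cutdist z)\<^sup>2) * f z \<partial>lam)"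
  unfolding theta_eq by (intro nn_integral_density) auto

lemma nn_integral_lam: "f \<in> borel_measurable borel \<Longrightarrow>
    (\<integral>\<^sup>+ z. f z \<partial>lam) = (\<integral>\<^sup>+ z. ennreal ((cutdist z)\<^sup>2) * f z \<partial>\<theta>)"
  by (subst lam_eq, intro nn_integral_density) auto

lemma nn_integral_lam_swap:
  assumes "f \<in> borel_measurable borel"
  shows "(\<integral>\<^sup>+ z. f (prod.swap z) \<partial>lam) = (\<integral>\<^sup>+ z. f z \<partial>lam)"
proof -
  have "(\<integral>\<^sup>+ z. f (prod.swap z) \<partial>lam) = (\<integral>\<^sup>+ z. ennreal ((cutdist (prod.swap z))\<^sup>2) * f (prod.swap z) \<partial>\<theta>)"
    using assms by (subst nn_integral_lam) (auto simp: cutdist_swap intro: measurable_compose[OF swap_measurable])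
  also have "\<dots> = (\<integral>\<^sup>+ z. ennreal ((cutdist z)\<^sup>2) * f z \<partial>\<theta>)"
    using assms by (intro nn_integral_theta_swap) auto
  finally show ?thesis using assms by (simp add: nn_integral_lam)
qed

lemma distr_lam_swap: "distr lam borel prod.swap = lam"
proof (rule measure_eqI)
  fix B assume B: "B \<in> sets (distr lam borel prod.swap)"
  then have "emeasure (distr lam borel prod.swap) B = (\<integral>\<^sup>+ z. indicator B z \<partial>distr lam borel prod.swap)" by simp
  also have "\<dots> = (\<integral>\<^sup>+ z. indicator B (prod.swap z) \<partial>lam)" using B by (intro nn_integral_distr) auto
  also have "\<dots> = emeasure lam B" using B by (subst nn_integral_lam_swap) auto
  finally show "emeasure (distr lam borel prod.swap) B = emeasure lam B" .
qed simp

text \<open>The first marginal of \<open>lam\<close> is absolutely continuous with respect to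
  \<open>\<pi>\<close> by construction; detailed balance carries this over to the second.\<close>

lemma AE_lam_marginals:
  assumes "AE x in \<pi>. P x"
  shows "AE z in lam. P (fst z) \<and> P (snd z)"
proof -
  obtain N where N: "N \<in> null_sets \<pi>" "{x. \<not> P x} \<subseteq> N"
    using AE_E2[OF assms] assms by (auto elim!: AE_E simp: pi null_sets_def)
  have Nb: "N \<in> sets borel" using N(1) pi(1) by (auto simp: null_sets_def)
  have NU: "{z::'v \<times> 'v. fst z \<notin> N} \<in> sets borel"
    using Nb measurable_sets[OF fst_snd_borel(1), of "- N"] by (auto simp: vimage_def)
  have 1: "AE z in lam. fst z \<notin> N"
    unfolding lam_def
    by (subst AE_semidirect[OF K_kernel pi(1) NU]) (use AE_not_in[OF N(1)] in auto)
  have "AE z in distr lam borel prod.swap. fst z \<notin> N" unfolding distr_lam_swap by (rule 1)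
  then have 2: "AE z in lam. snd z \<notin> N" using NU by (subst (asm) AE_distr_iff) auto
  from 1 2 show ?thesis by eventually_elim (use N(2) in auto)
qed

lemma edge_measure_weighted:
  fixes f :: "'v \<times> 'v \<Rightarrow> real"
  assumes [measurable]: "f \<in> borel_measurable borel"
  shows "edge_measure \<pi> (\<lambda>x. density (\<kappa> x) (\<lambda>y. ennreal (f (x, y)))) = density \<theta> (\<lambda>z. ennreal (f z))"
proof -
  have "density (\<kappa> x) (\<lambda>y. ennreal (f (x, y))) = density (K x) (\<lambda>y. ennreal (1 / (cutdist (x, y))\<^sup>2) * ennreal (f (x, y)))" for x
    unfolding kappa_eq[of x] using measurable_Pair_section[OF assms, of x] cutdist_section[of x]
    by (intro density_density_eq) (auto simp: measurable_cong_sets[OF finite_kernelD(1)[OF K_kernel] refl])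
  then have "edge_measure \<pi> (\<lambda>x. density (\<kappa> x) (\<lambda>y. ennreal (f (x, y))))
      = semidirect \<pi> (\<lambda>x. density (K x) (\<lambda>y. ennreal (1 / (cutdist (x, y))\<^sup>2) * ennreal (f (x, y))))"
    by (simp add: edge_measure_eq_semidirect)
  also have "\<dots> = density lam (\<lambda>z. ennreal (1 / (cutdist z)\<^sup>2) * ennreal (f z))"
    unfolding lam_def by (rule semidirect_density[OF K_kernel pi(1)]) simp
  also have "\<dots> = density \<theta> (\<lambda>z. ennreal (f z))"
    unfolding theta_eq by (intro density_density_eq[symmetric]) auto
  finally show ?thesis .
qed

end

section \<open>Entropy and dissipation\<close>

lemma ennreal_double_half: "(2::ennreal) * (x / 2) = x"
  using ennreal_mult_divide_eq[of 2 x] by (simp add: ennreal_times_divide mult.commute)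

lemma ennreal_add_le: "ennreal (x + y) \<le> ennreal x + ennreal y"
proof -
  have "ennreal (x + y) \<le> ennreal (max 0 x + max 0 y)" by (intro ennreal_leI) simp
  then show ?thesis by (simp add: max_def ennreal_neg split: if_splits)
qed

lemma ennreal_integral_le_nn_integral:
  assumes "integrable M f"
  shows "ennreal (\<integral>x. f x \<partial>M) \<le> (\<integral>\<^sup>+ x. ennreal (f x) \<partial>M)"
proof -
  have i: "integrable M (\<lambda>x. max 0 (f x))" using assms by simp
  have "ennreal (\<integral>x. f x \<partial>M) \<le> ennreal (\<integral>x. max 0 (f x) \<partial>M)" using assms i by (intro ennreal_leI integral_mono) auto
  also have "\<dots> = (\<integral>\<^sup>+ x. ennreal (max 0 (f x)) \<partial>M)" using i by (intro nn_integral_eq_integral[symmetric]) auto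
  also have "\<dots> = (\<integral>\<^sup>+ x. ennreal (f x) \<partial>M)" by (intro nn_integral_cong) (auto simp: max_def ennreal_neg)
  finally show ?thesis .
qed

locale jump_flow = jump \<pi> \<kappa> + flow_densities \<psi>s \<phi> \<alpha>
  for \<pi> :: "'v::{metric_space, second_countable_topology} measure" and \<kappa> \<psi>s \<phi> \<alpha> +
  assumes phi: "entropy_density \<phi>"
begin

abbreviation "Ent \<equiv> entropy_functional \<pi> \<phi>"
abbreviation "Diss \<kappa>' \<equiv> dissipation_potential \<pi> \<kappa>' \<psi>s \<alpha>"
abbreviation "Fisher \<kappa>' \<equiv> Fisher_information \<pi> \<kappa>' \<phi> \<psi>s \<alpha>"

lemma phi_nonneg: "r \<ge> 0 \<Longrightarrow> 0 \<le> \<phi> r"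
  using phi by (auto simp: entropy_density_def)

lemma dens_nonneg: "0 \<le> dens \<pi> \<rho> x"
  by (simp add: dens_def)

lemma dens_measurable [measurable]: "dens \<pi> \<rho> \<in> borel_measurable borel"
  using borel_measurable_RN_deriv[of \<pi> \<rho>] unfolding dens_def pi_measurable by simp

text \<open>Clipping both arguments at 0 extends a function continuous on the quadrant to a
  continuous function on the plane.\<close>

lemma nonneg_compose_measurable:
  assumes g: "continuous_on quadrant g" and f: "f1 \<in> borel_measurable M" "f2 \<in> borel_measurable M"
    and nn: "\<And>x. 0 \<le> f1 x" "\<And>x. 0 \<le> f2 x"
  shows "(\<lambda>x. g (f1 x, f2 x)) \<in> borel_measurable M"
proof -
  have "continuous_on UNIV (\<lambda>z. g (max 0 (fst z), max 0 (snd z)))"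
    by (rule continuous_on_compose2[OF g]) (auto intro!: continuous_intros)
  then have "(\<lambda>z. g (max 0 (fst z), max 0 (snd z))) \<in> borel_measurable borel"
    by (rule borel_measurable_continuous_onI)
  then have "(\<lambda>x. (\<lambda>z. g (max 0 (fst z), max 0 (snd z))) (f1 x, f2 x)) \<in> borel_measurable M"
    by (rule measurable_compose[rotated]) (use f in \<open>simp add: borel_measurable_Pair\<close>)
  then show ?thesis using nn by (simp add: max_def)
qed

lemma alpha_measurable:
  assumes "f1 \<in> borel_measurable M" "f2 \<in> borel_measurable M" "\<And>x. 0 \<le> f1 x" "\<And>x. 0 \<le> f2 x"
  shows "(\<lambda>x. \<alpha> (f1 x, f2 x)) \<in> borel_measurable M"
  by (rule nonneg_compose_measurable) (use alpha assms in \<open>auto simp: flux_density_def\<close>)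

lemma phi_measurable:
  assumes "f \<in> borel_measurable M" "\<And>x. 0 \<le> f x"
  shows "(\<lambda>x. \<phi> (f x)) \<in> borel_measurable M"
proof -
  have "continuous_on {0..} \<phi>" using phi by (auto simp: entropy_density_def)
  then have "continuous_on quadrant (\<lambda>z. \<phi> (fst z))"
    by (rule continuous_on_compose2) (auto intro!: continuous_intros)
  from nonneg_compose_measurable[OF this assms(1,1) assms(2,2)] show ?thesis by simp
qed

lemma integrand_measurable:
  assumes "w \<in> borel_measurable M" "u \<in> borel_measurable M" "v \<in> borel_measurable M"
  shows "(\<lambda>x. integrand (w x, u x, v x)) \<in> borel_measurable M"
  unfolding integrand_def dual_val_def
proof (intro borel_measurable_SUP)
  fix i
  obtain \<xi> b c d where "dual_seq i = (\<xi>, b, c, d)" by (cases "dual_seq i") auto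
  then show "(\<lambda>x. ennreal ((\<lambda>(\<xi>, b, c, d) (w, u, v). 2 * \<xi> * w + b + c * u + d * v) (dual_seq i) (w x, u x, v x))) \<in> borel_measurable M"
    using assms by simp
qed auto

text \<open>At \<open>w = 0\<close> an element of the dual family has value at most
  \<open>D\<close>, since the omitted term \<open>\<psi>s \<xi> * \<alpha>\<close> is nonnegative.
  The equality presents \<open>D\<close> as a countable supremum of affine functions, which yields
  its measurability.\<close>

lemma D_eq_integrand:
  assumes uv: "u \<ge> 0" "v \<ge> 0"
  shows "D (u, v) = integrand (0, u, v)"
proof (rule antisym)
  show "D (u, v) \<le> integrand (0, u, v)" by (rule integrand_ge_D[OF uv])
  show "integrand (0, u, v) \<le> D (u, v)"
    unfolding integrand_def
  proof (rule SUP_least)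
    fix n
    obtain \<xi> b c d where e: "dual_seq n = (\<xi>, b, c, d)" by (cases "dual_seq n") auto
    have "ennreal (b + c * u + d * v) \<le> ennreal (b + c * u + d * v + \<psi>s \<xi> * \<alpha> (u, v))"
      using psis_nonneg[of \<xi>] alpha_nonneg[OF uv] by (intro ennreal_leI) simp
    also have "\<dots> \<le> D (u, v)" using dual_seq_in[of n] uv by (auto simp: e dual_family_def)
    finally show "ennreal (dual_val (dual_seq n) (0, u, v)) \<le> D (u, v)" by (simp add: e dual_val_def)
  qed
qed

lemma D_measurable:
  assumes "f1 \<in> borel_measurable M" "f2 \<in> borel_measurable M" "\<And>x. 0 \<le> f1 x" "\<And>x. 0 \<le> f2 x"
  shows "(\<lambda>x. D (f1 x, f2 x)) \<in> borel_measurable M"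
  using integrand_measurable[of "\<lambda>_. 0" M f1 f2] assms by (simp add: D_eq_integrand)

section \<open>Uniform integrability from the entropy\<close>

lemma entropy_finite:
  assumes \<rho>: "\<rho> \<in> finite_borel_measures" and E: "Ent \<rho> < \<infinity>"
  shows "absolutely_continuous \<pi> \<rho>" "\<rho> = density \<pi> (\<lambda>x. ennreal (dens \<pi> \<rho> x))"
    "Ent \<rho> = (\<integral>\<^sup>+ x. ennreal (\<phi> (dens \<pi> \<rho> x)) \<partial>\<pi>)"
proof -
  show ac: "absolutely_continuous \<pi> \<rho>" using E by (auto simp: entropy_functional_def split: if_splits)
  have \<rho>': "sets \<rho> = sets borel" "finite_measure \<rho>" using \<rho> by (auto simp: finite_borel_measures_def)
  interpret p: finite_measure \<pi> by (rule pi(2))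
  interpret r: finite_measure \<rho> by (rule \<rho>'(2))
  show "\<rho> = density \<pi> (\<lambda>x. ennreal (dens \<pi> \<rho> x))"
    unfolding dens_def by (rule density_enn2real_RN_deriv[symmetric])
      (use ac \<rho>' pi in \<open>auto intro: p.sigma_finite_measure_axioms r.sigma_finite_measure_axioms\<close>)
  show "Ent \<rho> = (\<integral>\<^sup>+ x. ennreal (\<phi> (dens \<pi> \<rho> x)) \<partial>\<pi>)"
    using ac by (simp add: entropy_functional_def)
qed

lemma nn_integral_dens:
  assumes \<rho>: "\<rho> \<in> finite_borel_measures" "Ent \<rho> < \<infinity>" and h: "h \<in> borel_measurable borel"
  shows "(\<integral>\<^sup>+ x. h x \<partial>\<rho>) = (\<integral>\<^sup>+ x. ennreal (dens \<pi> \<rho> x) * h x \<partial>\<pi>)"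
  by (subst entropy_finite(2)[OF \<rho>]) (use h in \<open>simp add: nn_integral_density pi_measurable\<close>)

text \<open>Uniform integrability with test functions in place of sets, so that it applies directly
  to functions obtained by integrating out one variable of a kernel.\<close>

definition uniform_bound :: "real \<Rightarrow> real \<Rightarrow> 'v measure \<Rightarrow> bool" where
  "uniform_bound m \<epsilon> \<rho> \<longleftrightarrow> (\<forall>h\<in>borel_measurable borel. (\<forall>x. h x \<le> 1) \<longrightarrow>
     (\<integral>\<^sup>+ x. h x \<partial>\<rho>) \<le> ennreal m * (\<integral>\<^sup>+ x. h x \<partial>\<pi>) + ennreal \<epsilon>)"

text \<open>Sublevels of the entropy are uniformly integrable because \<open>\<phi>\<close> grows superlinearly.\<close>
lemma entropy_uniform_bound:
  assumes \<epsilon>: "\<epsilon> > 0" and C: "C \<ge> 0"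
  shows "\<exists>m\<ge>0. \<forall>\<rho>\<in>finite_borel_measures. Ent \<rho> \<le> ennreal C \<longrightarrow> uniform_bound m \<epsilon> \<rho>"
proof -
  \<comment> \<open>Chosen so that the factor in front of \<open>\<phi>\<close>, multiplied by the
    entropy bound, stays below \<open>\<epsilon>\<close>; the added 1 covers
    \<open>C = 0\<close>.\<close>
  define \<epsilon>' where "\<epsilon>' = \<epsilon> / (C + 1)"
  have e': "\<epsilon>' > 0" using \<epsilon> C by (simp add: \<epsilon>'_def)
  obtain m where m: "m \<ge> 0" "\<And>r. r \<ge> 0 \<Longrightarrow> r \<le> m + \<epsilon>' * \<phi> r" using entropy_density_superlinear[OF phi e'] by blast
  have "uniform_bound m \<epsilon> \<rho>" if \<rho>: "\<rho> \<in> finite_borel_measures" and E: "Ent \<rho> \<le> ennreal C" for \<rho>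
    unfolding uniform_bound_def
  proof (intro ballI impI)
    fix h :: "'v \<Rightarrow> ennreal" assume h: "h \<in> borel_measurable borel" "\<forall>x. h x \<le> 1"
    have Ef: "Ent \<rho> < \<infinity>" using E by (auto intro: le_less_trans)
    let ?u = "dens \<pi> \<rho>"
    have pm: "(\<lambda>x. \<phi> (?u x)) \<in> borel_measurable \<pi>" by (intro phi_measurable) (auto simp: dens_nonneg pi_measurable)
    have "(\<integral>\<^sup>+ x. h x \<partial>\<rho>) = (\<integral>\<^sup>+ x. ennreal (?u x) * h x \<partial>\<pi>)" by (rule nn_integral_dens[OF \<rho> Ef h(1)])
    also have "\<dots> \<le> (\<integral>\<^sup>+ x. ennreal m * h x + ennreal \<epsilon>' * ennreal (\<phi> (?u x)) \<partial>\<pi>)"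
    proof (rule nn_integral_mono)
      fix x
      have "ennreal (?u x) \<le> ennreal (m + \<epsilon>' * \<phi> (?u x))" by (intro ennreal_leI m dens_nonneg)
      also have "\<dots> = ennreal m + ennreal \<epsilon>' * ennreal (\<phi> (?u x))"
        using m(1) e' phi_nonneg[OF dens_nonneg] by (simp add: ennreal_mult)
      finally have "ennreal (?u x) * h x \<le> (ennreal m + ennreal \<epsilon>' * ennreal (\<phi> (?u x))) * h x" by (rule mult_right_mono) simp
      also have "\<dots> \<le> ennreal m * h x + ennreal \<epsilon>' * ennreal (\<phi> (?u x)) * 1"
        unfolding distrib_right using h(2) by (intro add_left_mono mult_left_mono) auto
      finally show "ennreal (?u x) * h x \<le> ennreal m * h x + ennreal \<epsilon>' * ennreal (\<phi> (?u x))" by simp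
    qed
    also have "\<dots> = ennreal m * (\<integral>\<^sup>+ x. h x \<partial>\<pi>) + ennreal \<epsilon>' * (\<integral>\<^sup>+ x. ennreal (\<phi> (?u x)) \<partial>\<pi>)"
      using h(1) pm by (simp add: nn_integral_add nn_integral_cmult pi_measurable)
    also have "ennreal \<epsilon>' * (\<integral>\<^sup>+ x. ennreal (\<phi> (?u x)) \<partial>\<pi>) \<le> ennreal \<epsilon>' * ennreal C"
      using E by (simp add: entropy_finite(3)[OF \<rho> Ef] mult_left_mono)
    also have "\<dots> \<le> ennreal \<epsilon>"
      using C e' \<epsilon> by (simp add: \<epsilon>'_def ennreal_mult[symmetric] field_simps)
    finally show "(\<integral>\<^sup>+ x. h x \<partial>\<rho>) \<le> ennreal m * (\<integral>\<^sup>+ x. h x \<partial>\<pi>) + ennreal \<epsilon>" by (simp add: add_left_mono)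
  qed
  then show ?thesis using m(1) by blast
qed

lemma nn_integral_lam_dens_fst:
  assumes \<rho>: "\<rho> \<in> finite_borel_measures" "Ent \<rho> < \<infinity>" and h: "h \<in> borel_measurable borel"
  shows "(\<integral>\<^sup>+ z. ennreal (dens \<pi> \<rho> (fst z)) * h z \<partial>lam) = (\<integral>\<^sup>+ x. (\<integral>\<^sup>+ y. h (x, y) \<partial>K x) \<partial>\<rho>)"
proof -
  have m: "(\<lambda>y. h (x, y)) \<in> borel_measurable (K x)" for x
    using measurable_Pair_section[OF h] by (simp add: measurable_cong_sets[OF finite_kernelD(1)[OF K_kernel] refl])
  have "(\<integral>\<^sup>+ z. ennreal (dens \<pi> \<rho> (fst z)) * h z \<partial>lam) = (\<integral>\<^sup>+ x. (\<integral>\<^sup>+ y. ennreal (dens \<pi> \<rho> x) * h (x, y) \<partial>K x) \<partial>\<pi>)"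
    unfolding lam_def using h
    by (subst nn_integral_semidirect[OF K_kernel pi(1)])
      (auto intro!: borel_measurable_times_ennreal measurable_compose[OF _ measurable_ennreal] measurable_compose[OF fst_snd_borel(1) dens_measurable])
  also have "\<dots> = (\<integral>\<^sup>+ x. ennreal (dens \<pi> \<rho> x) * (\<integral>\<^sup>+ y. h (x, y) \<partial>K x) \<partial>\<pi>)"
    by (intro nn_integral_cong nn_integral_cmult m)
  also have "\<dots> = (\<integral>\<^sup>+ x. (\<integral>\<^sup>+ y. h (x, y) \<partial>K x) \<partial>\<rho>)"
    by (rule nn_integral_dens[OF \<rho>, symmetric]) (rule kernel_nn_integral_measurable[OF K_kernel h])
  finally show ?thesis .
qed

text \<open>Integrating \<open>h\<close> over the second variable gives a function bounded by
  \<open>K0\<close>; divided by \<open>K0\<close> it is an admissible test for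
  \<open>\<rho>\<close>. The density in the second variable is reduced to this by the symmetry of
  \<open>lam\<close>.\<close>

lemma lam_dens_bound:
  assumes \<rho>: "\<rho> \<in> finite_borel_measures" "Ent \<rho> < \<infinity>"
    and ub: "uniform_bound m \<epsilon> \<rho>" and m: "m \<ge> 0" and \<epsilon>: "\<epsilon> \<ge> 0"
    and h: "h \<in> borel_measurable borel" "\<And>z. h z \<le> 1"
  shows "(\<integral>\<^sup>+ z. ennreal (dens \<pi> \<rho> (fst z)) * h z \<partial>lam) \<le> ennreal m * (\<integral>\<^sup>+ z. h z \<partial>lam) + ennreal (K0 * \<epsilon>)"
    and "(\<integral>\<^sup>+ z. ennreal (dens \<pi> \<rho> (snd z)) * h z \<partial>lam) \<le> ennreal m * (\<integral>\<^sup>+ z. h z \<partial>lam) + ennreal (K0 * \<epsilon>)"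
proof -
  have *: "(\<integral>\<^sup>+ z. ennreal (dens \<pi> \<rho> (fst z)) * h z \<partial>lam) \<le> ennreal m * (\<integral>\<^sup>+ z. h z \<partial>lam) + ennreal (K0 * \<epsilon>)"
    if h: "h \<in> borel_measurable borel" "\<And>z. h z \<le> 1" for h
  proof -
    let ?k = "\<lambda>x. \<integral>\<^sup>+ y. h (x, y) \<partial>K x"
    have km: "?k \<in> borel_measurable borel" by (rule kernel_nn_integral_measurable[OF K_kernel h(1)])
    have kb: "?k x \<le> ennreal K0" for x
    proof -
      have "?k x \<le> (\<integral>\<^sup>+ y. 1 \<partial>K x)" by (intro nn_integral_mono h(2))
      also have "\<dots> = emeasure (K x) UNIV" by (simp add: finite_kernelD[OF K_kernel])
      finally show ?thesis using K_bounded[of x] by (rule order_trans)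
    qed
    have K0: "ennreal K0 * (?k x / ennreal K0) = ?k x" for x
      using K0_ge_1 ennreal_mult_divide_eq[of "ennreal K0" "?k x"] by (simp add: ennreal_times_divide mult.commute)
    have "(\<integral>\<^sup>+ z. ennreal (dens \<pi> \<rho> (fst z)) * h z \<partial>lam) = (\<integral>\<^sup>+ x. ?k x \<partial>\<rho>)"
      by (rule nn_integral_lam_dens_fst[OF \<rho> h(1)])
    also have "\<dots> = ennreal K0 * (\<integral>\<^sup>+ x. ?k x / ennreal K0 \<partial>\<rho>)"
      using km \<rho>(1) by (subst nn_integral_cmult[symmetric]) (auto simp: K0 finite_borel_measures_def cong: measurable_cong_sets)
    also have "\<dots> \<le> ennreal K0 * (ennreal m * (\<integral>\<^sup>+ x. ?k x / ennreal K0 \<partial>\<pi>) + ennreal \<epsilon>)"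
    proof (rule mult_left_mono)
      have "?k x / ennreal K0 \<le> 1" for x
        using kb[of x] K0_ge_1 by (simp add: divide_le_posI_ennreal)
      then show "(\<integral>\<^sup>+ x. ?k x / ennreal K0 \<partial>\<rho>) \<le> ennreal m * (\<integral>\<^sup>+ x. ?k x / ennreal K0 \<partial>\<pi>) + ennreal \<epsilon>"
        using ub km unfolding uniform_bound_def by auto
    qed simp
    also have "\<dots> = ennreal m * (\<integral>\<^sup>+ x. ennreal K0 * (?k x / ennreal K0) \<partial>\<pi>) + ennreal (K0 * \<epsilon>)"
      using km K0_ge_1 \<epsilon> by (subst nn_integral_cmult) (auto simp: pi_measurable distrib_left mult.left_commute ennreal_mult)
    also have "\<dots> = ennreal m * (\<integral>\<^sup>+ z. h z \<partial>lam) + ennreal (K0 * \<epsilon>)"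
      unfolding K0 lam_def nn_integral_semidirect[OF K_kernel pi(1) h(1)] ..
    finally show ?thesis .
  qed
  show "(\<integral>\<^sup>+ z. ennreal (dens \<pi> \<rho> (fst z)) * h z \<partial>lam) \<le> ennreal m * (\<integral>\<^sup>+ z. h z \<partial>lam) + ennreal (K0 * \<epsilon>)"
    by (rule *[OF h])
  have hs: "(\<lambda>z. h (prod.swap z)) \<in> borel_measurable borel" by (rule measurable_compose[OF swap_measurable h(1)])
  have "(\<integral>\<^sup>+ z. ennreal (dens \<pi> \<rho> (snd z)) * h z \<partial>lam) = (\<integral>\<^sup>+ z. ennreal (dens \<pi> \<rho> (snd (prod.swap z))) * h (prod.swap z) \<partial>lam)"
    using h(1) by (subst nn_integral_lam_swap[symmetric]) (auto intro!: borel_measurable_times_ennreal measurable_compose[OF _ measurable_ennreal] measurable_compose[OF fst_snd_borel(2) dens_measurable])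
  also have "\<dots> \<le> ennreal m * (\<integral>\<^sup>+ z. h (prod.swap z) \<partial>lam) + ennreal (K0 * \<epsilon>)"
    using *[OF hs h(2)] by simp
  also have "(\<integral>\<^sup>+ z. h (prod.swap z) \<partial>lam) = (\<integral>\<^sup>+ z. h z \<partial>lam)" by (rule nn_integral_lam_swap[OF h(1)])
  finally show "(\<integral>\<^sup>+ z. ennreal (dens \<pi> \<rho> (snd z)) * h z \<partial>lam) \<le> ennreal m * (\<integral>\<^sup>+ z. h z \<partial>lam) + ennreal (K0 * \<epsilon>)" .
qed

section \<open>Dissipation through densities: Young's inequality and duality\<close>

definition "activity a \<rho> z = a z * \<alpha> (dens \<pi> \<rho> (fst z), dens \<pi> \<rho> (snd z))"

lemma activity_nonneg: "(\<And>z. 0 \<le> a z) \<Longrightarrow> 0 \<le> activity a \<rho> z"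
  by (simp add: activity_def alpha_nonneg dens_nonneg)

lemma activity_measurable: "a \<in> borel_measurable borel \<Longrightarrow> activity a \<rho> \<in> borel_measurable borel"
  unfolding activity_def by (intro borel_measurable_times alpha_measurable) (auto simp: dens_nonneg)

lemma edge_activity_eq:
  assumes \<kappa>': "edge_measure \<pi> \<kappa>' = density \<theta> (\<lambda>z. ennreal (a z))" and a: "a \<in> borel_measurable borel" "\<And>z. 0 \<le> a z"
  shows "edge_activity \<pi> \<kappa>' \<alpha> \<rho> = density \<theta> (\<lambda>z. ennreal (activity a \<rho> z))"
proof -
  have "(\<lambda>z. \<alpha> (dens \<pi> \<rho> (fst z), dens \<pi> \<rho> (snd z))) \<in> borel_measurable borel"
    by (intro alpha_measurable) (auto simp: dens_nonneg)
  then show ?thesis unfolding edge_activity_def \<kappa>' case_prod_beta activity_def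
    using a by (subst density_density_eq) (auto simp: ennreal_mult'[symmetric] alpha_nonneg dens_nonneg)
qed

text \<open>Finite dissipation forces both parts of the flux to be absolutely continuous, which
  makes the potential an explicit integral against \<open>\<theta>\<close> that can be estimated
  pointwise. Mutual singularity of the parts becomes the vanishing of the product of their densities
  where the activity is positive.\<close>

lemma dissipation_finite_densities:
  assumes \<kappa>': "edge_measure \<pi> \<kappa>' = density \<theta> (\<lambda>z. ennreal (a z))" and a: "a \<in> borel_measurable borel" "\<And>z. 0 \<le> a z"
    and j: "j \<in> sigma_fluxes borel"
    and R: "Diss \<kappa>' \<rho> j < \<infinity>"
  obtains p q where "p \<in> borel_measurable borel" "q \<in> borel_measurable borel" "\<And>z. 0 \<le> p z" "\<And>z. 0 \<le> q z"
    "fst j = density \<theta> (\<lambda>z. ennreal (activity a \<rho> z * p z))" "snd j = density \<theta> (\<lambda>z. ennreal (activity a \<rho> z * q z))"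
    "2 * Diss \<kappa>' \<rho> j = (\<integral>\<^sup>+ z. ennreal (\<psi> (2 * (p z - q z)) * activity a \<rho> z) \<partial>\<theta>)"
    "AE z in \<theta>. activity a \<rho> z * p z * q z = 0"
proof -
  let ?A = "activity a \<rho>"
  note A0 = activity_nonneg[of a \<rho>, OF a(2)] and Am [measurable] = activity_measurable[OF a(1), of \<rho>]
  define \<nu> where "\<nu> = edge_activity \<pi> \<kappa>' \<alpha> \<rho>"
  have \<nu>: "\<nu> = density \<theta> (\<lambda>z. ennreal (?A z))" unfolding \<nu>_def by (rule edge_activity_eq[OF \<kappa>' a])
  have sets\<nu>: "sets \<nu> = sets borel" by (simp add: \<nu>)
  note \<nu>m = measurable_cong_sets[OF sets\<nu> refl]
  interpret th: sigma_finite_measure \<theta> by (rule sigma_finite_theta)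
  have \<nu>s: "sigma_finite_measure \<nu>" unfolding \<nu> by (subst th.sigma_finite_iff_density_finite) auto
  have js: "sets (fst j) = sets \<nu>" "sets (snd j) = sets \<nu>" "sigma_finite_measure (fst j)" "sigma_finite_measure (snd j)"
    "mutually_singular (fst j) (snd j)"
    using j by (auto simp: sigma_fluxes_def sets\<nu>)
  have ac: "absolutely_continuous \<nu> (total_variation j)"
    and Req: "Diss \<kappa>' \<rho> j = (\<integral>\<^sup>+ z. ennreal (\<psi> (flux_RN_deriv \<nu> (double_flux j) z)) \<partial>\<nu>) / 2"
    using R by (auto simp: dissipation_potential_def Let_def \<nu>_def split: if_splits)
  have ac': "absolutely_continuous \<nu> (fst j)" "absolutely_continuous \<nu> (snd j)"
    using ac by (auto simp: absolutely_continuous_total_variation[OF js(1,2)])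
  define p where "p z = enn2real (RN_deriv \<nu> (fst j) z)" for z
  define q where "q z = enn2real (RN_deriv \<nu> (snd j) z)" for z
  have pm [measurable]: "p \<in> borel_measurable borel" "q \<in> borel_measurable borel"
    using borel_measurable_RN_deriv[of \<nu>] unfolding p_def q_def \<nu>m by auto
  have p: "fst j = density \<nu> (\<lambda>z. ennreal (p z))" and q: "snd j = density \<nu> (\<lambda>z. ennreal (q z))"
    unfolding p_def q_def using density_enn2real_RN_deriv[OF \<nu>s js(3,1) ac'(1)] density_enn2real_RN_deriv[OF \<nu>s js(4,2) ac'(2)] by auto
  have pq0: "0 \<le> p z" "0 \<le> q z" for z by (auto simp: p_def q_def)
  have p': "fst j = density \<theta> (\<lambda>z. ennreal (?A z * p z))" and q': "snd j = density \<theta> (\<lambda>z. ennreal (?A z * q z))"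
    using p q unfolding \<nu> by (auto simp: density_density_eq ennreal_mult A0 pq0)
  have "AE z in \<nu>. flux_RN_deriv \<nu> (double_flux j) z = 2 * (p z - q z)"
    by (rule flux_RN_deriv_density[OF \<nu>s _ pq0(1) _ pq0(2) p q]) (auto simp: \<nu>m)
  then have "2 * Diss \<kappa>' \<rho> j = (\<integral>\<^sup>+ z. ennreal (\<psi> (2 * (p z - q z))) \<partial>\<nu>)"
    unfolding Req by (subst nn_integral_cong_AE) (auto simp: ennreal_double_half)
  also have "\<dots> = (\<integral>\<^sup>+ z. ennreal (\<psi> (2 * (p z - q z)) * ?A z) \<partial>\<theta>)"
    unfolding \<nu> by (subst nn_integral_density) (auto simp: ennreal_mult psi_nonneg A0 mult.commute)
  finally have R': "2 * Diss \<kappa>' \<rho> j = (\<integral>\<^sup>+ z. ennreal (\<psi> (2 * (p z - q z)) * ?A z) \<partial>\<theta>)" .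
  obtain N where N: "N \<in> sets borel" "emeasure (fst j) (UNIV - N) = 0" "emeasure (snd j) N = 0"
    using js(5) space_eq_UNIV[of "fst j"] js(1) by (auto simp: mutually_singular_def sets\<nu>)
  have "emeasure (density \<theta> (\<lambda>z. ennreal (?A z * p z))) (UNIV - N) = 0" using N(2) p' by simp
  then have "AE z in \<theta>. ennreal (?A z * p z) * indicator (UNIV - N) z = 0"
    using N(1) by (subst (asm) emeasure_density) (auto simp: nn_integral_0_iff_AE)
  moreover have "emeasure (density \<theta> (\<lambda>z. ennreal (?A z * q z))) N = 0" using N(3) q' by simp
  then have "AE z in \<theta>. ennreal (?A z * q z) * indicator N z = 0"
    using N(1) by (subst (asm) emeasure_density) (auto simp: nn_integral_0_iff_AE)
  ultimately have "AE z in \<theta>. ?A z * p z * q z = 0"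
  proof eventually_elim
    case (elim z)
    then have "?A z * p z \<le> 0 \<or> ?A z * q z \<le> 0"
      by (cases "z \<in> N") (auto simp: indicator_def ennreal_eq_0_iff)
    then show ?case using A0[of z] pq0[of z] by (metis mult_eq_0_iff mult_nonneg_nonneg order_antisym)
  qed
  from that[OF pm pq0 p' q' R' this] show thesis .
qed

text \<open>At points with positive activity \<open>p\<close> or \<open>q\<close> is zero, so
  \<open>2 (p + q)\<close> is the absolute value of \<open>2 (p - q)\<close>. Evenness of
  \<open>\<psi>s\<close> permits the slope \<open>- \<xi>\<close> as well, and the bound concerns
  the total variation of the flux, not only its signed value.\<close>

lemma dissipation_Young:
  assumes \<kappa>': "edge_measure \<pi> \<kappa>' = density \<theta> (\<lambda>z. ennreal (a z))" and a: "a \<in> borel_measurable borel" "\<And>z. 0 \<le> a z"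
    and j: "j \<in> sigma_fluxes borel" and \<xi>: "\<xi> \<in> borel_measurable borel" "\<And>z. 0 \<le> \<xi> z"
  shows "2 * ((\<integral>\<^sup>+ z. ennreal (\<xi> z) \<partial>fst j) + (\<integral>\<^sup>+ z. ennreal (\<xi> z) \<partial>snd j))
    \<le> 2 * Diss \<kappa>' \<rho> j + (\<integral>\<^sup>+ z. ennreal (\<psi>s (\<xi> z) * activity a \<rho> z) \<partial>\<theta>)"
proof (cases "Diss \<kappa>' \<rho> j < \<infinity>")
  case False
  then have "2 * Diss \<kappa>' \<rho> j = top" by (simp add: ennreal_mult_eq_top_iff less_top[symmetric])
  then show ?thesis by (simp add: distrib_left)
next
  case True
  let ?A = "activity a \<rho>"
  note A0 = activity_nonneg[of a \<rho>, OF a(2)] and Am [measurable] = activity_measurable[OF a(1), of \<rho>]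
  obtain p q where pm [measurable]: "p \<in> borel_measurable borel" "q \<in> borel_measurable borel" and pq0: "\<And>z. 0 \<le> p z" "\<And>z. 0 \<le> q z"
    and d: "fst j = density \<theta> (\<lambda>z. ennreal (?A z * p z))" "snd j = density \<theta> (\<lambda>z. ennreal (?A z * q z))"
    and R: "2 * Diss \<kappa>' \<rho> j = (\<integral>\<^sup>+ z. ennreal (\<psi> (2 * (p z - q z)) * ?A z) \<partial>\<theta>)"
    and z: "AE z in \<theta>. ?A z * p z * q z = 0"
    by (rule dissipation_finite_densities[OF \<kappa>' a j True]) (rule that; assumption)
  note [measurable] = \<xi>(1)
  have "2 * ((\<integral>\<^sup>+ z. ennreal (\<xi> z) \<partial>fst j) + (\<integral>\<^sup>+ z. ennreal (\<xi> z) \<partial>snd j))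
      = (\<integral>\<^sup>+ z. ennreal (2 * (?A z * (p z + q z) * \<xi> z)) \<partial>\<theta>)"
    unfolding d using A0 pq0 \<xi>(2)
    by (simp add: nn_integral_density nn_integral_add[symmetric] nn_integral_cmult[symmetric] ennreal_mult distrib_left distrib_right)
  also have "\<dots> \<le> (\<integral>\<^sup>+ z. ennreal (\<psi> (2 * (p z - q z)) * ?A z) + ennreal (\<psi>s (\<xi> z) * ?A z) \<partial>\<theta>)"
  proof (rule nn_integral_mono_AE)
    from z show "AE z in \<theta>. ennreal (2 * (?A z * (p z + q z) * \<xi> z))
        \<le> ennreal (\<psi> (2 * (p z - q z)) * ?A z) + ennreal (\<psi>s (\<xi> z) * ?A z)"
    proof eventually_elim
      case (elim z)
      show ?case
      proof (cases "?A z = 0")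
        case False
        then have "p z = 0 \<or> q z = 0" using elim by auto
        then have "2 * (p z + q z) * \<xi> z \<le> \<psi> (2 * (p z - q z)) + \<psi>s (\<xi> z)"
          using Young[of "2 * (p z - q z)" "\<xi> z"] Young[of "2 * (p z - q z)" "- \<xi> z"] by (auto simp: psis_minus)
        then have "2 * (p z + q z) * \<xi> z * ?A z \<le> (\<psi> (2 * (p z - q z)) + \<psi>s (\<xi> z)) * ?A z"
          using A0 by (rule mult_right_mono)
        then have "ennreal (2 * (?A z * (p z + q z) * \<xi> z)) \<le> ennreal (\<psi> (2 * (p z - q z)) * ?A z + \<psi>s (\<xi> z) * ?A z)"
          by (intro ennreal_leI) (simp add: algebra_simps)
        then show ?thesis using A0[of z] psi_nonneg psis_nonneg by simp
      qed simp
    qed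
  qed
  also have "\<dots> = (\<integral>\<^sup>+ z. ennreal (\<psi> (2 * (p z - q z)) * ?A z) \<partial>\<theta>) + (\<integral>\<^sup>+ z. ennreal (\<psi>s (\<xi> z) * ?A z) \<partial>\<theta>)"
    by (intro nn_integral_add) auto
  finally show ?thesis unfolding R .
qed

text \<open>Young's inequality for the slope \<open>\<xi>\<close> loses the term
  \<open>\<psi>s \<xi> * \<alpha>\<close>; membership in the dual family says that \<open>D\<close>
  pays for it together with the affine part. The left side is linear in the flux and in the density,
  so it can pass to setwise limits.\<close>

lemma dissipation_lower_bound:
  assumes \<kappa>': "edge_measure \<pi> \<kappa>' = density \<theta> (\<lambda>z. ennreal (a z))" and a: "a \<in> borel_measurable borel" "\<And>z. 0 \<le> a z"
    and j: "j \<in> sigma_fluxes borel"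
    and fam: "\<And>z. (\<xi> z, b z, c z, d z) \<in> dual_family"
    and m: "\<xi> \<in> borel_measurable borel" "b \<in> borel_measurable borel" "c \<in> borel_measurable borel" "d \<in> borel_measurable borel"
    and int: "integrable (fst j) \<xi>" "integrable (snd j) \<xi>"
      "integrable \<theta> (\<lambda>z. a z * (b z + c z * dens \<pi> \<rho> (fst z) + d z * dens \<pi> \<rho> (snd z)))"
  shows "ennreal (2 * (\<integral>z. \<xi> z \<partial>fst j) - 2 * (\<integral>z. \<xi> z \<partial>snd j)
      + (\<integral>z. a z * (b z + c z * dens \<pi> \<rho> (fst z) + d z * dens \<pi> \<rho> (snd z)) \<partial>\<theta>))
    \<le> 2 * (Diss \<kappa>' \<rho> j + Fisher \<kappa>' \<rho>)"
proof (cases "Diss \<kappa>' \<rho> j < \<infinity>")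
  case False
  then have "2 * Diss \<kappa>' \<rho> j = top" by (simp add: ennreal_mult_eq_top_iff less_top[symmetric])
  then show ?thesis by (simp add: distrib_left)
next
  case True
  let ?A = "activity a \<rho>" and ?u = "\<lambda>z. dens \<pi> \<rho> (fst z)" and ?v = "\<lambda>z. dens \<pi> \<rho> (snd z)"
  note A0 = activity_nonneg[of a \<rho>, OF a(2)] and Am [measurable] = activity_measurable[OF a(1), of \<rho>]
  note [measurable] = m a(1)
  have ac: "absolutely_continuous \<pi> \<rho>" using True by (auto simp: dissipation_potential_def Let_def split: if_splits)
  obtain p q where pm [measurable]: "p \<in> borel_measurable borel" "q \<in> borel_measurable borel" and pq0: "\<And>z. 0 \<le> p z" "\<And>z. 0 \<le> q z"
    and dj: "fst j = density \<theta> (\<lambda>z. ennreal (?A z * p z))" "snd j = density \<theta> (\<lambda>z. ennreal (?A z * q z))"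
    and R: "2 * Diss \<kappa>' \<rho> j = (\<integral>\<^sup>+ z. ennreal (\<psi> (2 * (p z - q z)) * ?A z) \<partial>\<theta>)"
    by (rule dissipation_finite_densities[OF \<kappa>' a j True]) (rule that; assumption)
  have Dm: "(\<lambda>z. D (?u z, ?v z)) \<in> borel_measurable \<theta>"
    unfolding measurable_theta by (intro D_measurable) (auto simp: dens_nonneg)
  have F: "2 * Fisher \<kappa>' \<rho> = (\<integral>\<^sup>+ z. ennreal (a z) * D (?u z, ?v z) \<partial>\<theta>)"
  proof -
    have "2 * Fisher \<kappa>' \<rho> = (\<integral>\<^sup>+ z. D (?u z, ?v z) \<partial>density \<theta> (\<lambda>z. ennreal (a z)))"
      using ac by (simp add: Fisher_information_def \<kappa>' case_prod_unfold ennreal_double_half)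
    also have "\<dots> = (\<integral>\<^sup>+ z. ennreal (a z) * D (?u z, ?v z) \<partial>\<theta>)"
      using Dm by (intro nn_integral_density) auto
    finally show ?thesis .
  qed
  have ip: "integrable \<theta> (\<lambda>z. ?A z * p z * \<xi> z)" and iq: "integrable \<theta> (\<lambda>z. ?A z * q z * \<xi> z)"
    using int(1,2) A0 pq0 unfolding dj by (auto simp: integrable_density)
  have ep: "(\<integral>z. \<xi> z \<partial>fst j) = (\<integral>z. ?A z * p z * \<xi> z \<partial>\<theta>)" and eq: "(\<integral>z. \<xi> z \<partial>snd j) = (\<integral>z. ?A z * q z * \<xi> z \<partial>\<theta>)"
    using A0 pq0 unfolding dj by (auto simp: integral_density)
  let ?g = "\<lambda>z. a z * (b z + c z * ?u z + d z * ?v z)"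
  have "2 * (\<integral>z. \<xi> z \<partial>fst j) - 2 * (\<integral>z. \<xi> z \<partial>snd j) + (\<integral>z. ?g z \<partial>\<theta>)
      = (\<integral>z. 2 * (?A z * p z * \<xi> z) - 2 * (?A z * q z * \<xi> z) + ?g z \<partial>\<theta>)"
    unfolding ep eq using ip iq int(3) by simp
  note tot = this
  have "ennreal (2 * (\<integral>z. \<xi> z \<partial>fst j) - 2 * (\<integral>z. \<xi> z \<partial>snd j) + (\<integral>z. ?g z \<partial>\<theta>))
      \<le> (\<integral>\<^sup>+ z. ennreal (2 * (?A z * p z * \<xi> z) - 2 * (?A z * q z * \<xi> z) + ?g z) \<partial>\<theta>)"
    unfolding tot by (rule ennreal_integral_le_nn_integral) (use ip iq int(3) in auto)
  also have "\<dots> \<le> (\<integral>\<^sup>+ z. ennreal (\<psi> (2 * (p z - q z)) * ?A z) + ennreal (a z) * D (?u z, ?v z) \<partial>\<theta>)"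
  proof (rule nn_integral_mono)
    fix z
    let ?al = "\<alpha> (?u z, ?v z)"
    have "(2 * (p z - q z)) * \<xi> z * ?A z \<le> (\<psi> (2 * (p z - q z)) + \<psi>s (\<xi> z)) * ?A z"
      by (intro mult_right_mono Young A0)
    then have "2 * (?A z * p z * \<xi> z) - 2 * (?A z * q z * \<xi> z) + ?g z
        \<le> \<psi> (2 * (p z - q z)) * ?A z + a z * (b z + c z * ?u z + d z * ?v z + \<psi>s (\<xi> z) * ?al)"
      by (simp add: algebra_simps activity_def)
    then have "ennreal (2 * (?A z * p z * \<xi> z) - 2 * (?A z * q z * \<xi> z) + ?g z)
        \<le> ennreal (\<psi> (2 * (p z - q z)) * ?A z + a z * (b z + c z * ?u z + d z * ?v z + \<psi>s (\<xi> z) * ?al))" by (rule ennreal_leI)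
    also have "\<dots> \<le> ennreal (\<psi> (2 * (p z - q z)) * ?A z) + ennreal (a z * (b z + c z * ?u z + d z * ?v z + \<psi>s (\<xi> z) * ?al))"
      by (rule ennreal_add_le)
    also have "ennreal (a z * (b z + c z * ?u z + d z * ?v z + \<psi>s (\<xi> z) * ?al))
        = ennreal (a z) * ennreal (b z + c z * ?u z + d z * ?v z + \<psi>s (\<xi> z) * ?al)"
      using a(2) by (rule ennreal_mult')
    also have "\<dots> \<le> ennreal (a z) * D (?u z, ?v z)"
      using fam[of z] dens_nonneg by (intro mult_left_mono) (auto simp: dual_family_def)
    finally show "ennreal (2 * (?A z * p z * \<xi> z) - 2 * (?A z * q z * \<xi> z) + ?g z)
        \<le> ennreal (\<psi> (2 * (p z - q z)) * ?A z) + ennreal (a z) * D (?u z, ?v z)" by (simp add: add_left_mono)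
  qed
  also have "\<dots> = 2 * Diss \<kappa>' \<rho> j + 2 * Fisher \<kappa>' \<rho>"
    unfolding R F using Dm by (intro nn_integral_add) auto
  finally show ?thesis by (simp add: distrib_left)
qed

text \<open>If the right side is finite, the integrand is finite almost everywhere, so the flux
  density vanishes where the activity does. This gives the absolute continuity demanded by the
  dissipation potential, and the pointwise lower bounds on \<open>integrand\<close> finish the
  estimate.\<close>

lemma limit_dissipation_le:
  assumes ac: "absolutely_continuous \<pi> \<rho>" and w: "w \<in> borel_measurable borel"
  shows "Diss \<kappa> \<rho> (density \<theta> (\<lambda>z. ennreal (w z)), density \<theta> (\<lambda>z. ennreal (- w z)))
      + Fisher \<kappa> \<rho>
    \<le> (\<integral>\<^sup>+ z. integrand (w z, dens \<pi> \<rho> (fst z), dens \<pi> \<rho> (snd z)) \<partial>\<theta>) / 2"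
proof (cases "(\<integral>\<^sup>+ z. integrand (w z, dens \<pi> \<rho> (fst z), dens \<pi> \<rho> (snd z)) \<partial>\<theta>) = \<infinity>")
  case True then show ?thesis by (simp add: ennreal_top_divide)
next
  case False
  let ?u = "\<lambda>z. dens \<pi> \<rho> (fst z)" and ?v = "\<lambda>z. dens \<pi> \<rho> (snd z)"
  let ?j = "(density \<theta> (\<lambda>z. ennreal (w z)), density \<theta> (\<lambda>z. ennreal (- w z)))"
  note [measurable] = w
  define A where "A z = \<alpha> (?u z, ?v z)" for z
  have Am [measurable]: "A \<in> borel_measurable borel"
    unfolding A_def by (intro alpha_measurable) (auto simp: dens_nonneg)
  have A0: "0 \<le> A z" for z by (simp add: A_def alpha_nonneg dens_nonneg)
  define \<nu> where "\<nu> = density \<theta> (\<lambda>z. ennreal (A z))"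
  have \<nu>: "edge_activity \<pi> \<kappa> \<alpha> \<rho> = \<nu>" by (simp add: edge_activity_def \<nu>_def A_def case_prod_unfold)
  interpret th: sigma_finite_measure \<theta> by (rule sigma_finite_theta)
  have \<nu>s: "sigma_finite_measure \<nu>" unfolding \<nu>_def by (subst th.sigma_finite_iff_density_finite) auto
  have \<nu>m: "measurable \<nu> N = measurable borel N" for N by (rule measurable_cong_sets) (simp_all add: \<nu>_def)
  have im: "(\<lambda>z. integrand (w z, ?u z, ?v z)) \<in> borel_measurable \<theta>"
    unfolding measurable_theta by (intro integrand_measurable) auto
  have fin: "AE z in \<theta>. integrand (w z, ?u z, ?v z) \<noteq> \<infinity>"
    using False by (intro nn_integral_noteq_infinite[OF im]) auto
  then have w0: "AE z in \<theta>. A z = 0 \<longrightarrow> w z = 0"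
  proof eventually_elim
    case (elim z)
    then show ?case using integrand_ge_all(1)[OF dens_nonneg dens_nonneg, of "w z" \<rho> "fst z" \<rho> "snd z"]
      by (auto simp: A_def less_top)
  qed
  \<comment> \<open>Where \<open>A z = 0\<close> the convention for division by zero gives
    \<open>p z = 0\<close>, consistent with \<open>w0\<close>.\<close>
  define p where "p z = max 0 (w z) / A z" for z
  define q where "q z = max 0 (- w z) / A z" for z
  have pm [measurable]: "p \<in> borel_measurable borel" "q \<in> borel_measurable borel" unfolding p_def q_def by auto
  have pq0: "0 \<le> p z" "0 \<le> q z" for z using A0[of z] by (auto simp: p_def q_def)
  have p: "fst ?j = density \<nu> (\<lambda>z. ennreal (p z))"
    unfolding \<nu>_def fst_conv
  proof (subst density_density_eq)
    show "density \<theta> (\<lambda>z. ennreal (w z)) = density \<theta> (\<lambda>z. ennreal (A z) * ennreal (p z))"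
    proof (rule density_cong)
      from w0 show "AE z in \<theta>. ennreal (w z) = ennreal (A z) * ennreal (p z)"
        by eventually_elim (auto simp: p_def max_def ennreal_neg A0 ennreal_mult[symmetric] divide_nonneg_nonneg)
    qed auto
  qed auto
  have q: "snd ?j = density \<nu> (\<lambda>z. ennreal (q z))"
    unfolding \<nu>_def snd_conv
  proof (subst density_density_eq)
    show "density \<theta> (\<lambda>z. ennreal (- w z)) = density \<theta> (\<lambda>z. ennreal (A z) * ennreal (q z))"
    proof (rule density_cong)
      from w0 show "AE z in \<theta>. ennreal (- w z) = ennreal (A z) * ennreal (q z)"
        by eventually_elim (auto simp: q_def max_def ennreal_neg A0 ennreal_mult[symmetric] divide_nonneg_nonneg)
    qed auto
  qed auto
  have "absolutely_continuous \<nu> (fst ?j)" "absolutely_continuous \<nu> (snd ?j)"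
    unfolding p q by (auto intro!: absolutely_continuousI_density simp: \<nu>m)
  then have acj: "absolutely_continuous \<nu> (total_variation ?j)"
    by (subst absolutely_continuous_total_variation) (auto simp: \<nu>_def)
  have "AE z in \<nu>. flux_RN_deriv \<nu> (double_flux ?j) z = 2 * (p z - q z)"
    by (rule flux_RN_deriv_density[OF \<nu>s _ pq0(1) _ pq0(2) p q]) (auto simp: \<nu>m)
  then have "Diss \<kappa> \<rho> ?j = (\<integral>\<^sup>+ z. ennreal (\<psi> (2 * (p z - q z))) \<partial>\<nu>) / 2"
    using ac acj unfolding dissipation_potential_def Let_def \<nu> by (auto intro!: arg_cong2[where f = "(/)"] nn_integral_cong_AE)
  also have "(\<integral>\<^sup>+ z. ennreal (\<psi> (2 * (p z - q z))) \<partial>\<nu>) = (\<integral>\<^sup>+ z. ennreal (\<psi> (2 * w z / A z)) * ennreal (A z) \<partial>\<theta>)"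
  proof -
    have "2 * (p z - q z) = 2 * w z / A z" for z by (auto simp: p_def q_def max_def)
    then show ?thesis unfolding \<nu>_def by (subst nn_integral_density) (auto simp: mult.commute)
  qed
  finally have eq: "Diss \<kappa> \<rho> ?j + Fisher \<kappa> \<rho>
      = ((\<integral>\<^sup>+ z. ennreal (\<psi> (2 * w z / A z)) * ennreal (A z) \<partial>\<theta>) + (\<integral>\<^sup>+ z. D (?u z, ?v z) \<partial>\<theta>)) / 2"
    using ac by (simp add: Fisher_information_def case_prod_unfold add_divide_distrib_ennreal)
  have "(\<integral>\<^sup>+ z. ennreal (\<psi> (2 * w z / A z)) * ennreal (A z) \<partial>\<theta>) + (\<integral>\<^sup>+ z. D (?u z, ?v z) \<partial>\<theta>)
      = (\<integral>\<^sup>+ z. ennreal (\<psi> (2 * w z / A z)) * ennreal (A z) + D (?u z, ?v z) \<partial>\<theta>)"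
  proof (rule nn_integral_add[symmetric])
    show "(\<lambda>z. D (?u z, ?v z)) \<in> borel_measurable \<theta>"
      unfolding measurable_theta by (intro D_measurable) (auto simp: dens_nonneg)
  qed auto
  also have "\<dots> \<le> (\<integral>\<^sup>+ z. integrand (w z, ?u z, ?v z) \<partial>\<theta>)"
  proof (rule nn_integral_mono_AE)
    from fin show "AE z in \<theta>. ennreal (\<psi> (2 * w z / A z)) * ennreal (A z) + D (?u z, ?v z) \<le> integrand (w z, ?u z, ?v z)"
    proof eventually_elim
      case (elim z)
      then show ?case unfolding A_def
        using integrand_ge_all(2)[OF dens_nonneg dens_nonneg, of "w z" \<rho> "fst z" \<rho> "snd z"] by (auto simp: less_top)
    qed
  qed
  finally show ?thesis unfolding eq by (rule divide_right_mono_ennreal)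
qed

end

section \<open>Space-time fluxes\<close>

lemma nn_integral_AE_zero: "AE x in M. f x = 0 \<Longrightarrow> (\<integral>\<^sup>+ x. f x \<partial>M) = 0"
  using nn_integral_cong_AE[where M = M and u = f and v = "\<lambda>_. 0"] by simp

lemma family_nn_integral_measurable:
  fixes N :: "'a::topological_space \<Rightarrow> 'b::topological_space measure"
  assumes N: "\<And>t. sets (N t) = sets borel" "\<And>B. B \<in> sets borel \<Longrightarrow> (\<lambda>t. emeasure (N t) B) \<in> borel_measurable borel"
    and f: "f \<in> borel_measurable borel"
  shows "(\<lambda>t. \<integral>\<^sup>+ z. f z \<partial>N t) \<in> borel_measurable borel"
  using f
proof (induction rule: borel_measurable_induct)
  case (cong f g) then show ?case by simp
next
  case (set A) then show ?case using N by simp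
next
  case (mult f c) then show ?case by (simp add: nn_integral_cmult measurable_cong_sets[OF N(1) refl])
next
  case (add f g) then show ?case by (simp add: nn_integral_add measurable_cong_sets[OF N(1) refl])
next
  case (seq U)
  have "(\<integral>\<^sup>+ z. (SUP i. U i) z \<partial>N t) = (SUP i. \<integral>\<^sup>+ z. U i z \<partial>N t)" for t
    unfolding SUP_apply using seq by (intro nn_integral_monotone_convergence_SUP) (auto simp: measurable_cong_sets[OF N(1) refl])
  then show ?case using seq by simp
qed

lemma family_integral_measurable:
  fixes N :: "'a::topological_space \<Rightarrow> 'b::topological_space measure" and f :: "'b \<Rightarrow> real"
  assumes N: "\<And>t. sets (N t) = sets borel" "\<And>B. B \<in> sets borel \<Longrightarrow> (\<lambda>t. emeasure (N t) B) \<in> borel_measurable borel"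
    and f: "f \<in> borel_measurable borel"
  shows "(\<lambda>t. \<integral>z. f z \<partial>N t) \<in> borel_measurable borel"
proof -
  define p where "p t = (\<integral>\<^sup>+ z. ennreal (f z) \<partial>N t)" for t
  define n where "n t = (\<integral>\<^sup>+ z. ennreal (- f z) \<partial>N t)" for t
  have m: "p \<in> borel_measurable borel" "n \<in> borel_measurable borel"
    unfolding p_def n_def using f by (auto intro!: family_nn_integral_measurable[OF N])
  have fN: "f \<in> borel_measurable (N t)" for t using f by (simp add: measurable_cong_sets[OF N(1) refl])
  have "(\<lambda>t. \<integral>z. f z \<partial>N t) = (\<lambda>t. if p t < \<infinity> \<and> n t < \<infinity> then enn2real (p t) - enn2real (n t) else 0)"
  proof
    fix t
    show "(\<integral>z. f z \<partial>N t) = (if p t < \<infinity> \<and> n t < \<infinity> then enn2real (p t) - enn2real (n t) else 0)"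
    proof (cases "p t < \<infinity> \<and> n t < \<infinity>")
      case True
      then have "integrable (N t) f" using fN by (auto simp: real_integrable_def p_def n_def)
      then show ?thesis using True unfolding p_def n_def by (simp add: real_lebesgue_integral_def)
    next
      case False
      then have "\<not> integrable (N t) f" by (auto simp: real_integrable_def p_def n_def top.not_eq_extremum)
      then show ?thesis unfolding if_not_P[OF False] by (rule not_integrable_integral_eq)
    qed
  qed
  then show ?thesis using m by simp
qed

definition positive_family :: "real \<Rightarrow> (real \<Rightarrow> ('v::{metric_space, second_countable_topology} \<times> 'v) measure) \<Rightarrow> bool" where
  "positive_family T m \<longleftrightarrow> (\<forall>t\<in>{0..T}. sets (m t) = sets borel \<and> emeasure (m t) (- off_diagonal) = 0) \<and>
     (\<forall>B\<in>sets borel. (\<lambda>t. emeasure (m t) B) \<in> borel_measurable (restrict_space borel {0..T})) \<and>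
     (\<integral>\<^sup>+ t\<in>{0..T}. (\<integral>\<^sup>+ z. ennreal (cutdist z) \<partial>m t) \<partial>lborel) < \<infinity>"

text \<open>Curves have prescribed values on \<open>[0,T]\<close> only; the null measure elsewhere
  gives a Borel family on the whole line.\<close>

definition clipped :: "real \<Rightarrow> (real \<Rightarrow> 'a::topological_space measure) \<Rightarrow> real \<Rightarrow> 'a measure" where
  "clipped T m t = (if t \<in> {0..T} then m t else null_measure borel)"

text \<open>Times at which the weighted slice has infinite mass form a null set for the families
  considered; the null measure is used there, so that a finite kernel results at every time.\<close>

definition weighted :: "real \<Rightarrow> (real \<Rightarrow> ('v::{metric_space, second_countable_topology} \<times> 'v) measure) \<Rightarrow> real \<Rightarrow> ('v \<times> 'v) measure" where
  "weighted T m t = (if t \<in> {0..T} \<and> (\<integral>\<^sup>+ z. ennreal (cutdist z) \<partial>m t) < \<infinity>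
     then density (m t) (\<lambda>z. ennreal (cutdist z)) else null_measure borel)"

lemma clipped_family:
  assumes "\<And>t. t \<in> {0..T} \<Longrightarrow> sets (m t) = sets borel"
    and "\<And>B. B \<in> sets borel \<Longrightarrow> (\<lambda>t. emeasure (m t) B) \<in> borel_measurable (restrict_space borel {0..T})"
  shows "sets (clipped T m t) = sets borel"
    "B \<in> sets borel \<Longrightarrow> (\<lambda>t. emeasure (clipped T m t) B) \<in> borel_measurable borel"
proof -
  show "sets (clipped T m t) = sets borel" using assms(1) by (auto simp: clipped_def)
  assume B: "B \<in> sets borel"
  have "(\<lambda>t. emeasure (m t) B * indicator {0..T} t) \<in> borel_measurable borel"
    using assms(2)[OF B] by (subst (asm) borel_measurable_restrict_space_iff_ennreal) auto
  moreover have "(\<lambda>t. emeasure (clipped T m t) B) = (\<lambda>t. emeasure (m t) B * indicator {0..T} t)"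
    by (auto simp: clipped_def indicator_def)
  ultimately show "(\<lambda>t. emeasure (clipped T m t) B) \<in> borel_measurable borel" by simp
qed

locale weighted_family =
  fixes T :: real and m :: "real \<Rightarrow> ('v::{metric_space, second_countable_topology} \<times> 'v) measure"
  assumes family: "positive_family T m"
begin

lemma sets_m: "t \<in> {0..T} \<Longrightarrow> sets (m t) = sets borel"
  and off: "t \<in> {0..T} \<Longrightarrow> emeasure (m t) (- off_diagonal) = 0"
  and total: "(\<integral>\<^sup>+ t\<in>{0..T}. (\<integral>\<^sup>+ z. ennreal (cutdist z) \<partial>m t) \<partial>lborel) < \<infinity>"
  using family by (auto simp: positive_family_def)

lemma clip: "sets (clipped T m t) = sets borel"
    "B \<in> sets borel \<Longrightarrow> (\<lambda>t. emeasure (clipped T m t) B) \<in> borel_measurable borel"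
  using family by (auto intro!: clipped_family simp: positive_family_def)

lemma clip_nn_integral_measurable:
  "f \<in> borel_measurable borel \<Longrightarrow> (\<lambda>t. \<integral>\<^sup>+ z. f z \<partial>clipped T m t) \<in> borel_measurable borel"
  by (rule family_nn_integral_measurable[OF clip])

lemma nn_integral_clipped: "(\<integral>\<^sup>+ z. f z \<partial>clipped T m t) = (\<integral>\<^sup>+ z. f z \<partial>m t) * indicator {0..T} t"
  by (auto simp: clipped_def)

lemma emeasure_weighted:
  assumes "B \<in> sets borel"
  shows "emeasure (weighted T m t) B = (if (\<integral>\<^sup>+ z. ennreal (cutdist z) \<partial>clipped T m t) < \<infinity>
     then \<integral>\<^sup>+ z. ennreal (cutdist z) * indicator B z \<partial>clipped T m t else 0)"
  using assms sets_m[of t] by (auto simp: weighted_def clipped_def emeasure_density measurable_cong_sets[OF sets_m refl])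

lemma weighted_kernel: "finite_kernel (weighted T m)"
  unfolding finite_kernel_def
proof (intro conjI allI ballI)
  show "sets (weighted T m t) = sets borel" for t using sets_m[of t] by (auto simp: weighted_def)
  show "emeasure (weighted T m t) UNIV < \<infinity>" for t by (simp add: emeasure_weighted)
  fix B :: "('v \<times> 'v) set" assume "B \<in> sets borel"
  then show "(\<lambda>t. emeasure (weighted T m t) B) \<in> borel_measurable borel"
    using clip_nn_integral_measurable[of "\<lambda>z. ennreal (cutdist z)"] clip_nn_integral_measurable[of "\<lambda>z. ennreal (cutdist z) * indicator B z"]
    by (simp add: emeasure_weighted)
qed

lemma weighted_null:
  assumes t: "t \<in> {0..T}" and N: "N \<in> sets borel" "emeasure (m t) N = 0"
  shows "emeasure (weighted T m t) N = 0"
proof -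
  have "N \<in> null_sets (m t)" using N sets_m[OF t] by (auto simp: null_sets_def)
  then have "AE z in m t. z \<notin> N" by (rule AE_not_in)
  then have "AE z in m t. ennreal (cutdist z) * indicator N z = 0" by eventually_elim simp
  then have "(\<integral>\<^sup>+ z. ennreal (cutdist z) * indicator N z \<partial>m t) = 0" by (rule nn_integral_AE_zero)
  then show ?thesis using N(1) by (simp add: emeasure_weighted nn_integral_clipped)
qed

lemma AE_finite: "AE t in lborel. t \<in> {0..T} \<longrightarrow> (\<integral>\<^sup>+ z. ennreal (cutdist z) \<partial>m t) < \<infinity>"
proof -
  have "(\<integral>\<^sup>+ t. (\<integral>\<^sup>+ z. ennreal (cutdist z) \<partial>clipped T m t) \<partial>lborel) \<noteq> \<infinity>"
    using total by (simp add: nn_integral_clipped less_top)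
  then have "AE t in lborel. (\<integral>\<^sup>+ z. ennreal (cutdist z) \<partial>clipped T m t) \<noteq> \<infinity>"
    using clip_nn_integral_measurable[of "\<lambda>z. ennreal (cutdist z)"] by (intro nn_integral_noteq_infinite) auto
  then show ?thesis by eventually_elim (auto simp: nn_integral_clipped less_top)
qed

text \<open>The weight vanishes only on the diagonal, which the family does not charge, so dividing
  by it restores the slice.\<close>

lemma weighted_density:
  assumes t: "t \<in> {0..T}" "(\<integral>\<^sup>+ z. ennreal (cutdist z) \<partial>m t) < \<infinity>"
  shows "m t = density (weighted T m t) (\<lambda>z. ennreal (1 / cutdist z))"
proof -
  note mb = measurable_cong_sets[OF sets_m[OF t(1)] refl]
  have "density (weighted T m t) (\<lambda>z. ennreal (1 / cutdist z)) = density (m t) (\<lambda>z. ennreal (cutdist z) * ennreal (1 / cutdist z))"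
    using t by (simp add: weighted_def density_density_eq mb)
  also have "\<dots> = density (m t) (\<lambda>_. 1)"
  proof (rule density_cong)
    have "(- off_diagonal :: ('v \<times> 'v) set) = {z. cutdist z = 0}" by (auto simp: off_diagonal_def cutdist_eq_0)
    moreover have "{z::'v \<times> 'v. cutdist z = 0} \<in> sets borel" by measurable
    ultimately have "- off_diagonal \<in> null_sets (m t)" using off[OF t(1)] sets_m[OF t(1)] by (auto simp: null_sets_def)
    then have "AE z in m t. z \<notin> - off_diagonal" by (rule AE_not_in)
    then show "AE z in m t. ennreal (cutdist z) * ennreal (1 / cutdist z) = 1"
      by eventually_elim (auto simp: off_diagonal_def cutdist_eq_0 ennreal_mult[symmetric] cutdist_bounds)
  qed (auto simp: mb)
  finally show ?thesis by (simp add: density_1)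
qed

abbreviation "J \<equiv> semidirect lborel (weighted T m)"

lemma finite_total: "(\<integral>\<^sup>+ t. emeasure (weighted T m t) UNIV \<partial>lborel) < \<infinity>"
proof -
  have "(\<integral>\<^sup>+ t. emeasure (weighted T m t) UNIV \<partial>lborel) \<le> (\<integral>\<^sup>+ t. (\<integral>\<^sup>+ z. ennreal (cutdist z) \<partial>clipped T m t) \<partial>lborel)"
    by (intro nn_integral_mono) (simp add: emeasure_weighted)
  also have "\<dots> < \<infinity>" using total by (simp add: nn_integral_clipped)
  finally show ?thesis .
qed

lemma finite_J: "finite_measure J"
  by (rule finite_measure_semidirect[OF weighted_kernel _ finite_total]) simp

lemma sets_time_space: "sets (time_space T :: (real \<times> 'v \<times> 'v) measure) = {B \<in> sets borel. B \<subseteq> {0..T} \<times> UNIV}"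
proof -
  have "{0..T} \<times> UNIV \<in> sets (borel :: (real \<times> 'v \<times> 'v) measure)" by (intro borel_Times) auto
  then show ?thesis unfolding time_space_def sets_restrict_space by (auto simp: image_iff intro!: bexI[of _ "_ :: (real \<times> 'v \<times> 'v) set"])
qed

text \<open>\<open>measure_of\<close> returns the zero measure unless the given set function is a
  measure. Equality with the restriction of a density settles this and moves all later computations
  to the finite measure \<open>J\<close>.\<close>

lemma time_measure_eq:
  "time_measure T m = restrict_space (density J (\<lambda>z. ennreal (1 / cutdist (snd z)))) ({0..T} \<times> UNIV)" (is "_ = ?R")
proof -
  let ?I = "{0..T} \<times> (UNIV :: ('v \<times> 'v) set)"
  have I: "?I \<in> sets borel" by (intro borel_Times) auto
  have sp: "space ?R = ?I" by (simp add: space_restrict_space)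
  have st: "sets ?R = sets (time_space T)"
    unfolding time_space_def by (rule sets_restrict_space_cong) simp
  have cm: "(\<lambda>z::real \<times> 'v \<times> 'v. ennreal (1 / cutdist (snd z))) \<in> borel_measurable borel"
    by (intro measurable_compose[OF fst_snd_borel(2)]) auto
  have "time_measure T m = measure_of ?I (sets (time_space T)) (emeasure ?R)"
    unfolding time_measure_def
  proof (rule measure_of_eq)
    show "sets (time_space T) \<subseteq> Pow ?I" by (auto simp: sets_time_space)
    fix B assume "B \<in> sigma_sets ?I (sets (time_space T :: (real \<times> 'v \<times> 'v) measure))"
    moreover have "space (time_space T :: (real \<times> 'v \<times> 'v) measure) = ?I" by (simp add: time_space_def space_restrict_space)
    ultimately have "B \<in> sets (time_space T)" by (metis sets.sigma_sets_eq)
    then have B: "B \<in> sets borel" "B \<subseteq> ?I" by (auto simp: sets_time_space)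
    have "emeasure ?R B = (\<integral>\<^sup>+ z. ennreal (1 / cutdist (snd z)) * indicator B z \<partial>J)"
      using B I cm by (subst emeasure_restrict_space) (auto simp: emeasure_density)
    also have "\<dots> = (\<integral>\<^sup>+ t. \<integral>\<^sup>+ z. ennreal (1 / cutdist z) * indicator B (t, z) \<partial>weighted T m t \<partial>lborel)"
      using B cm by (subst nn_integral_semidirect[OF weighted_kernel]) auto
    also have "\<dots> = (\<integral>\<^sup>+ t\<in>{0..T}. emeasure (m t) (Pair t -` B) \<partial>lborel)"
    proof (rule nn_integral_cong_AE)
      from AE_finite show "AE t in lborel. (\<integral>\<^sup>+ z. ennreal (1 / cutdist z) * indicator B (t, z) \<partial>weighted T m t)
          = emeasure (m t) (Pair t -` B) * indicator {0..T} t"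
      proof eventually_elim
        case (elim t)
        show ?case
        proof (cases "t \<in> {0..T}")
          case True
          with elim have e: "m t = density (weighted T m t) (\<lambda>z. ennreal (1 / cutdist z))" by (intro weighted_density) auto
          have "emeasure (m t) (Pair t -` B) = (\<integral>\<^sup>+ z. ennreal (1 / cutdist z) * indicator (Pair t -` B) z \<partial>weighted T m t)"
            using sets_Pair_section[OF B(1)]
            by (subst e, intro emeasure_density) (auto simp: finite_kernelD(1)[OF weighted_kernel] measurable_cong_sets[OF finite_kernelD(1)[OF weighted_kernel] refl])
          then show ?thesis using True by (simp add: indicator_vimage)
        next
          case False
          then show ?thesis by (auto simp: weighted_def)
        qed
      qed
    qed
    finally show "(\<integral>\<^sup>+ t\<in>{0..T}. emeasure (m t) (Pair t -` B) \<partial>lborel) = emeasure ?R B" by simp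
  qed
  also have "\<dots> = ?R" using measure_of_of_measure[of ?R] unfolding sp st .
  finally show ?thesis .
qed

lemma sets_time_measure: "sets (time_measure T m) = sets (time_space T)"
  unfolding time_measure_eq time_space_def by (rule sets_restrict_space_cong) simp

lemma emeasure_time_measure:
  assumes B: "B \<in> sets borel" "B \<subseteq> {0..T} \<times> UNIV"
  shows "emeasure (time_measure T m) B = (\<integral>\<^sup>+ z. ennreal (1 / cutdist (snd z)) * indicator B z \<partial>J)"
proof -
  have I: "{0..T} \<times> UNIV \<in> sets (borel :: (real \<times> 'v \<times> 'v) measure)" by (intro borel_Times) auto
  have cm: "(\<lambda>z::real \<times> 'v \<times> 'v. ennreal (1 / cutdist (snd z))) \<in> borel_measurable borel"
    by (intro measurable_compose[OF fst_snd_borel(2)]) auto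
  show ?thesis unfolding time_measure_eq using B I cm
    by (subst emeasure_restrict_space) (auto simp: emeasure_density)
qed

lemma sigma_finite_time_measure: "sigma_finite_measure (time_measure T m)"
proof -
  interpret finite_measure J by (rule finite_J)
  have "sigma_finite_measure (density J (\<lambda>z. ennreal (1 / cutdist (snd z))))"
    by (subst sigma_finite_iff_density_finite) (auto intro!: measurable_compose[OF fst_snd_borel(2)])
  then show ?thesis unfolding time_measure_eq by (rule sigma_finite_measure_restrict_space) (auto intro!: borel_Times)
qed

text \<open>With \<open>1 / cutdist\<close> bounded on \<open>B\<close>, the possibly infinite
  space-time measure of \<open>B\<close> becomes the integral of a bounded function against the
  finite measure \<open>J\<close>. On the diagonal \<open>1 / cutdist\<close> is 0 by convention, in
  accordance with the family not charging it.\<close>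

lemma measure_time_measure:
  assumes B: "B \<in> sets borel" "B \<subseteq> {0..T} \<times> UNIV" and c: "\<And>z. z \<in> B \<Longrightarrow> 1 / cutdist (snd z) \<le> c"
  shows "measure (time_measure T m) B = (\<integral>z. indicator B z / cutdist (snd z) \<partial>J)"
    "emeasure (time_measure T m) B < \<infinity>"
proof -
  interpret finite_measure J by (rule finite_J)
  have cm: "(\<lambda>z::real \<times> 'v \<times> 'v. indicator B z / cutdist (snd z)) \<in> borel_measurable borel"
    using B(1) by (intro borel_measurable_divide measurable_compose[OF fst_snd_borel(2)]) auto
  have nn: "0 \<le> indicator B z / cutdist (snd z)" for z by (auto simp: cutdist_bounds)
  have b: "norm (indicator B z / cutdist (snd z)) \<le> \<bar>c\<bar>" for z
    using c[of z] cutdist_bounds(1)[of "snd z"] by (auto simp: indicator_def)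
  have e: "emeasure (time_measure T m) B = (\<integral>\<^sup>+ z. ennreal (indicator B z / cutdist (snd z)) \<partial>J)"
    unfolding emeasure_time_measure[OF B] by (intro nn_integral_cong) (auto simp: indicator_def)
  have i: "integrable J (\<lambda>z. indicator B z / cutdist (snd z))"
    by (rule integrable_const_bound[of _ "\<bar>c\<bar>"]) (use b cm in auto)
  have "emeasure (time_measure T m) B = ennreal (\<integral>z. indicator B z / cutdist (snd z) \<partial>J)"
    unfolding e by (rule nn_integral_eq_integral[OF i]) (use nn in auto)
  then show "measure (time_measure T m) B = (\<integral>z. indicator B z / cutdist (snd z) \<partial>J)" "emeasure (time_measure T m) B < \<infinity>"
    using nn by (auto simp: measure_def integral_nonneg_AE)
qed

lemma integral_weighted_density:
  fixes F :: "'v \<times> 'v \<Rightarrow> real"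
  assumes t: "t \<in> {0..T}" "(\<integral>\<^sup>+ z. ennreal (cutdist z) \<partial>m t) < \<infinity>" and F: "F \<in> borel_measurable borel"
  shows "(\<integral>z. F z \<partial>m t) = (\<integral>z. F z / cutdist z \<partial>weighted T m t)"
  using F
  by (subst weighted_density[OF t], subst integral_density)
    (auto simp: measurable_cong_sets[OF finite_kernelD(1)[OF weighted_kernel] refl] cutdist_bounds intro!: AE_I2)

text \<open>A function dominated by the truncated distance becomes bounded after division by it,
  hence integrable against the finite measure \<open>J\<close>. The exceptional times of
  \<open>weighted\<close> form a null set.\<close>

lemma integral_family:
  fixes F :: "'v \<times> 'v \<Rightarrow> real"
  assumes F: "F \<in> borel_measurable borel" "\<And>z. \<bar>F z / cutdist z\<bar> \<le> c" and st: "0 \<le> s" "t \<le> T"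
  shows "integrable lborel (\<lambda>r. indicator {s..t} r * (\<integral>z. F z \<partial>m r))"
    "(\<integral>r. indicator {s..t} r * (\<integral>z. F z \<partial>m r) \<partial>lborel) = (\<integral>z. indicator {s..t} (fst z) * (F (snd z) / cutdist (snd z)) \<partial>J)"
proof -
  interpret finite_measure J by (rule finite_J)
  have gm: "(\<lambda>z::real \<times> 'v \<times> 'v. indicator {s..t} (fst z) * (F (snd z) / cutdist (snd z))) \<in> borel_measurable borel"
    using F(1) by (intro borel_measurable_times borel_measurable_divide measurable_compose[OF fst_snd_borel(2)] measurable_compose[OF fst_snd_borel(1)]) auto
  have "c \<ge> 0" using F(2) abs_ge_zero order_trans by blast
  then have i: "integrable J (\<lambda>z. indicator {s..t} (fst z) * (F (snd z) / cutdist (snd z)))"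
    by (intro integrable_const_bound[of _ c]) (use F(2) gm in \<open>auto simp: abs_mult indicator_def\<close>)
  note I = integral_semidirect[OF weighted_kernel sets_lborel i, unfolded fst_conv snd_conv integral_mult_right_zero]
  have ae: "AE r in lborel. indicator {s..t} r * (\<integral>z. F z / cutdist z \<partial>weighted T m r) = indicator {s..t} r * (\<integral>z. F z \<partial>m r)"
    using AE_finite
  proof eventually_elim
    case (elim r)
    show ?case
    proof (cases "r \<in> {s..t}")
      case True
      then have "r \<in> {0..T}" using st by auto
      then show ?thesis using integral_weighted_density[of r F] F elim by auto
    qed simp
  qed
  have "(\<lambda>r. indicator {s..t} r * (\<integral>z. F z \<partial>clipped T m r)) \<in> borel_measurable borel"
    by (intro borel_measurable_times family_integral_measurable[OF clip] F) auto
  moreover have "(\<lambda>r. indicator {s..t} r * (\<integral>z. F z \<partial>clipped T m r)) = (\<lambda>r. indicator {s..t} r * (\<integral>z. F z \<partial>m r))"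
    using st by (auto simp: fun_eq_iff clipped_def indicator_def)
  ultimately have mm: "(\<lambda>r. indicator {s..t} r * (\<integral>z. F z \<partial>m r)) \<in> borel_measurable lborel" by simp
  show "integrable lborel (\<lambda>r. indicator {s..t} r * (\<integral>z. F z \<partial>m r))"
    by (rule integrable_cong_AE_imp[OF I(2) mm]) (use ae in auto)
  show "(\<integral>r. indicator {s..t} r * (\<integral>z. F z \<partial>m r) \<partial>lborel) = (\<integral>z. indicator {s..t} (fst z) * (F (snd z) / cutdist (snd z)) \<partial>J)"
    unfolding I(1) by (rule integral_cong_AE[OF mm borel_measurable_integrable[OF I(2)]]) (use ae in auto)
qed

end

text \<open>The Lipschitz constant controls short jumps and the supremum norm controls long ones;
  the two regimes are those of the truncated distance.\<close>

lemma Lip_b_gradient_bound: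
  assumes "f \<in> Lip_b"
  shows "\<exists>c. \<forall>z. \<bar>(f (snd z) - f (fst z)) / cutdist z\<bar> \<le> c"
proof -
  obtain L B where L: "L-lipschitz_on UNIV f" and B: "\<And>x. \<bar>f x\<bar> \<le> B"
    using assms unfolding Lip_b_def bounded_iff by auto
  have L0: "L \<ge> 0" using L by (auto simp: lipschitz_on_def)
  have B0: "B \<ge> 0" using B[of undefined] by simp
  have "\<bar>(f (snd z) - f (fst z)) / cutdist z\<bar> \<le> max L (2 * B)" for z
  proof (cases "cutdist z = 0")
    case False
    then have c: "cutdist z > 0" using cutdist_bounds(1)[of z] by simp
    have "\<bar>f (snd z) - f (fst z)\<bar> \<le> L * dist (fst z) (snd z)"
      using lipschitz_onD[OF L, of "snd z" "fst z"] by (simp add: dist_real_def dist_commute)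
    moreover have "\<bar>f (snd z) - f (fst z)\<bar> \<le> 2 * B" using B[of "snd z"] B[of "fst z"] by linarith
    ultimately have "\<bar>f (snd z) - f (fst z)\<bar> \<le> max L (2 * B) * cutdist z"
      unfolding cutdist_def min_def using L0 B0
      by (smt (verit) max.cobounded1 max.cobounded2 mult_cancel_left2 mult_right_mono zero_le_dist)
    then show ?thesis using c by (simp add: abs_divide divide_le_eq)
  qed (use L0 in simp)
  then show ?thesis by blast
qed

section \<open>Curves of signed fluxes as space-time measures\<close>

locale flux_curve =
  fixes T :: real and j :: "real \<Rightarrow> ('v::{metric_space, second_countable_topology} \<times> 'v) flux"
  assumes meas: "measurable_flux_family T j"
    and offd: "\<And>t. t \<in> {0..T} \<Longrightarrow> emeasure (total_variation (j t)) (- off_diagonal) = 0"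
    and fin: "(\<integral>\<^sup>+ t\<in>{0..T}. (\<integral>\<^sup>+ z. ennreal (min 1 (dist (fst z) (snd z))) \<partial>total_variation (j t)) \<partial>lborel) < \<infinity>"
begin

lemma flux: "t \<in> {0..T} \<Longrightarrow> j t \<in> sigma_fluxes borel"
  using meas by (auto simp: measurable_flux_family_def)

lemma sets_flux: "t \<in> {0..T} \<Longrightarrow> sets (fst (j t)) = sets borel" "t \<in> {0..T} \<Longrightarrow> sets (snd (j t)) = sets borel"
  using flux by (auto simp: sigma_fluxes_def)

lemma off_diagonal_borel: "- off_diagonal \<in> sets (borel :: ('v \<times> 'v) measure)"
proof -
  have "(- off_diagonal :: ('v \<times> 'v) set) = {z. cutdist z = 0}" by (auto simp: off_diagonal_def cutdist_eq_0)
  then show ?thesis by simp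
qed

lemma emeasure_tv:
  "t \<in> {0..T} \<Longrightarrow> B \<in> sets borel \<Longrightarrow> emeasure (total_variation (j t)) B = emeasure (fst (j t)) B + emeasure (snd (j t)) B"
  using sets_flux by (intro emeasure_total_variation) auto

lemma families:
  "positive_family T (\<lambda>t. fst (j t))" "positive_family T (\<lambda>t. snd (j t))" "positive_family T (\<lambda>t. total_variation (j t))"
proof -
  have m: "(\<lambda>t. emeasure (fst (j t)) B) \<in> borel_measurable (restrict_space borel {0..T})"
    "(\<lambda>t. emeasure (snd (j t)) B) \<in> borel_measurable (restrict_space borel {0..T})" if "B \<in> sets borel" for B
    using meas that by (auto simp: measurable_flux_family_def)
  have s: "sets (total_variation (j t)) = sets borel" if "t \<in> {0..T}" for t
    using sets_flux[OF that] by (subst sets_total_variation) auto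
  have nn: "(\<integral>\<^sup>+ z. f z \<partial>total_variation (j t)) = (\<integral>\<^sup>+ z. f z \<partial>fst (j t)) + (\<integral>\<^sup>+ z. f z \<partial>snd (j t))"
    if "t \<in> {0..T}" "f \<in> borel_measurable borel" for t f
    using sets_flux[OF that(1)] that(2) by (intro nn_integral_total_variation) (auto simp: measurable_cong_sets[OF sets_flux(1)[OF that(1)] refl])
  have o: "emeasure (fst (j t)) (- off_diagonal) = 0 \<and> emeasure (snd (j t)) (- off_diagonal) = 0" if "t \<in> {0..T}" for t
    using offd[OF that] emeasure_tv[OF that off_diagonal_borel] by simp
  have fin': "(\<integral>\<^sup>+ t\<in>{0..T}. (\<integral>\<^sup>+ z. ennreal (cutdist z) \<partial>total_variation (j t)) \<partial>lborel) < \<infinity>"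
    using fin by (simp add: cutdist_def)
  have le: "(\<integral>\<^sup>+ t\<in>{0..T}. (\<integral>\<^sup>+ z. ennreal (cutdist z) \<partial>fst (j t)) \<partial>lborel) \<le> (\<integral>\<^sup>+ t\<in>{0..T}. (\<integral>\<^sup>+ z. ennreal (cutdist z) \<partial>total_variation (j t)) \<partial>lborel)"
    "(\<integral>\<^sup>+ t\<in>{0..T}. (\<integral>\<^sup>+ z. ennreal (cutdist z) \<partial>snd (j t)) \<partial>lborel) \<le> (\<integral>\<^sup>+ t\<in>{0..T}. (\<integral>\<^sup>+ z. ennreal (cutdist z) \<partial>total_variation (j t)) \<partial>lborel)"
    by (intro nn_integral_mono; simp add: nn indicator_def)+
  show "positive_family T (\<lambda>t. fst (j t))" "positive_family T (\<lambda>t. snd (j t))"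
    unfolding positive_family_def using sets_flux o m le[THEN le_less_trans, OF fin'] by auto
  have "(\<lambda>t. emeasure (total_variation (j t)) B) \<in> borel_measurable (restrict_space borel {0..T})" if "B \<in> sets borel" for B
  proof -
    have "(\<lambda>t. emeasure (fst (j t)) B + emeasure (snd (j t)) B) \<in> borel_measurable (restrict_space borel {0..T})"
      using m[OF that] by (rule borel_measurable_add)
    then show ?thesis by (rule measurable_cong[THEN iffD1, rotated]) (simp add: space_restrict_space emeasure_tv that)
  qed
  then show "positive_family T (\<lambda>t. total_variation (j t))"
    unfolding positive_family_def using s offd fin' by auto
qed

sublocale pos: weighted_family T "\<lambda>t. fst (j t)" by unfold_locales (rule families)
sublocale neg: weighted_family T "\<lambda>t. snd (j t)" by unfold_locales (rule families)
sublocale tv: weighted_family T "\<lambda>t. total_variation (j t)" by unfold_locales (rule families)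

abbreviation "Jp \<equiv> weighted T (\<lambda>t. fst (j t))"
abbreviation "Jm \<equiv> weighted T (\<lambda>t. snd (j t))"
abbreviation "Jtv \<equiv> weighted T (\<lambda>t. total_variation (j t))"

text \<open>Only almost everywhere, since \<open>weighted\<close> resets infinite slices of the two
  parts and of the total variation independently. The set may depend on \<open>t\<close> so that
  sections of space-time sets can be inserted.\<close>

lemma AE_weighted_le:
  assumes B: "\<And>t. B t \<in> sets borel"
  shows "AE t in lborel. emeasure (Jp t) (B t) \<le> emeasure (Jtv t) (B t)" "AE t in lborel. emeasure (Jm t) (B t) \<le> emeasure (Jtv t) (B t)"
proof -
  let ?I = "\<lambda>m t C. \<integral>\<^sup>+ z. ennreal (cutdist z) * indicator C z \<partial>clipped T m t"
  have *: "?I (\<lambda>t. total_variation (j t)) t C = ?I (\<lambda>t. fst (j t)) t C + ?I (\<lambda>t. snd (j t)) t C"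
    if "C \<in> sets borel" for t C
  proof (cases "t \<in> {0..T}")
    case True
    then show ?thesis using sets_flux[OF True] that
      by (simp add: clipped_def) (intro nn_integral_total_variation, auto simp: measurable_cong_sets[OF sets_flux(1)[OF True] refl])
  next
    case False
    then show ?thesis unfolding clipped_def if_not_P[OF False] by simp
  qed
  have f: "AE t in lborel. ?I (\<lambda>t. total_variation (j t)) t UNIV < \<infinity>"
    using tv.AE_finite by eventually_elim (auto simp: tv.nn_integral_clipped indicator_def)
  have tv: "emeasure (Jtv t) (B t) = ?I (\<lambda>t. fst (j t)) t (B t) + ?I (\<lambda>t. snd (j t)) t (B t)"
    if "?I (\<lambda>t. total_variation (j t)) t UNIV < \<infinity>" for t
    using that *[OF B] by (simp add: tv.emeasure_weighted[OF B])
  from f show "AE t in lborel. emeasure (Jp t) (B t) \<le> emeasure (Jtv t) (B t)"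
    by eventually_elim (simp add: tv pos.emeasure_weighted[OF B])
  from f show "AE t in lborel. emeasure (Jm t) (B t) \<le> emeasure (Jtv t) (B t)"
    by eventually_elim (simp add: tv neg.emeasure_weighted[OF B])
qed

lemma absolutely_continuous_J:
  "absolutely_continuous tv.J pos.J" "absolutely_continuous tv.J neg.J"
proof -
  have *: "emeasure pos.J B \<le> emeasure tv.J B \<and> emeasure neg.J B \<le> emeasure tv.J B" if "B \<in> sets borel" for B
    using that AE_weighted_le[of "\<lambda>t. Pair t -` B"] sets_Pair_section[OF that]
    by (auto simp: emeasure_semidirect[OF pos.weighted_kernel] emeasure_semidirect[OF neg.weighted_kernel]
        emeasure_semidirect[OF tv.weighted_kernel] intro!: nn_integral_mono_AE)
  then show "absolutely_continuous tv.J pos.J" "absolutely_continuous tv.J neg.J"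
    unfolding absolutely_continuous_def null_sets_def by auto (metis le_zero_eq)+
qed

text \<open>Mutual singularity of the slices passes to the space-time measures: for almost every \<open>t\<close> the product
  of the two slice densities vanishes.\<close>
lemma J_mutually_singular:
  "\<exists>P\<in>sets borel. emeasure pos.J (- P) = 0 \<and> emeasure neg.J P = 0"
proof -
  interpret S: sigma_finite_measure "lborel :: real measure" by (rule sigma_finite_lborel)
  obtain f where f: "f \<in> borel_measurable borel" "\<And>z. 0 \<le> f z" "pos.J = density tv.J (\<lambda>z. ennreal (f z))"
    "AE t in lborel. Jp t = density (Jtv t) (\<lambda>z. ennreal (f (t, z)))"
    using kernel_Radon_Nikodym[OF pos.weighted_kernel tv.weighted_kernel sets_lborel sigma_finite_lborel pos.finite_total tv.finite_total absolutely_continuous_J(1)] by blast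
  obtain g where g: "g \<in> borel_measurable borel" "\<And>z. 0 \<le> g z" "neg.J = density tv.J (\<lambda>z. ennreal (g z))"
    "AE t in lborel. Jm t = density (Jtv t) (\<lambda>z. ennreal (g (t, z)))"
    using kernel_Radon_Nikodym[OF neg.weighted_kernel tv.weighted_kernel sets_lborel sigma_finite_lborel neg.finite_total tv.finite_total absolutely_continuous_J(2)] by blast
  have mz: "{z. f z = 0 \<or> g z = 0} \<in> sets borel" using f(1) g(1) by measurable
  have "AE t in lborel. AE z in Jtv t. f (t, z) = 0 \<or> g (t, z) = 0"
    using f(4) g(4)
  proof eventually_elim
    case (elim t)
    note mt = measurable_cong_sets[OF finite_kernelD(1)[OF tv.weighted_kernel, of t] refl]
    have fm: "(\<lambda>z. ennreal (f (t, z))) \<in> borel_measurable (Jtv t)" "(\<lambda>z. ennreal (g (t, z))) \<in> borel_measurable (Jtv t)"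
      using measurable_Pair_section[OF f(1), of t] measurable_Pair_section[OF g(1), of t] by (auto simp: mt)
    have st: "sets (Jtv t) = sets borel" by (rule finite_kernelD(1)[OF tv.weighted_kernel])
    show ?case
    proof (cases "t \<in> {0..T}")
      case True
      \<comment> \<open>The separating set \<open>N\<close> depends on \<open>t\<close> without any
        measurable choice. It serves only to show that \<open>f\<close> or \<open>g\<close> vanishes
        on this slice; as these densities are jointly measurable, the set where \<open>f\<close> is
        not 0 separates the space-time measures.\<close>
      obtain N where N: "N \<in> sets borel" "emeasure (fst (j t)) (- N) = 0" "emeasure (snd (j t)) N = 0"
        using flux[OF True] space_eq_UNIV[OF sets_flux(1)[OF True]] sets_flux[OF True]
        by (auto simp: sigma_fluxes_def mutually_singular_def Compl_eq_Diff_UNIV)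
      have z: "emeasure (Jp t) (- N) = 0" "emeasure (Jm t) N = 0"
        using pos.weighted_null[OF True _ N(2)] neg.weighted_null[OF True _ N(3)] N(1) by auto
      have "emeasure (density (Jtv t) (\<lambda>z. ennreal (f (t, z)))) (- N) = 0" using z(1) elim(1) by simp
      then have 1: "AE z in Jtv t. ennreal (f (t, z)) * indicator (- N) z = 0"
        using fm(1) N(1) st by (subst (asm) emeasure_density) (auto simp: nn_integral_0_iff_AE)
      have "emeasure (density (Jtv t) (\<lambda>z. ennreal (g (t, z)))) N = 0" using z(2) elim(2) by simp
      then have 2: "AE z in Jtv t. ennreal (g (t, z)) * indicator N z = 0"
        using fm(2) N(1) st by (subst (asm) emeasure_density) (auto simp: nn_integral_0_iff_AE)
      from 1 2 show ?thesis
      proof eventually_elim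
        case (elim z)
        then have "f (t, z) \<le> 0 \<or> g (t, z) \<le> 0" by (cases "z \<in> N") (auto simp: ennreal_eq_0_iff)
        then show ?case using f(2) g(2) by (meson order_antisym)
      qed
    next
      case False
      then show ?thesis by (simp add: weighted_def null_measure_def AE_iff_null_sets eventually_ae_filter) (auto simp: null_sets_def emeasure_sigma)
    qed
  qed
  then have fg: "AE z in tv.J. f z = 0 \<or> g z = 0"
    by (subst AE_semidirect[OF tv.weighted_kernel]) (use mz in auto)
  define P where "P = {z. f z \<noteq> 0}"
  have P: "P \<in> sets borel" unfolding P_def using f(1) by measurable
  have "emeasure pos.J (- P) = (\<integral>\<^sup>+ z. ennreal (f z) * indicator (- P) z \<partial>tv.J)"
    unfolding f(3) using f(1) P by (intro emeasure_density) auto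
  also have "\<dots> = 0" by (intro nn_integral_AE_zero AE_I2) (auto simp: P_def indicator_def)
  finally have p: "emeasure pos.J (- P) = 0" .
  have "emeasure neg.J P = (\<integral>\<^sup>+ z. ennreal (g z) * indicator P z \<partial>tv.J)"
    unfolding g(3) using g(1) P by (intro emeasure_density) auto
  also have "\<dots> = 0" by (rule nn_integral_AE_zero) (use fg in \<open>eventually_elim, auto simp: P_def indicator_def\<close>)
  finally show ?thesis using P p by blast
qed

lemma time_flux_in: "time_flux T j \<in> sigma_fluxes (time_space T)"
proof -
  obtain P where P: "P \<in> sets borel" "emeasure pos.J (- P) = 0" "emeasure neg.J P = 0" using J_mutually_singular by blast
  let ?I = "{0..T} \<times> (UNIV :: ('v \<times> 'v) set)"
  have I: "?I \<in> sets borel" by (intro borel_Times) auto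
  have sp: "space (time_measure T (\<lambda>t. fst (j t))) = ?I"
    using sets_eq_imp_space_eq[OF pos.sets_time_measure] by (simp add: time_space_def space_restrict_space)
  have z: "(\<integral>\<^sup>+ z. ennreal (h z) * indicator B z \<partial>M) = 0" if "sets M = sets borel" "N \<in> sets borel" "emeasure M N = 0" "B \<subseteq> N" for M :: "(real \<times> 'v \<times> 'v) measure" and h B N
  proof (rule nn_integral_AE_zero)
    have "AE z in M. z \<notin> N" using that by (intro AE_not_in) (auto simp: null_sets_def)
    then show "AE z in M. ennreal (h z) * indicator B z = 0" by eventually_elim (use that in \<open>auto simp: indicator_def\<close>)
  qed
  have "emeasure (time_measure T (\<lambda>t. fst (j t))) (?I - (P \<inter> ?I)) = 0"
    using P(1) I z[of pos.J "- P" "?I - (P \<inter> ?I)" "\<lambda>z. 1 / cutdist (snd z)"] P(2)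
    by (subst pos.emeasure_time_measure) auto
  moreover have "emeasure (time_measure T (\<lambda>t. snd (j t))) (P \<inter> ?I) = 0"
    using P(1) I z[of neg.J P "P \<inter> ?I" "\<lambda>z. 1 / cutdist (snd z)"] P(3)
    by (subst neg.emeasure_time_measure) auto
  moreover have "P \<inter> ?I \<in> sets (time_measure T (\<lambda>t. fst (j t)))"
    using P(1) I by (simp add: pos.sets_time_measure pos.sets_time_space)
  ultimately have "mutually_singular (time_measure T (\<lambda>t. fst (j t))) (time_measure T (\<lambda>t. snd (j t)))"
    unfolding mutually_singular_def sp by blast
  then show ?thesis
    by (simp add: sigma_fluxes_def time_flux_def pos.sets_time_measure neg.sets_time_measure
        pos.sigma_finite_time_measure neg.sigma_finite_time_measure)
qed

lemma flux_integral_time: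
  assumes f: "f \<in> Lip_b" and st: "0 \<le> s" "t \<le> T"
  shows "(LINT r:{s..t}|lborel. flux_integral (j r) off_diagonal (\<lambda>(x, y). f y - f x))
    = (\<integral>z. indicator {s..t} (fst z) * ((f (snd (snd z)) - f (fst (snd z))) / cutdist (snd z)) \<partial>pos.J)
    - (\<integral>z. indicator {s..t} (fst z) * ((f (snd (snd z)) - f (fst (snd z))) / cutdist (snd z)) \<partial>neg.J)"
proof -
  let ?F = "\<lambda>z::'v \<times> 'v. f (snd z) - f (fst z)"
  obtain c where c: "\<And>z. \<bar>?F z / cutdist z\<bar> \<le> c" using Lip_b_gradient_bound[OF f] by blast
  have Fm: "?F \<in> borel_measurable borel"
    using Lip_b_measurable[OF f] by (intro borel_measurable_diff measurable_compose[OF fst_snd_borel(1)] measurable_compose[OF fst_snd_borel(2)])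
  have "flux_integral (j r) off_diagonal (\<lambda>(x, y). f y - f x) = (\<integral>z. ?F z \<partial>fst (j r)) - (\<integral>z. ?F z \<partial>snd (j r))" for r
    unfolding flux_integral_def set_lebesgue_integral_def
    by (intro arg_cong2[where f = "(-)"] Bochner_Integration.integral_cong refl) (auto simp: off_diagonal_def indicator_def)
  then have "(LINT r:{s..t}|lborel. flux_integral (j r) off_diagonal (\<lambda>(x, y). f y - f x))
      = (\<integral>r. indicator {s..t} r * (\<integral>z. ?F z \<partial>fst (j r)) - indicator {s..t} r * (\<integral>z. ?F z \<partial>snd (j r)) \<partial>lborel)"
    unfolding set_lebesgue_integral_def by (simp add: right_diff_distrib)
  also have "\<dots> = (\<integral>r. indicator {s..t} r * (\<integral>z. ?F z \<partial>fst (j r)) \<partial>lborel) - (\<integral>r. indicator {s..t} r * (\<integral>z. ?F z \<partial>snd (j r)) \<partial>lborel)"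
    by (intro Bochner_Integration.integral_diff pos.integral_family[OF Fm c st] neg.integral_family[OF Fm c st])
  finally show ?thesis unfolding pos.integral_family(2)[OF Fm c st] neg.integral_family(2)[OF Fm c st] .
qed

end

section \<open>Compactness\<close>

definition time_interval :: "real \<Rightarrow> real measure" where
  "time_interval T = density lborel (\<lambda>t. indicator {0..T} t)"

lemma time_interval [simp]: "sets (time_interval T) = sets borel" "space (time_interval T) = UNIV"
  by (simp_all add: time_interval_def)

lemma measurable_time_interval [simp]: "measurable (time_interval T) N = measurable borel N"
  by (rule measurable_cong_sets) auto

lemma nn_integral_time_interval:
  "f \<in> borel_measurable borel \<Longrightarrow> (\<integral>\<^sup>+ t. f t \<partial>time_interval T) = (\<integral>\<^sup>+ t\<in>{0..T}. f t \<partial>lborel)"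
  unfolding time_interval_def by (subst nn_integral_density) (auto simp: mult.commute)

lemma AE_time_interval: "(AE t in time_interval T. P t) \<longleftrightarrow> (AE t in lborel. t \<in> {0..T} \<longrightarrow> P t)"
  unfolding time_interval_def by (subst AE_density) (auto simp: indicator_def)

lemma finite_time_interval: "finite_measure (time_interval T)"
proof (rule finite_measureI)
  have "emeasure (time_interval T) UNIV = emeasure lborel {0..T}"
    unfolding time_interval_def by (subst emeasure_density) auto
  then show "emeasure (time_interval T) (space (time_interval T)) \<noteq> \<infinity>"
    by (cases "0 \<le> T") auto
qed

text \<open>The coefficients \<open>a n\<close> are bounded everywhere here, which truncation at the
  essential supremum will provide; the kernels \<open>\<kappa>n n\<close> enter through their edge
  measures, which do not notice null sets. All assumptions pass to subsequences, so the locale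
  applies again after extraction.\<close>

locale flow_sequence = jump_flow \<pi> \<kappa> \<psi>s \<phi> \<alpha>
  for \<pi> :: "'v::{metric_space, second_countable_topology} measure" and \<kappa> \<psi>s \<phi> \<alpha> +
  fixes T Abar Ebar :: real and a :: "nat \<Rightarrow> 'v \<times> 'v \<Rightarrow> real"
    and \<kappa>n :: "nat \<Rightarrow> 'v \<Rightarrow> 'v measure"
    and \<rho>n :: "nat \<Rightarrow> real \<Rightarrow> 'v measure" and jn :: "nat \<Rightarrow> real \<Rightarrow> ('v \<times> 'v) flux"
  assumes T: "0 < T" and Ebar: "0 \<le> Ebar"
    and a [measurable]: "\<And>n. a n \<in> borel_measurable borel" and a_nonneg: "\<And>n z. 0 \<le> a n z" and a_le: "\<And>n z. a n z \<le> Abar"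
    and a_lim: "AE z in \<theta>. (\<lambda>n. a n z) \<longlonglongrightarrow> 1"
    and edge: "\<And>n. edge_measure \<pi> (\<kappa>n n) = density \<theta> (\<lambda>z. ennreal (a n z))"
    and CE: "\<And>n. (\<rho>n n, jn n) \<in> CE T"
    and energy: "\<And>n t. t \<in> {0..T} \<Longrightarrow>
      (\<integral>\<^sup>+ r\<in>{0..t}. (Diss (\<kappa>n n) (\<rho>n n r) (jn n r) +
          Fisher (\<kappa>n n) (\<rho>n n r)) \<partial>lborel)
        + Ent (\<rho>n n t) \<le> Ent (\<rho>n n 0)"
    and initial: "\<And>n. Ent (\<rho>n n 0) \<le> ennreal Ebar"
begin

abbreviation "Rn n r \<equiv> Diss (\<kappa>n n) (\<rho>n n r) (jn n r)"
abbreviation "Fn n r \<equiv> Fisher (\<kappa>n n) (\<rho>n n r)"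

lemma Abar: "0 \<le> Abar" using a_nonneg[of 0 undefined] a_le[of 0 undefined] by simp

lemma rho: "t \<in> {0..T} \<Longrightarrow> \<rho>n n t \<in> finite_borel_measures"
  using CE[of n] by (auto simp: CE_def)

lemma rho': "t \<in> {0..T} \<Longrightarrow> sets (\<rho>n n t) = sets borel" "t \<in> {0..T} \<Longrightarrow> finite_measure (\<rho>n n t)"
  using rho[of t n] by (auto simp: finite_borel_measures_def)

lemma entropy_le: "t \<in> {0..T} \<Longrightarrow> Ent (\<rho>n n t) \<le> ennreal Ebar"
  using energy[of t n] initial[of n] by (meson add_increasing order_trans zero_le order_refl)

lemma entropy_fin: "t \<in> {0..T} \<Longrightarrow> Ent (\<rho>n n t) < \<infinity>"
  using entropy_le[of t n] by (auto intro: le_less_trans)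

lemma dissipation_le: "(\<integral>\<^sup>+ r\<in>{0..T}. Rn n r \<partial>lborel) \<le> ennreal Ebar"
proof -
  have "(\<integral>\<^sup>+ r\<in>{0..T}. Rn n r \<partial>lborel) \<le> (\<integral>\<^sup>+ r\<in>{0..T}. (Rn n r + Fn n r) \<partial>lborel)"
    by (intro nn_integral_mono mult_right_mono) auto
  also have "\<dots> \<le> (\<integral>\<^sup>+ r\<in>{0..T}. (Rn n r + Fn n r) \<partial>lborel) + Ent (\<rho>n n T)" by simp
  also have "\<dots> \<le> ennreal Ebar" using energy[of T n] initial[of n] T by auto
  finally show ?thesis .
qed

lemma uniform_bounds: "\<epsilon> > 0 \<Longrightarrow> \<exists>m\<ge>0. \<forall>n. \<forall>t\<in>{0..T}. uniform_bound m \<epsilon> (\<rho>n n t)"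
  using entropy_uniform_bound[of \<epsilon> Ebar] Ebar rho entropy_le by meson

lemma curve: "flux_curve T (jn n)"
  using CE[of n] by (auto simp: CE_def intro!: flux_curve.intro)

abbreviation "Jp n \<equiv> weighted T (\<lambda>t. fst (jn n t))"
abbreviation "Jm n \<equiv> weighted T (\<lambda>t. snd (jn n t))"
abbreviation "SJp n \<equiv> semidirect lborel (Jp n)"
abbreviation "SJm n \<equiv> semidirect lborel (Jm n)"

lemma fam: "weighted_family T (\<lambda>t. fst (jn n t))" "weighted_family T (\<lambda>t. snd (jn n t))"
  using flux_curve.families[OF curve] by (auto intro: weighted_family.intro)

lemmas Jp_kernel = weighted_family.weighted_kernel[OF fam(1)]
lemmas Jm_kernel = weighted_family.weighted_kernel[OF fam(2)]
lemmas Jp_finite = weighted_family.finite_J[OF fam(1)]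
lemmas Jm_finite = weighted_family.finite_J[OF fam(2)]

definition "Lam = semidirect (time_interval T) (\<lambda>_. lam)"
abbreviation "Lam_dens g \<equiv> density Lam (\<lambda>z. ennreal (g z))"

lemma lam_kernel: "finite_kernel (\<lambda>_::real. lam)"
  by (rule finite_kernel_const[OF sets_lam finite_lam])

lemma Lam [simp]: "sets Lam = sets borel" "space Lam = UNIV" "measurable Lam N = measurable borel N"
  by (simp_all add: Lam_def)

lemma nn_integral_Lam: "f \<in> borel_measurable borel \<Longrightarrow>
    (\<integral>\<^sup>+ z. f z \<partial>Lam) = (\<integral>\<^sup>+ t\<in>{0..T}. (\<integral>\<^sup>+ z. f (t, z) \<partial>lam) \<partial>lborel)"
  unfolding Lam_def using kernel_nn_integral_measurable[OF lam_kernel, of f]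
  by (simp add: nn_integral_semidirect[OF lam_kernel] nn_integral_time_interval)

lemma emeasure_Lam: "B \<in> sets borel \<Longrightarrow> emeasure Lam B = (\<integral>\<^sup>+ t\<in>{0..T}. emeasure lam (Pair t -` B) \<partial>lborel)"
  unfolding Lam_def using kernel_emeasure_measurable[OF lam_kernel, of B]
  by (simp add: emeasure_semidirect[OF lam_kernel] nn_integral_time_interval)

lemma finite_Lam: "finite_measure Lam"
  unfolding Lam_def
proof (rule finite_measure_semidirect[OF lam_kernel])
  show "(\<integral>\<^sup>+ x. emeasure lam UNIV \<partial>time_interval T) < \<infinity>"
    using finite_measure.emeasure_finite[OF finite_lam] finite_measure.emeasure_finite[OF finite_time_interval, of T UNIV]
    by (simp add: ennreal_mult_less_top less_top)
qed simp

lemma activity_le: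
  "activity (a n) \<rho> z \<le> Abar * \<alpha>bound * (1 + dens \<pi> \<rho> (fst z) + dens \<pi> \<rho> (snd z))"
proof -
  have "activity (a n) \<rho> z \<le> Abar * (\<alpha>bound * (1 + dens \<pi> \<rho> (fst z) + dens \<pi> \<rho> (snd z)))"
    unfolding activity_def by (intro mult_mono a_le alpha_bound alpha_nonneg dens_nonneg Abar)
  then show ?thesis by (simp add: mult.assoc)
qed

text \<open>Young's inequality with a slope proportional to the weight: the quadratic bound on
  \<open>\<psi>s\<close> supplies the factor \<open>cutdist\<^sup>2\<close> that turns
  \<open>\<theta>\<close> into \<open>lam\<close>. The linear growth of \<open>\<alpha>\<close>
  leaves the terms 1, \<open>u\<close>, \<open>v\<close>, whence \<open>1 + 2 * m\<close>, and
  uniform integrability of the two densities costs \<open>K0 * \<epsilon>\<close> each.\<close>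

lemma flux_slice_bound:
  assumes L: "L > 0" and CL: "CL \<ge> 0" "\<And>s. s \<in> {0..1} \<Longrightarrow> \<psi>s (L * s) \<le> CL * s\<^sup>2"
    and ub: "uniform_bound m \<epsilon> (\<rho>n n t)" "m \<ge> 0" "\<epsilon> \<ge> 0" and t: "t \<in> {0..T}" and B: "B \<in> sets borel"
  shows "ennreal L * (emeasure (Jp n t) B + emeasure (Jm n t) B)
    \<le> Rn n t + ennreal (CL * (Abar * \<alpha>bound)) * (ennreal (1 + 2 * m) * emeasure lam B + ennreal (2 * K0 * \<epsilon>))"
proof -
  let ?u = "\<lambda>z. dens \<pi> (\<rho>n n t) (fst z)" and ?v = "\<lambda>z. dens \<pi> (\<rho>n n t) (snd z)"
  let ?C = "CL * (Abar * \<alpha>bound)"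
  have C0: "0 \<le> ?C" using CL(1) Abar alpha_bound_pos by simp
  note sf = flux_curve.sets_flux[OF curve t, of n] and j = flux_curve.flux[OF curve t, of n]
  define \<xi> where "\<xi> z = L * cutdist z * indicator B z" for z
  have \<xi>m: "\<xi> \<in> borel_measurable borel" unfolding \<xi>_def using B by measurable
  have \<xi>0: "0 \<le> \<xi> z" for z using L by (simp add: \<xi>_def cutdist_bounds)
  have J: "ennreal L * emeasure (Jp n t) B \<le> (\<integral>\<^sup>+ z. ennreal (\<xi> z) \<partial>fst (jn n t))"
    "ennreal L * emeasure (Jm n t) B \<le> (\<integral>\<^sup>+ z. ennreal (\<xi> z) \<partial>snd (jn n t))"
  proof -
    have *: "ennreal L * (\<integral>\<^sup>+ z. ennreal (cutdist z) * indicator B z \<partial>M) = (\<integral>\<^sup>+ z. ennreal (\<xi> z) \<partial>M)" if "sets M = sets borel" for M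
    proof -
      have "(\<integral>\<^sup>+ z. ennreal (\<xi> z) \<partial>M) = (\<integral>\<^sup>+ z. ennreal L * (ennreal (cutdist z) * indicator B z) \<partial>M)"
        using L by (intro nn_integral_cong) (auto simp: \<xi>_def indicator_def ennreal_mult cutdist_bounds)
      also have "\<dots> = ennreal L * (\<integral>\<^sup>+ z. ennreal (cutdist z) * indicator B z \<partial>M)"
        using B by (intro nn_integral_cmult) (auto simp: measurable_cong_sets[OF that refl])
      finally show ?thesis by simp
    qed
    show "ennreal L * emeasure (Jp n t) B \<le> (\<integral>\<^sup>+ z. ennreal (\<xi> z) \<partial>fst (jn n t))"
      "ennreal L * emeasure (Jm n t) B \<le> (\<integral>\<^sup>+ z. ennreal (\<xi> z) \<partial>snd (jn n t))"
      unfolding weighted_family.emeasure_weighted[OF fam(1) B] weighted_family.emeasure_weighted[OF fam(2) B]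
      using t *[OF sf(1)] *[OF sf(2)] by (auto simp: clipped_def)
  qed
  have "2 * (ennreal L * (emeasure (Jp n t) B + emeasure (Jm n t) B))
      \<le> 2 * ((\<integral>\<^sup>+ z. ennreal (\<xi> z) \<partial>fst (jn n t)) + (\<integral>\<^sup>+ z. ennreal (\<xi> z) \<partial>snd (jn n t)))"
    using J by (intro mult_left_mono) (auto simp: distrib_left intro: add_mono)
  also have "\<dots> \<le> 2 * Rn n t + (\<integral>\<^sup>+ z. ennreal (\<psi>s (\<xi> z) * activity (a n) (\<rho>n n t) z) \<partial>\<theta>)"
    by (rule dissipation_Young[OF edge a a_nonneg j \<xi>m \<xi>0])
  also have "(\<integral>\<^sup>+ z. ennreal (\<psi>s (\<xi> z) * activity (a n) (\<rho>n n t) z) \<partial>\<theta>)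
      \<le> (\<integral>\<^sup>+ z. ennreal ((cutdist z)\<^sup>2) * (ennreal ?C * (indicator B z + ennreal (?u z) * indicator B z + ennreal (?v z) * indicator B z)) \<partial>\<theta>)"
  proof (rule nn_integral_mono)
    fix z
    have nn: "0 \<le> ?u z" "0 \<le> ?v z" by (auto simp: dens_nonneg)
    show "ennreal (\<psi>s (\<xi> z) * activity (a n) (\<rho>n n t) z) \<le> ennreal ((cutdist z)\<^sup>2) * (ennreal ?C * (indicator B z + ennreal (?u z) * indicator B z + ennreal (?v z) * indicator B z))"
    proof (cases "z \<in> B")
      case True
      have "\<psi>s (\<xi> z) * activity (a n) (\<rho>n n t) z \<le> (CL * (cutdist z)\<^sup>2) * (Abar * \<alpha>bound * (1 + ?u z + ?v z))"
        using True CL(2)[of "cutdist z"] CL(1) by (intro mult_mono activity_le activity_nonneg a_nonneg) (auto simp: \<xi>_def cutdist_bounds)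
      then have "ennreal (\<psi>s (\<xi> z) * activity (a n) (\<rho>n n t) z) \<le> ennreal ((cutdist z)\<^sup>2 * (?C * (1 + ?u z + ?v z)))"
        by (intro ennreal_leI) (simp add: algebra_simps)
      also have "\<dots> = ennreal ((cutdist z)\<^sup>2) * (ennreal ?C * (1 + ennreal (?u z) + ennreal (?v z)))"
        using nn C0 by (simp add: ennreal_mult)
      finally show ?thesis using True by simp
    qed (simp add: \<xi>_def psis_0)
  qed
  also have "\<dots> = (\<integral>\<^sup>+ z. ennreal ?C * (indicator B z + ennreal (?u z) * indicator B z + ennreal (?v z) * indicator B z) \<partial>lam)"
    using B by (subst nn_integral_lam) auto
  also have "\<dots> = ennreal ?C * (emeasure lam B + (\<integral>\<^sup>+ z. ennreal (?u z) * indicator B z \<partial>lam) + (\<integral>\<^sup>+ z. ennreal (?v z) * indicator B z \<partial>lam))"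
    using B by (simp add: nn_integral_cmult nn_integral_add)
  also have "\<dots> \<le> ennreal ?C * (emeasure lam B + (ennreal m * emeasure lam B + ennreal (K0 * \<epsilon>)) + (ennreal m * emeasure lam B + ennreal (K0 * \<epsilon>)))"
  proof -
    have h: "indicator B \<in> borel_measurable borel" "\<And>z. indicator B z \<le> (1::ennreal)" using B by (auto simp: indicator_def)
    have "(\<integral>\<^sup>+ z. indicator B z \<partial>lam) = emeasure lam B" using B by simp
    then show ?thesis using lam_dens_bound[OF rho[OF t] entropy_fin[OF t] ub h] by (intro mult_left_mono add_mono) auto
  qed
  also have "emeasure lam B + (ennreal m * emeasure lam B + ennreal (K0 * \<epsilon>)) + (ennreal m * emeasure lam B + ennreal (K0 * \<epsilon>))
      = ennreal (1 + 2 * m) * emeasure lam B + ennreal (2 * K0 * \<epsilon>)"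
  proof -
    have "ennreal (2 * K0 * \<epsilon>) = ennreal (K0 * \<epsilon> + K0 * \<epsilon>)" by (simp add: algebra_simps)
    also have "\<dots> = ennreal (K0 * \<epsilon>) + ennreal (K0 * \<epsilon>)" using ub(3) K0_ge_1 by (intro ennreal_plus) auto
    finally have e1: "ennreal (2 * K0 * \<epsilon>) = ennreal (K0 * \<epsilon>) + ennreal (K0 * \<epsilon>)" .
    have "ennreal (1 + 2 * m) = ennreal (1 + m + m)" by (simp add: algebra_simps)
    also have "\<dots> = 1 + ennreal m + ennreal m"
      by (simp only: ennreal_plus[OF add_nonneg_nonneg[OF zero_le_one ub(2)] ub(2)] ennreal_plus[OF zero_le_one ub(2)] ennreal_1)
    finally show ?thesis unfolding e1 by (simp add: distrib_right distrib_left ac_simps)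
  qed
  \<comment> \<open>The second term is doubled only so that the common factor 2 cancels.\<close>
  also have "2 * Rn n t + ennreal ?C * (ennreal (1 + 2 * m) * emeasure lam B + ennreal (2 * K0 * \<epsilon>))
      \<le> 2 * (Rn n t + ennreal ?C * (ennreal (1 + 2 * m) * emeasure lam B + ennreal (2 * K0 * \<epsilon>)))"
    unfolding distrib_left[of 2] mult_2[of "ennreal ?C * _"] by (intro add_left_mono) simp
  finally have "2 * (ennreal L * (emeasure (Jp n t) B + emeasure (Jm n t) B))
      \<le> 2 * (Rn n t + ennreal ?C * (ennreal (1 + 2 * m) * emeasure lam B + ennreal (2 * K0 * \<epsilon>)))"
    by (simp add: add_left_mono)
  then show ?thesis by (subst (asm) ennreal_mult_le_mult_iff) auto
qed

text \<open>The slice bound integrated over time. The rate \<open>Rn n\<close> is not known to be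
  measurable, so the lower integral on the right is split off by
  \<open>nn_integral_le_add_nonmeasurable\<close>.\<close>

lemma flux_bound:
  assumes L: "L > 0" and CL: "CL \<ge> 0" "\<And>s. s \<in> {0..1} \<Longrightarrow> \<psi>s (L * s) \<le> CL * s\<^sup>2"
    and ub: "\<And>t. t \<in> {0..T} \<Longrightarrow> uniform_bound m \<epsilon> (\<rho>n n t)" and m: "m \<ge> 0" "\<epsilon> \<ge> 0" and B: "B \<in> sets borel"
  shows "L * (measure (SJp n) B + measure (SJm n) B)
    \<le> Ebar + CL * (Abar * \<alpha>bound) * ((1 + 2 * m) * measure Lam B + 2 * K0 * \<epsilon> * T)"
proof -
  let ?C = "CL * (Abar * \<alpha>bound)"
  have C0: "0 \<le> ?C" using CL(1) Abar alpha_bound_pos by simp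
  have sec: "Pair t -` B \<in> sets borel" for t by (rule sets_Pair_section[OF B])
  let ?X = "\<lambda>t. ennreal L * (emeasure (Jp n t) (Pair t -` B) + emeasure (Jm n t) (Pair t -` B))"
  let ?Z = "\<lambda>t. (ennreal ?C * (ennreal (1 + 2 * m) * emeasure lam (Pair t -` B) + ennreal (2 * K0 * \<epsilon>))) * indicator {0..T} t"
  have em: "(\<lambda>t. emeasure (Jp n t) (Pair t -` B)) \<in> borel_measurable borel"
    "(\<lambda>t. emeasure (Jm n t) (Pair t -` B)) \<in> borel_measurable borel"
    "(\<lambda>t. emeasure lam (Pair t -` B)) \<in> borel_measurable borel"
    by (rule kernel_emeasure_measurable[OF Jp_kernel B] kernel_emeasure_measurable[OF Jm_kernel B] kernel_emeasure_measurable[OF lam_kernel B])+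
  have "(\<integral>\<^sup>+ t. ?X t \<partial>lborel) \<le> (\<integral>\<^sup>+ t\<in>{0..T}. Rn n t \<partial>lborel) + (\<integral>\<^sup>+ t. ?Z t \<partial>lborel)"
  proof (rule nn_integral_le_add_nonmeasurable)
    show "?X \<in> borel_measurable lborel" "?Z \<in> borel_measurable lborel" using em by auto
    have "emeasure lam (Pair t -` B) < \<infinity>" for t
      using finite_measure.emeasure_finite[OF finite_lam] by (simp add: less_top)
    then show "AE t in lborel. ?Z t < \<infinity>" by (auto simp: ennreal_mult_less_top indicator_def)
    show "AE t in lborel. ?X t \<le> Rn n t * indicator {0..T} t + ?Z t"
    proof (rule AE_I2)
      fix t
      show "?X t \<le> Rn n t * indicator {0..T} t + ?Z t"
      proof (cases "t \<in> {0..T}")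
        case True
        then show ?thesis using flux_slice_bound[OF L CL ub[OF True] m True sec[of t]] by simp
      next
        case False
        then have "Jp n t = null_measure borel" "Jm n t = null_measure borel" by (auto simp: weighted_def)
        then show ?thesis by simp
      qed
    qed
  qed
  also have "\<dots> \<le> ennreal Ebar + (\<integral>\<^sup>+ t. ?Z t \<partial>lborel)" using dissipation_le by (simp add: add_right_mono)
  also have "(\<integral>\<^sup>+ t. ?Z t \<partial>lborel) = ennreal ?C * (ennreal (1 + 2 * m) * emeasure Lam B + ennreal (2 * K0 * \<epsilon>) * ennreal T)"
  proof -
    have "(\<integral>\<^sup>+ t. ?Z t \<partial>lborel) = (\<integral>\<^sup>+ t. ennreal ?C * (ennreal (1 + 2 * m) * (emeasure lam (Pair t -` B) * indicator {0..T} t) + ennreal (2 * K0 * \<epsilon>) * indicator {0..T} t) \<partial>lborel)"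
      by (intro nn_integral_cong) (auto simp: indicator_def)
    also have "\<dots> = ennreal ?C * (ennreal (1 + 2 * m) * emeasure Lam B + ennreal (2 * K0 * \<epsilon>) * (\<integral>\<^sup>+ t. indicator {0..T} t \<partial>lborel))"
      using em(3) by (simp add: nn_integral_cmult nn_integral_add emeasure_Lam[OF B])
    finally show ?thesis using T by simp
  qed
  also have "(\<integral>\<^sup>+ t. ?X t \<partial>lborel) = ennreal L * (emeasure (SJp n) B + emeasure (SJm n) B)"
    using em B by (simp add: nn_integral_cmult nn_integral_add emeasure_semidirect[OF Jp_kernel] emeasure_semidirect[OF Jm_kernel])
  finally have "ennreal L * (emeasure (SJp n) B + emeasure (SJm n) B)
      \<le> ennreal Ebar + ennreal ?C * (ennreal (1 + 2 * m) * emeasure Lam B + ennreal (2 * K0 * \<epsilon>) * ennreal T)" .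
  then have "ennreal (L * (measure (SJp n) B + measure (SJm n) B))
      \<le> ennreal (Ebar + ?C * ((1 + 2 * m) * measure Lam B + 2 * K0 * \<epsilon> * T))"
    using L C0 m T Ebar K0_ge_1
    by (simp add: finite_measure.emeasure_eq_measure[OF Jp_finite] finite_measure.emeasure_eq_measure[OF Jm_finite]
        finite_measure.emeasure_eq_measure[OF finite_Lam] ennreal_mult ennreal_plus)
  then show ?thesis
    using Ebar C0 m T K0_ge_1 by (subst (asm) ennreal_le_iff) (auto intro!: add_nonneg_nonneg mult_nonneg_nonneg)
qed

lemma flux_bounded: "\<exists>C. \<forall>n. \<forall>B\<in>sets borel. measure (SJp n) B \<le> C \<and> measure (SJm n) B \<le> C"
proof -
  obtain CL where CL: "CL \<ge> 0" "\<And>s. s \<in> {0..1} \<Longrightarrow> \<psi>s (1 * s) \<le> CL * s\<^sup>2" using psis_quadratic_bound[of 1] by auto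
  obtain m where m: "m \<ge> 0" "\<And>n t. t \<in> {0..T} \<Longrightarrow> uniform_bound m 1 (\<rho>n n t)" using uniform_bounds[of 1] by auto
  define C where "C = Ebar + CL * (Abar * \<alpha>bound) * ((1 + 2 * m) * measure Lam UNIV + 2 * K0 * 1 * T)"
  have "measure (SJp n) UNIV + measure (SJm n) UNIV \<le> C" for n
    using flux_bound[OF _ CL m(2) m(1), where n = n and B = UNIV] by (simp add: C_def)
  moreover have "measure (SJp n) B \<le> measure (SJp n) UNIV" "measure (SJm n) B \<le> measure (SJm n) UNIV" for n B
    by (rule order_trans[OF finite_measure.bounded_measure[OF Jp_finite]], simp)
      (rule order_trans[OF finite_measure.bounded_measure[OF Jm_finite]], simp)
  ultimately show ?thesis
    by (intro exI[of _ C]) (smt (verit) measure_nonneg)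
qed

lemma flux_uniformly_ac: "uniformly_ac Lam SJp" "uniformly_ac Lam SJm"
proof -
  have *: "\<exists>\<delta>>0. \<forall>n. \<forall>B\<in>sets borel. measure Lam B < \<delta> \<longrightarrow> measure (SJp n) B + measure (SJm n) B < \<eta>" if \<eta>: "\<eta> > 0" for \<eta>
  proof -
    \<comment> \<open>The choices are made in the order \<open>L\<close>, \<open>\<epsilon>\<close>,
      \<open>m\<close>, \<open>\<delta>\<close>: a large slope \<open>L\<close> beats the energy
      bound, \<open>\<epsilon>\<close> the error of uniform integrability, and
      \<open>\<delta>\<close> the measure of the set. Each of the three terms is then at most
      \<open>L * \<eta> / 3\<close>, the energy strictly, because
      \<open>L * \<eta> / 3 = Ebar + 1\<close>.\<close>
    define L where "L = 3 * (Ebar + 1) / \<eta>"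
    have L: "L > 0" using Ebar \<eta> by (simp add: L_def)
    obtain CL where CL: "CL \<ge> 0" "\<And>s. s \<in> {0..1} \<Longrightarrow> \<psi>s (L * s) \<le> CL * s\<^sup>2" using psis_quadratic_bound[of L] L by auto
    define C where "C = CL * (Abar * \<alpha>bound) + 1"
    have C: "C > 0" "CL * (Abar * \<alpha>bound) \<le> C" using CL(1) Abar alpha_bound_pos by (auto simp: C_def add_nonneg_pos)
    define \<epsilon> where "\<epsilon> = L * \<eta> / 3 / (C * (2 * K0 * T))"
    have \<epsilon>: "\<epsilon> > 0" using L \<eta> C K0_ge_1 T by (simp add: \<epsilon>_def)
    obtain m where m: "m \<ge> 0" "\<And>n t. t \<in> {0..T} \<Longrightarrow> uniform_bound m \<epsilon> (\<rho>n n t)" using uniform_bounds[OF \<epsilon>] by auto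
    define \<delta> where "\<delta> = L * \<eta> / 3 / (C * (1 + 2 * m))"
    have \<delta>: "\<delta> > 0" using L \<eta> C m(1) by (simp add: \<delta>_def)
    have "measure (SJp n) B + measure (SJm n) B < \<eta>" if B: "B \<in> sets borel" "measure Lam B < \<delta>" for n B
    proof -
      have nn: "0 \<le> (1 + 2 * m) * measure Lam B + 2 * K0 * \<epsilon> * T" using m(1) K0_ge_1 \<epsilon> T by simp
      have "L * (measure (SJp n) B + measure (SJm n) B) \<le> Ebar + CL * (Abar * \<alpha>bound) * ((1 + 2 * m) * measure Lam B + 2 * K0 * \<epsilon> * T)"
        by (rule flux_bound[OF L CL m(2) m(1)]) (use \<epsilon> B in auto)
      also have "\<dots> \<le> Ebar + C * ((1 + 2 * m) * measure Lam B + 2 * K0 * \<epsilon> * T)"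
        using C(2) nn by (intro add_left_mono mult_right_mono)
      also have "\<dots> = Ebar + (C * (1 + 2 * m)) * measure Lam B + C * (2 * K0 * T) * \<epsilon>" by (simp add: algebra_simps)
      also have "(C * (1 + 2 * m)) * measure Lam B \<le> (C * (1 + 2 * m)) * \<delta>"
        using B(2) C m(1) by (intro mult_left_mono) auto
      also have "(C * (1 + 2 * m)) * \<delta> = L * \<eta> / 3" using C m(1) by (simp add: \<delta>_def)
      also have "C * (2 * K0 * T) * \<epsilon> = L * \<eta> / 3" using C K0_ge_1 T by (simp add: \<epsilon>_def)
      also have "Ebar + L * \<eta> / 3 + L * \<eta> / 3 < L * \<eta>"
      proof -
        have "L * \<eta> / 3 = Ebar + 1" using \<eta> by (simp add: L_def)
        then show ?thesis by linarith
      qed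
      finally have "L * (measure (SJp n) B + measure (SJm n) B) < L * \<eta>" by simp
      then show ?thesis using L by simp
    qed
    then show ?thesis using \<delta> by blast
  qed
  have le: "measure M B < \<eta>" if "measure M B + measure N B < \<eta>" for M N :: "(real \<times> 'v \<times> 'v) measure" and B \<eta>
    using that measure_nonneg[of N B] by linarith
  show "uniformly_ac Lam SJp" "uniformly_ac Lam SJm"
    unfolding uniformly_ac_def using * le by (simp_all, metis, metis add.commute)
qed

section \<open>Equicontinuity in time\<close>

lemma integral_rho_diff:
  assumes f: "f \<in> Lip_b" and st: "0 \<le> s" "s \<le> t" "t \<le> T"
  shows "(\<integral>x. f x \<partial>\<rho>n n t) - (\<integral>x. f x \<partial>\<rho>n n s)
    = (\<integral>z. indicator {s..t} (fst z) * ((f (snd (snd z)) - f (fst (snd z))) / cutdist (snd z)) \<partial>SJp n)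
    - (\<integral>z. indicator {s..t} (fst z) * ((f (snd (snd z)) - f (fst (snd z))) / cutdist (snd z)) \<partial>SJm n)"
proof -
  have "(\<integral>x. f x \<partial>\<rho>n n t) - (\<integral>x. f x \<partial>\<rho>n n s) = (LINT r:{s..t}|lborel. flux_integral (jn n r) off_diagonal (\<lambda>(x, y). f y - f x))"
    using CE[of n] f st unfolding CE_def by auto
  then show ?thesis using flux_curve.flux_integral_time[OF curve f st(1,3)] by simp
qed

lemma measure_Lam_strip:
  assumes "0 \<le> s" "s \<le> t" "t \<le> T"
  shows "measure Lam ({s..t} \<times> UNIV) = (t - s) * measure lam UNIV"
proof -
  have B: "{s..t} \<times> UNIV \<in> sets (borel :: (real \<times> 'v \<times> 'v) measure)" by (intro borel_Times) auto
  have "emeasure Lam ({s..t} \<times> UNIV) = (\<integral>\<^sup>+ r. emeasure lam UNIV * indicator {s..t} r \<partial>lborel)"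
    unfolding emeasure_Lam[OF B] using assms by (intro nn_integral_cong) (auto simp: indicator_def vimage_def)
  also have "\<dots> = emeasure lam UNIV * ennreal (t - s)" using assms by (subst nn_integral_cmult_indicator) auto
  finally show ?thesis using assms by (simp add: measure_def enn2real_mult mult.commute)
qed

text \<open>A short time strip has small reference measure, hence carries little weighted flux,
  uniformly in \<open>n\<close>; the difference quotient of \<open>f\<close> with respect to the
  weight is bounded.\<close>

lemma Lip_equicontinuous:
  assumes f: "f \<in> Lip_b" and \<eta>: "\<eta> > 0"
  shows "\<exists>\<delta>>0. \<forall>n. \<forall>s\<in>{0..T}. \<forall>t\<in>{0..T}. \<bar>t - s\<bar> < \<delta> \<longrightarrow> \<bar>(\<integral>x. f x \<partial>\<rho>n n t) - (\<integral>x. f x \<partial>\<rho>n n s)\<bar> < \<eta>"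
proof -
  obtain c where c: "\<And>z. \<bar>(f (snd z) - f (fst z)) / cutdist z\<bar> \<le> c" using Lip_b_gradient_bound[OF f] by blast
  have c0: "c \<ge> 0" using c abs_ge_zero order_trans by blast
  \<comment> \<open>The factor 2 accounts for the two parts of the flux, and the added 1 covers
    \<open>c = 0\<close>.\<close>
  define \<eta>' where "\<eta>' = \<eta> / (2 * (c + 1))"
  have \<eta>': "\<eta>' > 0" using c0 \<eta> by (simp add: \<eta>'_def)
  obtain \<delta>1 where \<delta>1: "\<delta>1 > 0" "\<And>n B. B \<in> sets Lam \<Longrightarrow> measure Lam B < \<delta>1 \<Longrightarrow> measure (SJp n) B < \<eta>'"
    by (rule uniformly_acE[OF flux_uniformly_ac(1) \<eta>']) blast
  obtain \<delta>2 where \<delta>2: "\<delta>2 > 0" "\<And>n B. B \<in> sets Lam \<Longrightarrow> measure Lam B < \<delta>2 \<Longrightarrow> measure (SJm n) B < \<eta>'"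
    by (rule uniformly_acE[OF flux_uniformly_ac(2) \<eta>']) blast
  define \<delta> where "\<delta> = min \<delta>1 \<delta>2 / (measure lam UNIV + 1)"
  have lp: "measure lam UNIV + 1 > 0" by (simp add: add_nonneg_pos)
  have \<delta>: "\<delta> > 0" using \<delta>1(1) \<delta>2(1) lp by (simp add: \<delta>_def)
  let ?q = "\<lambda>s t z. indicator {s..t} (fst z) * ((f (snd (snd z)) - f (fst (snd z))) / cutdist (snd z))"
  have main: "\<bar>(\<integral>x. f x \<partial>\<rho>n n t) - (\<integral>x. f x \<partial>\<rho>n n s)\<bar> < \<eta>" if st: "0 \<le> s" "s \<le> t" "t \<le> T" "t - s < \<delta>" for n s t
  proof -
    have B: "{s..t} \<times> UNIV \<in> sets (borel :: (real \<times> 'v \<times> 'v) measure)" by (intro borel_Times) auto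
    have "measure Lam ({s..t} \<times> UNIV) \<le> \<delta> * measure lam UNIV"
      unfolding measure_Lam_strip[OF st(1-3)] using st(4) by (intro mult_right_mono) auto
    also have "\<dots> < min \<delta>1 \<delta>2" unfolding \<delta>_def using \<delta>1(1) \<delta>2(1) lp by (simp add: field_simps min_def)
    finally have small: "measure (SJp n) ({s..t} \<times> UNIV) < \<eta>'" "measure (SJm n) ({s..t} \<times> UNIV) < \<eta>'"
      using \<delta>1(2)[of "{s..t} \<times> UNIV"] \<delta>2(2)[of "{s..t} \<times> UNIV"] B by auto
    have b: "\<bar>\<integral>z. ?q s t z \<partial>M\<bar> \<le> c * measure M ({s..t} \<times> UNIV)" if M: "finite_measure M" "sets M = sets borel" for M
    proof -
      interpret finite_measure M by fact
      have i: "integrable M (\<lambda>z. c * indicator ({s..t} \<times> UNIV) z)"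
        using B M by (intro integrable_mult_right integrable_real_indicator) (auto simp: less_top[symmetric])
      have "\<bar>\<integral>z. ?q s t z \<partial>M\<bar> \<le> (\<integral>z. \<bar>?q s t z\<bar> \<partial>M)" by (rule integral_abs_bound)
      also have "\<dots> \<le> (\<integral>z. c * indicator ({s..t} \<times> UNIV) z \<partial>M)"
        by (rule integral_mono'[OF i]) (use c c0 in \<open>auto simp: abs_mult indicator_def mem_Times_iff\<close>)
      finally have "\<bar>\<integral>z. ?q s t z \<partial>M\<bar> \<le> (\<integral>z. c * indicator ({s..t} \<times> UNIV) z \<partial>M)" .
      then show ?thesis using B M sets_eq_imp_space_eq[OF M(2)] by simp
    qed
    have "\<bar>(\<integral>x. f x \<partial>\<rho>n n t) - (\<integral>x. f x \<partial>\<rho>n n s)\<bar> \<le> c * measure (SJp n) ({s..t} \<times> UNIV) + c * measure (SJm n) ({s..t} \<times> UNIV)"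
      unfolding integral_rho_diff[OF f st(1-3)]
      by (rule order_trans[OF abs_triangle_ineq4]) (intro add_mono b Jp_finite Jm_finite sets_semidirect)
    also have "\<dots> \<le> c * \<eta>' + c * \<eta>'" using small c0 by (intro add_mono mult_left_mono) auto
    also have "\<dots> < \<eta>"
    proof -
      have "2 * (c + 1) * \<eta>' = \<eta>" using c0 by (simp add: \<eta>'_def)
      then have "c * \<eta>' + c * \<eta>' = \<eta> - 2 * \<eta>'" by (simp add: algebra_simps)
      then show ?thesis using \<eta>' by simp
    qed
    finally show ?thesis .
  qed
  have "\<bar>(\<integral>x. f x \<partial>\<rho>n n t) - (\<integral>x. f x \<partial>\<rho>n n s)\<bar> < \<eta>" if "s \<in> {0..T}" "t \<in> {0..T}" "\<bar>t - s\<bar> < \<delta>" for n s t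
    using main[of s t n] main[of t s n] that by (cases "s \<le> t") (auto simp: abs_minus_commute)
  then show ?thesis using \<delta> by blast
qed

lemma measure_bound_real:
  assumes ub: "uniform_bound m \<epsilon> \<rho>" and \<rho>: "\<rho> \<in> finite_borel_measures" and m: "m \<ge> 0" "\<epsilon> \<ge> 0"
    and h: "h \<in> borel_measurable borel" "\<And>x. 0 \<le> h x" "\<And>x. h x \<le> (1::real)"
  shows "(\<integral>x. h x \<partial>\<rho>) \<le> m * (\<integral>x. h x \<partial>\<pi>) + \<epsilon>"
proof -
  have \<rho>': "sets \<rho> = sets borel" "finite_measure \<rho>" using \<rho> by (auto simp: finite_borel_measures_def)
  have i: "integrable M h" if "finite_measure M" "sets M = sets borel" for M
    by (rule finite_measure.integrable_const_bound[OF that(1), of _ 1])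
      (use h in \<open>auto simp: measurable_cong_sets[OF that(2) refl]\<close>)
  have e: "(\<integral>\<^sup>+ x. ennreal (h x) \<partial>M) = ennreal (\<integral>x. h x \<partial>M)" if "finite_measure M" "sets M = sets borel" for M
    by (rule nn_integral_eq_integral[OF i[OF that]]) (use h in auto)
  have "(\<integral>\<^sup>+ x. ennreal (h x) \<partial>\<rho>) \<le> ennreal m * (\<integral>\<^sup>+ x. ennreal (h x) \<partial>\<pi>) + ennreal \<epsilon>"
    using ub h unfolding uniform_bound_def by (auto simp: ennreal_le_1)
  then have "ennreal (\<integral>x. h x \<partial>\<rho>) \<le> ennreal (m * (\<integral>x. h x \<partial>\<pi>) + \<epsilon>)"
    unfolding e[OF \<rho>'(2,1)] e[OF pi(2,1)] using m h(2) by (simp add: ennreal_mult integral_nonneg_AE ennreal_plus)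
  then show ?thesis using m h(2) by (subst (asm) ennreal_le_iff) (auto intro!: add_nonneg_nonneg mult_nonneg_nonneg integral_nonneg_AE)
qed

lemma rho_uniformly_ac:
  assumes "\<And>n. t n \<in> {0..T}"
  shows "uniformly_ac \<pi> (\<lambda>n. \<rho>n (k n) (t n))"
  unfolding uniformly_ac_def
proof (intro allI impI)
  fix \<eta> :: real assume \<eta>: "\<eta> > 0"
  obtain m where m: "m \<ge> 0" "\<And>n t. t \<in> {0..T} \<Longrightarrow> uniform_bound m (\<eta> / 2) (\<rho>n n t)" using uniform_bounds[of "\<eta> / 2"] \<eta> by auto
  have "measure (\<rho>n (k n) (t n)) B < \<eta>" if B: "B \<in> sets \<pi>" "measure \<pi> B < \<eta> / (2 * (m + 1))" for n B
  proof -
    have Bb: "B \<in> sets borel" using B(1) pi(1) by simp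
    have "measure (\<rho>n (k n) (t n)) B \<le> m * measure \<pi> B + \<eta> / 2"
      using measure_bound_real[OF m(2)[OF assms] rho[OF assms] m(1), of "indicator B"] Bb \<eta> rho'(1)[OF assms] pi
        sets_eq_imp_space_eq[OF rho'(1)[OF assms]] by (simp add: indicator_le_1)
    also have "m * measure \<pi> B \<le> m * (\<eta> / (2 * (m + 1)))" using B(2) m(1) by (intro mult_left_mono) auto
    also have "m * (\<eta> / (2 * (m + 1))) < \<eta> / 2" using m(1) \<eta> by (simp add: field_simps)
    finally show ?thesis by simp
  qed
  then show "\<exists>\<delta>>0. \<forall>n. \<forall>B\<in>sets \<pi>. measure \<pi> B < \<delta> \<longrightarrow> measure (\<rho>n (k n) (t n)) B < \<eta>"
    using \<eta> m(1) by (intro exI[of _ "\<eta> / (2 * (m + 1))"]) auto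
qed

text \<open>A Lipschitz approximation of the indicator in \<open>L\<^sup>1\<close> of
  \<open>\<pi>\<close> is, by uniform integrability, an approximation for all
  \<open>\<rho>n n t\<close> simultaneously. Its error \<open>\<eta> / 3\<close>, composed of two
  parts \<open>\<eta> / 6\<close>, occurs at both times, and the Lipschitz function contributes the
  remaining third.\<close>

lemma measure_equicontinuous:
  assumes cl: "closed B" and \<eta>: "\<eta> > 0"
  shows "\<exists>\<delta>>0. \<forall>n. \<forall>s\<in>{0..T}. \<forall>t\<in>{0..T}. \<bar>t - s\<bar> < \<delta> \<longrightarrow> \<bar>measure (\<rho>n n t) B - measure (\<rho>n n s) B\<bar> < \<eta>"
proof -
  have B: "B \<in> sets borel" using cl by simp
  obtain m where m: "m \<ge> 0" "\<And>n t. t \<in> {0..T} \<Longrightarrow> uniform_bound m (\<eta> / 6) (\<rho>n n t)" using uniform_bounds[of "\<eta> / 6"] \<eta> by auto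
  obtain f where f: "f \<in> Lip_b" "\<And>x. 0 \<le> f x \<and> f x \<le> 1" "(\<integral>x. \<bar>indicator B x - f x\<bar> \<partial>\<pi>) < \<eta> / (6 * (m + 1))"
    using Lip_b_L1_approx[OF pi(2,1) cl, of "\<eta> / (6 * (m + 1))"] m(1) \<eta> by auto
  obtain \<delta> where \<delta>: "\<delta> > 0" "\<And>n s t. s \<in> {0..T} \<Longrightarrow> t \<in> {0..T} \<Longrightarrow> \<bar>t - s\<bar> < \<delta> \<Longrightarrow> \<bar>(\<integral>x. f x \<partial>\<rho>n n t) - (\<integral>x. f x \<partial>\<rho>n n s)\<bar> < \<eta> / 3"
    using Lip_equicontinuous[OF f(1), of "\<eta> / 3"] \<eta> by auto
  have fm: "f \<in> borel_measurable borel" by (rule Lip_b_measurable[OF f(1)])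
  have close: "\<bar>measure (\<rho>n n t) B - (\<integral>x. f x \<partial>\<rho>n n t)\<bar> < \<eta> / 3" if t: "t \<in> {0..T}" for n t
  proof -
    interpret finite_measure "\<rho>n n t" by (rule rho'(2)[OF t])
    have Bs: "B \<in> sets (\<rho>n n t)" using B rho'(1)[OF t] by simp
    note rm = measurable_cong_sets[OF rho'(1)[OF t, of n] refl]
    have i: "integrable (\<rho>n n t) f" "integrable (\<rho>n n t) (indicator B :: _ \<Rightarrow> real)"
      using f(2) fm B by (auto intro!: integrable_const_bound[of _ 1] simp: rm)
    have "measure (\<rho>n n t) B - (\<integral>x. f x \<partial>\<rho>n n t) = (\<integral>x. indicator B x - f x \<partial>\<rho>n n t)"
      using i B sets.sets_into_space[OF Bs] by (simp add: Int_absorb2)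
    then have "\<bar>measure (\<rho>n n t) B - (\<integral>x. f x \<partial>\<rho>n n t)\<bar> \<le> (\<integral>x. \<bar>indicator B x - f x\<bar> \<partial>\<rho>n n t)"
      by simp
    also have "\<dots> \<le> m * (\<integral>x. \<bar>indicator B x - f x\<bar> \<partial>\<pi>) + \<eta> / 6"
      using fm B abs_indicator_diff_le_1[OF f(2)] \<eta> by (intro measure_bound_real[OF m(2)[OF t] rho[OF t] m(1)]) auto
    also have "m * (\<integral>x. \<bar>indicator B x - f x\<bar> \<partial>\<pi>) \<le> m * (\<eta> / (6 * (m + 1)))" using f(3) m(1) by (intro mult_left_mono) auto
    also have "m * (\<eta> / (6 * (m + 1))) < \<eta> / 6" using m(1) \<eta> by (simp add: field_simps)
    finally show ?thesis by simp
  qed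
  have "\<bar>measure (\<rho>n n t) B - measure (\<rho>n n s) B\<bar> < \<eta>" if "s \<in> {0..T}" "t \<in> {0..T}" "\<bar>t - s\<bar> < \<delta>" for n s t
    using \<delta>(2)[OF that, of n] close[OF that(1), of n] close[OF that(2), of n] unfolding abs_less_iff by linarith
  then show ?thesis using \<delta>(1) by blast
qed

text \<open>Only countably many real sequences are extracted: masses of generating sets at rational
  times, and weighted fluxes of generating space-time sets. Uniform absolute continuity extends
  convergence to all Borel sets, and equicontinuity extends it to all times, so no further
  subsequence is taken.\<close>

lemma compactness:
  "\<exists>r \<rho> gp gm. strict_mono (r :: nat \<Rightarrow> nat) \<and>
     (\<forall>t\<in>{0..T}. \<rho> t \<in> finite_borel_measures \<and> absolutely_continuous \<pi> (\<rho> t) \<and>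
        (\<forall>B\<in>sets borel. (\<lambda>n. measure (\<rho>n (r n) t) B) \<longlonglongrightarrow> measure (\<rho> t) B)) \<and>
     gp \<in> borel_measurable borel \<and> gm \<in> borel_measurable borel \<and> (\<forall>z. 0 \<le> gp z) \<and> (\<forall>z. 0 \<le> gm z) \<and>
     finite_measure (Lam_dens gp) \<and> finite_measure (Lam_dens gm) \<and>
     (\<forall>B\<in>sets borel. (\<lambda>n. measure (SJp (r n)) B) \<longlonglongrightarrow> measure (Lam_dens gp) B) \<and>
     (\<forall>B\<in>sets borel. (\<lambda>n. measure (SJm (r n)) B) \<longlonglongrightarrow> measure (Lam_dens gm) B)"
proof -
  obtain G :: "'v set set" where G: "countable G" "Int_stable G" "UNIV \<in> G" "sets borel = sigma_sets UNIV G"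
    using ex_countable_Int_stable_generator by blast
  obtain H :: "(real \<times> 'v \<times> 'v) set set" where H: "countable H" "Int_stable H" "UNIV \<in> H" "sets borel = sigma_sets UNIV H"
    using ex_countable_Int_stable_generator by blast
  \<comment> \<open>Left summands index pairs of a rational time and a set of \<open>G\<close>;
    right summands pair a set of \<open>H\<close> with a sign of the flux.\<close>
  define I where "I = ((\<lambda>(q, C). Inl (real_of_rat q, C)) ` {(q, C). real_of_rat q \<in> {0..T} \<and> C \<in> G}) \<union> Inr ` ((UNIV :: bool set) \<times> H)"
  have "{(q::rat, C). real_of_rat q \<in> {0..T} \<and> C \<in> G} \<subseteq> UNIV \<times> G" by auto
  then have "countable {(q::rat, C). real_of_rat q \<in> {0..T} \<and> C \<in> G}" by (rule countable_subset) (use G(1) in auto)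
  then have cI: "countable I" unfolding I_def using H(1) by auto
  define x where "x i n = (case i of Inl (t, C) \<Rightarrow> measure (\<rho>n n t) C | Inr (b, C) \<Rightarrow> measure (if b then SJp n else SJm n) C)" for i n
  obtain Cb where Cb: "\<And>n B. B \<in> sets borel \<Longrightarrow> measure (SJp n) B \<le> Cb \<and> measure (SJm n) B \<le> Cb" using flux_bounded by blast
  have rb: "\<exists>C. \<forall>n. \<forall>t\<in>{0..T}. \<forall>B. measure (\<rho>n n t) B \<le> C"
  proof -
    obtain m where m: "m \<ge> 0" "\<And>n t. t \<in> {0..T} \<Longrightarrow> uniform_bound m 1 (\<rho>n n t)" using uniform_bounds[of 1] by auto
    have "measure (\<rho>n n t) B \<le> m * measure \<pi> UNIV + 1" if t: "t \<in> {0..T}" for n t B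
    proof -
      have "measure (\<rho>n n t) B \<le> measure (\<rho>n n t) UNIV"
        using finite_measure.bounded_measure[OF rho'(2)[OF t, of n], of B] sets_eq_imp_space_eq[OF rho'(1)[OF t, of n]] by simp
      also have "\<dots> \<le> m * measure \<pi> UNIV + 1"
        using measure_bound_real[OF m(2)[OF t, of n] rho[OF t] m(1), of "\<lambda>_. 1"] sets_eq_imp_space_eq[OF rho'(1)[OF t, of n]] pi by simp
      finally show ?thesis .
    qed
    then show ?thesis by blast
  qed
  then obtain Cr where Cr: "\<And>n t B. t \<in> {0..T} \<Longrightarrow> measure (\<rho>n n t) B \<le> Cr" by blast
  have bs: "Bseq (x i)" if "i \<in> I" for i
  proof (rule BseqI'[where K = "max Cr Cb"])
    fix n
    show "norm (x i n) \<le> max Cr Cb"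
      using that Cr Cb H(4) by (auto simp: I_def x_def split: if_splits intro: le_max_iff_disj[THEN iffD2])
  qed
  obtain r :: "nat \<Rightarrow> nat" where
    r: "strict_mono r" "\<And>i. i \<in> I \<Longrightarrow> convergent (\<lambda>n. x i (r n))"
    using ex_convergent_diagonal[OF cI, of x] bs by blast
  have cJ: "convergent (\<lambda>n. measure (SJp (r n)) B)" "convergent (\<lambda>n. measure (SJm (r n)) B)" if B: "B \<in> sets borel" for B
  proof -
    have "convergent (\<lambda>n. measure (SJp (r n)) C)" "convergent (\<lambda>n. measure (SJm (r n)) C)" if "C \<in> H" for C
      using r(2)[of "Inr (True, C)"] r(2)[of "Inr (False, C)"] that by (auto simp: I_def x_def)
    then show "convergent (\<lambda>n. measure (SJp (r n)) B)" "convergent (\<lambda>n. measure (SJm (r n)) B)"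
      by (auto intro!: convergent_on_generator[OF finite_Lam Lam(1) _ _ _ H(2-4) _ B] Jp_finite Jm_finite
          uniformly_ac_subseq flux_uniformly_ac)
  qed
  obtain gp :: "real \<times> 'v \<times> 'v \<Rightarrow> real" where gp: "gp \<in> borel_measurable borel" "\<forall>z. 0 \<le> gp z" "finite_measure (Lam_dens gp)"
    "\<forall>B\<in>sets borel. (\<lambda>n. measure (SJp (r n)) B) \<longlonglongrightarrow> measure (Lam_dens gp) B"
    using setwise_limit_density[OF finite_Lam Lam(1) Jp_finite sets_semidirect uniformly_ac_subseq[OF flux_uniformly_ac(1)] cJ(1)] by blast
  obtain gm :: "real \<times> 'v \<times> 'v \<Rightarrow> real" where gm: "gm \<in> borel_measurable borel" "\<forall>z. 0 \<le> gm z" "finite_measure (Lam_dens gm)"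
    "\<forall>B\<in>sets borel. (\<lambda>n. measure (SJm (r n)) B) \<longlonglongrightarrow> measure (Lam_dens gm) B"
    using setwise_limit_density[OF finite_Lam Lam(1) Jm_finite sets_semidirect uniformly_ac_subseq[OF flux_uniformly_ac(2)] cJ(2)] by blast
  have cq: "convergent (\<lambda>n. measure (\<rho>n (r n) (of_rat q)) B)" if q: "real_of_rat q \<in> {0..T}" and B: "B \<in> sets borel" for q B
  proof (rule convergent_on_generator[OF pi(2,1) _ _ _ G(2-4) _ B])
    show "convergent (\<lambda>n. measure (\<rho>n (r n) (of_rat q)) C)" if "C \<in> G" for C
      using r(2)[of "Inl (of_rat q, C)"] that q by (force simp: I_def x_def)
    show "uniformly_ac \<pi> (\<lambda>n. \<rho>n (r n) (real_of_rat q))" using q by (rule rho_uniformly_ac)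
  qed (use rho'[OF q] in auto)
  \<comment> \<open>Equicontinuity in time is available for closed sets only. Comparison with a
    nearby rational time is thus made for closed \<open>B\<close>, and the closed sets act as the
    generator at a general time.\<close>
  have ct_closed: "convergent (\<lambda>n. measure (\<rho>n (r n) t) B)" if t: "t \<in> {0..T}" and B: "closed B" for t B
  proof (rule Cauchy_convergent, rule metric_CauchyI)
    fix \<eta> :: real assume \<eta>: "\<eta> > 0"
    obtain \<delta> where \<delta>: "\<delta> > 0" "\<And>n s t. s \<in> {0..T} \<Longrightarrow> t \<in> {0..T} \<Longrightarrow> \<bar>t - s\<bar> < \<delta> \<Longrightarrow> \<bar>measure (\<rho>n n t) B - measure (\<rho>n n s) B\<bar> < \<eta> / 3"
      using measure_equicontinuous[OF B, of "\<eta> / 3"] \<eta> by auto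
    have "max 0 (t - \<delta>) < min T (t + \<delta>)" using t \<delta>(1) T by auto
    then obtain q where q: "max 0 (t - \<delta>) < real_of_rat q" "real_of_rat q < min T (t + \<delta>)" using of_rat_dense by blast
    then have qT: "real_of_rat q \<in> {0..T}" and qd: "\<bar>t - real_of_rat q\<bar> < \<delta>" by auto
    have "Cauchy (\<lambda>n. measure (\<rho>n (r n) (of_rat q)) B)" by (intro convergent_Cauchy cq[OF qT borel_closed[OF B]])
    then obtain N where N: "\<And>k l. k \<ge> N \<Longrightarrow> l \<ge> N \<Longrightarrow> dist (measure (\<rho>n (r k) (of_rat q)) B) (measure (\<rho>n (r l) (of_rat q)) B) < \<eta> / 3"
      using metric_CauchyD[of "\<lambda>n. measure (\<rho>n (r n) (of_rat q)) B" "\<eta> / 3"] \<eta> by (meson divide_pos_pos zero_less_numeral)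
    have "dist (measure (\<rho>n (r k) t) B) (measure (\<rho>n (r l) t) B) < \<eta>" if "k \<ge> N" "l \<ge> N" for k l
      using N[OF that] \<delta>(2)[OF qT t qd, of "r k"] \<delta>(2)[OF qT t qd, of "r l"] unfolding dist_real_def abs_less_iff by linarith
    then show "\<exists>N. \<forall>k\<ge>N. \<forall>l\<ge>N. dist (measure (\<rho>n (r k) t) B) (measure (\<rho>n (r l) t) B) < \<eta>" by blast
  qed
  have ct: "convergent (\<lambda>n. measure (\<rho>n (r n) t) B)" if t: "t \<in> {0..T}" and B: "B \<in> sets borel" for t B
    by (rule convergent_on_generator[OF pi(2,1) rho'(2)[OF t] rho'(1)[OF t] rho_uniformly_ac[of "\<lambda>_. t", OF t] closed_sets_generate(1) _ closed_sets_generate(2) _ B])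
      (use ct_closed[OF t] in auto)
  have "\<exists>M. M \<in> finite_borel_measures \<and> absolutely_continuous \<pi> M \<and> (\<forall>B\<in>sets borel. (\<lambda>n. measure (\<rho>n (r n) t) B) \<longlonglongrightarrow> measure M B)"
    if t: "t \<in> {0..T}" for t
  proof -
    obtain g :: "'v \<Rightarrow> real" where g: "g \<in> borel_measurable borel" "finite_measure (density \<pi> (\<lambda>x. ennreal (g x)))"
      "\<forall>B\<in>sets borel. (\<lambda>n. measure (\<rho>n (r n) t) B) \<longlonglongrightarrow> measure (density \<pi> (\<lambda>x. ennreal (g x))) B"
      using setwise_limit_density[OF pi(2,1) rho'(2)[OF t] rho'(1)[OF t] rho_uniformly_ac[of "\<lambda>_. t", OF t] ct[OF t]] by blast
    then show ?thesis
      by (intro exI[of _ "density \<pi> (\<lambda>x. ennreal (g x))"])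
        (auto simp: finite_borel_measures_def pi pi_measurable intro!: absolutely_continuousI_density)
  qed
  then obtain \<rho> where "\<forall>t\<in>{0..T}. \<rho> t \<in> finite_borel_measures \<and> absolutely_continuous \<pi> (\<rho> t) \<and> (\<forall>B\<in>sets borel. (\<lambda>n. measure (\<rho>n (r n) t) B) \<longlonglongrightarrow> measure (\<rho> t) B)"
    by metis
  then show ?thesis using r(1) gp gm by (intro exI[of _ r] exI[of _ \<rho>] exI[of _ gp] exI[of _ gm]) auto
qed

end

section \<open>The limit curve\<close>

locale flow_limit = flow_sequence \<pi> \<kappa> \<psi>s \<phi> \<alpha> T Abar Ebar a \<kappa>n \<rho>n jn
  for \<pi> :: "'v::{metric_space, second_countable_topology} measure" and \<kappa> \<psi>s \<phi> \<alpha> T Abar Ebar a \<kappa>n \<rho>n jn +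
  fixes \<rho> :: "real \<Rightarrow> 'v measure" and gp gm :: "real \<times> 'v \<times> 'v \<Rightarrow> real" and E0 :: ennreal
  assumes rho_lim: "\<And>t. t \<in> {0..T} \<Longrightarrow> \<rho> t \<in> finite_borel_measures" "\<And>t. t \<in> {0..T} \<Longrightarrow> absolutely_continuous \<pi> (\<rho> t)"
      "\<And>t B. t \<in> {0..T} \<Longrightarrow> B \<in> sets borel \<Longrightarrow> (\<lambda>n. measure (\<rho>n n t) B) \<longlonglongrightarrow> measure (\<rho> t) B"
    and gp [measurable]: "gp \<in> borel_measurable borel" and gm [measurable]: "gm \<in> borel_measurable borel"
    and gp0: "\<And>z. 0 \<le> gp z" and gm0: "\<And>z. 0 \<le> gm z"
    and gp_fin: "finite_measure (Lam_dens gp)" and gm_fin: "finite_measure (Lam_dens gm)"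
    and Jp_lim: "\<And>B. B \<in> sets borel \<Longrightarrow> (\<lambda>n. measure (SJp n) B) \<longlonglongrightarrow> measure (Lam_dens gp) B"
    and Jm_lim: "\<And>B. B \<in> sets borel \<Longrightarrow> (\<lambda>n. measure (SJm n) B) \<longlonglongrightarrow> measure (Lam_dens gm) B"
    and E0_lim: "(\<lambda>n. Ent (\<rho>n n 0)) \<longlonglongrightarrow> E0"
begin

lemma rho_sets: "t \<in> {0..T} \<Longrightarrow> sets (\<rho> t) = sets borel" "t \<in> {0..T} \<Longrightarrow> finite_measure (\<rho> t)" "t \<in> {0..T} \<Longrightarrow> space (\<rho> t) = UNIV"
  using rho_lim(1)[of t] space_eq_UNIV[of "\<rho> t"] by (auto simp: finite_borel_measures_def)

lemma g_integrable: "integrable Lam gp" "integrable Lam gm"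
proof -
  have *: "integrable Lam g" if "g \<in> borel_measurable borel" "\<And>z. 0 \<le> g z" "finite_measure (Lam_dens g)" for g
  proof (rule integrableI_nonneg)
    have "(\<integral>\<^sup>+ z. ennreal (g z) \<partial>Lam) = emeasure (Lam_dens g) UNIV"
      using that(1) by (subst emeasure_density) auto
    then show "(\<integral>\<^sup>+ z. ennreal (g z) \<partial>Lam) < \<infinity>"
      using finite_measure.emeasure_finite[OF that(3), of UNIV] by (simp add: less_top)
  qed (use that in auto)
  show "integrable Lam gp" "integrable Lam gm" using gp gm gp0 gm0 gp_fin gm_fin by (auto intro: *)
qed

lemma flux_test_lim:
  fixes h :: "real \<times> 'v \<times> 'v \<Rightarrow> real"
  assumes h: "h \<in> borel_measurable borel" "\<And>z. \<bar>h z\<bar> \<le> C"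
  shows "(\<lambda>n. \<integral>z. h z \<partial>SJp n) \<longlonglongrightarrow> (\<integral>z. gp z * h z \<partial>Lam)"
    "(\<lambda>n. \<integral>z. h z \<partial>SJm n) \<longlonglongrightarrow> (\<integral>z. gm z * h z \<partial>Lam)"
proof -
  have "(\<lambda>n. \<integral>z. h z \<partial>SJp n) \<longlonglongrightarrow> (\<integral>z. h z \<partial>Lam_dens gp)"
    by (rule setwise_conv_integral[OF Jp_finite _ gp_fin _ _ h(2)]) (use h(1) Jp_lim in auto)
  then show "(\<lambda>n. \<integral>z. h z \<partial>SJp n) \<longlonglongrightarrow> (\<integral>z. gp z * h z \<partial>Lam)"
    using h(1) gp0 by (simp add: integral_density)
  have "(\<lambda>n. \<integral>z. h z \<partial>SJm n) \<longlonglongrightarrow> (\<integral>z. h z \<partial>Lam_dens gm)"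
    by (rule setwise_conv_integral[OF Jm_finite _ gm_fin _ _ h(2)]) (use h(1) Jm_lim in auto)
  then show "(\<lambda>n. \<integral>z. h z \<partial>SJm n) \<longlonglongrightarrow> (\<integral>z. gm z * h z \<partial>Lam)"
    using h(1) gm0 by (simp add: integral_density)
qed

text \<open>The density of the limit flux with respect to \<open>\<theta>\<close>: the limit of the
  weighted fluxes has signed density \<open>gp - gm\<close> with respect to \<open>lam\<close>,
  which is \<open>cutdist\<^sup>2\<close> times \<open>\<theta>\<close>, and removing the weight
  leaves one factor \<open>cutdist\<close>.\<close>

definition "W z = (gp z - gm z) * cutdist (snd z)"

lemma W_measurable [measurable]: "W \<in> borel_measurable borel"
  unfolding W_def by (intro borel_measurable_times borel_measurable_diff gp gm measurable_compose[OF fst_snd_borel(2) cutdist_measurable])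

text \<open>\<open>ennreal\<close> truncates negative numbers to 0, so the two components are the
  positive and negative part of \<open>W\<close> and are mutually singular. Densities built from
  \<open>gp\<close> and \<open>gm\<close> separately could overlap.\<close>

definition "j t = (density \<theta> (\<lambda>z. ennreal (W (t, z))), density \<theta> (\<lambda>z. ennreal (- W (t, z))))"

lemma nn_integral_j:
  assumes f [measurable]: "f \<in> borel_measurable borel"
  shows "(\<integral>\<^sup>+ z. ennreal (cutdist z) * f z \<partial>fst (j t)) = (\<integral>\<^sup>+ z. ennreal (gp (t, z) - gm (t, z)) * f z \<partial>lam)"
    "(\<integral>\<^sup>+ z. ennreal (cutdist z) * f z \<partial>snd (j t)) = (\<integral>\<^sup>+ z. ennreal (gm (t, z) - gp (t, z)) * f z \<partial>lam)"
proof -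
  have e: "ennreal (x * cutdist z) = ennreal (cutdist z) * ennreal x" for x and z :: "'v \<times> 'v"
    by (simp add: mult.commute[of x] ennreal_mult' cutdist_bounds)
  have e': "ennreal (cutdist z * x) = ennreal (cutdist z) * ennreal x" for x and z :: "'v \<times> 'v"
    by (simp add: ennreal_mult' cutdist_bounds)
  show "(\<integral>\<^sup>+ z. ennreal (cutdist z) * f z \<partial>fst (j t)) = (\<integral>\<^sup>+ z. ennreal (gp (t, z) - gm (t, z)) * f z \<partial>lam)"
    unfolding j_def by (simp add: nn_integral_density nn_integral_lam)
      (auto intro!: nn_integral_cong simp: W_def e e' power2_eq_square ennreal_mult cutdist_bounds mult_ac)
  have m: "- W (t, z) = (gm (t, z) - gp (t, z)) * cutdist z" for z by (simp add: W_def algebra_simps)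
  show "(\<integral>\<^sup>+ z. ennreal (cutdist z) * f z \<partial>snd (j t)) = (\<integral>\<^sup>+ z. ennreal (gm (t, z) - gp (t, z)) * f z \<partial>lam)"
    unfolding j_def by (simp add: nn_integral_density nn_integral_lam m)
      (auto intro!: nn_integral_cong simp: e e' power2_eq_square ennreal_mult cutdist_bounds mult_ac)
qed

lemma j_flux: "j t \<in> sigma_fluxes borel"
proof -
  interpret sigma_finite_measure \<theta> by (rule sigma_finite_theta)
  have "sigma_finite_measure (fst (j t))" "sigma_finite_measure (snd (j t))"
    unfolding j_def fst_conv snd_conv by (subst sigma_finite_iff_density_finite; simp)+
  moreover have "mutually_singular (fst (j t)) (snd (j t))"
    unfolding mutually_singular_def
  proof (intro bexI conjI)
    let ?A = "{z. 0 < W (t, z)}"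
    have A: "?A \<in> sets borel" by measurable
    then show "?A \<in> sets (fst (j t))" by (simp add: j_def)
    have "emeasure (fst (j t)) (space (fst (j t)) - ?A) = (\<integral>\<^sup>+ z. ennreal (W (t, z)) * indicator (UNIV - ?A) z \<partial>\<theta>)"
      using A by (simp add: j_def emeasure_density)
    also have "\<dots> = 0" by (intro nn_integral_AE_zero AE_I2) (auto simp: indicator_def ennreal_neg)
    finally show "emeasure (fst (j t)) (space (fst (j t)) - ?A) = 0" .
    have "emeasure (snd (j t)) ?A = (\<integral>\<^sup>+ z. ennreal (- W (t, z)) * indicator ?A z \<partial>\<theta>)"
      using A by (simp add: j_def emeasure_density)
    also have "\<dots> = 0" by (intro nn_integral_AE_zero AE_I2) (auto simp: indicator_def ennreal_neg)
    finally show "emeasure (snd (j t)) ?A = 0" .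
  qed
  ultimately show ?thesis by (simp add: sigma_fluxes_def j_def)
qed

lemma curve_lim: "flux_curve T j"
proof
  have m: "(\<lambda>t. emeasure (density \<theta> (\<lambda>z. ennreal (V (t, z)))) B) \<in> borel_measurable borel"
    if [measurable]: "V \<in> borel_measurable borel" and B: "B \<in> sets borel" for V :: "real \<times> 'v \<times> 'v \<Rightarrow> real" and B
  proof -
    let ?f = "\<lambda>z. ennreal (1 / (cutdist (snd z))\<^sup>2) * (ennreal (V z) * indicator B (snd z))"
    have Vt: "(\<lambda>z. V (t, z)) \<in> borel_measurable borel" for t by (rule measurable_Pair_section) simp
    have "?f \<in> borel_measurable borel" using B
      by (intro borel_measurable_times_ennreal measurable_compose[OF fst_snd_borel(2)]) auto
    from kernel_nn_integral_measurable[OF lam_kernel this]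
    have "(\<lambda>t. \<integral>\<^sup>+ z. ennreal (1 / (cutdist z)\<^sup>2) * (ennreal (V (t, z)) * indicator B z) \<partial>lam) \<in> borel_measurable borel" by simp
    then show ?thesis using B Vt by (simp add: emeasure_density nn_integral_theta)
  qed
  show "measurable_flux_family T j"
    unfolding measurable_flux_family_def
  proof (intro conjI ballI)
    fix B :: "('v \<times> 'v) set" assume B: "B \<in> sets borel"
    show "(\<lambda>t. emeasure (fst (j t)) B) \<in> borel_measurable (restrict_space borel {0..T})"
      unfolding j_def fst_conv by (intro measurable_restrict_space1 m B) simp
    show "(\<lambda>t. emeasure (snd (j t)) B) \<in> borel_measurable (restrict_space borel {0..T})"
      unfolding j_def snd_conv using m[of "\<lambda>z. - W z", OF _ B] by (intro measurable_restrict_space1) simp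
  qed (rule j_flux)
  have tv: "emeasure (total_variation (j t)) B = emeasure (fst (j t)) B + emeasure (snd (j t)) B" if "B \<in> sets borel" for B t
    using that by (intro emeasure_total_variation) (auto simp: j_def)
  have od: "(- off_diagonal :: ('v \<times> 'v) set) = {z. cutdist z = 0}" by (auto simp: off_diagonal_def cutdist_eq_0)
  show "emeasure (total_variation (j t)) (- off_diagonal) = 0" for t
  proof -
    have "AE z in \<theta>. cutdist z \<noteq> 0" using lam_off_diagonal by (simp add: AE_lam_iff_theta)
    then have "emeasure (density \<theta> (\<lambda>z. ennreal (V z))) {z. cutdist z = 0} = 0" if "V \<in> borel_measurable borel" for V
      using that by (subst emeasure_density) (auto intro!: nn_integral_AE_zero elim!: eventually_mono simp: indicator_def)
    then show ?thesis unfolding od by (subst tv) (auto simp: j_def)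
  qed
  have nn: "(\<integral>\<^sup>+ z. ennreal (min 1 (dist (fst z) (snd z))) \<partial>total_variation (j t)) \<le> (\<integral>\<^sup>+ z. ennreal (gp (t, z)) + ennreal (gm (t, z)) \<partial>lam)" for t
  proof -
    have "(\<integral>\<^sup>+ z. ennreal (min 1 (dist (fst z) (snd z))) \<partial>total_variation (j t)) = (\<integral>\<^sup>+ z. ennreal (cutdist z) \<partial>fst (j t)) + (\<integral>\<^sup>+ z. ennreal (cutdist z) \<partial>snd (j t))"
      unfolding cutdist_def[symmetric] by (intro nn_integral_total_variation) (auto simp: j_def)
    also have "\<dots> = (\<integral>\<^sup>+ z. ennreal (gp (t, z) - gm (t, z)) \<partial>lam) + (\<integral>\<^sup>+ z. ennreal (gm (t, z) - gp (t, z)) \<partial>lam)"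
      using nn_integral_j[of "\<lambda>_. 1" t] by simp
    also have "\<dots> \<le> (\<integral>\<^sup>+ z. ennreal (gp (t, z)) \<partial>lam) + (\<integral>\<^sup>+ z. ennreal (gm (t, z)) \<partial>lam)"
      using gp0 gm0 by (intro add_mono nn_integral_mono ennreal_leI) auto
    also have "\<dots> = (\<integral>\<^sup>+ z. ennreal (gp (t, z)) + ennreal (gm (t, z)) \<partial>lam)" by (intro nn_integral_add[symmetric]) auto
    finally show ?thesis .
  qed
  have "(\<integral>\<^sup>+ t\<in>{0..T}. (\<integral>\<^sup>+ z. ennreal (min 1 (dist (fst z) (snd z))) \<partial>total_variation (j t)) \<partial>lborel)
      \<le> (\<integral>\<^sup>+ t\<in>{0..T}. (\<integral>\<^sup>+ z. ennreal (gp (t, z)) + ennreal (gm (t, z)) \<partial>lam) \<partial>lborel)"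
    by (intro nn_integral_mono mult_right_mono nn) auto
  also have "\<dots> = (\<integral>\<^sup>+ z. ennreal (gp z) + ennreal (gm z) \<partial>Lam)" by (subst nn_integral_Lam) auto
  also have "\<dots> = (\<integral>\<^sup>+ z. ennreal (gp z) \<partial>Lam) + (\<integral>\<^sup>+ z. ennreal (gm z) \<partial>Lam)" by (intro nn_integral_add) auto
  also have "\<dots> < \<infinity>" using g_integrable gp0 gm0 by (simp add: nn_integral_eq_integral less_top[symmetric])
  finally show "(\<integral>\<^sup>+ t\<in>{0..T}. (\<integral>\<^sup>+ z. ennreal (min 1 (dist (fst z) (snd z))) \<partial>total_variation (j t)) \<partial>lborel) < \<infinity>" .
qed

abbreviation "SJp_lim \<equiv> semidirect lborel (weighted T (\<lambda>t. fst (j t)))"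
abbreviation "SJm_lim \<equiv> semidirect lborel (weighted T (\<lambda>t. snd (j t)))"

lemma fam_lim: "weighted_family T (\<lambda>t. fst (j t))" "weighted_family T (\<lambda>t. snd (j t))"
  using flux_curve.families[OF curve_lim] by (auto intro: weighted_family.intro)

text \<open>After cancellation the weighted limit flux has the parts of \<open>gp - gm\<close> as
  densities. These need not be the limits \<open>gp\<close> and \<open>gm\<close> of the individual
  parts.\<close>

lemma SJ_lim_eq:
  "SJp_lim = density Lam (\<lambda>z. ennreal (gp z - gm z))" "SJm_lim = density Lam (\<lambda>z. ennreal (gm z - gp z))"
proof -
  have *: "semidirect lborel (weighted T m) = Lam_dens g"
    if fam: "weighted_family T m" and [measurable]: "g \<in> borel_measurable borel"
      and e: "\<And>f t. f \<in> borel_measurable borel \<Longrightarrow> (\<integral>\<^sup>+ z. ennreal (cutdist z) * f z \<partial>m t) = (\<integral>\<^sup>+ z. ennreal (g (t, z)) * f z \<partial>lam)"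
    for m and g :: "real \<times> 'v \<times> 'v \<Rightarrow> real"
  proof (rule measure_eqI)
    interpret weighted_family T m by fact
    fix B assume "B \<in> sets (semidirect lborel (weighted T m))"
    then have B: "B \<in> sets borel" by simp
    have "emeasure (semidirect lborel (weighted T m)) B = (\<integral>\<^sup>+ t. emeasure (weighted T m t) (Pair t -` B) \<partial>lborel)"
      by (rule emeasure_semidirect[OF weighted_kernel sets_lborel B])
    also have "\<dots> = (\<integral>\<^sup>+ t\<in>{0..T}. (\<integral>\<^sup>+ z. ennreal (g (t, z)) * indicator B (t, z) \<partial>lam) \<partial>lborel)"
    proof (rule nn_integral_cong_AE)
      from AE_finite show "AE t in lborel. emeasure (weighted T m t) (Pair t -` B) = (\<integral>\<^sup>+ z. ennreal (g (t, z)) * indicator B (t, z) \<partial>lam) * indicator {0..T} t"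
      proof eventually_elim
        case (elim t)
        have sB: "Pair t -` B \<in> sets borel" by (rule sets_Pair_section[OF B])
        show ?case using elim e[of "indicator (Pair t -` B)" t] sB
          by (cases "t \<in> {0..T}") (auto simp: emeasure_weighted[OF sB] nn_integral_clipped indicator_vimage)
      qed
    qed
    also have "\<dots> = (\<integral>\<^sup>+ z. ennreal (g z) * indicator B z \<partial>Lam)" using B by (subst nn_integral_Lam) auto
    also have "\<dots> = emeasure (Lam_dens g) B" using B by (subst emeasure_density) auto
    finally show "emeasure (semidirect lborel (weighted T m)) B = emeasure (Lam_dens g) B" .
  qed simp
  show "SJp_lim = density Lam (\<lambda>z. ennreal (gp z - gm z))" by (rule *[OF fam_lim(1) _ nn_integral_j(1)]) measurable
  show "SJm_lim = density Lam (\<lambda>z. ennreal (gm z - gp z))" by (rule *[OF fam_lim(2) _ nn_integral_j(2)]) measurable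
qed

text \<open>The mass cancelled between \<open>gp\<close> and \<open>gm\<close> drops out of a
  difference of integrals, so signed tests converge to the tests of the limit flux.\<close>

lemma flux_test_lim':
  fixes h :: "real \<times> 'v \<times> 'v \<Rightarrow> real"
  assumes h: "h \<in> borel_measurable borel" "\<And>z. \<bar>h z\<bar> \<le> C"
  shows "(\<lambda>n. (\<integral>z. h z \<partial>SJp n) - (\<integral>z. h z \<partial>SJm n)) \<longlonglongrightarrow> (\<integral>z. h z \<partial>SJp_lim) - (\<integral>z. h z \<partial>SJm_lim)"
proof -
  note [measurable] = h(1)
  have C: "C \<ge> 0" using h(2)[of undefined] by linarith
  have i: "integrable Lam (\<lambda>z. g z * h z)" if g: "integrable Lam g" for g
  proof (rule Bochner_Integration.integrable_bound[OF integrable_mult_right[OF g, of C]])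
    show "(\<lambda>z. g z * h z) \<in> borel_measurable Lam" using g h(1) by (auto dest: borel_measurable_integrable)
    show "AE z in Lam. norm (g z * h z) \<le> norm (C * g z)"
      using h(2) C by (intro AE_I2) (auto simp: abs_mult mult.commute[of C] intro!: mult_left_mono)
  qed
  have pos: "Lam_dens g = density Lam (\<lambda>z. ennreal (max 0 (g z)))" for g
    by (rule arg_cong[of _ _ "density Lam"]) (auto simp: fun_eq_iff max_def ennreal_neg)
  have d: "(\<integral>z. h z \<partial>Lam_dens g) = (\<integral>z. max 0 (g z) * h z \<partial>Lam)"
    if "g \<in> borel_measurable borel" for g
    unfolding pos[of g] using that by (simp add: integral_density)
  have "(\<integral>z. h z \<partial>SJp_lim) - (\<integral>z. h z \<partial>SJm_lim) = (\<integral>z. max 0 (gp z - gm z) * h z \<partial>Lam) - (\<integral>z. max 0 (gm z - gp z) * h z \<partial>Lam)"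
    unfolding SJ_lim_eq by (simp add: d)
  also have "\<dots> = (\<integral>z. max 0 (gp z - gm z) * h z - max 0 (gm z - gp z) * h z \<partial>Lam)"
    using g_integrable by (intro Bochner_Integration.integral_diff[symmetric] i) auto
  also have "\<dots> = (\<integral>z. gp z * h z - gm z * h z \<partial>Lam)"
    by (intro Bochner_Integration.integral_cong) (auto simp: max_def algebra_simps)
  also have "\<dots> = (\<integral>z. gp z * h z \<partial>Lam) - (\<integral>z. gm z * h z \<partial>Lam)"
    by (intro Bochner_Integration.integral_diff i g_integrable)
  finally have e: "(\<integral>z. h z \<partial>SJp_lim) - (\<integral>z. h z \<partial>SJm_lim) = (\<integral>z. gp z * h z \<partial>Lam) - (\<integral>z. gm z * h z \<partial>Lam)" .
  show ?thesis unfolding e by (intro tendsto_diff flux_test_lim[OF h])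
qed

lemma rho_test_lim:
  fixes f :: "'v \<Rightarrow> real"
  assumes "t \<in> {0..T}" "f \<in> borel_measurable borel" "\<And>x. \<bar>f x\<bar> \<le> C"
  shows "(\<lambda>n. \<integral>x. f x \<partial>\<rho>n n t) \<longlonglongrightarrow> (\<integral>x. f x \<partial>\<rho> t)"
  using assms rho' rho_sets rho_lim(3)
  by (intro setwise_conv_integral[where C = C]) (auto simp: measurable_cong_sets[OF rho_sets(1)[OF assms(1)] refl])

text \<open>Both sides of the continuity equation are bounded tests: \<open>f\<close> against
  \<open>\<rho>n\<close>, and the gradient divided by the weight, cut off to the time interval,
  against the weighted fluxes.\<close>

lemma CE_lim: "(\<rho>, j) \<in> CE T"
  unfolding CE_def
proof (clarsimp, intro conjI ballI allI impI)
  interpret L: flux_curve T j by (rule curve_lim)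
  show "\<rho> t \<in> finite_borel_measures" if "t \<in> {0..T}" for t using rho_lim(1)[OF that] .
  show "measurable_flux_family T j" by (rule L.meas)
  show "emeasure (total_variation (j t)) (- off_diagonal) = 0" if "t \<in> {0..T}" for t by (rule L.offd[OF that])
  show "(\<integral>\<^sup>+ t\<in>{0..T}. (\<integral>\<^sup>+ z. ennreal (min 1 (dist (fst z) (snd z))) \<partial>total_variation (j t)) \<partial>lborel) < top"
    using L.fin by simp
  fix f :: "'v \<Rightarrow> real" and s t assume f: "f \<in> Lip_b" and "0 \<le> s \<and> s \<le> t \<and> t \<le> T"
  then have st: "0 \<le> s" "s \<le> t" "t \<le> T" by auto
  obtain B where B: "\<And>x. \<bar>f x\<bar> \<le> B" using f unfolding Lip_b_def bounded_iff by auto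
  obtain c where c: "\<And>z. \<bar>(f (snd z) - f (fst z)) / cutdist z\<bar> \<le> c" using Lip_b_gradient_bound[OF f] by blast
  have c0: "c \<ge> 0" using c[of undefined] by linarith
  note fm = Lip_b_measurable[OF f]
  let ?q = "\<lambda>z. indicator {s..t} (fst z) * ((f (snd (snd z)) - f (fst (snd z))) / cutdist (snd z))"
  have "(\<lambda>z. (f (snd z) - f (fst z)) / cutdist z) \<in> borel_measurable (borel :: ('v \<times> 'v) measure)"
    using fm by (intro borel_measurable_divide borel_measurable_diff measurable_compose[OF fst_snd_borel(1)] measurable_compose[OF fst_snd_borel(2)]) auto
  then have qm: "?q \<in> borel_measurable (borel :: (real \<times> 'v \<times> 'v) measure)"
    by (intro borel_measurable_times measurable_compose[OF fst_snd_borel(1)] measurable_compose[OF fst_snd_borel(2)]) auto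
  have qb: "\<bar>?q z\<bar> \<le> c" for z using c[of "snd z"] c0 by (auto simp: indicator_def)
  have "(\<lambda>n. (\<integral>z. ?q z \<partial>SJp n) - (\<integral>z. ?q z \<partial>SJm n)) \<longlonglongrightarrow> (\<integral>z. ?q z \<partial>SJp_lim) - (\<integral>z. ?q z \<partial>SJm_lim)"
    by (rule flux_test_lim'[OF qm qb])
  moreover have "(\<lambda>n. (\<integral>x. f x \<partial>\<rho>n n t) - (\<integral>x. f x \<partial>\<rho>n n s)) \<longlonglongrightarrow> (\<integral>x. f x \<partial>\<rho> t) - (\<integral>x. f x \<partial>\<rho> s)"
    using st by (intro tendsto_diff rho_test_lim[where C = B] fm B) auto
  ultimately have "(\<integral>x. f x \<partial>\<rho> t) - (\<integral>x. f x \<partial>\<rho> s) = (\<integral>z. ?q z \<partial>SJp_lim) - (\<integral>z. ?q z \<partial>SJm_lim)"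
    unfolding integral_rho_diff[OF f st] by (rule LIMSEQ_unique[rotated])
  then show "(\<integral>x. f x \<partial>\<rho> t) - (\<integral>x. f x \<partial>\<rho> s) = (LINT r:{s..t}|lborel. flux_integral (j r) off_diagonal (\<lambda>(x, y). f y - f x))"
    unfolding L.flux_integral_time[OF f st(1,3)] .
qed

lemma sigma_setwise_lim: "sigma_setwise_conv (time_space T) (\<lambda>n. time_flux T (jn n)) (time_flux T j)"
  unfolding sigma_setwise_conv_def
proof (intro conjI allI exI)
  \<comment> \<open>On these sets the weight can be removed at the price of a factor
    \<open>k\<close>. They cover everything, including the diagonal, where
    \<open>1 / cutdist\<close> is 0 by convention.\<close>
  let ?A = "\<lambda>k::nat. {0..T} \<times> {z :: 'v \<times> 'v. 1 / cutdist z \<le> real k}"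
  have Ab: "?A k \<in> sets borel" for k by (intro borel_Times) auto
  have At: "?A k \<in> sets (time_space T)" for k
    using Ab[of k] by (subst weighted_family.sets_time_space[OF fam_lim(1)]) auto
  show "time_flux T (jn n) \<in> sigma_fluxes (time_space T)" for n by (rule flux_curve.time_flux_in[OF curve])
  show "time_flux T j \<in> sigma_fluxes (time_space T)" by (rule flux_curve.time_flux_in[OF curve_lim])
  show "incseq ?A" by (auto simp: incseq_def intro: order_trans)
  show "range ?A \<subseteq> sets (time_space T)" using At by auto
  show "(\<Union>k. ?A k) = space (time_space T)"
    by (auto simp: time_space_def space_restrict_space intro: real_arch_simple)
  have m: "measure (time_measure T m) (B \<inter> ?A k) = (\<integral>z. indicator (B \<inter> ?A k) z / cutdist (snd z) \<partial>semidirect lborel (weighted T m))"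
    "emeasure (time_measure T m) (B \<inter> ?A k) < \<infinity>"
    if "weighted_family T m" "B \<in> sets borel" for m B k
  proof -
    have BA: "B \<inter> ?A k \<in> sets borel" "B \<inter> ?A k \<subseteq> {0..T} \<times> UNIV" "\<And>z. z \<in> B \<inter> ?A k \<Longrightarrow> 1 / cutdist (snd z) \<le> real k"
      using Ab[of k] that(2) by auto
    show "measure (time_measure T m) (B \<inter> ?A k) = (\<integral>z. indicator (B \<inter> ?A k) z / cutdist (snd z) \<partial>semidirect lborel (weighted T m))"
      by (rule weighted_family.measure_time_measure(1)[OF that(1) BA])
    show "emeasure (time_measure T m) (B \<inter> ?A k) < \<infinity>"
      by (rule weighted_family.measure_time_measure(2)[OF that(1) BA])
  qed
  have fin: "emeasure (total_variation (time_flux T i)) (?A k) < \<infinity>"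
    if c: "flux_curve T i" for i :: "real \<Rightarrow> ('v \<times> 'v) flux" and k
  proof -
    interpret F: flux_curve T i by fact
    have "emeasure (total_variation (time_flux T i)) (?A k)
        = emeasure (time_measure T (\<lambda>t. fst (i t))) (?A k) + emeasure (time_measure T (\<lambda>t. snd (i t))) (?A k)"
      using At[of k] by (subst emeasure_total_variation) (auto simp: time_flux_def F.pos.sets_time_measure F.neg.sets_time_measure)
    then show ?thesis
      using m(2)[OF F.pos.weighted_family_axioms, of UNIV k] m(2)[OF F.neg.weighted_family_axioms, of UNIV k] by simp
  qed
  show "emeasure (total_variation (time_flux T j)) (?A k) < \<infinity>" for k by (rule fin[OF curve_lim])
  show "emeasure (total_variation (time_flux T (jn n))) (?A k) < \<infinity>" for n k by (rule fin[OF curve])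
  show "setwise_conv (time_space T) (\<lambda>n B. signed_value (time_flux T (jn n)) (B \<inter> ?A k)) (\<lambda>B. signed_value (time_flux T j) (B \<inter> ?A k))" for k
    unfolding setwise_conv_def
  proof
    fix B assume "B \<in> sets (time_space T :: (real \<times> 'v \<times> 'v) measure)"
    then have B: "B \<in> sets borel" by (subst (asm) weighted_family.sets_time_space[OF fam_lim(1)]) auto
    let ?h = "\<lambda>z. indicator (B \<inter> ?A k) z / cutdist (snd z)"
    have hm: "?h \<in> borel_measurable borel"
      using B Ab[of k] by (intro borel_measurable_divide measurable_compose[OF fst_snd_borel(2) cutdist_measurable]) auto
    have hb: "\<bar>?h z\<bar> \<le> real k" for z
      using cutdist_bounds(1)[of "snd z"] by (auto simp: indicator_def)
    show "(\<lambda>n. signed_value (time_flux T (jn n)) (B \<inter> ?A k)) \<longlonglongrightarrow> signed_value (time_flux T j) (B \<inter> ?A k)"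
      unfolding signed_value_def time_flux_def fst_conv snd_conv
        m(1)[OF fam(1) B] m(1)[OF fam(2) B] m(1)[OF fam_lim(1) B] m(1)[OF fam_lim(2) B]
      by (rule flux_test_lim'[OF hm hb])
  qed
qed

text \<open>The definition of \<open>CE\<close> demands no measurability of the curve in time. For
  closed sets the masses along \<open>\<rho>n n\<close> are continuous in \<open>t\<close>; a Dynkin
  argument reaches all Borel sets, and pointwise limits reach \<open>\<rho>\<close>.\<close>

lemma rho_kernels: "finite_kernel (clipped T (\<rho>n n))" "finite_kernel (clipped T \<rho>)"
proof -
  have closed: "(\<lambda>t. emeasure (\<rho>n n t) B) \<in> borel_measurable (restrict_space borel {0..T})" if B: "closed B" for n B
  proof -
    have "continuous_on {0..T} (\<lambda>t. measure (\<rho>n n t) B)"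
      unfolding continuous_on_iff
    proof (intro ballI allI impI)
      fix t \<eta> :: real assume "t \<in> {0..T}" "\<eta> > 0"
      then show "\<exists>d>0. \<forall>s\<in>{0..T}. dist s t < d \<longrightarrow> dist (measure (\<rho>n n s) B) (measure (\<rho>n n t) B) < \<eta>"
        using measure_equicontinuous[OF B \<open>\<eta> > 0\<close>] unfolding dist_real_def by blast
    qed
    then have "(\<lambda>t. ennreal (measure (\<rho>n n t) B)) \<in> borel_measurable (restrict_space borel {0..T})"
      by (intro measurable_compose[OF borel_measurable_continuous_on_restrict measurable_ennreal])
    then show ?thesis
      by (rule measurable_cong[THEN iffD1, rotated])
        (auto simp: space_restrict_space finite_measure.emeasure_eq_measure[OF rho'(2)])
  qed
  have m: "(\<lambda>t. emeasure (\<rho>n n t) B) \<in> borel_measurable (restrict_space borel {0..T})" if B: "B \<in> sets borel" for n B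
  proof -
    have "B \<in> sigma_sets UNIV {C. closed C}" using B closed_sets_generate(2)[where 'a='v] by simp
    with closed_sets_generate(1) subset_UNIV[of "{C::'v set. closed C}", folded Pow_UNIV] show ?thesis
    proof (induction rule: sigma_sets_induct_disjoint)
      case (basic C) then show ?case by (simp add: closed)
    next
      case empty then show ?case by simp
    next
      case (compl A)
      have "emeasure (\<rho>n n t) UNIV - emeasure (\<rho>n n t) A = emeasure (\<rho>n n t) (UNIV - A)" if "t \<in> {0..T}" for t
        using emeasure_compl[of A "\<rho>n n t"] compl(1) closed_sets_generate(2)[where 'a='v] rho'(1)[OF that, of n]
          finite_measure.emeasure_finite[OF rho'(2)[OF that]] sets_eq_imp_space_eq[OF rho'(1)[OF that, of n]] by simp
      then show ?case
        by (intro measurable_cong[THEN iffD1, OF _ borel_measurable_minus_ennreal[OF closed[OF closed_UNIV] compl(2)]])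
          (simp add: space_restrict_space)
    next
      case (union A)
      have "(\<Sum>i. emeasure (\<rho>n n t) (A i)) = emeasure (\<rho>n n t) (\<Union>i. A i)" if "t \<in> {0..T}" for t
        using union(1,2) closed_sets_generate(2)[where 'a='v] rho'(1)[OF that, of n] by (intro suminf_emeasure) auto
      then show ?case
        by (intro measurable_cong[THEN iffD1, OF _ borel_measurable_suminf_order[OF union(3)]]) (simp add: space_restrict_space)
    qed
  qed
  have ml: "(\<lambda>t. emeasure (\<rho> t) B) \<in> borel_measurable (restrict_space borel {0..T})" if B: "B \<in> sets borel" for B
  proof (rule borel_measurable_LIMSEQ_order[OF _ m[OF B]])
    fix t assume "t \<in> space (restrict_space borel {0..T})"
    then have t: "t \<in> {0..T}" by (simp add: space_restrict_space)
    show "(\<lambda>n. emeasure (\<rho>n n t) B) \<longlonglongrightarrow> emeasure (\<rho> t) B"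
      unfolding finite_measure.emeasure_eq_measure[OF rho'(2)[OF t]] finite_measure.emeasure_eq_measure[OF rho_sets(2)[OF t]]
      by (intro tendsto_ennrealI rho_lim(3) t B)
  qed
  show "finite_kernel (clipped T (\<rho>n n))" "finite_kernel (clipped T \<rho>)"
    unfolding finite_kernel_def
    using clipped_family[of T "\<rho>n n", OF rho'(1) m] clipped_family[of T \<rho>, OF rho_sets(1) ml]
      finite_measure.emeasure_finite[OF rho'(2)] finite_measure.emeasure_finite[OF rho_sets(2)]
    by (auto simp: clipped_def less_top)
qed

lemma rho_mass_bounded: "\<exists>C\<ge>0. (\<forall>n. \<forall>t\<in>{0..T}. measure (\<rho>n n t) UNIV \<le> C) \<and> (\<forall>t\<in>{0..T}. measure (\<rho> t) UNIV \<le> C)"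
proof -
  obtain m where m: "m \<ge> 0" "\<And>n t. t \<in> {0..T} \<Longrightarrow> uniform_bound m 1 (\<rho>n n t)" using uniform_bounds[of 1] by auto
  have b: "measure (\<rho>n n t) UNIV \<le> m * measure \<pi> UNIV + 1" if t: "t \<in> {0..T}" for n t
    using measure_bound_real[OF m(2)[OF t, of n] rho[OF t] m(1), of "\<lambda>_. 1"] sets_eq_imp_space_eq[OF rho'(1)[OF t, of n]] pi by simp
  moreover have "measure (\<rho> t) UNIV \<le> m * measure \<pi> UNIV + 1" if t: "t \<in> {0..T}" for t
    by (rule LIMSEQ_le_const2[OF rho_lim(3)[OF t]]) (use b[OF t] in auto)
  ultimately show ?thesis using m(1) by (intro exI[of _ "m * measure \<pi> UNIV + 1"]) auto
qed

section \<open>Jointly measurable densities of the limit curve\<close>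

lemma pi_kernel: "finite_kernel (\<lambda>_::real. \<pi>)"
  by (rule finite_kernel_const[OF pi(1,2)])

text \<open>\<open>dens \<pi> (\<rho> t)\<close> is chosen for each \<open>t\<close> on its own, so
  nothing is known about its dependence on time. The Radon-Nikodym derivative of the space-time
  measure is jointly measurable, and its slices agree with it at almost every time.\<close>

lemma joint_density:
  "\<exists>U::real \<times> 'v \<Rightarrow> real. U \<in> borel_measurable borel \<and> (\<forall>z. 0 \<le> U z) \<and>
     integrable (semidirect (time_interval T) (\<lambda>_. \<pi>)) U \<and>
     (AE t in lborel. t \<in> {0..T} \<longrightarrow> (AE x in \<pi>. dens \<pi> (\<rho> t) x = U (t, x)))"
proof -
  let ?I = "time_interval T"
  interpret I: finite_measure ?I by (rule finite_time_interval)
  obtain C where C: "C \<ge> 0" "\<And>t. t \<in> {0..T} \<Longrightarrow> measure (\<rho> t) UNIV \<le> C" using rho_mass_bounded by blast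
  have "(\<integral>\<^sup>+ t. emeasure (clipped T \<rho> t) UNIV \<partial>?I) \<le> (\<integral>\<^sup>+ t. ennreal C \<partial>?I)"
  proof (rule nn_integral_mono)
    fix t show "emeasure (clipped T \<rho> t) UNIV \<le> ennreal C"
      using C(2)[of t] finite_measure.emeasure_eq_measure[OF rho_sets(2)[of t]] by (auto simp: clipped_def intro: ennreal_leI)
  qed
  also have "\<dots> < \<infinity>" using I.emeasure_finite[of UNIV] by (auto simp: less_top[symmetric] ennreal_mult_eq_top_iff)
  finally have fin: "(\<integral>\<^sup>+ t. emeasure (clipped T \<rho> t) UNIV \<partial>?I) < \<infinity>" .
  have fin': "(\<integral>\<^sup>+ t. emeasure \<pi> UNIV \<partial>?I) < \<infinity>"
    using finite_measure.emeasure_finite[OF pi(2), of UNIV] I.emeasure_finite[of UNIV] by (auto simp: less_top[symmetric] ennreal_mult_eq_top_iff)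
  have "absolutely_continuous (semidirect ?I (\<lambda>_. \<pi>)) (semidirect ?I (clipped T \<rho>))"
    unfolding absolutely_continuous_def
  proof
    fix N assume "N \<in> null_sets (semidirect ?I (\<lambda>_. \<pi>))"
    then have N: "N \<in> sets borel" "(\<integral>\<^sup>+ t. emeasure \<pi> (Pair t -` N) \<partial>?I) = 0"
      by (auto simp: null_sets_def emeasure_semidirect[OF pi_kernel])
    have "AE t in ?I. emeasure \<pi> (Pair t -` N) = 0"
      using N kernel_emeasure_measurable[OF pi_kernel N(1)] by (simp add: nn_integral_0_iff_AE)
    then have "AE t in ?I. emeasure (clipped T \<rho> t) (Pair t -` N) = 0"
    proof eventually_elim
      case (elim t)
      then have "Pair t -` N \<in> null_sets \<pi>" using sets_Pair_section[OF N(1)] by (auto simp: null_sets_def pi)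
      then show ?case using rho_lim(2)[of t] by (auto simp: clipped_def absolutely_continuous_def null_sets_def)
    qed
    then have "(\<integral>\<^sup>+ t. emeasure (clipped T \<rho> t) (Pair t -` N) \<partial>?I) = 0" by (rule nn_integral_AE_zero)
    then show "N \<in> null_sets (semidirect ?I (clipped T \<rho>))"
      using N by (simp add: null_sets_def emeasure_semidirect[OF rho_kernels(2)])
  qed
  from kernel_Radon_Nikodym[OF rho_kernels(2) pi_kernel time_interval(1) I.sigma_finite_measure_axioms fin fin' this]
  obtain U :: "real \<times> 'v \<Rightarrow> real" where U: "U \<in> borel_measurable borel" "\<And>z. 0 \<le> U z"
    "semidirect ?I (clipped T \<rho>) = density (semidirect ?I (\<lambda>_. \<pi>)) (\<lambda>z. ennreal (U z))"
    "AE t in ?I. clipped T \<rho> t = density \<pi> (\<lambda>x. ennreal (U (t, x)))" by blast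
  interpret p: finite_measure \<pi> by (rule pi(2))
  have "AE t in lborel. t \<in> {0..T} \<longrightarrow> (AE x in \<pi>. dens \<pi> (\<rho> t) x = U (t, x))"
    using U(4) unfolding AE_time_interval
  proof eventually_elim
    case (elim t)
    show ?case
    proof
      assume t: "t \<in> {0..T}"
      have Um: "(\<lambda>x. ennreal (U (t, x))) \<in> borel_measurable \<pi>"
        using measurable_Pair_section[OF U(1)] by (simp add: pi_measurable)
      have "density \<pi> (\<lambda>x. ennreal (U (t, x))) = \<rho> t" using elim t by (simp add: clipped_def)
      from p.RN_deriv_unique[OF Um this] show "AE x in \<pi>. dens \<pi> (\<rho> t) x = U (t, x)"
        by eventually_elim (metis dens_def enn2real_ennreal U(2))
    qed
  qed
  moreover have "integrable (semidirect ?I (\<lambda>_. \<pi>)) U"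
  proof (rule integrableI_nonneg)
    have "(\<integral>\<^sup>+ z. ennreal (U z) \<partial>semidirect ?I (\<lambda>_. \<pi>)) = emeasure (semidirect ?I (clipped T \<rho>)) UNIV"
      unfolding U(3) using U(1) by (subst emeasure_density) auto
    also have "\<dots> < \<infinity>" using fin by (simp add: emeasure_semidirect[OF rho_kernels(2)])
    finally show "(\<integral>\<^sup>+ z. ennreal (U z) \<partial>semidirect ?I (\<lambda>_. \<pi>)) < \<infinity>" .
  qed (use U in auto)
  ultimately show ?thesis using U(1,2) by blast
qed

lemma rho_density: "t \<in> {0..T} \<Longrightarrow> \<rho> t = density \<pi> (\<lambda>x. ennreal (dens \<pi> (\<rho> t) x))"
  unfolding dens_def
  by (rule density_enn2real_RN_deriv[symmetric])
    (use rho_lim(2) rho_sets pi in \<open>auto intro: finite_measure.axioms(1)\<close>)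

lemma dens_integrable:
  assumes t: "t \<in> {0..T}"
  shows "integrable \<pi> (dens \<pi> (\<rho> t))" "(\<integral>x. \<bar>dens \<pi> (\<rho> t) x\<bar> \<partial>\<pi>) = measure (\<rho> t) UNIV"
proof -
  have "emeasure (\<rho> t) UNIV = (\<integral>\<^sup>+ x. ennreal (dens \<pi> (\<rho> t) x) \<partial>\<pi>)"
    by (subst rho_density[OF t], subst emeasure_density) (auto simp: pi_measurable pi)
  moreover have "emeasure (\<rho> t) UNIV = ennreal (measure (\<rho> t) UNIV)"
    by (rule finite_measure.emeasure_eq_measure[OF rho_sets(2)[OF t]])
  ultimately have e: "(\<integral>\<^sup>+ x. ennreal (dens \<pi> (\<rho> t) x) \<partial>\<pi>) = ennreal (measure (\<rho> t) UNIV)" by simp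
  show i: "integrable \<pi> (dens \<pi> (\<rho> t))"
    by (rule integrableI_nonneg) (use e in \<open>auto simp: pi_measurable dens_nonneg\<close>)
  show "(\<integral>x. \<bar>dens \<pi> (\<rho> t) x\<bar> \<partial>\<pi>) = measure (\<rho> t) UNIV"
    using e nn_integral_eq_integral[OF i] by (simp add: dens_nonneg integral_nonneg_AE)
qed

text \<open>The joint density is approximated by rectangle functions in \<open>L\<^sup>1\<close> of
  the product. The spatial \<open>L\<^sup>1\<close> distances then tend to 0 in
  \<open>L\<^sup>1\<close> of time, hence almost everywhere along a subsequence, which is strong
  measurability.\<close>

lemma Bochner_dens: "Bochner_L1 T \<pi> (\<lambda>t. dens \<pi> (\<rho> t))"
  unfolding Bochner_L1_def
proof (intro conjI ballI)
  let ?I = "time_interval T" and ?S = "semidirect (time_interval T) (\<lambda>_. \<pi>)"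
  show "integrable \<pi> (dens \<pi> (\<rho> t))" if "t \<in> {0..T}" for t by (rule dens_integrable[OF that])
  obtain U where U: "U \<in> borel_measurable borel" "integrable ?S U"
    "AE t in lborel. t \<in> {0..T} \<longrightarrow> (AE x in \<pi>. dens \<pi> (\<rho> t) x = U (t, x))" using joint_density by blast
  have "\<exists>s. rectangle_simple \<pi> s \<and> (\<integral>z. \<bar>U z - s z\<bar> \<partial>?S) < 1 / real (Suc k)" for k
    by (rule rectangle_simple_approx[OF finite_time_interval time_interval(1) pi(2,1) U(2)]) simp
  then obtain s where s: "\<And>k. rectangle_simple \<pi> (s k)" "\<And>k. (\<integral>z. \<bar>U z - s k z\<bar> \<partial>?S) < 1 / real (Suc k)" by metis
  have ints: "integrable ?S (s k)" for k
    by (rule rectangle_simple_integrable[OF finite_time_interval time_interval(1) pi(2,1) s(1)])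
  have id: "integrable ?S (\<lambda>z. \<bar>U z - s k z\<bar>)" for k using U(2) ints[of k] by auto
  define d where "d k t = (\<integral>x. \<bar>U (t, x) - s k (t, x)\<bar> \<partial>\<pi>)" for k t
  have di: "integrable ?I (d k)" and de: "(\<integral>t. d k t \<partial>?I) < 1 / real (Suc k)" for k
    unfolding d_def using integral_semidirect[OF pi_kernel time_interval(1) id[of k]] s(2)[of k] by auto
  have "(\<lambda>k. \<integral>t. norm (d k t) \<partial>?I) \<longlonglongrightarrow> 0"
  proof (rule real_tendsto_sandwich)
    show "eventually (\<lambda>k. 0 \<le> (\<integral>t. norm (d k t) \<partial>?I)) sequentially" by (simp add: integral_nonneg_AE)
    have "norm (d k t) = d k t" for k t by (simp add: d_def integral_nonneg_AE)
    then show "eventually (\<lambda>k. (\<integral>t. norm (d k t) \<partial>?I) \<le> 1 / real (Suc k)) sequentially" using de by (auto intro!: always_eventually less_imp_le)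
    show "(\<lambda>k. 1 / real (Suc k)) \<longlonglongrightarrow> 0" using LIMSEQ_inverse_real_of_nat by (simp add: inverse_eq_divide)
  qed simp
  from tendsto_L1_AE_subseq[OF di this] obtain r :: "nat \<Rightarrow> nat" where r: "AE t in ?I. (\<lambda>k. d (r k) t) \<longlonglongrightarrow> 0" by blast
  show "\<exists>s. (\<forall>k. simple_L1_curve T \<pi> (s k)) \<and>
      (AE t in lborel. t \<in> {0..T} \<longrightarrow> (\<lambda>k. \<integral>x. \<bar>s k t x - dens \<pi> (\<rho> t) x\<bar> \<partial>\<pi>) \<longlonglongrightarrow> 0)"
  proof (intro exI conjI allI)
    show "simple_L1_curve T \<pi> (\<lambda>t x. s (r k) (t, x))" for k
      using s(1)[of "r k"] unfolding rectangle_simple_def simple_L1_curve_def by metis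
    have "AE t in lborel. t \<in> {0..T} \<longrightarrow> (\<lambda>k. d (r k) t) \<longlonglongrightarrow> 0" using r by (simp add: AE_time_interval)
    with U(3) show "AE t in lborel. t \<in> {0..T} \<longrightarrow> (\<lambda>k. \<integral>x. \<bar>s (r k) (t, x) - dens \<pi> (\<rho> t) x\<bar> \<partial>\<pi>) \<longlonglongrightarrow> 0"
    proof eventually_elim
      case (elim t)
      show ?case
      proof
        assume t: "t \<in> {0..T}"
        have sm: "(\<lambda>x. s (r k) (t, x)) \<in> borel_measurable borel" for k
          by (rule measurable_Pair_section[OF rectangle_simple_measurable[OF s(1)]])
        have "(\<integral>x. \<bar>s (r k) (t, x) - dens \<pi> (\<rho> t) x\<bar> \<partial>\<pi>) = d (r k) t" for k
          unfolding d_def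
        proof (rule integral_cong_AE)
          show "(\<lambda>x. \<bar>U (t, x) - s (r k) (t, x)\<bar>) \<in> borel_measurable \<pi>"
            using sm[of k] measurable_Pair_section[OF U(1), of t] by (simp add: pi_measurable)
          show "(\<lambda>x. \<bar>s (r k) (t, x) - dens \<pi> (\<rho> t) x\<bar>) \<in> borel_measurable \<pi>"
            using sm[of k] by (simp add: pi_measurable)
          from elim t have "AE x in \<pi>. dens \<pi> (\<rho> t) x = U (t, x)" by blast
          then show "AE x in \<pi>. \<bar>s (r k) (t, x) - dens \<pi> (\<rho> t) x\<bar> = \<bar>U (t, x) - s (r k) (t, x)\<bar>"
            by eventually_elim (simp add: abs_minus_commute)
        qed
        then show "(\<lambda>k. \<integral>x. \<bar>s (r k) (t, x) - dens \<pi> (\<rho> t) x\<bar> \<partial>\<pi>) \<longlonglongrightarrow> 0" using elim t by simp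
      qed
    qed
  qed
  obtain C where C: "C \<ge> 0" "\<And>t. t \<in> {0..T} \<Longrightarrow> measure (\<rho> t) UNIV \<le> C" using rho_mass_bounded by blast
  have "(\<integral>\<^sup>+ t\<in>{0..T}. ennreal (\<integral>x. \<bar>dens \<pi> (\<rho> t) x\<bar> \<partial>\<pi>) \<partial>lborel) \<le> (\<integral>\<^sup>+ t. ennreal C * indicator {0..T} t \<partial>lborel)"
    using C(2) by (intro nn_integral_mono) (auto simp: indicator_def dens_integrable(2) intro: ennreal_leI)
  also have "\<dots> < \<infinity>" using T by (simp add: nn_integral_cmult ennreal_mult_less_top)
  finally show "(\<integral>\<^sup>+ t\<in>{0..T}. ennreal (\<integral>x. \<bar>dens \<pi> (\<rho> t) x\<bar> \<partial>\<pi>) \<partial>lborel) < \<infinity>" .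
qed

end

section \<open>Lower bounds along the sequence\<close>

text \<open>A selection of the largest among \<open>v 0\<close>, ..., \<open>v m\<close>, with ties
  resolved in favour of the smaller index. Having finitely many values, it is measurable together
  with everything composed with it.\<close>

primrec argmax_upto :: "(nat \<Rightarrow> 'a \<Rightarrow> real) \<Rightarrow> nat \<Rightarrow> 'a \<Rightarrow> nat" where
  "argmax_upto v 0 x = 0"
| "argmax_upto v (Suc m) x = (if v (argmax_upto v m x) x < v (Suc m) x then Suc m else argmax_upto v m x)"

lemma argmax_upto_le: "argmax_upto v m x \<le> m"
  by (induction m) (auto intro: le_SucI)

lemma argmax_upto_ge: "i \<le> m \<Longrightarrow> v i x \<le> v (argmax_upto v m x) x"
  by (induction m) (auto simp: le_Suc_eq intro: order_trans less_imp_le)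

lemma argmax_upto_mono: "m \<le> n \<Longrightarrow> v (argmax_upto v m x) x \<le> v (argmax_upto v n x) x"
  by (rule argmax_upto_ge) (rule order_trans[OF argmax_upto_le])

lemma argmax_upto_measurable:
  assumes "\<And>i. v i \<in> borel_measurable M"
  shows "argmax_upto v m \<in> measurable M (count_space UNIV)"
proof (induction m)
  case 0 show ?case by (simp add: measurable_const[of 0] argmax_upto.simps(1)[abs_def])
next
  case (Suc m)
  have [measurable]: "(\<lambda>x. v (argmax_upto v m x) x) \<in> borel_measurable M" "v (Suc m) \<in> borel_measurable M"
    "argmax_upto v m \<in> measurable M (count_space UNIV)"
    using assms Suc by (auto intro: measurable_compose_countable[of v])
  show ?case unfolding argmax_upto.simps(2)[abs_def] by measurable
qed

lemma SUP_argmax_upto: "(SUP m. ennreal (v (argmax_upto v m x) x)) = (SUP i. ennreal (v i x))"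
proof (rule antisym)
  show "(SUP m. ennreal (v (argmax_upto v m x) x)) \<le> (SUP i. ennreal (v i x))"
    by (rule SUP_least) (rule SUP_upper, simp)
  show "(SUP i. ennreal (v i x)) \<le> (SUP m. ennreal (v (argmax_upto v m x) x))"
  proof (rule SUP_least)
    fix i
    have "ennreal (v i x) \<le> ennreal (v (argmax_upto v i x) x)" by (intro ennreal_leI argmax_upto_ge) simp
    also have "\<dots> \<le> (SUP m. ennreal (v (argmax_upto v m x) x))" by (rule SUP_upper) simp
    finally show "ennreal (v i x) \<le> (SUP m. ennreal (v (argmax_upto v m x) x))" .
  qed
qed

text \<open>Coefficients picked along the selection take finitely many values and are therefore
  bounded, as tests against setwise convergent measures must be.\<close>

lemma argmax_upto_value:
  fixes c :: "nat \<Rightarrow> real"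
  assumes "\<And>i. v i \<in> borel_measurable M"
  shows "(\<lambda>x. c (argmax_upto v m x)) \<in> borel_measurable M" "\<bar>c (argmax_upto v m x)\<bar> \<le> (\<Sum>i\<le>m. \<bar>c i\<bar>)"
proof -
  show "(\<lambda>x. c (argmax_upto v m x)) \<in> borel_measurable M"
    by (rule measurable_compose[OF argmax_upto_measurable[OF assms]]) auto
  show "\<bar>c (argmax_upto v m x)\<bar> \<le> (\<Sum>i\<le>m. \<bar>c i\<bar>)"
    by (rule member_le_sum[of _ _ "\<lambda>i. \<bar>c i\<bar>"]) (auto simp: argmax_upto_le)
qed

lemma integral_time_interval:
  fixes f :: "real \<Rightarrow> real"
  assumes "f \<in> borel_measurable borel"
  shows "(\<integral>t. f t \<partial>time_interval T) = (\<integral>t. indicator {0..T} t * f t \<partial>lborel)"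
    "integrable (time_interval T) f \<longleftrightarrow> integrable lborel (\<lambda>t. indicator {0..T} t * f t)"
proof -
  have e: "time_interval T = density lborel (\<lambda>t. ennreal (indicator {0..T} t))"
    by (simp add: time_interval_def ennreal_indicator)
  show "(\<integral>t. f t \<partial>time_interval T) = (\<integral>t. indicator {0..T} t * f t \<partial>lborel)"
    unfolding e using assms by (subst integral_density) auto
  show "integrable (time_interval T) f \<longleftrightarrow> integrable lborel (\<lambda>t. indicator {0..T} t * f t)"
    unfolding e using assms by (subst integrable_density) auto
qed

context flow_limit
begin

text \<open>The affine minorant is selected by the limit density, so its coefficients do not depend
  on \<open>n\<close> and the resulting test converges. Monotone convergence in \<open>m\<close>
  recovers the entropy of the limit. Explicit lower sequences are stated instead of a limit
  inferior, so that they can be added to those of the dissipation for the same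
  \<open>n\<close>.\<close>

lemma entropy_lower:
  assumes t: "t \<in> {0..T}"
  shows "\<exists>e. incseq e \<and> (SUP m. e m) = Ent (\<rho> t) \<and>
    (\<forall>m. \<exists>x. (\<forall>n. ennreal (x n) \<le> Ent (\<rho>n n t)) \<and> (\<lambda>n. ennreal (x n)) \<longlonglongrightarrow> e m)"
proof -
  obtain b c :: "nat \<Rightarrow> real" where bc0: "b 0 = 0" "c 0 = 0" and bc: "\<And>i r. r \<ge> 0 \<Longrightarrow> b i + c i * r \<le> \<phi> r"
    "\<And>r. r \<ge> 0 \<Longrightarrow> ennreal (\<phi> r) = (SUP i. ennreal (b i + c i * r))" using entropy_density_affine[OF phi] by blast
  let ?u = "dens \<pi> (\<rho> t)"
  define v where "v i x = b i + c i * ?u x" for i x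
  have vm: "v i \<in> borel_measurable borel" for i unfolding v_def by measurable
  let ?N = "argmax_upto v"
  define e where "e m = (\<integral>\<^sup>+ x. ennreal (v (?N m x) x) \<partial>\<pi>)" for m
  have Nb: "(\<lambda>x. b (?N m x)) \<in> borel_measurable borel" "(\<lambda>x. c (?N m x)) \<in> borel_measurable borel" for m
    by (rule argmax_upto_value[OF vm])+
  have vNm: "(\<lambda>x. v (?N m x) x) \<in> borel_measurable borel" for m
    by (rule measurable_compose_countable[OF vm argmax_upto_measurable[OF vm]])
  have v0: "0 \<le> v (?N m x) x" for m x using argmax_upto_ge[where i = 0 and m = m and v = v and x = x] by (simp add: v_def bc0)
  interpret p: finite_measure \<pi> by (rule pi(2))
  have ib: "integrable \<pi> (\<lambda>x. b (?N m x))" for m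
    using Nb argmax_upto_value(2)[OF vm, where c = b and m = m] by (intro p.integrable_const_bound[of _ "\<Sum>i\<le>m. \<bar>b i\<bar>"]) (auto simp: pi_measurable)
  have ic: "integrable M (\<lambda>x. c (?N m x))" if "finite_measure M" "sets M = sets borel" for m M
    using Nb argmax_upto_value(2)[OF vm, where c = c and m = m] that
    by (intro finite_measure.integrable_const_bound[OF that(1), of _ "\<Sum>i\<le>m. \<bar>c i\<bar>"]) (auto simp: measurable_cong_sets[OF that(2) refl])
  have dn: "\<mu> = density \<pi> (\<lambda>x. ennreal (dens \<pi> \<mu> x)) \<Longrightarrow> (\<integral>x. c (?N m x) \<partial>\<mu>) = (\<integral>x. c (?N m x) * dens \<pi> \<mu> x \<partial>\<pi>) \<and>
      (integrable \<mu> (\<lambda>x. c (?N m x)) \<longleftrightarrow> integrable \<pi> (\<lambda>x. c (?N m x) * dens \<pi> \<mu> x))" for \<mu> m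
  proof -
    assume "\<mu> = density \<pi> (\<lambda>x. ennreal (dens \<pi> \<mu> x))"
    then obtain u where u: "\<mu> = density \<pi> (\<lambda>x. ennreal (u x))" "u = dens \<pi> \<mu>" by blast
    have "u \<in> borel_measurable borel" "\<And>x. 0 \<le> u x" by (auto simp: u(2) dens_nonneg)
    then show ?thesis unfolding u(2)[symmetric] unfolding u(1)
      using Nb by (simp add: integral_density integrable_density pi_measurable mult.commute)
  qed
  have key: "(\<integral>x. b (?N m x) \<partial>\<pi>) + (\<integral>x. c (?N m x) \<partial>\<mu>) = (\<integral>x. b (?N m x) + c (?N m x) * dens \<pi> \<mu> x \<partial>\<pi>)"
    "integrable \<pi> (\<lambda>x. b (?N m x) + c (?N m x) * dens \<pi> \<mu> x)"
    if "\<mu> = density \<pi> (\<lambda>x. ennreal (dens \<pi> \<mu> x))" "finite_measure \<mu>" "sets \<mu> = sets borel" for \<mu> m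
    using dn[OF that(1), of m] ic[OF that(2,3), of m] ib[of m] by auto
  have "incseq e"
    unfolding e_def incseq_def by (auto intro!: nn_integral_mono ennreal_leI argmax_upto_mono)
  moreover have "(SUP m. e m) = Ent (\<rho> t)"
  proof -
    have "(SUP m. e m) = (\<integral>\<^sup>+ x. (SUP m. ennreal (v (?N m x) x)) \<partial>\<pi>)"
      unfolding e_def using vNm
      by (intro nn_integral_monotone_convergence_SUP[symmetric]) (auto simp: incseq_def le_fun_def pi_measurable intro!: ennreal_leI argmax_upto_mono)
    also have "\<dots> = (\<integral>\<^sup>+ x. ennreal (\<phi> (?u x)) \<partial>\<pi>)"
      unfolding SUP_argmax_upto by (simp add: bc(2)[OF dens_nonneg] v_def)
    finally show ?thesis using rho_lim(2)[OF t] by (simp add: entropy_functional_def)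
  qed
  moreover have "\<exists>x. (\<forall>n. ennreal (x n) \<le> Ent (\<rho>n n t)) \<and> (\<lambda>n. ennreal (x n)) \<longlonglongrightarrow> e m" for m
  proof (intro exI conjI allI)
    let ?x = "\<lambda>n. (\<integral>x. b (?N m x) \<partial>\<pi>) + (\<integral>x. c (?N m x) \<partial>\<rho>n n t)"
    show "ennreal (?x n) \<le> Ent (\<rho>n n t)" for n
    proof -
      note k = key[OF entropy_finite(2)[OF rho[OF t] entropy_fin[OF t]] rho'(2,1)[OF t], of m n]
      have "ennreal (?x n) \<le> (\<integral>\<^sup>+ x. ennreal (b (?N m x) + c (?N m x) * dens \<pi> (\<rho>n n t) x) \<partial>\<pi>)"
        unfolding k(1) by (rule ennreal_integral_le_nn_integral[OF k(2)])
      also have "\<dots> \<le> (\<integral>\<^sup>+ x. ennreal (\<phi> (dens \<pi> (\<rho>n n t) x)) \<partial>\<pi>)"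
        by (intro nn_integral_mono ennreal_leI bc(1) dens_nonneg)
      finally show ?thesis by (simp add: entropy_finite(3)[OF rho[OF t] entropy_fin[OF t]])
    qed
    note k = key[OF rho_density[OF t] rho_sets(2,1)[OF t], of m]
    have "(\<lambda>n. \<integral>x. c (?N m x) \<partial>\<rho>n n t) \<longlonglongrightarrow> (\<integral>x. c (?N m x) \<partial>\<rho> t)"
      by (rule rho_test_lim[OF t Nb(2) argmax_upto_value(2)[OF vm]])
    then have "?x \<longlonglongrightarrow> (\<integral>x. b (?N m x) \<partial>\<pi>) + (\<integral>x. c (?N m x) \<partial>\<rho> t)" by (intro tendsto_intros)
    then have "(\<lambda>n. ennreal (?x n)) \<longlonglongrightarrow> ennreal ((\<integral>x. b (?N m x) \<partial>\<pi>) + (\<integral>x. c (?N m x) \<partial>\<rho> t))" by (rule tendsto_ennrealI)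
    also have "ennreal ((\<integral>x. b (?N m x) \<partial>\<pi>) + (\<integral>x. c (?N m x) \<partial>\<rho> t)) = e m"
    proof -
      have vv: "v (?N m x) x = b (?N m x) + c (?N m x) * ?u x" for x by (rule v_def)
      have "0 \<le> b (?N m x) + c (?N m x) * ?u x" for x using v0[of m x] unfolding vv .
      then show ?thesis unfolding k(1) e_def vv by (intro nn_integral_eq_integral[symmetric] k(2)) auto
    qed
    finally show "(\<lambda>n. ennreal (?x n)) \<longlonglongrightarrow> e m" .
  qed
  ultimately show ?thesis by blast
qed

lemma entropy_lim_finite: "t \<in> {0..T} \<Longrightarrow> Ent (\<rho> t) < \<infinity>"
proof -
  assume t: "t \<in> {0..T}"
  obtain e :: "nat \<Rightarrow> ennreal" where e: "(SUP m. e m) = Ent (\<rho> t)"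
    "\<And>m. \<exists>x. (\<forall>n. ennreal (x n) \<le> Ent (\<rho>n n t)) \<and> (\<lambda>n. ennreal (x n)) \<longlonglongrightarrow> e m"
    using entropy_lower[OF t] by blast
  have "e m \<le> ennreal Ebar" for m
  proof -
    obtain x where x: "\<And>n. ennreal (x n) \<le> Ent (\<rho>n n t)" "(\<lambda>n. ennreal (x n)) \<longlonglongrightarrow> e m" using e(2) by blast
    show ?thesis by (rule LIMSEQ_le_const2[OF x(2)]) (use x(1) entropy_le[OF t] order_trans in blast)
  qed
  then have "(SUP m. e m) \<le> ennreal Ebar" by (rule SUP_least)
  then show ?thesis unfolding e(1) by (auto intro: le_less_trans)
qed

section \<open>Limits of tests against the densities\<close>

lemma dens_fst_lam:
  assumes \<mu>: "\<mu> \<in> finite_borel_measures" "Ent \<mu> < \<infinity>" and C: "measure \<mu> UNIV \<le> C"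
  shows "integrable lam (\<lambda>z. dens \<pi> \<mu> (fst z))" "(\<integral>z. dens \<pi> \<mu> (fst z) \<partial>lam) \<le> K0 * C"
    "integrable lam (\<lambda>z. dens \<pi> \<mu> (snd z))" "(\<integral>z. dens \<pi> \<mu> (snd z) \<partial>lam) \<le> K0 * C"
proof -
  have \<mu>': "sets \<mu> = sets borel" "finite_measure \<mu>" "space \<mu> = UNIV"
    using \<mu>(1) space_eq_UNIV[of \<mu>] by (auto simp: finite_borel_measures_def)
  have "(\<integral>\<^sup>+ z. ennreal (dens \<pi> \<mu> (fst z)) \<partial>lam) = (\<integral>\<^sup>+ x. emeasure (K x) UNIV \<partial>\<mu>)"
    using nn_integral_lam_dens_fst[OF \<mu>, of "\<lambda>_. 1"] by (simp add: finite_kernelD[OF K_kernel])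
  also have "\<dots> \<le> (\<integral>\<^sup>+ x. ennreal K0 \<partial>\<mu>)" by (intro nn_integral_mono K_bounded)
  also have "\<dots> = ennreal (K0 * measure \<mu> UNIV)"
    using K0_ge_1 by (simp add: \<mu>' finite_measure.emeasure_eq_measure[OF \<mu>'(2)] ennreal_mult)
  also have "\<dots> \<le> ennreal (K0 * C)" using C K0_ge_1 by (intro ennreal_leI mult_left_mono) auto
  finally have f: "(\<integral>\<^sup>+ z. ennreal (dens \<pi> \<mu> (fst z)) \<partial>lam) \<le> ennreal (K0 * C)" .
  have "(\<integral>\<^sup>+ z. ennreal (dens \<pi> \<mu> (snd z)) \<partial>lam) = (\<integral>\<^sup>+ z. ennreal (dens \<pi> \<mu> (snd (prod.swap z))) \<partial>lam)"
    by (rule nn_integral_lam_swap[symmetric]) measurable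
  with f have s: "(\<integral>\<^sup>+ z. ennreal (dens \<pi> \<mu> (snd z)) \<partial>lam) \<le> ennreal (K0 * C)" by simp
  have KC: "0 \<le> K0 * C" using K0_ge_1 order_trans[OF measure_nonneg C] by simp
  have *: "integrable lam g \<and> (\<integral>z. g z \<partial>lam) \<le> K0 * C"
    if "g \<in> borel_measurable borel" "\<And>z. 0 \<le> g z" "(\<integral>\<^sup>+ z. ennreal (g z) \<partial>lam) \<le> ennreal (K0 * C)" for g
  proof
    show i: "integrable lam g" using that by (intro integrableI_nonneg) (auto intro: le_less_trans)
    have "ennreal (\<integral>z. g z \<partial>lam) \<le> ennreal (K0 * C)" using that nn_integral_eq_integral[OF i] by simp
    then show "(\<integral>z. g z \<partial>lam) \<le> K0 * C" using KC by (simp add: ennreal_le_iff)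
  qed
  show "integrable lam (\<lambda>z. dens \<pi> \<mu> (fst z))" "(\<integral>z. dens \<pi> \<mu> (fst z) \<partial>lam) \<le> K0 * C"
    "integrable lam (\<lambda>z. dens \<pi> \<mu> (snd z))" "(\<integral>z. dens \<pi> \<mu> (snd z) \<partial>lam) \<le> K0 * C"
    using * f s by (auto simp: dens_nonneg)
qed

lemma integrable_bounded_mult:
  fixes f g :: "'x \<Rightarrow> real"
  assumes g: "integrable M g" and f: "f \<in> borel_measurable M" "\<And>z. \<bar>f z\<bar> \<le> H"
  shows "integrable M (\<lambda>z. f z * g z)" "\<bar>\<integral>z. f z * g z \<partial>M\<bar> \<le> H * (\<integral>z. \<bar>g z\<bar> \<partial>M)"
proof -
  have b: "\<bar>f z * g z\<bar> \<le> H * \<bar>g z\<bar>" for z using f(2)[of z] by (simp add: abs_mult mult_right_mono)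
  have H: "H \<ge> 0" using f(2)[of undefined] by linarith
  show i: "integrable M (\<lambda>z. f z * g z)"
    by (rule Bochner_Integration.integrable_bound[OF integrable_mult_right[OF g, of H]])
      (use f b g H in \<open>auto simp: abs_mult borel_measurable_integrable\<close>)
  have "\<bar>\<integral>z. f z * g z \<partial>M\<bar> \<le> (\<integral>z. \<bar>f z * g z\<bar> \<partial>M)" by (rule integral_abs_bound)
  also have "\<dots> \<le> (\<integral>z. H * \<bar>g z\<bar> \<partial>M)" using i g b by (intro integral_mono) auto
  finally show "\<bar>\<integral>z. f z * g z \<partial>M\<bar> \<le> H * (\<integral>z. \<bar>g z\<bar> \<partial>M)" by simp
qed

lemma integral_lam_dens_fst:
  fixes h :: "'v \<times> 'v \<Rightarrow> real"
  assumes \<mu>: "\<mu> \<in> finite_borel_measures" "Ent \<mu> < \<infinity>" and h: "h \<in> borel_measurable borel" "\<And>z. \<bar>h z\<bar> \<le> H"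
  shows "(\<integral>z. h z * dens \<pi> \<mu> (fst z) \<partial>lam) = (\<integral>x. (\<integral>y. h (x, y) \<partial>K x) \<partial>\<mu>)"
proof -
  let ?k = "\<lambda>x. \<integral>y. h (x, y) \<partial>K x"
  interpret l: finite_measure lam by (rule finite_lam)
  have "integrable lam h" by (rule l.integrable_const_bound[of _ H]) (use h in auto)
  then have km: "?k \<in> borel_measurable \<pi>"
    unfolding lam_def by (rule borel_measurable_integrable[OF integral_semidirect(2)[OF K_kernel pi(1)]])
  have i: "integrable lam (\<lambda>z. h z * dens \<pi> \<mu> (fst z))"
    using h by (intro integrable_bounded_mult(1)[OF dens_fst_lam(1)[OF \<mu> order_refl]]) auto
  have "(\<integral>z. h z * dens \<pi> \<mu> (fst z) \<partial>lam) = (\<integral>x. (\<integral>y. h (x, y) * dens \<pi> \<mu> x \<partial>K x) \<partial>\<pi>)"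
    using integral_semidirect(1)[OF K_kernel pi(1) i[unfolded lam_def]] by (simp add: lam_def)
  also have "\<dots> = (\<integral>x. dens \<pi> \<mu> x *\<^sub>R ?k x \<partial>\<pi>)" by (simp add: mult.commute)
  also have "\<dots> = (\<integral>x. ?k x \<partial>density \<pi> (\<lambda>x. ennreal (dens \<pi> \<mu> x)))"
    using km by (intro integral_density[symmetric]) (auto simp: pi_measurable dens_nonneg)
  finally show ?thesis using entropy_finite(2)[OF \<mu>] by simp
qed

text \<open>The densities converge only weakly, so the product with \<open>\<beta> n\<close> needs
  care: \<open>\<beta> n\<close> is replaced by 1, and the error vanishes because
  \<open>\<beta> n - 1\<close> is bounded and tends to 0 in \<open>L\<^sup>1\<close> of
  \<open>lam\<close> while the densities are uniformly integrable. \<open>\<beta>\<close> is general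
  so that the composition of \<open>a\<close> with the swap can be inserted.\<close>

lemma slice_test_lim:
  fixes h :: "'v \<times> 'v \<Rightarrow> real"
  assumes t: "t \<in> {0..T}" and h: "h \<in> borel_measurable borel" "\<And>z. \<bar>h z\<bar> \<le> H"
    and \<beta> [measurable]: "\<And>n. \<beta> n \<in> borel_measurable borel" and \<beta>b: "\<And>n z. 0 \<le> \<beta> n z" "\<And>n z. \<beta> n z \<le> Abar"
    and \<beta>l: "AE z in lam. (\<lambda>n. \<beta> n z) \<longlonglongrightarrow> 1"
  shows "(\<lambda>n. \<integral>z. \<beta> n z * h z * dens \<pi> (\<rho>n n t) (fst z) \<partial>lam) \<longlonglongrightarrow> (\<integral>z. h z * dens \<pi> (\<rho> t) (fst z) \<partial>lam)"
proof -
  interpret l: finite_measure lam by (rule finite_lam)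
  note [measurable] = h(1)
  have H: "H \<ge> 0" using h(2)[of undefined] by linarith
  let ?u = "\<lambda>n z. dens \<pi> (\<rho>n n t) (fst z)"
  define A where "A = Abar + 1"
  have A: "A > 0" using Abar by (simp add: A_def)
  have un: "integrable lam (?u n)" for n by (rule dens_fst_lam(1)[OF rho[OF t] entropy_fin[OF t] order_refl])
  have b1: "\<bar>\<beta> n z - 1\<bar> \<le> A" for n z using \<beta>b[of n z] unfolding A_def by linarith
  \<comment> \<open>Integrating \<open>h\<close> over the second variable against the tempered
    kernel gives one bounded function of the first, to which setwise convergence of
    \<open>\<rho>n n t\<close> applies.\<close>
  have "(\<lambda>n. \<integral>z. h z * ?u n z \<partial>lam) \<longlonglongrightarrow> (\<integral>z. h z * dens \<pi> (\<rho> t) (fst z) \<partial>lam)"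
  proof -
    let ?k = "\<lambda>x. \<integral>y. h (x, y) \<partial>K x"
    have "integrable lam h" by (rule l.integrable_const_bound[of _ H]) (use h in auto)
    then have km: "?k \<in> borel_measurable borel"
      unfolding lam_def using borel_measurable_integrable[OF integral_semidirect(2)[OF K_kernel pi(1)]] by (simp add: pi_measurable)
    have "\<bar>?k x\<bar> \<le> H * K0" for x
    proof -
      interpret k: finite_measure "K x" by (rule finite_kernelD(4)[OF K_kernel])
      have m: "(\<lambda>y. h (x, y)) \<in> borel_measurable (K x)"
        using measurable_Pair_section[OF h(1)] by (simp add: measurable_cong_sets[OF finite_kernelD(1)[OF K_kernel] refl])
      have "\<bar>?k x\<bar> \<le> H * (\<integral>y. \<bar>1\<bar> \<partial>K x)"
        using integrable_bounded_mult(2)[of "K x" "\<lambda>_. 1" "\<lambda>y. h (x, y)" H] m h(2) by simp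
      also have "\<dots> \<le> H * K0"
      proof (rule mult_left_mono[OF _ H])
        have "ennreal (measure (K x) UNIV) \<le> ennreal K0" using K_bounded[of x] k.emeasure_eq_measure by simp
        then show "(\<integral>y. \<bar>1\<bar> \<partial>K x) \<le> K0" using K0_ge_1 by (simp add: finite_kernelD(3)[OF K_kernel] ennreal_le_iff)
      qed
      finally show ?thesis .
    qed
    from rho_test_lim[OF t km this] show ?thesis
      by (simp add: integral_lam_dens_fst[OF rho[OF t] entropy_fin[OF t] h] integral_lam_dens_fst[OF rho_lim(1)[OF t] entropy_lim_finite[OF t] h])
  qed
  moreover have "(\<lambda>n. \<integral>z. (\<beta> n z - 1) * h z * ?u n z \<partial>lam) \<longlonglongrightarrow> 0"
  proof -
    have d0: "(\<lambda>n. \<integral>z. \<bar>\<beta> n z - 1\<bar> \<partial>lam) \<longlonglongrightarrow> (\<integral>z. 0 \<partial>lam)"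
    proof (rule integral_dominated_convergence[where w = "\<lambda>_. A"])
      from \<beta>l show "AE z in lam. (\<lambda>n. \<bar>\<beta> n z - 1\<bar>) \<longlonglongrightarrow> 0"
      proof eventually_elim
        case (elim z)
        have "(\<lambda>n. \<beta> n z - 1) \<longlonglongrightarrow> 1 - 1" by (intro tendsto_intros elim)
        then show ?case using tendsto_rabs_zero by fastforce
      qed
    qed (use b1 in auto)
    show ?thesis
    proof (rule LIMSEQ_I)
      fix \<eta> :: real assume \<eta>: "\<eta> > 0"
      \<comment> \<open>Makes the error of uniform integrability contribute exactly
        \<open>\<eta> / 4\<close> at the end, whatever \<open>m\<close> turns out to be.\<close>
      define \<epsilon> where "\<epsilon> = \<eta> / 4 / ((H + 1) * A * K0)"
      have nz: "(H + 1) * A * K0 > 0" using H A K0_ge_1 by simp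
      then have \<epsilon>: "\<epsilon> > 0" using \<eta> by (simp add: \<epsilon>_def)
      have cancel: "x * (y / x) = y" if "x \<noteq> 0" for x y :: real using that by simp
      obtain m where m: "m \<ge> 0" "\<And>n t. t \<in> {0..T} \<Longrightarrow> uniform_bound m \<epsilon> (\<rho>n n t)" using uniform_bounds[OF \<epsilon>] by auto
      have bound: "(\<integral>z. \<bar>\<beta> n z - 1\<bar> * ?u n z \<partial>lam) \<le> m * (\<integral>z. \<bar>\<beta> n z - 1\<bar> \<partial>lam) + A * K0 * \<epsilon>" for n
      proof -
        have i1: "integrable lam (\<lambda>z. \<bar>\<beta> n z - 1\<bar> * ?u n z)"
          by (rule integrable_bounded_mult(1)[OF un, of _ A]) (use b1 in auto)
        have i2: "integrable lam (\<lambda>z. \<bar>\<beta> n z - 1\<bar> / A)"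
          using b1 A by (intro integrable_divide l.integrable_const_bound[of _ A]) auto
        have "ennreal (\<integral>z. (\<bar>\<beta> n z - 1\<bar> * ?u n z) / A \<partial>lam) = (\<integral>\<^sup>+ z. ennreal ((\<bar>\<beta> n z - 1\<bar> * ?u n z) / A) \<partial>lam)"
          using i1 A by (intro nn_integral_eq_integral[symmetric]) (auto simp: dens_nonneg)
        also have "\<dots> = (\<integral>\<^sup>+ z. ennreal (?u n z) * ennreal (\<bar>\<beta> n z - 1\<bar> / A) \<partial>lam)"
          using A by (intro nn_integral_cong) (auto simp: ennreal_mult[symmetric] dens_nonneg mult.commute)
        also have "\<dots> \<le> ennreal m * (\<integral>\<^sup>+ z. ennreal (\<bar>\<beta> n z - 1\<bar> / A) \<partial>lam) + ennreal (K0 * \<epsilon>)"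
          using b1 A \<epsilon> by (intro lam_dens_bound(1)[OF rho[OF t] entropy_fin[OF t] m(2)[OF t] m(1)]) (auto simp: ennreal_le_1)
        also have "(\<integral>\<^sup>+ z. ennreal (\<bar>\<beta> n z - 1\<bar> / A) \<partial>lam) = ennreal (\<integral>z. \<bar>\<beta> n z - 1\<bar> / A \<partial>lam)"
          using A by (intro nn_integral_eq_integral[OF i2]) auto
        also have "ennreal m * ennreal (\<integral>z. \<bar>\<beta> n z - 1\<bar> / A \<partial>lam) + ennreal (K0 * \<epsilon>) = ennreal (m * (\<integral>z. \<bar>\<beta> n z - 1\<bar> / A \<partial>lam) + K0 * \<epsilon>)"
          unfolding ennreal_mult'[OF m(1), symmetric] using m(1) K0_ge_1 \<epsilon> A
          by (intro ennreal_plus[symmetric] mult_nonneg_nonneg integral_nonneg_AE) auto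
        finally have "(\<integral>z. (\<bar>\<beta> n z - 1\<bar> * ?u n z) / A \<partial>lam) \<le> m * (\<integral>z. \<bar>\<beta> n z - 1\<bar> / A \<partial>lam) + K0 * \<epsilon>"
          using m(1) K0_ge_1 \<epsilon> A by (subst (asm) ennreal_le_iff) (auto intro!: add_nonneg_nonneg mult_nonneg_nonneg integral_nonneg_AE)
        then show ?thesis using A by (simp add: pos_divide_le_eq distrib_right distrib_left mult_ac)
      qed
      have "(\<lambda>n. (H + 1) * (m * (\<integral>z. \<bar>\<beta> n z - 1\<bar> \<partial>lam))) \<longlonglongrightarrow> (H + 1) * (m * 0)"
        using d0 by (intro tendsto_intros) simp
      then have "eventually (\<lambda>n. (H + 1) * (m * (\<integral>z. \<bar>\<beta> n z - 1\<bar> \<partial>lam)) < \<eta> / 4) sequentially"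
        using \<eta> by (intro order_tendstoD(2)) auto
      then obtain n0 where n0: "\<And>n. n \<ge> n0 \<Longrightarrow> (H + 1) * (m * (\<integral>z. \<bar>\<beta> n z - 1\<bar> \<partial>lam)) < \<eta> / 4"
        by (auto simp: eventually_sequentially)
      have "norm ((\<integral>z. (\<beta> n z - 1) * h z * ?u n z \<partial>lam) - 0) < \<eta>" if "n \<ge> n0" for n
      proof -
        have "(\<integral>z. (\<beta> n z - 1) * h z * ?u n z \<partial>lam) = (\<integral>z. h z * ((\<beta> n z - 1) * ?u n z) \<partial>lam)" by (simp add: mult_ac)
        then have "\<bar>\<integral>z. (\<beta> n z - 1) * h z * ?u n z \<partial>lam\<bar> \<le> H * (\<integral>z. \<bar>(\<beta> n z - 1) * ?u n z\<bar> \<partial>lam)"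
          using integrable_bounded_mult(2)[OF integrable_bounded_mult(1)[OF un, of "\<lambda>z. \<beta> n z - 1" A], of h H n] b1 h by simp
        also have "\<dots> = H * (\<integral>z. \<bar>\<beta> n z - 1\<bar> * ?u n z \<partial>lam)" by (simp add: abs_mult dens_nonneg)
        also have "\<dots> \<le> H * (m * (\<integral>z. \<bar>\<beta> n z - 1\<bar> \<partial>lam) + A * K0 * \<epsilon>)" by (rule mult_left_mono[OF bound H])
        also have "\<dots> \<le> (H + 1) * (m * (\<integral>z. \<bar>\<beta> n z - 1\<bar> \<partial>lam) + A * K0 * \<epsilon>)"
          using m(1) A K0_ge_1 \<epsilon> by (intro mult_right_mono) (auto intro!: add_nonneg_nonneg mult_nonneg_nonneg integral_nonneg_AE)
        also have "\<dots> = (H + 1) * (m * (\<integral>z. \<bar>\<beta> n z - 1\<bar> \<partial>lam)) + (H + 1) * A * K0 * \<epsilon>" by (simp add: algebra_simps)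
        also have "(H + 1) * A * K0 * \<epsilon> = \<eta> / 4" unfolding \<epsilon>_def by (rule cancel[OF less_imp_neq[OF nz, symmetric]])
        finally show ?thesis using n0[OF that] \<eta> by simp
      qed
      then show "\<exists>n0. \<forall>n\<ge>n0. norm ((\<integral>z. (\<beta> n z - 1) * h z * ?u n z \<partial>lam) - 0) < \<eta>" by blast
    qed
  qed
  ultimately have "(\<lambda>n. (\<integral>z. h z * ?u n z \<partial>lam) + (\<integral>z. (\<beta> n z - 1) * h z * ?u n z \<partial>lam)) \<longlonglongrightarrow> (\<integral>z. h z * dens \<pi> (\<rho> t) (fst z) \<partial>lam) + 0"
    by (rule tendsto_add)
  moreover have "(\<integral>z. h z * ?u n z \<partial>lam) + (\<integral>z. (\<beta> n z - 1) * h z * ?u n z \<partial>lam) = (\<integral>z. \<beta> n z * h z * ?u n z \<partial>lam)" for n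
  proof -
    have "integrable lam (\<lambda>z. h z * ?u n z)" by (rule integrable_bounded_mult(1)[OF un]) (use h in auto)
    moreover have "integrable lam (\<lambda>z. (\<beta> n z - 1) * (h z * ?u n z))"
      by (rule integrable_bounded_mult(1)[OF calculation]) (use b1 in auto)
    ultimately have "(\<integral>z. h z * ?u n z \<partial>lam) + (\<integral>z. (\<beta> n z - 1) * (h z * ?u n z) \<partial>lam) = (\<integral>z. h z * ?u n z + (\<beta> n z - 1) * (h z * ?u n z) \<partial>lam)"
      by (rule Bochner_Integration.integral_add[symmetric])
    also have "(\<lambda>z. h z * ?u n z + (\<beta> n z - 1) * (h z * ?u n z)) = (\<lambda>z. \<beta> n z * h z * ?u n z)" by (rule ext) algebra
    finally show ?thesis by (simp only: mult.assoc)
  qed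
  ultimately show ?thesis by simp
qed

lemma integral_lam_swap:
  fixes f :: "'v \<times> 'v \<Rightarrow> real"
  assumes "f \<in> borel_measurable borel"
  shows "(\<integral>z. f (prod.swap z) \<partial>lam) = (\<integral>z. f z \<partial>lam)"
proof -
  have "(\<integral>z. f z \<partial>lam) = (\<integral>z. f z \<partial>distr lam borel prod.swap)" by (simp add: distr_lam_swap)
  also have "\<dots> = (\<integral>z. f (prod.swap z) \<partial>lam)" using assms by (intro integral_distr) auto
  finally show ?thesis by simp
qed

lemma a_lim_lam: "AE z in lam. (\<lambda>n. a n z) \<longlonglongrightarrow> 1" "AE z in lam. (\<lambda>n. a n (prod.swap z)) \<longlonglongrightarrow> 1"
proof -
  show 1: "AE z in lam. (\<lambda>n. a n z) \<longlonglongrightarrow> 1" using a_lim by (simp add: AE_lam_iff_theta)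
  have m: "{z. (\<lambda>n. a n z) \<longlonglongrightarrow> 1} \<in> sets borel" by measurable
  have "AE z in distr lam borel prod.swap. (\<lambda>n. a n z) \<longlonglongrightarrow> 1" unfolding distr_lam_swap by (rule 1)
  then show "AE z in lam. (\<lambda>n. a n (prod.swap z)) \<longlonglongrightarrow> 1" using m by (subst (asm) AE_distr_iff) auto
qed

lemma slice_test_lim_snd:
  fixes h :: "'v \<times> 'v \<Rightarrow> real"
  assumes t: "t \<in> {0..T}" and h: "h \<in> borel_measurable borel" "\<And>z. \<bar>h z\<bar> \<le> H"
  shows "(\<lambda>n. \<integral>z. a n z * h z * dens \<pi> (\<rho>n n t) (snd z) \<partial>lam) \<longlonglongrightarrow> (\<integral>z. h z * dens \<pi> (\<rho> t) (snd z) \<partial>lam)"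
proof -
  note [measurable] = h(1)
  have "(\<lambda>n. \<integral>z. a n (prod.swap z) * h (prod.swap z) * dens \<pi> (\<rho>n n t) (fst z) \<partial>lam) \<longlonglongrightarrow> (\<integral>z. h (prod.swap z) * dens \<pi> (\<rho> t) (fst z) \<partial>lam)"
    by (rule slice_test_lim[OF t _ h(2)]) (use a_nonneg a_le a_lim_lam(2) in \<open>auto intro: measurable_compose[OF swap_measurable]\<close>)
  moreover have "(\<integral>z. a n (prod.swap z) * h (prod.swap z) * dens \<pi> \<mu> (fst z) \<partial>lam) = (\<integral>z. a n z * h z * dens \<pi> \<mu> (snd z) \<partial>lam)" for n \<mu>
    using integral_lam_swap[of "\<lambda>z. a n z * h z * dens \<pi> \<mu> (snd z)"] by simp
  moreover have "(\<integral>z. h (prod.swap z) * dens \<pi> \<mu> (fst z) \<partial>lam) = (\<integral>z. h z * dens \<pi> \<mu> (snd z) \<partial>lam)" for \<mu>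
    using integral_lam_swap[of "\<lambda>z. h z * dens \<pi> \<mu> (snd z)"] by simp
  ultimately show ?thesis by simp
qed


text \<open>One joint version of the densities is fixed, since the selections of affine minorants
  have to be measurable in space-time.\<close>

definition "U = (SOME U::real \<times> 'v \<Rightarrow> real. U \<in> borel_measurable borel \<and> (\<forall>z. 0 \<le> U z) \<and>
     integrable (semidirect (time_interval T) (\<lambda>_. \<pi>)) U \<and>
     (AE t in lborel. t \<in> {0..T} \<longrightarrow> (AE x in \<pi>. dens \<pi> (\<rho> t) x = U (t, x))))"

lemma U: "U \<in> borel_measurable borel" "0 \<le> U z"
    "AE t in lborel. t \<in> {0..T} \<longrightarrow> (AE x in \<pi>. dens \<pi> (\<rho> t) x = U (t, x))"
  using someI_ex[OF joint_density] unfolding U_def[symmetric] by blast+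

abbreviation "Uu z \<equiv> U (fst z, fst (snd z))"
abbreviation "Uv z \<equiv> U (fst z, snd (snd z))"

lemma U_slice: "AE t in lborel. t \<in> {0..T} \<longrightarrow>
    (AE z in lam. dens \<pi> (\<rho> t) (fst z) = U (t, fst z) \<and> dens \<pi> (\<rho> t) (snd z) = U (t, snd z))"
  using U(3) by eventually_elim (auto dest: AE_lam_marginals)

lemma U_measurable [measurable]:
  "Uu \<in> borel_measurable (borel :: (real \<times> 'v \<times> 'v) measure)"
  "Uv \<in> borel_measurable (borel :: (real \<times> 'v \<times> 'v) measure)"
  by (rule measurable_compose[OF _ U(1)], intro borel_measurable_continuous_onI continuous_intros)+

lemma integrable_U:
  "integrable Lam Uu" "integrable Lam Uv"
proof -
  obtain C where C: "C \<ge> 0" "\<And>t. t \<in> {0..T} \<Longrightarrow> measure (\<rho> t) UNIV \<le> C" using rho_mass_bounded by blast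
  have main: "integrable Lam V"
    if V: "V \<in> borel_measurable borel" "\<And>z. 0 \<le> V z" and sd: "sd = fst \<or> sd = snd"
      and e: "AE t in lborel. t \<in> {0..T} \<longrightarrow> (AE z in lam. dens \<pi> (\<rho> t) (sd z) = V (t, z))" for V sd
  proof -
    have b: "(\<integral>\<^sup>+ z. ennreal (dens \<pi> (\<rho> t) (sd z)) \<partial>lam) \<le> ennreal (K0 * C)" if t: "t \<in> {0..T}" for t
      using dens_fst_lam[OF rho_lim(1)[OF t] entropy_lim_finite[OF t] C(2)[OF t]] sd
      by (auto simp: nn_integral_eq_integral dens_nonneg ennreal_leI)
    have "(\<integral>\<^sup>+ z. ennreal (V z) \<partial>Lam) = (\<integral>\<^sup>+ t\<in>{0..T}. (\<integral>\<^sup>+ z. ennreal (V (t, z)) \<partial>lam) \<partial>lborel)"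
      using V(1) by (intro nn_integral_Lam) simp
    also have "\<dots> \<le> (\<integral>\<^sup>+ t\<in>{0..T}. ennreal (K0 * C) \<partial>lborel)"
    proof (rule nn_integral_mono_AE)
      from e show "AE t in lborel. (\<integral>\<^sup>+ z. ennreal (V (t, z)) \<partial>lam) * indicator {0..T} t \<le> ennreal (K0 * C) * indicator {0..T} t"
      proof eventually_elim
        case (elim t)
        show ?case
        proof (cases "t \<in> {0..T}")
          case True
          with elim have "AE z in lam. dens \<pi> (\<rho> t) (sd z) = V (t, z)" by blast
          then have "AE z in lam. ennreal (V (t, z)) = ennreal (dens \<pi> (\<rho> t) (sd z))" by eventually_elim simp
          then have "(\<integral>\<^sup>+ z. ennreal (V (t, z)) \<partial>lam) = (\<integral>\<^sup>+ z. ennreal (dens \<pi> (\<rho> t) (sd z)) \<partial>lam)"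
            by (rule nn_integral_cong_AE)
          then show ?thesis using b[OF True] True by simp
        qed simp
      qed
    qed
    also have "\<dots> < \<infinity>" using T by (simp add: nn_integral_cmult ennreal_mult_less_top)
    finally show ?thesis using V by (intro integrableI_nonneg) auto
  qed
  show "integrable Lam Uu" by (rule main[OF U_measurable(1) U(2), of fst]) (use U_slice in \<open>auto elim!: eventually_mono\<close>)
  show "integrable Lam Uv" by (rule main[OF U_measurable(2) U(2), of snd]) (use U_slice in \<open>auto elim!: eventually_mono\<close>)
qed

definition "un n t x = (if t \<in> {0..T} then dens \<pi> (\<rho>n n t) x else 0)"

lemma un: "un n t \<in> borel_measurable borel" "0 \<le> un n t x"
  by (auto simp: un_def[abs_def] dens_nonneg)

lemma un_section [measurable]:
  "(\<lambda>z. un n t (fst z)) \<in> borel_measurable (borel :: ('v \<times> 'v) measure)"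
  "(\<lambda>z. un n t (snd z)) \<in> borel_measurable (borel :: ('v \<times> 'v) measure)"
  by (auto intro: measurable_compose[OF fst_snd_borel(1) un(1)] measurable_compose[OF fst_snd_borel(2) un(1)])

text \<open>The functions \<open>un n t\<close> need not be jointly measurable, but the measure with
  this density in the first variable is the integral of the kernel \<open>K\<close> against
  \<open>\<rho>n n t\<close>, and this is measurable in \<open>t\<close>. The second variable
  follows by the symmetry of \<open>lam\<close>.\<close>

lemma un_kernels:
  "finite_kernel (\<lambda>t. density lam (\<lambda>z. ennreal (un n t (fst z))))"
  "finite_kernel (\<lambda>t. density lam (\<lambda>z. ennreal (un n t (snd z))))"
proof -
  have e: "emeasure (density lam (\<lambda>z. ennreal (un n t (fst z)))) B = (\<integral>\<^sup>+ x. emeasure (K x) (Pair x -` B) \<partial>clipped T (\<rho>n n) t)"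
    if B: "B \<in> sets borel" for t B
  proof (cases "t \<in> {0..T}")
    case True
    have "emeasure (density lam (\<lambda>z. ennreal (un n t (fst z)))) B = (\<integral>\<^sup>+ z. ennreal (dens \<pi> (\<rho>n n t) (fst z)) * indicator B z \<partial>lam)"
      using True B by (subst emeasure_density) (auto simp: un_def)
    also have "\<dots> = (\<integral>\<^sup>+ x. (\<integral>\<^sup>+ y. indicator B (x, y) \<partial>K x) \<partial>\<rho>n n t)"
      using B by (intro nn_integral_lam_dens_fst[OF rho[OF True] entropy_fin[OF True]]) auto
    also have "\<dots> = (\<integral>\<^sup>+ x. emeasure (K x) (Pair x -` B) \<partial>\<rho>n n t)"
      by (intro nn_integral_cong nn_integral_indicator_section B finite_kernelD(1)[OF K_kernel])
    finally show ?thesis using True by (simp add: clipped_def)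
  next
    case False
    then show ?thesis using B by (subst emeasure_density) (auto simp: un_def clipped_def)
  qed
  have m: "(\<lambda>t. emeasure (density lam (\<lambda>z. ennreal (un n t (fst z)))) B) \<in> borel_measurable borel" if B: "B \<in> sets borel" for B
    unfolding e[OF B]
    by (rule family_nn_integral_measurable[OF finite_kernelD(1,5)[OF rho_kernels(1)] kernel_emeasure_measurable[OF K_kernel B]])
  have s: "emeasure (density lam (\<lambda>z. ennreal (un n t (snd z)))) B = emeasure (density lam (\<lambda>z. ennreal (un n t (fst z)))) (prod.swap -` B)"
    if B: "B \<in> sets borel" for t B
  proof -
    have Bs: "prod.swap -` B \<in> sets borel" using measurable_sets[OF swap_measurable B] by simp
    have "emeasure (density lam (\<lambda>z. ennreal (un n t (snd z)))) B = (\<integral>\<^sup>+ z. ennreal (un n t (snd z)) * indicator B z \<partial>lam)"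
      using B by (intro emeasure_density) auto
    also have "\<dots> = (\<integral>\<^sup>+ z. ennreal (un n t (snd (prod.swap z))) * indicator B (prod.swap z) \<partial>lam)"
      using B by (intro nn_integral_lam_swap[symmetric]) auto
    also have "\<dots> = emeasure (density lam (\<lambda>z. ennreal (un n t (fst z)))) (prod.swap -` B)"
      using Bs by (subst emeasure_density) (auto simp: indicator_vimage)
    finally show ?thesis .
  qed
  have fin: "emeasure (density lam (\<lambda>z. ennreal (un n t (fst z)))) B < \<infinity>" if B: "B \<in> sets borel" for t B
  proof (cases "t \<in> {0..T}")
    case True
    have "emeasure (density lam (\<lambda>z. ennreal (un n t (fst z)))) B \<le> emeasure (density lam (\<lambda>z. ennreal (un n t (fst z)))) UNIV"
      by (rule emeasure_mono) auto
    also have "\<dots> = (\<integral>\<^sup>+ z. ennreal (dens \<pi> (\<rho>n n t) (fst z)) \<partial>lam)" using True by (subst emeasure_density) (auto simp: un_def)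
    also have "\<dots> < \<infinity>"
      using dens_fst_lam(1)[OF rho[OF True] entropy_fin[OF True] order_refl] by (simp add: nn_integral_eq_integral dens_nonneg)
    finally show ?thesis .
  next
    case False then show ?thesis using B by (subst emeasure_density) (auto simp: un_def)
  qed
  have sw: "prod.swap -` B \<in> sets borel" if "B \<in> sets borel" for B :: "('v \<times> 'v) set"
    using measurable_sets[OF swap_measurable that] by simp
  show "finite_kernel (\<lambda>t. density lam (\<lambda>z. ennreal (un n t (fst z))))"
    using m fin[of UNIV] by (simp add: finite_kernel_def)
  show "finite_kernel (\<lambda>t. density lam (\<lambda>z. ennreal (un n t (snd z))))"
    using m sw fin[of UNIV] by (simp add: finite_kernel_def s)
qed

text \<open>Measurability in time of the spatial integrals is read off from the semidirect product
  with the kernels above, as it does not follow from the integrand.\<close>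

lemma un_time_integral:
  fixes h :: "real \<times> 'v \<times> 'v \<Rightarrow> real"
  assumes h [measurable]: "h \<in> borel_measurable borel" "\<And>z. \<bar>h z\<bar> \<le> H"
    and C: "\<forall>t\<in>{0..T}. measure (\<rho>n n t) UNIV \<le> C" and C0: "C \<ge> 0"
    and sd: "sd = fst \<or> sd = snd"
  shows "integrable (time_interval T) (\<lambda>t. \<integral>z. h (t, z) * un n t (sd z) \<partial>lam)"
    "\<bar>\<integral>z. h (t, z) * un n t (sd z) \<partial>lam\<bar> \<le> H * (K0 * C)"
    "integrable lam (\<lambda>z. h (t, z) * un n t (sd z))"
proof -
  have H: "H \<ge> 0" using h(2)[of undefined] by linarith
  note ht [measurable] = measurable_Pair_section[OF h(1)]
  have usd [measurable]: "(\<lambda>z. un n t (sd z)) \<in> borel_measurable borel" for t using sd by auto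
  have ui: "integrable lam (\<lambda>z. un n t (sd z)) \<and> (\<integral>z. un n t (sd z) \<partial>lam) \<le> K0 * C" for t
  proof (cases "t \<in> {0..T}")
    case True
    then show ?thesis using dens_fst_lam[OF rho[OF True] entropy_fin[OF True] bspec[OF C True]] sd by (auto simp: un_def)
  next
    case False
    then have "un n t x = 0" for x by (auto simp: un_def)
    then show ?thesis using K0_ge_1 C0 by simp
  qed
  show i: "integrable lam (\<lambda>z. h (t, z) * un n t (sd z))" for t
    by (rule integrable_bounded_mult(1)[of _ _ _ H]) (use ui h in auto)
  have "\<bar>\<integral>z. h (t, z) * un n t (sd z) \<partial>lam\<bar> \<le> H * (\<integral>z. \<bar>un n t (sd z)\<bar> \<partial>lam)"
    by (rule integrable_bounded_mult(2)) (use ui h in auto)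
  also have "\<dots> \<le> H * (K0 * C)" using ui H un(2) by (intro mult_left_mono) auto
  finally show "\<bar>\<integral>z. h (t, z) * un n t (sd z) \<partial>lam\<bar> \<le> H * (K0 * C)" .
  let ?P = "\<lambda>t. density lam (\<lambda>z. ennreal (un n t (sd z)))"
  have P: "finite_kernel ?P" using un_kernels sd by auto
  have "emeasure (?P t) UNIV \<le> ennreal (K0 * C)" for t
    using ui[of t] un(2) by (subst emeasure_density) (auto simp: nn_integral_eq_integral intro: ennreal_leI)
  then have "(\<integral>\<^sup>+ t. emeasure (?P t) UNIV \<partial>time_interval T) \<le> (\<integral>\<^sup>+ t. ennreal (K0 * C) \<partial>time_interval T)" by (intro nn_integral_mono)
  also have "\<dots> < \<infinity>"
    using finite_measure.emeasure_finite[OF finite_time_interval, of T UNIV] by (auto simp: less_top[symmetric] ennreal_mult_eq_top_iff)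
  finally interpret S: finite_measure "semidirect (time_interval T) ?P" by (intro finite_measure_semidirect[OF P]) auto
  have "integrable (semidirect (time_interval T) ?P) h" by (rule S.integrable_const_bound[of _ H]) (use h in auto)
  from integral_semidirect(2)[OF P time_interval(1) this]
  show "integrable (time_interval T) (\<lambda>t. \<integral>z. h (t, z) * un n t (sd z) \<partial>lam)"
    using un(2) by (subst (asm) integral_density) (auto simp: mult.commute)
qed

text \<open>Dominated convergence in time on top of the limits on slices; the masses of
  \<open>\<rho>n n t\<close> are bounded uniformly, which gives a constant majorant. Without a
  density factor the convergence of \<open>a\<close> almost everywhere suffices.\<close>

lemma spacetime_test_lim:
  fixes h :: "real \<times> 'v \<times> 'v \<Rightarrow> real"
  assumes h [measurable]: "h \<in> borel_measurable borel" "\<And>z. \<bar>h z\<bar> \<le> H"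
  shows "(\<lambda>n. \<integral>t. (\<integral>z. a n z * h (t, z) * un n t (fst z) \<partial>lam) \<partial>time_interval T) \<longlonglongrightarrow> (\<integral>z. h z * Uu z \<partial>Lam)"
    "(\<lambda>n. \<integral>t. (\<integral>z. a n z * h (t, z) * un n t (snd z) \<partial>lam) \<partial>time_interval T) \<longlonglongrightarrow> (\<integral>z. h z * Uv z \<partial>Lam)"
    "(\<lambda>n. \<integral>t. (\<integral>z. a n z * h (t, z) \<partial>lam) \<partial>time_interval T) \<longlonglongrightarrow> (\<integral>z. h z \<partial>Lam)"
proof -
  interpret I: finite_measure "time_interval T" by (rule finite_time_interval)
  interpret L: finite_measure Lam by (rule finite_Lam)
  have H: "H \<ge> 0" using h(2)[of undefined] by linarith
  note ht [measurable] = measurable_Pair_section[OF h(1)]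
  obtain C where C: "C \<ge> 0" "\<And>n. \<forall>t\<in>{0..T}. measure (\<rho>n n t) UNIV \<le> C" using rho_mass_bounded by blast
  have an [measurable]: "(\<lambda>z. a n (snd z)) \<in> borel_measurable (borel :: (real \<times> 'v \<times> 'v) measure)" for n
    by (rule measurable_compose[OF fst_snd_borel(2) a])
  have ahm: "(\<lambda>z. a n (snd z) * h z) \<in> borel_measurable borel" for n by measurable
  have ahb: "\<bar>a n (snd z) * h z\<bar> \<le> Abar * H" for n z
    using a_nonneg[of n "snd z"] a_le[of n "snd z"] h(2)[of z] by (auto simp: abs_mult intro!: mult_mono)
  have iU: "integrable Lam (\<lambda>z. h z * g z)" if "integrable Lam g" for g
    by (rule integrable_bounded_mult(1)[OF that]) (use h in auto)
  have main: "(\<lambda>n. \<integral>t. (\<integral>z. a n z * h (t, z) * un n t (sd z) \<partial>lam) \<partial>time_interval T) \<longlonglongrightarrow> (\<integral>z. h z * V z \<partial>Lam)"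
    if sd: "sd = fst \<or> sd = snd" and V: "integrable Lam V"
      and l: "\<And>t. t \<in> {0..T} \<Longrightarrow> (\<lambda>n. \<integral>z. a n z * h (t, z) * dens \<pi> (\<rho>n n t) (sd z) \<partial>lam) \<longlonglongrightarrow> (\<integral>z. h (t, z) * dens \<pi> (\<rho> t) (sd z) \<partial>lam)"
      and e: "AE t in lborel. t \<in> {0..T} \<longrightarrow> (AE z in lam. dens \<pi> (\<rho> t) (sd z) = V (t, z))" for sd V
  proof -
    note ti = un_time_integral[OF ahm ahb C(2,1) sd, unfolded snd_conv]
    note Ls = integral_semidirect[OF lam_kernel time_interval(1) iU[OF V, unfolded Lam_def], folded Lam_def]
    have Vm: "V \<in> borel_measurable borel" using V by (auto dest: borel_measurable_integrable)
    have usd: "(\<lambda>z. dens \<pi> \<mu> (sd z)) \<in> borel_measurable borel" for \<mu> using sd by auto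
    show ?thesis
      unfolding Ls(1)
    proof (rule integral_dominated_convergence[where w = "\<lambda>_. Abar * H * (K0 * C)"])
      show "(\<lambda>t. \<integral>z. h (t, z) * V (t, z) \<partial>lam) \<in> borel_measurable (time_interval T)" by (rule borel_measurable_integrable[OF Ls(2)])
      show "(\<lambda>t. \<integral>z. a n z * h (t, z) * un n t (sd z) \<partial>lam) \<in> borel_measurable (time_interval T)" for n
        by (rule borel_measurable_integrable[OF ti(1)])
      show "AE t in time_interval T. norm (\<integral>z. a n z * h (t, z) * un n t (sd z) \<partial>lam) \<le> Abar * H * (K0 * C)" for n
        using ti(2) by (intro AE_I2) auto
      show "AE t in time_interval T. (\<lambda>n. \<integral>z. a n z * h (t, z) * un n t (sd z) \<partial>lam) \<longlonglongrightarrow> (\<integral>z. h (t, z) * V (t, z) \<partial>lam)"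
        unfolding AE_time_interval using e
      proof eventually_elim
        case (elim t)
        show ?case
        proof
          assume t: "t \<in> {0..T}"
          have "(\<integral>z. h (t, z) * dens \<pi> (\<rho> t) (sd z) \<partial>lam) = (\<integral>z. h (t, z) * V (t, z) \<partial>lam)"
          proof (rule integral_cong_AE)
            show "(\<lambda>z. h (t, z) * V (t, z)) \<in> borel_measurable lam" "(\<lambda>z. h (t, z) * dens \<pi> (\<rho> t) (sd z)) \<in> borel_measurable lam"
              using measurable_Pair_section[OF Vm, of t] usd[of "\<rho> t"] by auto
            show "AE z in lam. h (t, z) * dens \<pi> (\<rho> t) (sd z) = h (t, z) * V (t, z)"
              using elim t by (auto elim!: eventually_mono)
          qed
          then show "(\<lambda>n. \<integral>z. a n z * h (t, z) * un n t (sd z) \<partial>lam) \<longlonglongrightarrow> (\<integral>z. h (t, z) * V (t, z) \<partial>lam)"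
            using l[OF t] t by (simp add: un_def)
        qed
      qed
    qed simp
  qed
  show "(\<lambda>n. \<integral>t. (\<integral>z. a n z * h (t, z) * un n t (fst z) \<partial>lam) \<partial>time_interval T) \<longlonglongrightarrow> (\<integral>z. h z * Uu z \<partial>Lam)"
    by (rule main[OF _ integrable_U(1)])
      (use U_slice slice_test_lim[OF _ ht h(2) a a_nonneg a_le a_lim_lam(1)] in \<open>auto elim!: eventually_mono\<close>)
  show "(\<lambda>n. \<integral>t. (\<integral>z. a n z * h (t, z) * un n t (snd z) \<partial>lam) \<partial>time_interval T) \<longlonglongrightarrow> (\<integral>z. h z * Uv z \<partial>Lam)"
    by (rule main[OF _ integrable_U(2)])
      (use U_slice slice_test_lim_snd[OF _ ht h(2)] in \<open>auto elim!: eventually_mono\<close>)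
  have ia: "integrable Lam (\<lambda>z. a n (snd z) * h z)" for n
    by (rule L.integrable_const_bound[of _ "Abar * H"]) (use ahm ahb in auto)
  have "(\<lambda>n. \<integral>z. a n (snd z) * h z \<partial>Lam) \<longlonglongrightarrow> (\<integral>z. h z \<partial>Lam)"
  proof (rule integral_dominated_convergence[where w = "\<lambda>_. Abar * H"])
    have m: "{z :: real \<times> 'v \<times> 'v. (\<lambda>n. a n (snd z)) \<longlonglongrightarrow> 1} \<in> sets borel" by measurable
    have "AE z in Lam. (\<lambda>n. a n (snd z)) \<longlonglongrightarrow> 1"
      unfolding Lam_def by (subst AE_semidirect[OF lam_kernel time_interval(1) m]) (use a_lim_lam(1) in auto)
    then show "AE z in Lam. (\<lambda>n. a n (snd z) * h z) \<longlonglongrightarrow> h z"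
    proof eventually_elim
      case (elim z)
      have "(\<lambda>n. a n (snd z) * h z) \<longlonglongrightarrow> 1 * h z" by (intro tendsto_intros elim)
      then show ?case by simp
    qed
  qed (use ahb in auto)
  then show "(\<lambda>n. \<integral>t. (\<integral>z. a n z * h (t, z) \<partial>lam) \<partial>time_interval T) \<longlonglongrightarrow> (\<integral>z. h z \<partial>Lam)"
    using integral_semidirect(1)[OF lam_kernel time_interval(1) ia[unfolded Lam_def]] by (simp add: Lam_def)
qed

abbreviation "tested \<xi> b c d z \<equiv> (2 * \<xi> z * W z + b z + c z * Uu z + d z * Uv z) / (cutdist (snd z))\<^sup>2"

text \<open>\<open>X n\<close> is linear in the weighted fluxes and in the densities, which gives
  its limit; slice by slice it is the left side of \<open>dissipation_lower_bound\<close>, which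
  gives the estimate. The support condition on the coefficients keeps them bounded after division by
  the weight and by its square.\<close>

lemma dissipation_lower_time:
  fixes \<xi> b c d :: "real \<times> 'v \<times> 'v \<Rightarrow> real"
  assumes dual: "\<And>z. (\<xi> z, b z, c z, d z) \<in> dual_family"
    and m [measurable]: "\<xi> \<in> borel_measurable borel" "b \<in> borel_measurable borel" "c \<in> borel_measurable borel" "d \<in> borel_measurable borel"
    and bd: "\<And>z. \<bar>\<xi> z\<bar> \<le> B" "\<And>z. \<bar>b z\<bar> \<le> B" "\<And>z. \<bar>c z\<bar> \<le> B" "\<And>z. \<bar>d z\<bar> \<le> B"
    and t0: "t0 \<in> {0..T}"
    and supp: "\<And>z. \<not> (fst z \<in> {0..t0} \<and> 1 / cutdist (snd z) \<le> real k) \<Longrightarrow> \<xi> z = 0 \<and> b z = 0 \<and> c z = 0 \<and> d z = 0"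
  defines "X \<equiv> \<lambda>n. 2 * ((\<integral>z. \<xi> z / cutdist (snd z) \<partial>SJp n) - (\<integral>z. \<xi> z / cutdist (snd z) \<partial>SJm n))
      + (\<integral>t. (\<integral>z. a n z * (b (t, z) / (cutdist z)\<^sup>2) \<partial>lam) \<partial>time_interval T)
      + (\<integral>t. (\<integral>z. a n z * (c (t, z) / (cutdist z)\<^sup>2) * un n t (fst z) \<partial>lam) \<partial>time_interval T)
      + (\<integral>t. (\<integral>z. a n z * (d (t, z) / (cutdist z)\<^sup>2) * un n t (snd z) \<partial>lam) \<partial>time_interval T)"
  shows "ennreal (X n / 2) \<le> (\<integral>\<^sup>+ r\<in>{0..t0}. (Rn n r + Fn n r) \<partial>lborel)"
    "X \<longlonglongrightarrow> (\<integral>z. tested \<xi> b c d z \<partial>Lam)"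
    "integrable Lam (tested \<xi> b c d)"
proof -
  have B: "B \<ge> 0" using bd(1)[of undefined] by linarith
  obtain C where C: "C \<ge> 0" "\<And>n. \<forall>t\<in>{0..T}. measure (\<rho>n n t) UNIV \<le> C" using rho_mass_bounded by blast
  interpret l: finite_measure lam by (rule finite_lam)
  note sec [measurable] = m[THEN measurable_Pair_section]
  have cm [measurable]: "(\<lambda>z::real \<times> 'v \<times> 'v. cutdist (snd z)) \<in> borel_measurable borel"
    by (rule measurable_compose[OF fst_snd_borel(2) cutdist_measurable])
  have w1: "\<bar>f z / cutdist (snd z)\<bar> \<le> B * real k" and w2: "\<bar>f z / (cutdist (snd z))\<^sup>2\<bar> \<le> B * (real k)\<^sup>2"
    if f: "\<And>z. \<bar>f z\<bar> \<le> B" "\<And>z. \<not> (fst z \<in> {0..t0} \<and> 1 / cutdist (snd z) \<le> real k) \<Longrightarrow> f z = 0" for f and z :: "real \<times> 'v \<times> 'v"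
  proof -
    have "\<bar>f z\<bar> * (1 / cutdist (snd z)) \<le> B * real k \<and> \<bar>f z\<bar> * (1 / cutdist (snd z))\<^sup>2 \<le> B * (real k)\<^sup>2"
    proof (cases "1 / cutdist (snd z) \<le> real k")
      case True
      then show ?thesis using B cutdist_bounds(1)[of "snd z"] by (intro conjI mult_mono power_mono f(1)) simp_all
    next
      case False then show ?thesis using f(2)[of z] B by simp
    qed
    then show "\<bar>f z / cutdist (snd z)\<bar> \<le> B * real k" "\<bar>f z / (cutdist (snd z))\<^sup>2\<bar> \<le> B * (real k)\<^sup>2"
      using cutdist_bounds(1)[of "snd z"] by (simp_all add: abs_divide power_one_over)
  qed
  have \<xi>1: "\<bar>\<xi> z / cutdist (snd z)\<bar> \<le> B * real k" for z by (rule w1) (use bd supp in auto)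
  have b2: "\<bar>b z / (cutdist (snd z))\<^sup>2\<bar> \<le> B * (real k)\<^sup>2" for z by (rule w2) (use bd supp in auto)
  have c2: "\<bar>c z / (cutdist (snd z))\<^sup>2\<bar> \<le> B * (real k)\<^sup>2" for z by (rule w2) (use bd supp in auto)
  have d2: "\<bar>d z / (cutdist (snd z))\<^sup>2\<bar> \<le> B * (real k)\<^sup>2" for z by (rule w2) (use bd supp in auto)
  have wm: "(\<lambda>z. \<xi> z / cutdist (snd z)) \<in> borel_measurable borel" "(\<lambda>z. b z / (cutdist (snd z))\<^sup>2) \<in> borel_measurable borel"
    "(\<lambda>z. c z / (cutdist (snd z))\<^sup>2) \<in> borel_measurable borel" "(\<lambda>z. d z / (cutdist (snd z))\<^sup>2) \<in> borel_measurable borel"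
    by measurable
  let ?\<xi> = "\<lambda>z. \<xi> z / cutdist (snd z)" and ?b = "\<lambda>z. b z / (cutdist (snd z))\<^sup>2" and ?c = "\<lambda>z. c z / (cutdist (snd z))\<^sup>2" and ?d = "\<lambda>z. d z / (cutdist (snd z))\<^sup>2"
  interpret L: finite_measure Lam by (rule finite_Lam)
  have i: "integrable Lam (\<lambda>z. ?\<xi> z * gp z)" "integrable Lam (\<lambda>z. ?\<xi> z * gm z)"
    by (rule integrable_bounded_mult(1)[OF g_integrable(1) _ \<xi>1] integrable_bounded_mult(1)[OF g_integrable(2) _ \<xi>1], use wm in simp)+
  have i': "integrable Lam ?b" "integrable Lam (\<lambda>z. ?c z * Uu z)" "integrable Lam (\<lambda>z. ?d z * Uv z)"
  proof -
    show "integrable Lam ?b" by (rule L.integrable_const_bound[of _ "B * (real k)\<^sup>2"]) (use wm(2) b2 in auto)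
    show "integrable Lam (\<lambda>z. ?c z * Uu z)" by (rule integrable_bounded_mult(1)[OF integrable_U(1) _ c2]) (use wm(3) in simp)
    show "integrable Lam (\<lambda>z. ?d z * Uv z)" by (rule integrable_bounded_mult(1)[OF integrable_U(2) _ d2]) (use wm(4) in simp)
  qed
  \<comment> \<open>\<open>W\<close> contains one factor \<open>cutdist\<close>, which accounts for
    the square in the denominator of the flux term. On the diagonal both sides of that term are
    0.\<close>
  have ptw: "2 * (?\<xi> z * gp z - ?\<xi> z * gm z) + ?b z + ?c z * Uu z + ?d z * Uv z
        = tested \<xi> b c d z" for z
  proof -
      have "2 * (?\<xi> z * gp z - ?\<xi> z * gm z) = 2 * \<xi> z * W z / (cutdist (snd z))\<^sup>2"
        by (cases "cutdist (snd z) = 0") (auto simp: W_def power2_eq_square field_simps)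
      then show ?thesis by (simp add: add_divide_distrib)
  qed
  show "integrable Lam (tested \<xi> b c d)"
    using i i' by (simp only: ptw[symmetric]) (intro Bochner_Integration.integrable_add Bochner_Integration.integrable_diff integrable_mult_right)
  show "X \<longlonglongrightarrow> (\<integral>z. tested \<xi> b c d z \<partial>Lam)"
  proof -
    have "X \<longlonglongrightarrow> 2 * ((\<integral>z. gp z * ?\<xi> z \<partial>Lam) - (\<integral>z. gm z * ?\<xi> z \<partial>Lam)) + (\<integral>z. ?b z \<partial>Lam)
        + (\<integral>z. ?c z * Uu z \<partial>Lam) + (\<integral>z. ?d z * Uv z \<partial>Lam)"
      unfolding X_def
      using spacetime_test_lim(3)[OF wm(2) b2] spacetime_test_lim(1)[OF wm(3) c2] spacetime_test_lim(2)[OF wm(4) d2]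
      by (intro tendsto_intros flux_test_lim[OF wm(1) \<xi>1]) auto
    also have "2 * ((\<integral>z. gp z * ?\<xi> z \<partial>Lam) - (\<integral>z. gm z * ?\<xi> z \<partial>Lam)) + (\<integral>z. ?b z \<partial>Lam)
        + (\<integral>z. ?c z * Uu z \<partial>Lam) + (\<integral>z. ?d z * Uv z \<partial>Lam)
      = (\<integral>z. 2 * (?\<xi> z * gp z - ?\<xi> z * gm z) + ?b z + ?c z * Uu z + ?d z * Uv z \<partial>Lam)"
    proof -
      have "2 * ((\<integral>z. f1 z \<partial>Lam) - (\<integral>z. f2 z \<partial>Lam)) + (\<integral>z. f3 z \<partial>Lam) + (\<integral>z. f4 z \<partial>Lam) + (\<integral>z. f5 z \<partial>Lam)
          = (\<integral>z. 2 * (f1 z - f2 z) + f3 z + f4 z + f5 z \<partial>Lam)"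
        if "integrable Lam f1" "integrable Lam f2" "integrable Lam f3" "integrable Lam f4" "integrable Lam f5" for f1 f2 f3 f4 f5 :: "real \<times> 'v \<times> 'v \<Rightarrow> real"
        using that by simp
      from this[OF i i'] show ?thesis by (simp only: mult.commute[of "gp _"] mult.commute[of "gm _"])
    qed
    also have "\<dots> = (\<integral>z. tested \<xi> b c d z \<partial>Lam)" by (simp only: ptw)
    finally show ?thesis .
  qed
  show "ennreal (X n / 2) \<le> (\<integral>\<^sup>+ r\<in>{0..t0}. (Rn n r + Fn n r) \<partial>lborel)"
  proof -
    interpret Sp: finite_measure "SJp n" by (rule Jp_finite)
    interpret Sm: finite_measure "SJm n" by (rule Jm_finite)
    interpret L: finite_measure Lam by (rule finite_Lam)
    have ip: "integrable (SJp n) (\<lambda>z. \<xi> z / cutdist (snd z))" and im: "integrable (SJm n) (\<lambda>z. \<xi> z / cutdist (snd z))"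
      using \<xi>1 wm(1) by (auto intro!: Sp.integrable_const_bound[of _ "B * real k"] Sm.integrable_const_bound[of _ "B * real k"])
    note Ip = integral_semidirect[OF Jp_kernel sets_lborel ip, unfolded snd_conv]
    note Im = integral_semidirect[OF Jm_kernel sets_lborel im, unfolded snd_conv]
    have an [measurable]: "(\<lambda>z. a n (snd z)) \<in> borel_measurable (borel :: (real \<times> 'v \<times> 'v) measure)"
      by (rule measurable_compose[OF fst_snd_borel(2) a])
    have ab: "\<bar>a n (snd z) * f z\<bar> \<le> Abar * H" if "\<And>z. \<bar>f z\<bar> \<le> H" for f H and z :: "real \<times> 'v \<times> 'v"
      using a_nonneg[of n "snd z"] a_le[of n "snd z"] that[of z] by (auto simp: abs_mult intro!: mult_mono)
    have ab': "\<bar>a n (snd z) * (b z / (cutdist (snd z))\<^sup>2)\<bar> \<le> Abar * (B * (real k)\<^sup>2)"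
      "\<bar>a n (snd z) * (c z / (cutdist (snd z))\<^sup>2)\<bar> \<le> Abar * (B * (real k)\<^sup>2)"
      "\<bar>a n (snd z) * (d z / (cutdist (snd z))\<^sup>2)\<bar> \<le> Abar * (B * (real k)\<^sup>2)" for z
      by (rule ab, rule b2 c2 d2)+
    have am: "(\<lambda>z. a n (snd z) * (b z / (cutdist (snd z))\<^sup>2)) \<in> borel_measurable borel" "(\<lambda>z. a n (snd z) * (c z / (cutdist (snd z))\<^sup>2)) \<in> borel_measurable borel"
      "(\<lambda>z. a n (snd z) * (d z / (cutdist (snd z))\<^sup>2)) \<in> borel_measurable borel" by measurable
    have ib: "integrable Lam (\<lambda>z. a n (snd z) * (b z / (cutdist (snd z))\<^sup>2))"
      by (rule L.integrable_const_bound[of _ "Abar * (B * (real k)\<^sup>2)"]) (use am(1) ab'(1) in auto)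
    note Ib = integral_semidirect(2)[OF lam_kernel time_interval(1) ib[unfolded Lam_def], unfolded snd_conv]
    note Ic = un_time_integral[OF am(2) ab'(2) C(2,1), OF disjI1[OF refl], unfolded snd_conv]
    note Id = un_time_integral[OF am(3) ab'(3) C(2,1), OF disjI2[OF refl], unfolded snd_conv]
    define J where "J t = (\<integral>z. \<xi> (t, z) / cutdist z \<partial>Jp n t) - (\<integral>z. \<xi> (t, z) / cutdist z \<partial>Jm n t)" for t
    define A where "A t = (\<integral>z. a n z * (b (t, z) / (cutdist z)\<^sup>2) \<partial>lam)
       + (\<integral>z. a n z * (c (t, z) / (cutdist z)\<^sup>2) * un n t (fst z) \<partial>lam)
       + (\<integral>z. a n z * (d (t, z) / (cutdist z)\<^sup>2) * un n t (snd z) \<partial>lam)" for t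
    have Ji: "integrable lborel J" unfolding J_def by (intro Bochner_Integration.integrable_diff Ip(2) Im(2))
    have Ai: "integrable (time_interval T) A"
      unfolding A_def by (intro Bochner_Integration.integrable_add Ib Ic(1) Id(1))
    then have Am: "A \<in> borel_measurable borel" by (auto dest: borel_measurable_integrable)
    have Ai': "integrable lborel (\<lambda>t. indicator {0..T} t * A t)" using Ai by (simp add: integral_time_interval(2)[OF Am])
    have "X n = 2 * (\<integral>t. J t \<partial>lborel) + (\<integral>t. A t \<partial>time_interval T)"
    proof -
      have "2 * ((\<integral>z. g1 z \<partial>lborel) - (\<integral>z. g2 z \<partial>lborel)) + (\<integral>z. f1 z \<partial>I) + (\<integral>z. f2 z \<partial>I) + (\<integral>z. f3 z \<partial>I)
          = 2 * (\<integral>z. g1 z - g2 z \<partial>lborel) + (\<integral>z. f1 z + f2 z + f3 z \<partial>I)"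
        if "integrable lborel g1" "integrable lborel g2" "integrable I f1" "integrable I f2" "integrable I f3"
        for I :: "real measure" and f1 f2 f3 g1 g2 :: "real \<Rightarrow> real"
        using that by simp
      from this[OF Ip(2) Im(2) Ib Ic(1) Id(1)] show ?thesis by (simp only: X_def Ip(1) Im(1) J_def A_def)
    qed
    also have "\<dots> = (\<integral>t. 2 * J t + indicator {0..T} t * A t \<partial>lborel)"
      unfolding integral_time_interval(1)[OF Am] using Ji Ai' by simp
    finally have Xn: "X n / 2 = (\<integral>t. (2 * J t + indicator {0..T} t * A t) / 2 \<partial>lborel)" by simp
    have "ennreal (X n / 2) \<le> (\<integral>\<^sup>+ t. ennreal ((2 * J t + indicator {0..T} t * A t) / 2) \<partial>lborel)"
      unfolding Xn using Ji Ai' by (intro ennreal_integral_le_nn_integral) auto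
    also have "\<dots> \<le> (\<integral>\<^sup>+ r\<in>{0..t0}. (Rn n r + Fn n r) \<partial>lborel)"
    proof (rule nn_integral_mono_AE)
      \<comment> \<open>At almost every time the weighted slices have finite mass and determine the
        fluxes, so the tests can be rewritten as integrals against \<open>jn n t\<close> itself.
        Outside \<open>{0..t0}\<close> all coefficients vanish.\<close>
      from weighted_family.AE_finite[OF fam(1)[of n]] weighted_family.AE_finite[OF fam(2)[of n]]
      show "AE t in lborel. ennreal ((2 * J t + indicator {0..T} t * A t) / 2) \<le> (Rn n t + Fn n t) * indicator {0..t0} t"
      proof eventually_elim
        case (elim t)
        show ?case
        proof (cases "t \<in> {0..t0}")
          case False
          then have "\<xi> (t, z) = 0" "b (t, z) = 0" "c (t, z) = 0" "d (t, z) = 0" for z using supp[of "(t, z)"] by auto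
          then show ?thesis by (simp add: J_def A_def)
        next
          case True
          then have t: "t \<in> {0..T}" using t0 by auto
          note wf = weighted_family.weighted_density[OF fam(1) t, of n] weighted_family.weighted_density[OF fam(2) t, of n]
          have fin: "(\<integral>\<^sup>+ z. ennreal (cutdist z) \<partial>fst (jn n t)) < \<infinity>" "(\<integral>\<^sup>+ z. ennreal (cutdist z) \<partial>snd (jn n t)) < \<infinity>"
            using elim t by auto
          have ij: "integrable M (\<lambda>z. \<xi> (t, z))"
            if M: "M = density N (\<lambda>z. ennreal (1 / cutdist z))" "finite_measure N" "sets N = sets borel" for M N
          proof -
            have "integrable N (\<lambda>z. \<xi> (t, z) / cutdist z)"
              using \<xi>1[of "(t, _)"] by (intro finite_measure.integrable_const_bound[OF M(2), of _ "B * real k"]) (auto simp: measurable_cong_sets[OF M(3) refl])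
            then show ?thesis unfolding M(1)
              by (subst integrable_density) (auto simp: measurable_cong_sets[OF M(3) refl] cutdist_bounds)
          qed
          let ?u = "dens \<pi> (\<rho>n n t)"
          let ?f = "\<lambda>z. a n z * (b (t, z) / (cutdist z)\<^sup>2) + a n z * (c (t, z) / (cutdist z)\<^sup>2) * ?u (fst z) + a n z * (d (t, z) / (cutdist z)\<^sup>2) * ?u (snd z)"
          have itb: "integrable lam (\<lambda>z. a n z * (b (t, z) / (cutdist z)\<^sup>2))"
            by (rule l.integrable_const_bound[of _ "Abar * (B * (real k)\<^sup>2)"]) (use ab'(1)[of "(t, _)"] in auto)
          have itc: "integrable lam (\<lambda>z. a n z * (c (t, z) / (cutdist z)\<^sup>2) * ?u (fst z))" and itd: "integrable lam (\<lambda>z. a n z * (d (t, z) / (cutdist z)\<^sup>2) * ?u (snd z))"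
            using Ic(3)[of t] Id(3)[of t] t by (auto simp: un_def)
          have itf: "integrable lam ?f" using itb itc itd by auto
          have feq: "1 / (cutdist z)\<^sup>2 * (a n z * (b (t, z) + c (t, z) * ?u (fst z) + d (t, z) * ?u (snd z))) = ?f z" for z
            by (simp add: algebra_simps add_divide_distrib)
          have gm': "(\<lambda>z. a n z * (b (t, z) + c (t, z) * ?u (fst z) + d (t, z) * ?u (snd z))) \<in> borel_measurable lam" by simp
          have i\<theta>: "integrable \<theta> (\<lambda>z. a n z * (b (t, z) + c (t, z) * ?u (fst z) + d (t, z) * ?u (snd z)))"
            unfolding theta_eq by (subst integrable_density[OF gm']) (simp_all only: real_scaleR_def feq itf, simp_all)
          have e\<theta>: "(\<integral>z. a n z * (b (t, z) + c (t, z) * ?u (fst z) + d (t, z) * ?u (snd z)) \<partial>\<theta>) = A t"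
          proof -
            have "(\<integral>z. a n z * (b (t, z) + c (t, z) * ?u (fst z) + d (t, z) * ?u (snd z)) \<partial>\<theta>) = (\<integral>z. ?f z \<partial>lam)"
              unfolding theta_eq by (subst integral_density[OF gm']) (simp_all only: real_scaleR_def feq, simp_all)
            also have "\<dots> = A t" using t itb itc itd by (simp only: A_def un_def if_True Bochner_Integration.integral_add Bochner_Integration.integrable_add)
            finally show ?thesis .
          qed
          have eJ: "(\<integral>z. \<xi> (t, z) \<partial>fst (jn n t)) - (\<integral>z. \<xi> (t, z) \<partial>snd (jn n t)) = J t"
            unfolding J_def using weighted_family.integral_weighted_density[OF fam(1) t fin(1), of "\<lambda>z. \<xi> (t, z)"]
              weighted_family.integral_weighted_density[OF fam(2) t fin(2), of "\<lambda>z. \<xi> (t, z)"] by simp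
          have "ennreal (2 * (\<integral>z. \<xi> (t, z) \<partial>fst (jn n t)) - 2 * (\<integral>z. \<xi> (t, z) \<partial>snd (jn n t))
              + (\<integral>z. a n z * (b (t, z) + c (t, z) * ?u (fst z) + d (t, z) * ?u (snd z)) \<partial>\<theta>)) \<le> 2 * (Rn n t + Fn n t)"
          proof (rule dissipation_lower_bound[OF edge a a_nonneg flux_curve.flux[OF curve t] _ _ _ _ _ _ _ i\<theta>])
            show "(\<xi> (t, z), b (t, z), c (t, z), d (t, z)) \<in> dual_family" for z by (rule dual)
            show "integrable (fst (jn n t)) (\<lambda>z. \<xi> (t, z))"
              by (rule ij[OF wf(1)[OF fin(1)] finite_kernelD(4,1)[OF Jp_kernel]])
            show "integrable (snd (jn n t)) (\<lambda>z. \<xi> (t, z))"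
              by (rule ij[OF wf(2)[OF fin(2)] finite_kernelD(4,1)[OF Jm_kernel]])
          qed auto
          then have "ennreal (2 * J t + A t) \<le> 2 * (Rn n t + Fn n t)"
            unfolding e\<theta> eJ[symmetric] by (simp add: right_diff_distrib)
          then have "ennreal (2 * J t + A t) / 2 \<le> (2 * (Rn n t + Fn n t)) / 2" by (rule divide_right_mono_ennreal)
          also have "(2 * (Rn n t + Fn n t)) / 2 = Rn n t + Fn n t"
            by (metis ennreal_double_half ennreal_times_divide)
          also have "ennreal (2 * J t + A t) / 2 = ennreal ((2 * J t + A t) / 2)"
            by (cases "0 \<le> 2 * J t + A t") (simp_all add: divide_ennreal[of _ 2, simplified] ennreal_neg)
          finally show ?thesis using True t by simp
        qed
      qed
    qed
    finally show ?thesis .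
  qed
qed

end

section \<open>The energy inequality in the limit\<close>

context flow_limit
begin

abbreviation "limit_integrand z \<equiv> integrand (W z, Uu z, Uv z)"

lemma limit_integrand_measurable: "limit_integrand \<in> borel_measurable borel"
  by (intro integrand_measurable) auto

text \<open>The \<open>m\<close>-th approximation \<open>A m\<close> uses the best of the first \<open>m\<close> affine minorants of the integrand,
  cut off where \<open>\<theta>\<close> is not finite; both are selected by the limit, not by the sequence.\<close>
lemma dissipation_lower:
  assumes t0: "t0 \<in> {0..T}"
  shows "\<exists>A. incseq A \<and>
    (\<integral>\<^sup>+ t\<in>{0..t0}. (\<integral>\<^sup>+ z. ennreal (1 / (cutdist z)\<^sup>2) * limit_integrand (t, z) \<partial>lam) \<partial>lborel) \<le> (SUP m. ennreal (A m)) \<and>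
    (\<forall>m. \<exists>X. (\<forall>n. ennreal (X n / 2) \<le> (\<integral>\<^sup>+ r\<in>{0..t0}. (Rn n r + Fn n r) \<partial>lborel)) \<and> X \<longlonglongrightarrow> A m)"
proof -
  define q1 q2 q3 q4 where "q1 i = fst (dual_seq i)" and "q2 i = fst (snd (dual_seq i))"
    and "q3 i = fst (snd (snd (dual_seq i)))" and "q4 i = snd (snd (snd (dual_seq i)))" for i
  define v where "v i z = 2 * q1 i * W z + q2 i + q3 i * Uu z + q4 i * Uv z" for i and z :: "real \<times> 'v \<times> 'v"
  have v_eq: "dual_val (dual_seq i) (W z, Uu z, Uv z) = v i z" for i z
    by (cases "dual_seq i") (simp add: dual_val_def v_def q1_def q2_def q3_def q4_def)
  have vm [measurable]: "v i \<in> borel_measurable borel" for i unfolding v_def by measurable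
  have v0: "v 0 z = 0" for z by (simp add: v_def q1_def q2_def q3_def q4_def dual_seq_def)
  let ?N = "argmax_upto v"
  have vN0: "0 \<le> v (?N m z) z" for m z using argmax_upto_ge[of 0 m v z] by (simp add: v0)
  have vNm [measurable]: "(\<lambda>z. v (?N m z) z) \<in> borel_measurable borel" for m
    by (rule measurable_compose_countable[OF vm argmax_upto_measurable[OF vm]])
  have cm [measurable]: "(\<lambda>z::real \<times> 'v \<times> 'v. cutdist (snd z)) \<in> borel_measurable borel"
    by (rule measurable_compose[OF fst_snd_borel(2) cutdist_measurable])
  \<comment> \<open>Cutting off at \<open>1 / cutdist \<le> m\<close> makes the selected
    coefficients admissible for \<open>dissipation_lower_time\<close>; the sets grow to the whole
    strip up to time \<open>t0\<close>.\<close>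
  define S where "S m = {z :: real \<times> 'v \<times> 'v. fst z \<in> {0..t0} \<and> 1 / cutdist (snd z) \<le> real m}" for m
  have Sm [measurable]: "S m \<in> sets borel" for m
  proof -
    have "{z \<in> space borel. fst z \<in> {0..t0} \<and> 1 / cutdist (snd z) \<le> real m} \<in> sets (borel :: (real \<times> 'v \<times> 'v) measure)"
      using fst_snd_borel(1) by measurable
    then show ?thesis by (simp add: S_def)
  qed
  \<comment> \<open>Outside \<open>S m\<close> all four coefficients are 0, which is again an
    element of the dual family, so the cut-off keeps the selection admissible.\<close>
  define sel where "sel q m z = (if z \<in> S m then q (?N m z) else 0)" for q :: "nat \<Rightarrow> real" and m z
  have selm: "sel q m \<in> borel_measurable borel" for q m
    unfolding sel_def[abs_def] using argmax_upto_value(1)[OF vm, where c = q and m = m] by measurable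
  define B where "B m = (\<Sum>i\<le>m. \<bar>q1 i\<bar>) + (\<Sum>i\<le>m. \<bar>q2 i\<bar>) + (\<Sum>i\<le>m. \<bar>q3 i\<bar>) + (\<Sum>i\<le>m. \<bar>q4 i\<bar>)" for m
  have selb: "\<bar>sel q m z\<bar> \<le> (\<Sum>i\<le>m. \<bar>q i\<bar>)" for q m z
    using argmax_upto_value(2)[OF vm, where c = q and m = m and x = z] by (auto simp: sel_def intro: sum_nonneg)
  have B: "(\<Sum>i\<le>m. \<bar>q i\<bar>) \<le> B m" if "q = q1 \<or> q = q2 \<or> q = q3 \<or> q = q4" for q m
  proof -
    have "0 \<le> (\<Sum>i\<le>m. \<bar>q i\<bar>)" for q :: "nat \<Rightarrow> real" by (intro sum_nonneg) auto
    then show ?thesis using that by (auto simp: B_def intro: add_increasing add_increasing2)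
  qed
  have fam: "(sel q1 m z, sel q2 m z, sel q3 m z, sel q4 m z) \<in> dual_family" for m z
    using dual_seq_in[of "?N m z"] zero_in_dual_family by (simp add: sel_def q1_def q2_def q3_def q4_def)
  have supp: "sel q1 m z = 0 \<and> sel q2 m z = 0 \<and> sel q3 m z = 0 \<and> sel q4 m z = 0"
    if "\<not> (fst z \<in> {0..t0} \<and> 1 / cutdist (snd z) \<le> real m)" for m z
  proof -
    have "z \<notin> S m" using that by (simp add: S_def)
    then show ?thesis by (simp add: sel_def)
  qed
  define G where "G m = tested (sel q1 m) (sel q2 m) (sel q3 m) (sel q4 m)" for m
  have G: "G m z = (if z \<in> S m then v (?N m z) z else 0) / (cutdist (snd z))\<^sup>2" for m z
    by (simp add: G_def sel_def v_def)
  have G0: "0 \<le> G m z" for m z using vN0 by (simp add: G)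
  define A where "A m = (\<integral>z. G m z \<partial>Lam)" for m
  have selB: "\<bar>sel q1 m z\<bar> \<le> B m" "\<bar>sel q2 m z\<bar> \<le> B m" "\<bar>sel q3 m z\<bar> \<le> B m" "\<bar>sel q4 m z\<bar> \<le> B m" for m z
    by (rule order_trans[OF selb B], simp)+
  note low = dissipation_lower_time[OF fam selm selm selm selm selB t0 supp]
  have Gi: "integrable Lam (G m)" for m
    unfolding G_def by (rule low(3))
  have Gmono: "G m z \<le> G m' z" if "m \<le> m'" for m m' z
  proof (cases "z \<in> S m")
    case True
    then have "z \<in> S m'" using that unfolding S_def by auto
    then show ?thesis using True argmax_upto_mono[OF that, of v z] by (simp add: G divide_right_mono)
  next
    case False then show ?thesis using vN0 by (simp add: G)
  qed
  have "incseq A" unfolding A_def by (intro monoI integral_mono Gi Gmono)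
  moreover have "(\<integral>\<^sup>+ t\<in>{0..t0}. (\<integral>\<^sup>+ z. ennreal (1 / (cutdist z)\<^sup>2) * limit_integrand (t, z) \<partial>lam) \<partial>lborel) \<le> (SUP m. ennreal (A m))"
  proof -
    let ?H = "\<lambda>z. indicator {0..t0} (fst z) * (ennreal (1 / (cutdist (snd z))\<^sup>2) * limit_integrand z) :: ennreal"
    have Hm: "?H \<in> borel_measurable borel"
    proof -
      have [measurable]: "(\<lambda>z::real \<times> 'v \<times> 'v. fst z) \<in> borel_measurable borel" by (rule fst_snd_borel(1))
      note [measurable] = limit_integrand_measurable
      show ?thesis by measurable
    qed
    have "(\<integral>\<^sup>+ t\<in>{0..t0}. (\<integral>\<^sup>+ z. ennreal (1 / (cutdist z)\<^sup>2) * limit_integrand (t, z) \<partial>lam) \<partial>lborel)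
        = (\<integral>\<^sup>+ t\<in>{0..T}. (\<integral>\<^sup>+ z. ?H (t, z) \<partial>lam) \<partial>lborel)"
      using t0 by (intro nn_integral_cong) (auto simp: indicator_def)
    also have "\<dots> = (\<integral>\<^sup>+ z. ?H z \<partial>Lam)" by (rule nn_integral_Lam[OF Hm, symmetric])
    also have "\<dots> \<le> (\<integral>\<^sup>+ z. (SUP m. ennreal (G m z)) \<partial>Lam)"
    proof (rule nn_integral_mono)
      fix z
      show "?H z \<le> (SUP m. ennreal (G m z))"
      proof (cases "fst z \<in> {0..t0}")
        case True
        have "?H z = ennreal (1 / (cutdist (snd z))\<^sup>2) * (SUP m. ennreal (v (?N m z) z))"
          using True by (simp add: integrand_def v_eq SUP_argmax_upto)
        also have "\<dots> = (SUP m. ennreal (1 / (cutdist (snd z))\<^sup>2) * ennreal (v (?N m z) z))" by (simp add: SUP_mult_left_ennreal)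
        also have "\<dots> \<le> (SUP m. ennreal (G m z))"
        proof (rule SUP_mono)
          fix m
          \<comment> \<open>One index counts both the minorants and the cut-off;
            \<open>max m k\<close> is large enough for both.\<close>
          obtain k where k: "1 / cutdist (snd z) \<le> real k" using real_arch_simple by blast
          have "z \<in> S (max m k)" using True k by (auto simp: S_def)
          then have "ennreal (1 / (cutdist (snd z))\<^sup>2) * ennreal (v (?N m z) z) \<le> ennreal (G (max m k) z)"
            using argmax_upto_mono[of m "max m k" v z] vN0 by (simp add: G ennreal_mult'[symmetric] divide_right_mono ennreal_leI)
          then show "\<exists>n\<in>UNIV. ennreal (1 / (cutdist (snd z))\<^sup>2) * ennreal (v (?N m z) z) \<le> ennreal (G n z)" by blast
        qed
        finally show ?thesis .
      qed simp
    qed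
    also have "\<dots> = (SUP m. (\<integral>\<^sup>+ z. ennreal (G m z) \<partial>Lam))"
    proof (rule nn_integral_monotone_convergence_SUP)
      show "incseq (\<lambda>m z. ennreal (G m z))" by (auto simp: incseq_def le_fun_def intro!: ennreal_leI Gmono)
      show "(\<lambda>z. ennreal (G m z)) \<in> borel_measurable Lam" for m using borel_measurable_integrable[OF Gi[of m]] by simp
    qed
    also have "\<dots> = (SUP m. ennreal (A m))"
      using G0 by (simp add: A_def nn_integral_eq_integral[OF Gi])
    finally show ?thesis .
  qed
  moreover have "\<exists>X. (\<forall>n. ennreal (X n / 2) \<le> (\<integral>\<^sup>+ r\<in>{0..t0}. (Rn n r + Fn n r) \<partial>lborel)) \<and> X \<longlonglongrightarrow> A m" for m
    unfolding A_def G_def by (rule exI, rule conjI[rotated], rule low(2), assumption, intro allI, rule low(1))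
  ultimately show ?thesis by blast
qed

text \<open>Only at almost every time, since there the joint density \<open>U\<close> agrees with
  the densities of the slices, in both variables by \<open>U_slice\<close>.\<close>

lemma limit_dissipation:
  "AE t in lborel. t \<in> {0..T} \<longrightarrow> Diss \<kappa> (\<rho> t) (j t) + Fisher \<kappa> (\<rho> t)
     \<le> (\<integral>\<^sup>+ z. ennreal (1 / (cutdist z)\<^sup>2) * limit_integrand (t, z) \<partial>lam) / 2"
  using U_slice
proof eventually_elim
  case (elim t)
  have "Diss \<kappa> (\<rho> t) (j t) + Fisher \<kappa> (\<rho> t)
     \<le> (\<integral>\<^sup>+ z. ennreal (1 / (cutdist z)\<^sup>2) * limit_integrand (t, z) \<partial>lam) / 2" if t: "t \<in> {0..T}"
  proof -
    have "AE z in \<theta>. dens \<pi> (\<rho> t) (fst z) = U (t, fst z) \<and> dens \<pi> (\<rho> t) (snd z) = U (t, snd z)"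
      using elim t by (simp add: AE_lam_iff_theta)
    then have "AE z in \<theta>. integrand (W (t, z), dens \<pi> (\<rho> t) (fst z), dens \<pi> (\<rho> t) (snd z)) = limit_integrand (t, z)"
      by eventually_elim simp
    then have "(\<integral>\<^sup>+ z. integrand (W (t, z), dens \<pi> (\<rho> t) (fst z), dens \<pi> (\<rho> t) (snd z)) \<partial>\<theta>) = (\<integral>\<^sup>+ z. limit_integrand (t, z) \<partial>\<theta>)"
      by (rule nn_integral_cong_AE)
    also have "\<dots> = (\<integral>\<^sup>+ z. ennreal (1 / (cutdist z)\<^sup>2) * limit_integrand (t, z) \<partial>lam)"
      by (rule nn_integral_theta[OF measurable_Pair_section[OF limit_integrand_measurable]])
    finally show ?thesis
      using limit_dissipation_le[OF rho_lim(2)[OF t] measurable_Pair_section[OF W_measurable], of t] by (simp add: j_def)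
  qed
  then show ?case by blast
qed

text \<open>The lower sequences for dissipation and entropy are added for the same \<open>n\<close>,
  where a single energy inequality bounds the sum, and only then does \<open>n\<close> tend to
  infinity. The supremum over \<open>m\<close> of a sum of two increasing sequences is the sum of
  the suprema.\<close>

lemma energy_lim:
  assumes t0: "t0 \<in> {0..T}"
  shows "(\<integral>\<^sup>+ r\<in>{0..t0}. (Diss \<kappa> (\<rho> r) (j r) + Fisher \<kappa> (\<rho> r)) \<partial>lborel)
    + Ent (\<rho> t0) \<le> E0"
proof -
  let ?g = "\<lambda>t. \<integral>\<^sup>+ z. ennreal (1 / (cutdist z)\<^sup>2) * limit_integrand (t, z) \<partial>lam"
  obtain A where A: "incseq A" "(\<integral>\<^sup>+ t\<in>{0..t0}. ?g t \<partial>lborel) \<le> (SUP m. ennreal (A m))"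
    and X: "\<And>m. \<exists>X. (\<forall>n. ennreal (X n / 2) \<le> (\<integral>\<^sup>+ r\<in>{0..t0}. (Rn n r + Fn n r) \<partial>lborel)) \<and> X \<longlonglongrightarrow> A m"
    using dissipation_lower[OF t0] by blast
  obtain e where e: "incseq e" "(SUP m. e m) = Ent (\<rho> t0)"
    and x: "\<And>m. \<exists>x. (\<forall>n. ennreal (x n) \<le> Ent (\<rho>n n t0)) \<and> (\<lambda>n. ennreal (x n)) \<longlonglongrightarrow> e m"
    using entropy_lower[OF t0] by blast
  have le: "ennreal (A m / 2) + e m \<le> E0" for m
  proof -
    obtain X where X: "\<And>n. ennreal (X n / 2) \<le> (\<integral>\<^sup>+ r\<in>{0..t0}. (Rn n r + Fn n r) \<partial>lborel)" "X \<longlonglongrightarrow> A m" using X by blast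
    obtain x where x: "\<And>n. ennreal (x n) \<le> Ent (\<rho>n n t0)" "(\<lambda>n. ennreal (x n)) \<longlonglongrightarrow> e m" using x by blast
    have "(\<lambda>n. ennreal (X n / 2) + ennreal (x n)) \<longlonglongrightarrow> ennreal (A m / 2) + e m"
      by (intro tendsto_add tendsto_ennrealI tendsto_divide X(2) x(2)) auto
    then show ?thesis
    proof (rule LIMSEQ_le[OF _ E0_lim])
      have "ennreal (X n / 2) + ennreal (x n) \<le> Ent (\<rho>n n 0)" for n
        by (rule order_trans[OF add_mono[OF X(1) x(1)] energy[OF t0]])
      then show "\<exists>N. \<forall>n\<ge>N. ennreal (X n / 2) + ennreal (x n) \<le> Ent (\<rho>n n 0)" by blast
    qed
  qed
  have half: "ennreal (y / 2) = ennreal y / 2" for y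
    by (cases "0 \<le> y") (simp_all add: divide_ennreal[of _ 2, simplified] ennreal_neg)
  have cm: "(\<lambda>z::real \<times> 'v \<times> 'v. cutdist (snd z)) \<in> borel_measurable borel"
    by (rule measurable_compose[OF fst_snd_borel(2) cutdist_measurable])
  have gm: "(\<lambda>t. ?g t * indicator {0..t0} t) \<in> borel_measurable lborel"
    using kernel_nn_integral_measurable[OF lam_kernel, of "\<lambda>z. ennreal (1 / (cutdist (snd z))\<^sup>2) * limit_integrand z"]
      limit_integrand_measurable cm by simp
  have "(\<integral>\<^sup>+ r\<in>{0..t0}. (Diss \<kappa> (\<rho> r) (j r) + Fisher \<kappa> (\<rho> r)) \<partial>lborel)
      \<le> (\<integral>\<^sup>+ t. (?g t * indicator {0..t0} t) / 2 \<partial>lborel)"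
  proof (rule nn_integral_mono_AE)
    from limit_dissipation
    show "AE t in lborel. (Diss \<kappa> (\<rho> t) (j t) + Fisher \<kappa> (\<rho> t)) * indicator {0..t0} t
        \<le> (?g t * indicator {0..t0} t) / 2"
      by eventually_elim (use t0 in \<open>auto simp: indicator_def\<close>)
  qed
  also have "\<dots> = (\<integral>\<^sup>+ t\<in>{0..t0}. ?g t \<partial>lborel) / 2" by (rule nn_integral_divide[OF gm])
  also have "\<dots> \<le> (SUP m. ennreal (A m)) / 2" by (rule divide_right_mono_ennreal[OF A(2)])
  also have "\<dots> = (SUP m. ennreal (A m / 2))" by (simp add: half SUP_divide_ennreal)
  finally have "(\<integral>\<^sup>+ r\<in>{0..t0}. (Diss \<kappa> (\<rho> r) (j r) + Fisher \<kappa> (\<rho> r)) \<partial>lborel)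
      + Ent (\<rho> t0) \<le> (SUP m. ennreal (A m / 2)) + (SUP m. e m)"
    unfolding e(2) by (rule add_right_mono)
  also have "\<dots> = (SUP m. ennreal (A m / 2) + e m)"
    using A(1) e(1) by (intro ennreal_SUP_add[symmetric]) (auto simp: incseq_def intro!: ennreal_leI divide_right_mono)
  also have "\<dots> \<le> E0" by (rule SUP_least) (rule le)
  finally show ?thesis .
qed

end

theorem theorem5p4:
  fixes T :: real
    and \<pi> :: "'v::{metric_space, second_countable_topology} measure"
    and \<kappa> :: "'v \<Rightarrow> 'v measure"
    and \<phi> \<psi>s :: "real \<Rightarrow> real"
    and \<alpha> :: "real \<times> real \<Rightarrow> real"
    and a :: "nat \<Rightarrow> 'v \<times> 'v \<Rightarrow> real"
    and \<kappa>n :: "nat \<Rightarrow> 'v \<Rightarrow> 'v measure"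
    and \<rho>0n :: "nat \<Rightarrow> 'v measure"
    and \<rho>0 :: "'v measure"
    and \<rho>n :: "nat \<Rightarrow> real \<Rightarrow> 'v measure"
    and jn :: "nat \<Rightarrow> real \<Rightarrow> ('v \<times> 'v) flux"
  assumes T: "0 < T"
    and setting: "jump_setting \<pi> \<kappa>"
    and phi: "entropy_density \<phi>"
    and psi: "dual_dissipation_density \<psi>s"
    and alpha: "flux_density \<alpha>"
    and D_convex: "ext_convex_on quadrant (Fisher_density \<phi> \<psi>s \<alpha>)"
    and a_borel: "\<And>n. a n \<in> borel_measurable borel"
    and a_nonneg: "\<And>n z. 0 \<le> a n z"
    and a_sym: "\<And>n x y. a n (x, y) = a n (y, x)"
    and a_bounded: "\<And>n. bounded (range (a n))"
    and a_Linfty: "(SUP n. esssup (edge_measure \<pi> \<kappa>) (\<lambda>z. ennreal (a n z))) < \<infinity>"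
    and a_lim: "AE z in edge_measure \<pi> \<kappa>. (\<lambda>n. a n z) \<longlonglongrightarrow> 1"
    and kappa_n: "\<And>n x. \<kappa>n n x = density (\<kappa> x) (\<lambda>y. ennreal (a n (x, y)))"
    and kappa_n_bounded: "\<And>n. (SUP x. emeasure (\<kappa>n n x) UNIV) < \<infinity>"
    and rho0n: "\<And>n. \<rho>0n n \<in> finite_borel_measures"
               "\<And>n. entropy_functional \<pi> \<phi> (\<rho>0n n) < \<infinity>"
    and rho0: "\<rho>0 \<in> finite_borel_measures"
              "entropy_functional \<pi> \<phi> \<rho>0 < \<infinity>"
    and rho0_lim: "setwise_conv borel (\<lambda>n. measure (\<rho>0n n)) (measure \<rho>0)"
    and entropy_lim: "(\<lambda>n. entropy_functional \<pi> \<phi> (\<rho>0n n)) \<longlonglongrightarrow> entropy_functional \<pi> \<phi> \<rho>0"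
    and balanced: "\<And>n. balanced_solution T \<pi> (\<kappa>n n) \<phi> \<psi>s \<alpha> (\<rho>n n) (jn n)"
    and initial: "\<And>n. \<rho>n n 0 = \<rho>0n n"
  shows "\<exists>\<rho> j. (\<rho>, j) \<in> CE T \<and>
    (\<exists>\<sigma>::nat \<Rightarrow> nat. strict_mono \<sigma> \<and>
       (\<forall>t\<in>{0..T}. setwise_conv borel (\<lambda>n. measure (\<rho>n (\<sigma> n) t)) (measure (\<rho> t))) \<and>
       sigma_setwise_conv (time_space T) (\<lambda>n. time_flux T (jn (\<sigma> n))) (time_flux T j)) \<and>
    (\<exists>u. Bochner_L1 T \<pi> u \<and>
       (\<forall>t\<in>{0..T}. (AE x in \<pi>. 0 \<le> u t x) \<and> \<rho> t = density \<pi> (\<lambda>x. ennreal (u t x)))) \<and>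
    dissipative_solution T \<pi> \<kappa> \<phi> \<psi>s \<alpha> \<rho> j"
proof -
  let ?ent = "entropy_functional \<pi> \<phi>" and ?\<theta> = "edge_measure \<pi> \<kappa>"
  interpret jump_flow \<pi> \<kappa> \<psi>s \<phi> \<alpha>
    by unfold_locales (fact setting psi alpha D_convex phi)+
  define Abar where "Abar = enn2real (SUP n. esssup ?\<theta> (\<lambda>z. ennreal (a n z)))"
  have Abar: "(SUP n. esssup ?\<theta> (\<lambda>z. ennreal (a n z))) = ennreal Abar" "0 \<le> Abar"
    using a_Linfty by (auto simp: Abar_def)
  \<comment> \<open>The bound on \<open>a n\<close> holds only almost everywhere. Truncation makes
    it hold everywhere and changes \<open>a n\<close> on a null set of the edge measure, which
    leaves the edge measures of \<open>\<kappa>n n\<close> unchanged.\<close>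
  define b where "b n z = min (a n z) Abar" for n z
  note [measurable] = a_borel
  have b [measurable]: "b n \<in> borel_measurable borel" for n unfolding b_def[abs_def] by measurable
  have ab: "AE z in ?\<theta>. a n z = b n z" for n
    using esssup_AE[of "\<lambda>z. ennreal (a n z)" ?\<theta>]
  proof eventually_elim
    case (elim z)
    also have "esssup ?\<theta> (\<lambda>z. ennreal (a n z)) \<le> ennreal Abar" unfolding Abar(1)[symmetric] by (rule SUP_upper) simp
    finally show ?case using Abar(2) by (simp add: b_def ennreal_le_iff)
  qed
  have "AE z in ?\<theta>. \<forall>n. a n z = b n z" using ab by (simp add: AE_all_countable)
  with a_lim have b_lim: "AE z in ?\<theta>. (\<lambda>n. b n z) \<longlonglongrightarrow> 1" by eventually_elim simp
  have edge: "edge_measure \<pi> (\<kappa>n n) = density ?\<theta> (\<lambda>z. ennreal (b n z))" for n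
  proof -
    have "\<kappa>n n = (\<lambda>x. density (\<kappa> x) (\<lambda>y. ennreal (a n (x, y))))" by (rule ext) (rule kappa_n)
    then have "edge_measure \<pi> (\<kappa>n n) = density ?\<theta> (\<lambda>z. ennreal (a n z))" by (simp add: edge_measure_weighted)
    also have "\<dots> = density ?\<theta> (\<lambda>z. ennreal (b n z))" using ab[of n] by (intro density_cong) (auto elim!: eventually_mono)
    finally show ?thesis .
  qed
  \<comment> \<open>The initial entropies are finite and converge to a finite limit, hence are
    bounded uniformly in \<open>n\<close>.\<close>
  obtain Ebar where Ebar: "0 \<le> Ebar" "\<And>n. ?ent (\<rho>0n n) \<le> ennreal Ebar"
  proof -
    have "(\<lambda>n. enn2real (?ent (\<rho>0n n))) \<longlonglongrightarrow> enn2real (?ent \<rho>0)"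
      using rho0(2) entropy_lim by (intro tendsto_enn2real) auto
    then have "Bseq (\<lambda>n. enn2real (?ent (\<rho>0n n)))" by (rule convergent_imp_Bseq[OF convergentI])
    then obtain C where C: "enn2real (?ent (\<rho>0n n)) \<le> C" for n by (auto simp: Bseq_def dest: abs_le_D1)
    have "?ent (\<rho>0n n) \<le> ennreal C" for n
      using ennreal_leI[OF C[of n]] rho0n(2)[of n] by simp
    moreover have "0 \<le> C" using C[of 0] enn2real_nonneg order_trans by blast
    ultimately show ?thesis using that by blast
  qed
  interpret S: flow_sequence \<pi> \<kappa> \<psi>s \<phi> \<alpha> T Abar Ebar b \<kappa>n \<rho>n jn
  proof unfold_locales
    show "0 \<le> b n z" "b n z \<le> Abar" for n z using a_nonneg Abar(2) by (auto simp: b_def)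
    show "(\<rho>n n, jn n) \<in> CE T" for n using balanced[of n] by (simp add: balanced_solution_def)
    show "(\<integral>\<^sup>+ r\<in>{0..t}. (dissipation_potential \<pi> (\<kappa>n n) \<psi>s \<alpha> (\<rho>n n r) (jn n r) + Fisher_information \<pi> (\<kappa>n n) \<phi> \<psi>s \<alpha> (\<rho>n n r)) \<partial>lborel)
        + ?ent (\<rho>n n t) \<le> ?ent (\<rho>n n 0)" if "t \<in> {0..T}" for n t
      using balanced[of n] that by (simp add: balanced_solution_def)
    show "?ent (\<rho>n n 0) \<le> ennreal Ebar" for n using Ebar(2) by (simp add: initial)
  qed (fact T Ebar(1) b b_lim edge)+
  obtain r \<rho> gp gm where r: "strict_mono (r :: nat \<Rightarrow> nat)"
    and \<rho>': "\<forall>t\<in>{0..T}. \<rho> t \<in> finite_borel_measures \<and> absolutely_continuous \<pi> (\<rho> t) \<and>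
        (\<forall>B\<in>sets borel. (\<lambda>n. measure (\<rho>n (r n) t) B) \<longlonglongrightarrow> measure (\<rho> t) B)"
    and g: "gp \<in> borel_measurable borel" "gm \<in> borel_measurable borel" "\<forall>z. 0 \<le> gp z" "\<forall>z. 0 \<le> gm z"
      "finite_measure (S.Lam_dens gp)" "finite_measure (S.Lam_dens gm)"
      "\<forall>B\<in>sets borel. (\<lambda>n. measure (S.SJp (r n)) B) \<longlonglongrightarrow> measure (S.Lam_dens gp) B"
      "\<forall>B\<in>sets borel. (\<lambda>n. measure (S.SJm (r n)) B) \<longlonglongrightarrow> measure (S.Lam_dens gm) B"
    using S.compactness by (elim exE conjE) (rule that; assumption)
  have \<rho>: "\<rho> t \<in> finite_borel_measures" "absolutely_continuous \<pi> (\<rho> t)"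
      "B \<in> sets borel \<Longrightarrow> (\<lambda>n. measure (\<rho>n (r n) t) B) \<longlonglongrightarrow> measure (\<rho> t) B" if "t \<in> {0..T}" for t B
    using \<rho>' that by auto
  \<comment> \<open>The extracted subsequence satisfies the assumptions of
    \<open>flow_sequence\<close> again and is from here on treated as the sequence itself.\<close>
  interpret L: flow_limit \<pi> \<kappa> \<psi>s \<phi> \<alpha> T Abar Ebar "\<lambda>n. b (r n)" "\<lambda>n. \<kappa>n (r n)" "\<lambda>n. \<rho>n (r n)" "\<lambda>n. jn (r n)" \<rho> gp gm "?ent \<rho>0"
  proof (intro flow_limit.intro flow_limit_axioms.intro flow_sequence.intro flow_sequence_axioms.intro)
    from b_lim show "AE z in ?\<theta>. (\<lambda>n. b (r n) z) \<longlonglongrightarrow> 1"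
      by eventually_elim (use LIMSEQ_subseq_LIMSEQ[OF _ r] in \<open>auto simp: comp_def\<close>)
    show "(\<lambda>n. ?ent (\<rho>n (r n) 0)) \<longlonglongrightarrow> ?ent \<rho>0"
      using LIMSEQ_subseq_LIMSEQ[OF entropy_lim r] by (simp add: initial comp_def)
  qed (fact jump_flow_axioms T Ebar(1) S.a S.a_nonneg S.a_le S.edge S.CE S.energy S.initial \<rho> g[rule_format])+
  \<comment> \<open>The limiting energy inequality ends with the limit of the initial entropies;
    uniqueness of setwise limits at time 0 turns this into the entropy of the limit curve at its
    start.\<close>
  have "\<rho> 0 = \<rho>0"
  proof (rule measure_eqI)
    have s: "sets (\<rho> 0) = sets borel" "finite_measure (\<rho> 0)" and s0: "sets \<rho>0 = sets borel" "finite_measure \<rho>0"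
      using \<rho>(1)[of 0] T rho0(1) by (auto simp: finite_borel_measures_def)
    show "sets (\<rho> 0) = sets \<rho>0" using s s0 by simp
    fix B assume "B \<in> sets (\<rho> 0)"
    then have B: "B \<in> sets borel" using s by simp
    have "(\<lambda>n. measure (\<rho>n (r n) 0) B) \<longlonglongrightarrow> measure \<rho>0 B"
      using LIMSEQ_subseq_LIMSEQ[OF _ r] rho0_lim B by (auto simp: setwise_conv_def initial comp_def)
    then have "measure (\<rho> 0) B = measure \<rho>0 B" using \<rho>(3)[OF _ B, of 0] T LIMSEQ_unique by auto
    then show "emeasure (\<rho> 0) B = emeasure \<rho>0 B" using s(2) s0(2) by (simp add: finite_measure.emeasure_eq_measure)
  qed
  then have "dissipative_solution T \<pi> \<kappa> \<phi> \<psi>s \<alpha> \<rho> L.j"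
    using L.CE_lim rho0(2) L.energy_lim by (simp add: dissipative_solution_def)
  moreover have "\<forall>t\<in>{0..T}. setwise_conv borel (\<lambda>n. measure (\<rho>n (r n) t)) (measure (\<rho> t))"
    using \<rho>(3) by (simp add: setwise_conv_def)
  moreover have "\<forall>t\<in>{0..T}. (AE x in \<pi>. 0 \<le> dens \<pi> (\<rho> t) x) \<and> \<rho> t = density \<pi> (\<lambda>x. ennreal (dens \<pi> (\<rho> t) x))"
    using L.rho_density by (simp add: dens_nonneg)
  ultimately show ?thesis
    using L.CE_lim r L.sigma_setwise_lim L.Bochner_dens by (intro exI[of _ \<rho>] exI[of _ L.j] conjI exI[of _ r] exI[of _ "\<lambda>t. dens \<pi> (\<rho> t)"]) auto
qed

end
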